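(* Let $(U,A)$ be a left bialgebroid which is both left and right Hopf, and such that $U_{\triangleleft}$ and ${}_{\triangleright}U$ are projective over $A$. If $M$ is an anti Yetter-Drinfel'd module over $U$, then $T:=\operatorname{Hom}^U(-,M)$ yields a weak trace functor $U\text{-}\mathbf{Comod}\to k\text{-}\mathbf{Mod}$, which is unital if $M$ is stable (and vice versa). In particular, there are isomorphisms $$\operatorname{tr}_{N,P}:\operatorname{Hom}^U(N\otimes_A P,M)\xrightarrow{\ \simeq\ }\operatorname{Hom}^U(P\otimes_A N,M),$$ functorial in $N,P\in U\text{-}\mathbf{Comod}$, that explicitly read $$(\operatorname{tr}_{N,P}f)(p\otimes_A n)=f(n\otimes_A p_{[0]})\,p_{[1]}$$ for $n\in N$ and $p\in P$.
   Context: **Bialgebroids.** Let $k$ be a commutative ring and $A$ an associative unital $k$-algebra. A left bialgebroid $(U,A)$ consists of a $k$-algebra $U$, an algebra homomorphism $s:A\to U$ (source) and an algebra antihomomorphism $t:A\to U$ (target) with commuting images, inducing four commuting $A$-actions on $U$: $a\triangleright u=s(a)u$, $u\triangleleft a=t(a)u$, $a\blacktriangleright u=ut(a)$, $u\blacktriangleleft a=us(a)$, together with a comultiplication $\Delta:U\to U_{\triangleleft}\otimes_A{}_{\triangleright}U$, $u\mapsto u_{(1)}\otimes_A u_{(2)}$ (here $t(a)u\otimes_A v=u\otimes_A s(a)v$) and a counit $\varepsilon:U\to A$ making $U$ an $A$-coring with respect to $\triangleright,\triangleleft$, such that $\Delta(u)$ satisfies $u_{(1)}t(a)\otimes_A u_{(2)}=u_{(1)}\otimes_A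 u_{(2)}s(a)$ for all $a\in A$, $\Delta$ is unital and multiplicative, $\varepsilon(1)=1$, and $\varepsilon(uv)=\varepsilon(us(\varepsilon(v)))=\varepsilon(ut(\varepsilon(v)))$. **Left and right Hopf.** $(U,A)$ is left Hopf if $\alpha_\ell:{}_{\blacktriangleright}U\otimes_{A^{\mathrm{op}}}U_{\triangleleft}\to U_{\triangleleft}\otimes_A{}_{\triangleright}U$, $u\otimes v\mapsto u_{(1)}\otimes_A u_{(2)}v$, is bijective (in the source $ut(a)\otimes v=u\otimes t(a)v$), and right Hopf if $\alpha_r:U_{\blacktriangleleft}\otimes_A{}_{\triangleright}U\to U_{\triangleleft}\otimes_A{}_{\triangleright}U$, $u\otimes v\mapsto u_{(1)}v\otimes_A u_{(2)}$, is bijective (in the source $us(a)\otimes v=u\otimes s(a)v$). Write $u_+\otimes_{A^{\mathrm{op}}}u_-:=\alpha_\ell^{-1}(u\otimes_A1)$ and $u_{[+]}\otimes_A u_{[-]}:=\alpha_r^{-1}(1\otimes_A u)$. **Comodules.** A left $U$-comodule is a left $A$-module $M$ with a left $A$-linear, coassociative, counital coaction $M\to U_{\triangleleft}\otimes_A M$, $m\mapsto m_{(-1)}\otimes_A m_{(0)}$. It has an induced right $A$-action $ma=\varepsilon(m_{(-1)}s(a))m_{(0)}$. $U\text{-}\mathbf{Comod}$ is (strict) monoidal via $\otimes_A$ with coaction $n\otimes_A m\mapsto n_{(-1)}m_{(-1)}\otimes_A(n_{(0)}\otimes_A m_{(0)})$ and unit $A$, $a\mapsto s(a)\otimes_A 1$.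 $\operatorname{Hom}^U$ denotes left $U$-colinear maps. If $U$ is right Hopf and ${}_{\triangleright}U$ is $A$-projective, each left $U$-comodule becomes a right $U$-comodule by $m\mapsto m_{[0]}\otimes_A m_{[1]}:=\varepsilon(m_{(-1)[+]})m_{(0)}\otimes_A m_{(-1)[-]}$. **aYD modules.** An anti Yetter-Drinfel'd module over a left Hopf algebroid is a left $U$-comodule and right $U$-module $M$ such that $mt(a)s(b)=amb$ for all $a,b\in A$ (comodule-induced bimodule structure on the right hand side) and $(mu)_{(-1)}\otimes_A(mu)_{(0)}=u_-m_{(-1)}u_{+(1)}\otimes_A m_{(0)}u_{+(2)}$. It is stable if $m_{(0)}m_{(-1)}=m$ for all $m\in M$. **Trace functors.** For a (contravariant) functor $T$ on a monoidal category $\mathcal C$, a weak trace functor structure is a family of isomorphisms $\operatorname{tr}_{X,Y}:T(X\otimes Y)\to T(Y\otimes X)$, functorial in $X,Y$, such that, up to the isomorphisms induced by associativity constraints, $\operatorname{tr}_{Z,X\otimes Y}=\operatorname{tr}_{Y\otimes Z,X}\circ\operatorname{tr}_{Z\otimes X,Y}$ for all $X,Y,Z$. It is unital if $\operatorname{tr}_{\mathbb 1,X}$ becomes the identity of $T(X)$ under the isomorphisms $T(\mathbb 1\otimes X)\simeq T(X)\simeq T(X\otimes\mathbb 1)$ induced by the unit constraints. *)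

theory Defs
  imports "HOL-Algebra.Free_Abelian_Groups" "HOL-Algebra.Generated_Groups" "HOL-Algebra.Module"
begin

section \<open>Modules over noncommutative rings, algebras, projectivity\<close>

text \<open>The library's \<^locale>\<open>module\<close> and \<^locale>\<open>algebra\<close> require commutative rings. As for those locales,
  modules are records whose fields \<^const>\<open>mult\<close> and \<^const>\<open>one\<close> carry no meaning.\<close>

locale left_module = R?: ring R + M?: abelian_group M
  for R (structure) and M (structure) +
  assumes lsmult_closed:
      "\<lbrakk>a \<in> carrier R; x \<in> carrier M\<rbrakk> \<Longrightarrow> a \<odot>\<^bsub>M\<^esub> x \<in> carrier M"
    and lsmult_l_distr: "\<lbrakk>a \<in> carrier R; b \<in> carrier R; x \<in> carrier M\<rbrakk> \<Longrightarrow>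
      (a \<oplus>\<^bsub>R\<^esub> b) \<odot>\<^bsub>M\<^esub> x = a \<odot>\<^bsub>M\<^esub> x \<oplus>\<^bsub>M\<^esub> b \<odot>\<^bsub>M\<^esub> x"
    and lsmult_r_distr: "\<lbrakk>a \<in> carrier R; x \<in> carrier M; y \<in> carrier M\<rbrakk> \<Longrightarrow>
      a \<odot>\<^bsub>M\<^esub> (x \<oplus>\<^bsub>M\<^esub> y) = a \<odot>\<^bsub>M\<^esub> x \<oplus>\<^bsub>M\<^esub> a \<odot>\<^bsub>M\<^esub> y"
    and lsmult_assoc: "\<lbrakk>a \<in> carrier R; b \<in> carrier R; x \<in> carrier M\<rbrakk> \<Longrightarrow>
      (a \<otimes>\<^bsub>R\<^esub> b) \<odot>\<^bsub>M\<^esub> x = a \<odot>\<^bsub>M\<^esub> (b \<odot>\<^bsub>M\<^esub> x)"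
    and lsmult_one: "x \<in> carrier M \<Longrightarrow> \<one>\<^bsub>R\<^esub> \<odot>\<^bsub>M\<^esub> x = x"

definition linear_maps ::
  "('r, 'b) ring_scheme \<Rightarrow> ('r, 'x, 'c) module_scheme \<Rightarrow> ('r, 'y, 'd) module_scheme \<Rightarrow> ('x \<Rightarrow> 'y) set"
  where "linear_maps R X Y = {f \<in> carrier X \<rightarrow> carrier Y.
    (\<forall>x\<in>carrier X. \<forall>x'\<in>carrier X. f (x \<oplus>\<^bsub>X\<^esub> x') = f x \<oplus>\<^bsub>Y\<^esub> f x') \<and>
    (\<forall>a\<in>carrier R. \<forall>x\<in>carrier X. f (a \<odot>\<^bsub>X\<^esub> x) = a \<odot>\<^bsub>Y\<^esub> f x)}"

text \<open>The lifting property is tested on modules with elements in fixed types. These are large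
  enough for this to be projectivity without restriction: the free module on the carrier of \<open>P\<close>
  lives on \<^typ>\<open>'p \<Rightarrow> 'r\<close>, and its canonical surjection onto \<open>P\<close> is among the test maps.\<close>

definition projective_module :: "('r, 'b) ring_scheme \<Rightarrow> ('r, 'p, 'c) module_scheme \<Rightarrow> bool"
  where "projective_module R P \<longleftrightarrow> left_module R P \<and>
    (\<forall>(Y :: ('r, 'p \<Rightarrow> 'r) module) (Z :: ('r, 'p) module) g f.
      left_module R Y \<and> left_module R Z \<and> g \<in> linear_maps R Y Z \<and> g ` carrier Y = carrier Z \<and>
      f \<in> linear_maps R P Z \<longrightarrow>
      (\<exists>h\<in>linear_maps R P Y. \<forall>x\<in>carrier P. g (h x) = f x))"

definition opposite :: "('r, 'b) ring_scheme \<Rightarrow> ('r, 'b) ring_scheme"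
  where "opposite R = R\<lparr>mult := \<lambda>x y. y \<otimes>\<^bsub>R\<^esub> x\<rparr>"

locale k_algebra = module R M + ring M for R (structure) and M (structure) +
  assumes scale_left: "\<lbrakk>c \<in> carrier R; x \<in> carrier M; y \<in> carrier M\<rbrakk> \<Longrightarrow>
      (c \<odot>\<^bsub>M\<^esub> x) \<otimes>\<^bsub>M\<^esub> y = c \<odot>\<^bsub>M\<^esub> (x \<otimes>\<^bsub>M\<^esub> y)"
    and scale_right: "\<lbrakk>c \<in> carrier R; x \<in> carrier M; y \<in> carrier M\<rbrakk> \<Longrightarrow>
      x \<otimes>\<^bsub>M\<^esub> (c \<odot>\<^bsub>M\<^esub> y) = c \<odot>\<^bsub>M\<^esub> (x \<otimes>\<^bsub>M\<^esub> y)"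


section \<open>Tensor products over noncommutative rings\<close>

type_synonym ('x, 'y) tens = "(('x \<times> 'y) \<Rightarrow>\<^sub>0 int) set"

record ('x, 'y) tprod = "('x, 'y) tens ring" +
  factors :: "('x \<times> 'y) set"
  pure :: "'x \<Rightarrow> 'y \<Rightarrow> ('x, 'y) tens" (infixl \<open>\<boxtimes>\<index>\<close> 75)

definition tensor_relations ::
  "'a set \<Rightarrow> ('x, 'b) ring_scheme \<Rightarrow> ('x \<Rightarrow> 'a \<Rightarrow> 'x) \<Rightarrow> ('a \<Rightarrow> 'y \<Rightarrow> 'y) \<Rightarrow> ('y, 'c) ring_scheme \<Rightarrow>
    (('x \<times> 'y) \<Rightarrow>\<^sub>0 int) set"
  where "tensor_relations S X r l Y =
    {frag_of (x \<oplus>\<^bsub>X\<^esub> x', y) - frag_of (x, y) - frag_of (x', y) | x x' y.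
       x \<in> carrier X \<and> x' \<in> carrier X \<and> y \<in> carrier Y} \<union>
    {frag_of (x, y \<oplus>\<^bsub>Y\<^esub> y') - frag_of (x, y) - frag_of (x, y') | x y y'.
       x \<in> carrier X \<and> y \<in> carrier Y \<and> y' \<in> carrier Y} \<union>
    {frag_of (r x a, y) - frag_of (x, l a y) | x a y.
       x \<in> carrier X \<and> a \<in> S \<and> y \<in> carrier Y}"

text \<open>The quotient of the free abelian group on pairs by biadditivity and \<open>r x a \<otimes> y = x \<otimes> l a y\<close>.
  The two actions are arguments because the same group carries several of them.\<close>

definition tensor ::
  "'a set \<Rightarrow> ('x, 'b) ring_scheme \<Rightarrow> ('x \<Rightarrow> 'a \<Rightarrow> 'x) \<Rightarrow> ('a \<Rightarrow> 'y \<Rightarrow> 'y) \<Rightarrow> ('y, 'c) ring_scheme \<Rightarrow>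
    ('x, 'y) tprod"
  where "tensor S X r l Y =
    (let F = free_Abelian_group (carrier X \<times> carrier Y);
         H = generate F (tensor_relations S X r l Y)
     in \<lparr>carrier = carrier (F Mod H), mult = undefined, one = undefined,
         zero = one (F Mod H), add = mult (F Mod H),
         factors = carrier X \<times> carrier Y, pure = (\<lambda>x y. H #>\<^bsub>F\<^esub> frag_of (x, y))\<rparr>)"

definition list_sum :: "('g, 'b) ring_scheme \<Rightarrow> ('x \<Rightarrow> 'y \<Rightarrow> 'g) \<Rightarrow> ('x \<times> 'y) list \<Rightarrow> 'g"
  where "list_sum G g xs = foldr (\<lambda>(x, y) z. g x y \<oplus>\<^bsub>G\<^esub> z) xs \<zero>\<^bsub>G\<^esub>"

definition representative :: "('x, 'y) tprod \<Rightarrow> ('x, 'y) tens \<Rightarrow> ('x \<times> 'y) list"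
  where "representative T c = (SOME xs. set xs \<subseteq> factors T \<and> list_sum T (pure T) xs = c)"

text \<open>Sweedler notation: \<open>sweedler T G g c\<close> is \<open>\<Sum>\<^sub>i g x\<^sub>i y\<^sub>i\<close>, computed in \<open>G\<close>, for a chosen expression
  \<open>c = \<Sum>\<^sub>i x\<^sub>i \<otimes> y\<^sub>i\<close>. For biadditive balanced \<open>g\<close> it is the value at \<open>c\<close> of the induced homomorphism.
  In all uses below the result does not depend on the expression chosen.\<close>

definition sweedler ::
  "('x, 'y) tprod \<Rightarrow> ('g, 'b) ring_scheme \<Rightarrow> ('x \<Rightarrow> 'y \<Rightarrow> 'g) \<Rightarrow> ('x, 'y) tens \<Rightarrow> 'g"
  where "sweedler T G g c = list_sum G g (representative T c)"


section \<open>Left bialgebroids\<close>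

record ('k, 'a, 'u) bialgebroid =
  base_alg :: "('k, 'a) module"
  total_alg :: "('k, 'u) module"
  src :: "'a \<Rightarrow> 'u"
  tgt :: "'a \<Rightarrow> 'u"
  comul :: "'u \<Rightarrow> ('u, 'u) tens"
  counit :: "'u \<Rightarrow> 'a"

text \<open>The four actions, with the names and argument orders of \<open>a \<triangleright> u\<close>, \<open>u \<triangleleft> a\<close>,
  \<open>a \<blacktriangleright> u\<close> and \<open>u \<blacktriangleleft> a\<close>.\<close>

definition lwhite :: "('k, 'a, 'u) bialgebroid \<Rightarrow> 'a \<Rightarrow> 'u \<Rightarrow> 'u"
  where "lwhite B a u = src B a \<otimes>\<^bsub>total_alg B\<^esub> u"

definition rwhite :: "('k, 'a, 'u) bialgebroid \<Rightarrow> 'u \<Rightarrow> 'a \<Rightarrow> 'u"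
  where "rwhite B u a = tgt B a \<otimes>\<^bsub>total_alg B\<^esub> u"

definition lblack :: "('k, 'a, 'u) bialgebroid \<Rightarrow> 'a \<Rightarrow> 'u \<Rightarrow> 'u"
  where "lblack B a u = u \<otimes>\<^bsub>total_alg B\<^esub> tgt B a"

definition rblack :: "('k, 'a, 'u) bialgebroid \<Rightarrow> 'u \<Rightarrow> 'a \<Rightarrow> 'u"
  where "rblack B u a = u \<otimes>\<^bsub>total_alg B\<^esub> src B a"

definition U_left :: "('k, 'a, 'u) bialgebroid \<Rightarrow> ('a, 'u) module"
  where "U_left B = \<lparr>carrier = carrier (total_alg B), mult = mult (total_alg B),
    one = one (total_alg B), zero = zero (total_alg B), add = add (total_alg B),
    smult = lwhite B\<rparr>"

text \<open>\<open>U\<^sub>\<triangleleft>\<close> as a left module over the opposite ring of \<open>A\<close>.\<close>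

definition U_right :: "('k, 'a, 'u) bialgebroid \<Rightarrow> ('a, 'u) module"
  where "U_right B = \<lparr>carrier = carrier (total_alg B), mult = mult (total_alg B),
    one = one (total_alg B), zero = zero (total_alg B), add = add (total_alg B),
    smult = (\<lambda>a u. rwhite B u a)\<rparr>"

text \<open>\<open>U\<^sub>\<triangleleft> \<otimes>\<^sub>A M\<close>, its left \<open>A\<close>-action, and \<open>U\<^sub>\<triangleleft> \<otimes>\<^sub>A (U\<^sub>\<triangleleft> \<otimes>\<^sub>A M)\<close>.\<close>

definition UX :: "('k, 'a, 'u) bialgebroid \<Rightarrow> ('a, 'm, 'z) module_scheme \<Rightarrow> ('u, 'm) tprod"
  where "UX B M = tensor (carrier (base_alg B)) (total_alg B) (rwhite B) (smult M) M"

definition UX_left ::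
  "('k, 'a, 'u) bialgebroid \<Rightarrow> ('a, 'm, 'z) module_scheme \<Rightarrow> 'a \<Rightarrow> ('u, 'm) tens \<Rightarrow> ('u, 'm) tens"
  where "UX_left B M a = sweedler (UX B M) (UX B M) (\<lambda>u m. lwhite B a u \<boxtimes>\<^bsub>UX B M\<^esub> m)"

definition UUX ::
  "('k, 'a, 'u) bialgebroid \<Rightarrow> ('a, 'm, 'z) module_scheme \<Rightarrow> ('u, ('u, 'm) tens) tprod"
  where "UUX B M =
    tensor (carrier (base_alg B)) (total_alg B) (rwhite B) (UX_left B M) (UX B M)"

abbreviation UU :: "('k, 'a, 'u) bialgebroid \<Rightarrow> ('u, 'u) tprod"
  where "UU B \<equiv> UX B (U_left B)"

text \<open>\<open>(\<Delta> \<otimes> id) \<lambda> = (id \<otimes> \<lambda>) \<lambda>\<close> in \<open>U \<otimes>\<^sub>A (U \<otimes>\<^sub>A M)\<close>; used for comodules and, with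
  \<open>\<lambda> = \<Delta>\<close>, for the coring itself.\<close>

definition coassociative ::
  "('k, 'a, 'u) bialgebroid \<Rightarrow> ('a, 'm, 'z) module_scheme \<Rightarrow> ('m \<Rightarrow> ('u, 'm) tens) \<Rightarrow> bool"
  where "coassociative B M lam \<longleftrightarrow> (\<forall>m\<in>carrier M.
    sweedler (UX B M) (UUX B M)
      (\<lambda>u m'. sweedler (UU B) (UUX B M)
         (\<lambda>u1 u2. u1 \<boxtimes>\<^bsub>UUX B M\<^esub> (u2 \<boxtimes>\<^bsub>UX B M\<^esub> m')) (comul B u)) (lam m) =
    sweedler (UX B M) (UUX B M) (\<lambda>u m'. u \<boxtimes>\<^bsub>UUX B M\<^esub> lam m') (lam m))"

locale left_bialgebroid =
  fixes k :: "('k, 'r) ring_scheme" and B :: "('k, 'a, 'u) bialgebroid"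
  assumes base_algebra: "k_algebra k (base_alg B)"
    and total_algebra: "k_algebra k (total_alg B)"
    and src_hom: "src B \<in> ring_hom (base_alg B) (total_alg B)"
    and src_scale: "\<lbrakk>c \<in> carrier k; a \<in> carrier (base_alg B)\<rbrakk> \<Longrightarrow>
      src B (c \<odot>\<^bsub>base_alg B\<^esub> a) = c \<odot>\<^bsub>total_alg B\<^esub> src B a"
    and tgt_antihom: "tgt B \<in> ring_hom (opposite (base_alg B)) (total_alg B)"
    and tgt_scale: "\<lbrakk>c \<in> carrier k; a \<in> carrier (base_alg B)\<rbrakk> \<Longrightarrow>
      tgt B (c \<odot>\<^bsub>base_alg B\<^esub> a) = c \<odot>\<^bsub>total_alg B\<^esub> tgt B a"
    and src_tgt_commute: "\<lbrakk>a \<in> carrier (base_alg B); b \<in> carrier (base_alg B)\<rbrakk> \<Longrightarrow>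
      src B a \<otimes>\<^bsub>total_alg B\<^esub> tgt B b = tgt B b \<otimes>\<^bsub>total_alg B\<^esub> src B a"
    and comul_closed: "u \<in> carrier (total_alg B) \<Longrightarrow> comul B u \<in> carrier (UU B)"
    and comul_add: "\<lbrakk>u \<in> carrier (total_alg B); v \<in> carrier (total_alg B)\<rbrakk> \<Longrightarrow>
      comul B (u \<oplus>\<^bsub>total_alg B\<^esub> v) = comul B u \<oplus>\<^bsub>UU B\<^esub> comul B v"
    and comul_left: "\<lbrakk>a \<in> carrier (base_alg B); u \<in> carrier (total_alg B)\<rbrakk> \<Longrightarrow>
      comul B (lwhite B a u) =
      sweedler (UU B) (UU B) (\<lambda>u1 u2. lwhite B a u1 \<boxtimes>\<^bsub>UU B\<^esub> u2) (comul B u)"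
    and comul_right: "\<lbrakk>a \<in> carrier (base_alg B); u \<in> carrier (total_alg B)\<rbrakk> \<Longrightarrow>
      comul B (rwhite B u a) =
      sweedler (UU B) (UU B) (\<lambda>u1 u2. u1 \<boxtimes>\<^bsub>UU B\<^esub> rwhite B u2 a) (comul B u)"
    and counit_closed: "u \<in> carrier (total_alg B) \<Longrightarrow> counit B u \<in> carrier (base_alg B)"
    and counit_add: "\<lbrakk>u \<in> carrier (total_alg B); v \<in> carrier (total_alg B)\<rbrakk> \<Longrightarrow>
      counit B (u \<oplus>\<^bsub>total_alg B\<^esub> v) = counit B u \<oplus>\<^bsub>base_alg B\<^esub> counit B v"
    and counit_left: "\<lbrakk>a \<in> carrier (base_alg B); u \<in> carrier (total_alg B)\<rbrakk> \<Longrightarrow>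
      counit B (lwhite B a u) = a \<otimes>\<^bsub>base_alg B\<^esub> counit B u"
    and counit_right: "\<lbrakk>a \<in> carrier (base_alg B); u \<in> carrier (total_alg B)\<rbrakk> \<Longrightarrow>
      counit B (rwhite B u a) = counit B u \<otimes>\<^bsub>base_alg B\<^esub> a"
    and comul_coassoc: "coassociative B (U_left B) (comul B)"
    and counital_left: "u \<in> carrier (total_alg B) \<Longrightarrow>
      sweedler (UU B) (total_alg B) (\<lambda>u1 u2. lwhite B (counit B u1) u2) (comul B u) = u"
    and counital_right: "u \<in> carrier (total_alg B) \<Longrightarrow>
      sweedler (UU B) (total_alg B) (\<lambda>u1 u2. rwhite B u1 (counit B u2)) (comul B u) = u"
    and comul_takeuchi: "\<lbrakk>a \<in> carrier (base_alg B); u \<in> carrier (total_alg B)\<rbrakk> \<Longrightarrow>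
      sweedler (UU B) (UU B) (\<lambda>u1 u2. (u1 \<otimes>\<^bsub>total_alg B\<^esub> tgt B a) \<boxtimes>\<^bsub>UU B\<^esub> u2) (comul B u) =
      sweedler (UU B) (UU B) (\<lambda>u1 u2. u1 \<boxtimes>\<^bsub>UU B\<^esub> (u2 \<otimes>\<^bsub>total_alg B\<^esub> src B a)) (comul B u)"
    and comul_one: "comul B \<one>\<^bsub>total_alg B\<^esub> = \<one>\<^bsub>total_alg B\<^esub> \<boxtimes>\<^bsub>UU B\<^esub> \<one>\<^bsub>total_alg B\<^esub>"
    and comul_mult: "\<lbrakk>u \<in> carrier (total_alg B); v \<in> carrier (total_alg B)\<rbrakk> \<Longrightarrow>
      comul B (u \<otimes>\<^bsub>total_alg B\<^esub> v) =
      sweedler (UU B) (UU B)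
        (\<lambda>u1 u2. sweedler (UU B) (UU B)
           (\<lambda>v1 v2. (u1 \<otimes>\<^bsub>total_alg B\<^esub> v1) \<boxtimes>\<^bsub>UU B\<^esub> (u2 \<otimes>\<^bsub>total_alg B\<^esub> v2)) (comul B v)) (comul B u)"
    and counit_one: "counit B \<one>\<^bsub>total_alg B\<^esub> = \<one>\<^bsub>base_alg B\<^esub>"
    and counit_mult_src: "\<lbrakk>u \<in> carrier (total_alg B); v \<in> carrier (total_alg B)\<rbrakk> \<Longrightarrow>
      counit B (u \<otimes>\<^bsub>total_alg B\<^esub> v) = counit B (u \<otimes>\<^bsub>total_alg B\<^esub> src B (counit B v))"
    and counit_mult_tgt: "\<lbrakk>u \<in> carrier (total_alg B); v \<in> carrier (total_alg B)\<rbrakk> \<Longrightarrow>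
      counit B (u \<otimes>\<^bsub>total_alg B\<^esub> v) = counit B (u \<otimes>\<^bsub>total_alg B\<^esub> tgt B (counit B v))"


section \<open>Left and right Hopf algebroids\<close>

definition UopU :: "('k, 'a, 'u) bialgebroid \<Rightarrow> ('u, 'u) tprod"
  where "UopU B = tensor (carrier (base_alg B))
    (total_alg B) (\<lambda>u a. lblack B a u) (\<lambda>a v. rwhite B v a) (total_alg B)"

definition alpha_l :: "('k, 'a, 'u) bialgebroid \<Rightarrow> ('u, 'u) tens \<Rightarrow> ('u, 'u) tens"
  where "alpha_l B = sweedler (UopU B) (UU B)
    (\<lambda>u v. sweedler (UU B) (UU B)
       (\<lambda>u1 u2. u1 \<boxtimes>\<^bsub>UU B\<^esub> (u2 \<otimes>\<^bsub>total_alg B\<^esub> v)) (comul B u))"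

definition left_hopf :: "('k, 'a, 'u) bialgebroid \<Rightarrow> bool"
  where "left_hopf B \<longleftrightarrow> bij_betw (alpha_l B) (carrier (UopU B)) (carrier (UU B))"

definition UrU :: "('k, 'a, 'u) bialgebroid \<Rightarrow> ('u, 'u) tprod"
  where "UrU B = tensor (carrier (base_alg B)) (total_alg B) (rblack B) (lwhite B) (total_alg B)"

definition alpha_r :: "('k, 'a, 'u) bialgebroid \<Rightarrow> ('u, 'u) tens \<Rightarrow> ('u, 'u) tens"
  where "alpha_r B = sweedler (UrU B) (UU B)
    (\<lambda>u v. sweedler (UU B) (UU B)
       (\<lambda>u1 u2. (u1 \<otimes>\<^bsub>total_alg B\<^esub> v) \<boxtimes>\<^bsub>UU B\<^esub> u2) (comul B u))"

definition right_hopf :: "('k, 'a, 'u) bialgebroid \<Rightarrow> bool"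
  where "right_hopf B \<longleftrightarrow> bij_betw (alpha_r B) (carrier (UrU B)) (carrier (UU B))"

text \<open>\<open>u\<^sub>+ \<otimes> u\<^sub>-\<close> and \<open>u\<^bsub>[+]\<^esub> \<otimes> u\<^bsub>[-]\<^esub>\<close>.\<close>

definition transl_l :: "('k, 'a, 'u) bialgebroid \<Rightarrow> 'u \<Rightarrow> ('u, 'u) tens"
  where "transl_l B u =
    inv_into (carrier (UopU B)) (alpha_l B) (u \<boxtimes>\<^bsub>UU B\<^esub> \<one>\<^bsub>total_alg B\<^esub>)"

definition transl_r :: "('k, 'a, 'u) bialgebroid \<Rightarrow> 'u \<Rightarrow> ('u, 'u) tens"
  where "transl_r B u =
    inv_into (carrier (UrU B)) (alpha_r B) (\<one>\<^bsub>total_alg B\<^esub> \<boxtimes>\<^bsub>UU B\<^esub> u)"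


section \<open>Comodules\<close>

record ('a, 'u, 'm) comodule = "('a, 'm) module" +
  coact :: "'m \<Rightarrow> ('u, 'm) tens"

locale left_comodule =
  fixes B :: "('k, 'a, 'u) bialgebroid" and M :: "('a, 'u, 'm) comodule"
  assumes left_module: "left_module (base_alg B) M"
    and coact_closed: "m \<in> carrier M \<Longrightarrow> coact M m \<in> carrier (UX B M)"
    and coact_add: "\<lbrakk>m \<in> carrier M; m' \<in> carrier M\<rbrakk> \<Longrightarrow>
      coact M (m \<oplus>\<^bsub>M\<^esub> m') = coact M m \<oplus>\<^bsub>UX B M\<^esub> coact M m'"
    and coact_smult: "\<lbrakk>a \<in> carrier (base_alg B); m \<in> carrier M\<rbrakk> \<Longrightarrow>
      coact M (a \<odot>\<^bsub>M\<^esub> m) = UX_left B M a (coact M m)"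
    and coact_coassoc: "coassociative B M (coact M)"
    and coact_counital: "m \<in> carrier M \<Longrightarrow>
      sweedler (UX B M) M (\<lambda>u m'. counit B u \<odot>\<^bsub>M\<^esub> m') (coact M m) = m"

definition right_act :: "('k, 'a, 'u) bialgebroid \<Rightarrow> ('a, 'u, 'm) comodule \<Rightarrow> 'm \<Rightarrow> 'a \<Rightarrow> 'm"
  where "right_act B M m a = sweedler (UX B M) M
    (\<lambda>u m'. counit B (u \<otimes>\<^bsub>total_alg B\<^esub> src B a) \<odot>\<^bsub>M\<^esub> m') (coact M m)"

text \<open>Colinear maps are extensional functions, so that equality of morphisms is equality on the
  carrier.\<close>

definition comod_hom ::
  "('k, 'a, 'u) bialgebroid \<Rightarrow> ('a, 'u, 'm) comodule \<Rightarrow> ('a, 'u, 'n) comodule \<Rightarrow> ('m \<Rightarrow> 'n) set"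
  where "comod_hom B N M = {f \<in> carrier N \<rightarrow>\<^sub>E carrier M. f \<in> linear_maps (base_alg B) N M \<and>
    (\<forall>n\<in>carrier N. coact M (f n) =
       sweedler (UX B N) (UX B M) (\<lambda>u n'. u \<boxtimes>\<^bsub>UX B M\<^esub> f n') (coact N n))}"

text \<open>The \<open>k\<close>-module of colinear maps; \<open>k\<close> acts on comodules through \<open>k \<rightarrow> A\<close>.\<close>

definition comod_hom_module ::
  "('k, 'a, 'u) bialgebroid \<Rightarrow> ('a, 'u, 'm) comodule \<Rightarrow> ('a, 'u, 'n) comodule \<Rightarrow>
    ('k, 'n \<Rightarrow> 'm) module"
  where "comod_hom_module B M N = \<lparr>carrier = comod_hom B N M, mult = undefined, one = undefined,
    zero = (\<lambda>n\<in>carrier N. \<zero>\<^bsub>M\<^esub>), add = (\<lambda>f g. \<lambda>n\<in>carrier N. f n \<oplus>\<^bsub>M\<^esub> g n),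
    smult = (\<lambda>c f. \<lambda>n\<in>carrier N. (c \<odot>\<^bsub>base_alg B\<^esub> \<one>\<^bsub>base_alg B\<^esub>) \<odot>\<^bsub>M\<^esub> f n)\<rparr>"


section \<open>The right coaction on a left comodule over a right Hopf algebroid\<close>

text \<open>\<open>P \<otimes>\<^sub>A \<^sub>\<triangleright>U\<close>, where \<open>P\<close> carries the induced right action.\<close>

definition XU :: "('k, 'a, 'u) bialgebroid \<Rightarrow> ('a, 'u, 'm) comodule \<Rightarrow> ('m, 'u) tprod"
  where "XU B P = tensor (carrier (base_alg B)) P (right_act B P) (lwhite B) (total_alg B)"

text \<open>The formula \<open>p\<^bsub>[0]\<^esub> \<otimes> p\<^bsub>[1]\<^esub> = \<epsilon>(p\<^bsub>(-1)[+]\<^esub>) p\<^bsub>(0)\<^esub> \<otimes> p\<^bsub>(-1)[-]\<^esub>\<close> needs an interpretation: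
  \<open>u \<otimes> p \<otimes> v \<mapsto> \<epsilon>(u) p \<otimes> v\<close> is not balanced for the relation
  \<open>u s(a) \<otimes> p \<otimes> v = u \<otimes> p \<otimes> s(a) v\<close> on all of \<open>(U\<^sub>\<triangleleft> \<otimes>\<^sub>A P) \<otimes>\<^sub>A \<^sub>\<triangleright>U\<close>, because in general
  \<open>\<epsilon>(u s(a)) p \<noteq> \<epsilon>(u) (p a)\<close>. On the submodule \<open>E\<close> of those \<open>\<Sum> u \<otimes> p\<close> in \<open>U\<^sub>\<triangleleft> \<otimes>\<^sub>A P\<close> with
  \<open>\<Sum> u t(a) \<otimes> p = \<Sum> u \<otimes> p a\<close> for all \<open>a\<close>, the map \<open>u \<otimes> p \<mapsto> \<epsilon>(u) p\<close> is right \<open>A\<close>-linear.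
  The element \<open>(p\<^bsub>(-1)[+]\<^esub> \<otimes> p\<^bsub>(0)\<^esub>) \<otimes> p\<^bsub>(-1)[-]\<^esub>\<close> satisfies the corresponding equations for all \<open>a\<close>,
  and since \<open>\<^sub>\<triangleright>U\<close> is projective, it is the image of exactly one element of
  \<open>E \<otimes>\<^sub>A \<^sub>\<triangleright>U\<close>, to which the formula is then applied. Here projectivity is needed.\<close>

definition UX_right ::
  "('k, 'a, 'u) bialgebroid \<Rightarrow> ('a, 'u, 'm) comodule \<Rightarrow> ('u, 'm) tens \<Rightarrow> 'a \<Rightarrow> ('u, 'm) tens"
  where "UX_right B P c a = sweedler (UX B P) (UX B P) (\<lambda>u p. rblack B u a \<boxtimes>\<^bsub>UX B P\<^esub> p) c"

definition UXU ::
  "('k, 'a, 'u) bialgebroid \<Rightarrow> ('a, 'u, 'm) comodule \<Rightarrow> (('u, 'm) tens, 'u) tprod"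
  where "UXU B P =
    tensor (carrier (base_alg B)) (UX B P) (UX_right B P) (lwhite B) (total_alg B)"

definition takeuchi :: "('k, 'a, 'u) bialgebroid \<Rightarrow> ('a, 'u, 'm) comodule \<Rightarrow> ('u, 'm) tprod"
  where "takeuchi B P = (UX B P)\<lparr>carrier := {c \<in> carrier (UX B P). \<forall>a\<in>carrier (base_alg B).
    sweedler (UX B P) (UX B P) (\<lambda>u p. lblack B a u \<boxtimes>\<^bsub>UX B P\<^esub> p) c =
    sweedler (UX B P) (UX B P) (\<lambda>u p. u \<boxtimes>\<^bsub>UX B P\<^esub> right_act B P p a) c}\<rparr>"

definition takeuchi_U ::
  "('k, 'a, 'u) bialgebroid \<Rightarrow> ('a, 'u, 'm) comodule \<Rightarrow> (('u, 'm) tens, 'u) tprod"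
  where "takeuchi_U B P =
    tensor (carrier (base_alg B)) (takeuchi B P) (UX_right B P) (lwhite B) (total_alg B)"

definition takeuchi_incl ::
  "('k, 'a, 'u) bialgebroid \<Rightarrow> ('a, 'u, 'm) comodule \<Rightarrow> (('u, 'm) tens, 'u) tens \<Rightarrow>
    (('u, 'm) tens, 'u) tens"
  where "takeuchi_incl B P = sweedler (takeuchi_U B P) (UXU B P) (\<lambda>e v. e \<boxtimes>\<^bsub>UXU B P\<^esub> v)"

definition right_coact_pre ::
  "('k, 'a, 'u) bialgebroid \<Rightarrow> ('a, 'u, 'm) comodule \<Rightarrow> 'm \<Rightarrow> (('u, 'm) tens, 'u) tens"
  where "right_coact_pre B P p = sweedler (UX B P) (UXU B P)
    (\<lambda>u p'. sweedler (UrU B) (UXU B P)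
       (\<lambda>up um. (up \<boxtimes>\<^bsub>UX B P\<^esub> p') \<boxtimes>\<^bsub>UXU B P\<^esub> um) (transl_r B u)) (coact P p)"

definition right_coact ::
  "('k, 'a, 'u) bialgebroid \<Rightarrow> ('a, 'u, 'm) comodule \<Rightarrow> 'm \<Rightarrow> ('m, 'u) tens"
  where "right_coact B P p = sweedler (takeuchi_U B P) (XU B P)
    (\<lambda>e v. sweedler (UX B P) P (\<lambda>u p'. counit B u \<odot>\<^bsub>P\<^esub> p') e \<boxtimes>\<^bsub>XU B P\<^esub> v)
    (inv_into (carrier (takeuchi_U B P)) (takeuchi_incl B P) (right_coact_pre B P p))"


section \<open>Anti Yetter-Drinfel'd modules\<close>

text \<open>The expression \<open>u\<^sub>- m\<^bsub>(-1)\<^esub> u\<^bsub>+(1)\<^esub> \<otimes> m\<^bsub>(0)\<^esub> u\<^bsub>+(2)\<^esub>\<close> needs the same care as the right coaction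
  above. Write \<open>F\<close> for the submodule of those \<open>\<Sum> v \<otimes> y\<close> in \<open>\<^sub>\<blacktriangleright>U \<otimes> U\<^sub>\<triangleleft>\<close> (tensor over the opposite of
  \<open>A\<close>) with \<open>\<Sum> t(a) v \<otimes> y = \<Sum> v \<otimes> y t(a)\<close> for all \<open>a\<close>. For \<open>w \<in> U\<close> and \<open>\<Sum> v \<otimes> y \<in> F\<close> the sum
  \<open>\<Sum> y m\<^bsub>(-1)\<^esub> w \<otimes> m\<^bsub>(0)\<^esub> v\<close> is well defined and balanced over \<open>U\<^sub>\<triangleleft> \<otimes>\<^sub>A F\<close>, but for
  \<open>\<Sum> v \<otimes> y\<close> outside \<open>F\<close> it depends on the expression chosen for \<open>m\<^bsub>(-1)\<^esub> \<otimes> m\<^bsub>(0)\<^esub>\<close>.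
  The element \<open>u\<^bsub>+(1)\<^esub> \<otimes> (u\<^bsub>+(2)\<^esub> \<otimes> u\<^sub>-)\<close> equals \<open>u\<^bsub>(1)\<^esub> \<otimes> (u\<^bsub>(2)+\<^esub> \<otimes> u\<^bsub>(2)-\<^esub>)\<close>, so it comes
  from \<open>U\<^sub>\<triangleleft> \<otimes>\<^sub>A F\<close>, and from a unique element if \<open>U\<^sub>\<triangleleft>\<close> is flat.\<close>

definition UopU_left :: "('k, 'a, 'u) bialgebroid \<Rightarrow> 'a \<Rightarrow> ('u, 'u) tens \<Rightarrow> ('u, 'u) tens"
  where "UopU_left B a =
    sweedler (UopU B) (UopU B) (\<lambda>v y. lwhite B a v \<boxtimes>\<^bsub>UopU B\<^esub> y)"

definition UUopU :: "('k, 'a, 'u) bialgebroid \<Rightarrow> ('u, ('u, 'u) tens) tprod"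
  where "UUopU B =
    tensor (carrier (base_alg B)) (total_alg B) (rwhite B) (UopU_left B) (UopU B)"

definition UopU_balanced :: "('k, 'a, 'u) bialgebroid \<Rightarrow> ('u, 'u) tprod"
  where "UopU_balanced B = (UopU B)\<lparr>carrier := {c \<in> carrier (UopU B). \<forall>a\<in>carrier (base_alg B).
    sweedler (UopU B) (UopU B) (\<lambda>v y. rwhite B v a \<boxtimes>\<^bsub>UopU B\<^esub> y) c =
    sweedler (UopU B) (UopU B) (\<lambda>v y. v \<boxtimes>\<^bsub>UopU B\<^esub> lblack B a y) c}\<rparr>"

definition U_balanced :: "('k, 'a, 'u) bialgebroid \<Rightarrow> ('u, ('u, 'u) tens) tprod"
  where "U_balanced B =
    tensor (carrier (base_alg B)) (total_alg B) (rwhite B) (UopU_left B) (UopU_balanced B)"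

definition balanced_incl ::
  "('k, 'a, 'u) bialgebroid \<Rightarrow> ('u, ('u, 'u) tens) tens \<Rightarrow> ('u, ('u, 'u) tens) tens"
  where "balanced_incl B = sweedler (U_balanced B) (UUopU B) (\<lambda>w c. w \<boxtimes>\<^bsub>UUopU B\<^esub> c)"

definition comul_transl_l :: "('k, 'a, 'u) bialgebroid \<Rightarrow> 'u \<Rightarrow> ('u, ('u, 'u) tens) tens"
  where "comul_transl_l B u = inv_into (carrier (U_balanced B)) (balanced_incl B)
    (sweedler (UopU B) (UUopU B)
      (\<lambda>up um. sweedler (UU B) (UUopU B)
         (\<lambda>up1 up2. up1 \<boxtimes>\<^bsub>UUopU B\<^esub> (up2 \<boxtimes>\<^bsub>UopU B\<^esub> um)) (comul B up)) (transl_l B u))"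

locale anti_Yetter_Drinfeld = left_comodule B M
  for B :: "('k, 'a, 'u) bialgebroid" and M :: "('a, 'u, 'm) comodule" +
  fixes act :: "'m \<Rightarrow> 'u \<Rightarrow> 'm"
  assumes act_closed: "\<lbrakk>m \<in> carrier M; u \<in> carrier (total_alg B)\<rbrakk> \<Longrightarrow> act m u \<in> carrier M"
    and act_add_left: "\<lbrakk>m \<in> carrier M; m' \<in> carrier M; u \<in> carrier (total_alg B)\<rbrakk> \<Longrightarrow>
      act (m \<oplus>\<^bsub>M\<^esub> m') u = act m u \<oplus>\<^bsub>M\<^esub> act m' u"
    and act_add_right:
      "\<lbrakk>m \<in> carrier M; u \<in> carrier (total_alg B); v \<in> carrier (total_alg B)\<rbrakk> \<Longrightarrow>
      act m (u \<oplus>\<^bsub>total_alg B\<^esub> v) = act m u \<oplus>\<^bsub>M\<^esub> act m v"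
    and act_mult: "\<lbrakk>m \<in> carrier M; u \<in> carrier (total_alg B); v \<in> carrier (total_alg B)\<rbrakk> \<Longrightarrow>
      act m (u \<otimes>\<^bsub>total_alg B\<^esub> v) = act (act m u) v"
    and act_one: "m \<in> carrier M \<Longrightarrow> act m \<one>\<^bsub>total_alg B\<^esub> = m"
    and act_bimodule:
      "\<lbrakk>m \<in> carrier M; a \<in> carrier (base_alg B); b \<in> carrier (base_alg B)\<rbrakk> \<Longrightarrow>
      act (act m (tgt B a)) (src B b) = right_act B M (a \<odot>\<^bsub>M\<^esub> m) b"
    and coact_act: "\<lbrakk>m \<in> carrier M; u \<in> carrier (total_alg B)\<rbrakk> \<Longrightarrow>
      coact M (act m u) =
      sweedler (U_balanced B) (UX B M) (\<lambda>up1 c.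
        sweedler (UopU B) (UX B M) (\<lambda>up2 um.
          sweedler (UX B M) (UX B M) (\<lambda>x m'.
            (um \<otimes>\<^bsub>total_alg B\<^esub> x \<otimes>\<^bsub>total_alg B\<^esub> up1) \<boxtimes>\<^bsub>UX B M\<^esub> act m' up2)
          (coact M m)) c) (comul_transl_l B u)"

definition stable_aYD ::
  "('k, 'a, 'u) bialgebroid \<Rightarrow> ('a, 'u, 'm) comodule \<Rightarrow> ('m \<Rightarrow> 'u \<Rightarrow> 'm) \<Rightarrow> bool"
  where "stable_aYD B M act \<longleftrightarrow>
    (\<forall>m\<in>carrier M. sweedler (UX B M) M (\<lambda>u m'. act m' u) (coact M m) = m)"


section \<open>Monoidal categories and trace functors\<close>

text \<open>Hom sets need not be disjoint, so operations on morphisms take the objects as arguments: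
  \<open>cmp C X Y Z g f\<close> is \<open>g \<circ> f\<close> for \<open>f : X \<rightarrow> Y\<close> and \<open>g : Y \<rightarrow> Z\<close>, and
  \<open>tmor C X X' Y Y' f g\<close> is \<open>f \<otimes> g\<close> for \<open>f : X \<rightarrow> X'\<close> and \<open>g : Y \<rightarrow> Y'\<close>.\<close>

record ('o, 'm) moncat =
  Obj :: "'o set"
  Arr :: "'o \<Rightarrow> 'o \<Rightarrow> 'm set"
  ident :: "'o \<Rightarrow> 'm"
  cmp :: "'o \<Rightarrow> 'o \<Rightarrow> 'o \<Rightarrow> 'm \<Rightarrow> 'm \<Rightarrow> 'm"
  tobj :: "'o \<Rightarrow> 'o \<Rightarrow> 'o"
  tmor :: "'o \<Rightarrow> 'o \<Rightarrow> 'o \<Rightarrow> 'o \<Rightarrow> 'm \<Rightarrow> 'm \<Rightarrow> 'm"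
  tunit :: "'o"
  assoc :: "'o \<Rightarrow> 'o \<Rightarrow> 'o \<Rightarrow> 'm"
  lunit :: "'o \<Rightarrow> 'm"
  runit :: "'o \<Rightarrow> 'm"

definition iso_arr :: "('o, 'm) moncat \<Rightarrow> 'o \<Rightarrow> 'o \<Rightarrow> 'm \<Rightarrow> bool"
  where "iso_arr C X Y f \<longleftrightarrow> f \<in> Arr C X Y \<and>
    (\<exists>g\<in>Arr C Y X. cmp C X Y X g f = ident C X \<and> cmp C Y X Y f g = ident C Y)"

locale monoidal_category =
  fixes C :: "('o, 'm) moncat"
  assumes ident_arr: "X \<in> Obj C \<Longrightarrow> ident C X \<in> Arr C X X"
    and cmp_arr: "\<lbrakk>X \<in> Obj C; Y \<in> Obj C; Z \<in> Obj C; f \<in> Arr C X Y; g \<in> Arr C Y Z\<rbrakk> \<Longrightarrow>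
      cmp C X Y Z g f \<in> Arr C X Z"
    and cmp_ident_right: "\<lbrakk>X \<in> Obj C; Y \<in> Obj C; f \<in> Arr C X Y\<rbrakk> \<Longrightarrow>
      cmp C X X Y f (ident C X) = f"
    and cmp_ident_left: "\<lbrakk>X \<in> Obj C; Y \<in> Obj C; f \<in> Arr C X Y\<rbrakk> \<Longrightarrow>
      cmp C X Y Y (ident C Y) f = f"
    and cmp_assoc: "\<lbrakk>W \<in> Obj C; X \<in> Obj C; Y \<in> Obj C; Z \<in> Obj C;
        f \<in> Arr C W X; g \<in> Arr C X Y; h \<in> Arr C Y Z\<rbrakk> \<Longrightarrow>
      cmp C W X Z (cmp C X Y Z h g) f = cmp C W Y Z h (cmp C W X Y g f)"
    and tobj_obj: "\<lbrakk>X \<in> Obj C; Y \<in> Obj C\<rbrakk> \<Longrightarrow> tobj C X Y \<in> Obj C"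
    and tunit_obj: "tunit C \<in> Obj C"
    and tmor_arr: "\<lbrakk>X \<in> Obj C; X' \<in> Obj C; Y \<in> Obj C; Y' \<in> Obj C;
        f \<in> Arr C X X'; g \<in> Arr C Y Y'\<rbrakk> \<Longrightarrow>
      tmor C X X' Y Y' f g \<in> Arr C (tobj C X Y) (tobj C X' Y')"
    and tmor_ident: "\<lbrakk>X \<in> Obj C; Y \<in> Obj C\<rbrakk> \<Longrightarrow>
      tmor C X X Y Y (ident C X) (ident C Y) = ident C (tobj C X Y)"
    and tmor_cmp: "\<lbrakk>X \<in> Obj C; X' \<in> Obj C; X'' \<in> Obj C; Y \<in> Obj C; Y' \<in> Obj C; Y'' \<in> Obj C;
        f \<in> Arr C X X'; f' \<in> Arr C X' X''; g \<in> Arr C Y Y'; g' \<in> Arr C Y' Y''\<rbrakk> \<Longrightarrow>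
      tmor C X X'' Y Y'' (cmp C X X' X'' f' f) (cmp C Y Y' Y'' g' g) =
      cmp C (tobj C X Y) (tobj C X' Y') (tobj C X'' Y'')
        (tmor C X' X'' Y' Y'' f' g') (tmor C X X' Y Y' f g)"
    and assoc_iso: "\<lbrakk>X \<in> Obj C; Y \<in> Obj C; Z \<in> Obj C\<rbrakk> \<Longrightarrow>
      iso_arr C (tobj C (tobj C X Y) Z) (tobj C X (tobj C Y Z)) (assoc C X Y Z)"
    and lunit_iso: "X \<in> Obj C \<Longrightarrow> iso_arr C (tobj C (tunit C) X) X (lunit C X)"
    and runit_iso: "X \<in> Obj C \<Longrightarrow> iso_arr C (tobj C X (tunit C)) X (runit C X)"
    and assoc_natural: "\<lbrakk>X \<in> Obj C; X' \<in> Obj C; Y \<in> Obj C; Y' \<in> Obj C; Z \<in> Obj C; Z' \<in> Obj C;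
        f \<in> Arr C X X'; g \<in> Arr C Y Y'; h \<in> Arr C Z Z'\<rbrakk> \<Longrightarrow>
      cmp C (tobj C (tobj C X Y) Z) (tobj C (tobj C X' Y') Z') (tobj C X' (tobj C Y' Z'))
        (assoc C X' Y' Z')
        (tmor C (tobj C X Y) (tobj C X' Y') Z Z' (tmor C X X' Y Y' f g) h) =
      cmp C (tobj C (tobj C X Y) Z) (tobj C X (tobj C Y Z)) (tobj C X' (tobj C Y' Z'))
        (tmor C X X' (tobj C Y Z) (tobj C Y' Z') f (tmor C Y Y' Z Z' g h))
        (assoc C X Y Z)"
    and lunit_natural: "\<lbrakk>X \<in> Obj C; X' \<in> Obj C; f \<in> Arr C X X'\<rbrakk> \<Longrightarrow>
      cmp C (tobj C (tunit C) X) (tobj C (tunit C) X') X'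
        (lunit C X') (tmor C (tunit C) (tunit C) X X' (ident C (tunit C)) f) =
      cmp C (tobj C (tunit C) X) X X' f (lunit C X)"
    and runit_natural: "\<lbrakk>X \<in> Obj C; X' \<in> Obj C; f \<in> Arr C X X'\<rbrakk> \<Longrightarrow>
      cmp C (tobj C X (tunit C)) (tobj C X' (tunit C)) X'
        (runit C X') (tmor C X X' (tunit C) (tunit C) f (ident C (tunit C))) =
      cmp C (tobj C X (tunit C)) X X' f (runit C X)"
    and pentagon: "\<lbrakk>W \<in> Obj C; X \<in> Obj C; Y \<in> Obj C; Z \<in> Obj C\<rbrakk> \<Longrightarrow>
      cmp C (tobj C (tobj C (tobj C W X) Y) Z) (tobj C (tobj C W X) (tobj C Y Z))
          (tobj C W (tobj C X (tobj C Y Z)))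
        (assoc C W X (tobj C Y Z)) (assoc C (tobj C W X) Y Z) =
      cmp C (tobj C (tobj C (tobj C W X) Y) Z) (tobj C W (tobj C (tobj C X Y) Z))
          (tobj C W (tobj C X (tobj C Y Z)))
        (tmor C W W (tobj C (tobj C X Y) Z) (tobj C X (tobj C Y Z))
          (ident C W) (assoc C X Y Z))
        (cmp C (tobj C (tobj C (tobj C W X) Y) Z) (tobj C (tobj C W (tobj C X Y)) Z)
            (tobj C W (tobj C (tobj C X Y) Z))
          (assoc C W (tobj C X Y) Z)
          (tmor C (tobj C (tobj C W X) Y) (tobj C W (tobj C X Y)) Z Z
            (assoc C W X Y) (ident C Z)))"
    and triangle: "\<lbrakk>X \<in> Obj C; Y \<in> Obj C\<rbrakk> \<Longrightarrow>
      cmp C (tobj C (tobj C X (tunit C)) Y) (tobj C X (tobj C (tunit C) Y)) (tobj C X Y)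
        (tmor C X X (tobj C (tunit C) Y) Y (ident C X) (lunit C Y)) (assoc C X (tunit C) Y) =
      tmor C (tobj C X (tunit C)) X Y Y (runit C X) (ident C Y)"

text \<open>A contravariant functor to \<open>k\<close>-modules; \<open>Tm X Y f : T Y \<rightarrow> T X\<close> for \<open>f : X \<rightarrow> Y\<close>.\<close>

locale contravariant_functor = monoidal_category C for C :: "('o, 'm) moncat" +
  fixes k :: "('k, 'r) ring_scheme"
    and T :: "'o \<Rightarrow> ('k, 'e) module"
    and Tm :: "'o \<Rightarrow> 'o \<Rightarrow> 'm \<Rightarrow> 'e \<Rightarrow> 'e"
  assumes T_module: "X \<in> Obj C \<Longrightarrow> module k (T X)"
    and Tm_linear: "\<lbrakk>X \<in> Obj C; Y \<in> Obj C; f \<in> Arr C X Y\<rbrakk> \<Longrightarrow>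
      Tm X Y f \<in> linear_maps k (T Y) (T X)"
    and Tm_ident: "\<lbrakk>X \<in> Obj C; x \<in> carrier (T X)\<rbrakk> \<Longrightarrow> Tm X X (ident C X) x = x"
    and Tm_cmp: "\<lbrakk>X \<in> Obj C; Y \<in> Obj C; Z \<in> Obj C; f \<in> Arr C X Y; g \<in> Arr C Y Z;
        x \<in> carrier (T Z)\<rbrakk> \<Longrightarrow>
      Tm X Z (cmp C X Y Z g f) x = Tm X Y f (Tm Y Z g x)"

locale weak_trace_functor = contravariant_functor C k T Tm
  for C :: "('o, 'm) moncat" and k :: "('k, 'r) ring_scheme"
    and T :: "'o \<Rightarrow> ('k, 'e) module" and Tm :: "'o \<Rightarrow> 'o \<Rightarrow> 'm \<Rightarrow> 'e \<Rightarrow> 'e" +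
  fixes trc :: "'o \<Rightarrow> 'o \<Rightarrow> 'e \<Rightarrow> 'e"
  assumes trc_linear: "\<lbrakk>X \<in> Obj C; Y \<in> Obj C\<rbrakk> \<Longrightarrow>
      trc X Y \<in> linear_maps k (T (tobj C X Y)) (T (tobj C Y X))"
    and trc_bij: "\<lbrakk>X \<in> Obj C; Y \<in> Obj C\<rbrakk> \<Longrightarrow>
      bij_betw (trc X Y) (carrier (T (tobj C X Y))) (carrier (T (tobj C Y X)))"
    and trc_natural: "\<lbrakk>X \<in> Obj C; X' \<in> Obj C; Y \<in> Obj C; Y' \<in> Obj C;
        f \<in> Arr C X X'; g \<in> Arr C Y Y'; x \<in> carrier (T (tobj C X' Y'))\<rbrakk> \<Longrightarrow>
      trc X Y (Tm (tobj C X Y) (tobj C X' Y') (tmor C X X' Y Y' f g) x) =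
      Tm (tobj C Y X) (tobj C Y' X') (tmor C Y Y' X X' g f) (trc X' Y' x)"
    and trc_tobj: "\<lbrakk>X \<in> Obj C; Y \<in> Obj C; Z \<in> Obj C; x \<in> carrier (T (tobj C Z (tobj C X Y)))\<rbrakk> \<Longrightarrow>
      trc Z (tobj C X Y) x =
      Tm (tobj C (tobj C X Y) Z) (tobj C X (tobj C Y Z)) (assoc C X Y Z)
        (trc (tobj C Y Z) X
          (Tm (tobj C (tobj C Y Z) X) (tobj C Y (tobj C Z X)) (assoc C Y Z X)
            (trc (tobj C Z X) Y
              (Tm (tobj C (tobj C Z X) Y) (tobj C Z (tobj C X Y)) (assoc C Z X Y) x))))"

definition unital_trace ::
  "('o, 'm) moncat \<Rightarrow> ('o \<Rightarrow> ('k, 'e) module) \<Rightarrow> ('o \<Rightarrow> 'o \<Rightarrow> 'm \<Rightarrow> 'e \<Rightarrow> 'e) \<Rightarrow>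
    ('o \<Rightarrow> 'o \<Rightarrow> 'e \<Rightarrow> 'e) \<Rightarrow> bool"
  where "unital_trace C T Tm trc \<longleftrightarrow> (\<forall>X\<in>Obj C. \<forall>x\<in>carrier (T X).
    trc (tunit C) X (Tm (tobj C (tunit C) X) X (lunit C X) x) =
    Tm (tobj C X (tunit C)) X (runit C X) x)"


section \<open>The monoidal category of comodules\<close>

text \<open>Objects of one category need elements in one type. The following type contains an arbitrary
  type \<open>'v\<close>, the base algebra, and is closed under tensor products: \<open>Tens xs\<close> stands for
  \<open>\<Sum>\<^sub>i x\<^sub>i \<otimes> y\<^sub>i\<close>, for one chosen expression of each element.\<close>

datatype ('a, 'v) univ =
  Atom 'v | Scalar (the_scalar: 'a) | Tens (the_pairs: "(('a, 'v) univ \<times> ('a, 'v) univ) list")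

type_synonym ('a, 'u, 'v) ucomodule = "('a, 'u, ('a, 'v) univ) comodule"

definition enc ::
  "(('a, 'v) univ, ('a, 'v) univ) tprod \<Rightarrow> (('a, 'v) univ, ('a, 'v) univ) tens \<Rightarrow> ('a, 'v) univ"
  where "enc T c = Tens (representative T c)"

definition dec ::
  "(('a, 'v) univ, ('a, 'v) univ) tprod \<Rightarrow> ('a, 'v) univ \<Rightarrow> (('a, 'v) univ, ('a, 'v) univ) tens"
  where "dec T x = list_sum T (pure T) (the_pairs x)"

definition XX ::
  "('k, 'a, 'u) bialgebroid \<Rightarrow> ('a, 'u, 'v) ucomodule \<Rightarrow> ('a, 'u, 'v) ucomodule \<Rightarrow>
    (('a, 'v) univ, ('a, 'v) univ) tprod"
  where "XX B N P = tensor (carrier (base_alg B)) N (right_act B N) (smult P) P"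

definition comod_pure ::
  "('k, 'a, 'u) bialgebroid \<Rightarrow> ('a, 'u, 'v) ucomodule \<Rightarrow> ('a, 'u, 'v) ucomodule \<Rightarrow>
    ('a, 'v) univ \<Rightarrow> ('a, 'v) univ \<Rightarrow> ('a, 'v) univ"
  where "comod_pure B N P n p = enc (XX B N P) (n \<boxtimes>\<^bsub>XX B N P\<^esub> p)"

definition comod_tensor_module ::
  "('k, 'a, 'u) bialgebroid \<Rightarrow> ('a, 'u, 'v) ucomodule \<Rightarrow> ('a, 'u, 'v) ucomodule \<Rightarrow>
    ('a, ('a, 'v) univ) module"
  where "comod_tensor_module B N P = (let T = XX B N P in
    \<lparr>carrier = enc T ` carrier T, mult = undefined, one = undefined, zero = enc T \<zero>\<^bsub>T\<^esub>,
     add = (\<lambda>x y. enc T (dec T x \<oplus>\<^bsub>T\<^esub> dec T y)),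
     smult = (\<lambda>a x. enc T (sweedler T T (\<lambda>n p. (a \<odot>\<^bsub>N\<^esub> n) \<boxtimes>\<^bsub>T\<^esub> p) (dec T x)))\<rparr>)"

definition comod_tensor ::
  "('k, 'a, 'u) bialgebroid \<Rightarrow> ('a, 'u, 'v) ucomodule \<Rightarrow> ('a, 'u, 'v) ucomodule \<Rightarrow>
    ('a, 'u, 'v) ucomodule"
  where "comod_tensor B N P =
    (let T = XX B N P; W = UX B (comod_tensor_module B N P) in
     module.extend (comod_tensor_module B N P) (comodule.fields
       (\<lambda>x. sweedler T W (\<lambda>n p.
          sweedler (UX B N) W (\<lambda>u n'.
            sweedler (UX B P) W (\<lambda>v p'.
              (u \<otimes>\<^bsub>total_alg B\<^esub> v) \<boxtimes>\<^bsub>W\<^esub> comod_pure B N P n' p')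
            (coact P p)) (coact N n)) (dec T x))))"

definition comod_unit_module :: "('k, 'a, 'u) bialgebroid \<Rightarrow> ('a, ('a, 'v) univ) module"
  where "comod_unit_module B =
    \<lparr>carrier = Scalar ` carrier (base_alg B), mult = undefined, one = undefined,
     zero = Scalar \<zero>\<^bsub>base_alg B\<^esub>,
     add = (\<lambda>x y. Scalar (the_scalar x \<oplus>\<^bsub>base_alg B\<^esub> the_scalar y)),
     smult = (\<lambda>a x. Scalar (a \<otimes>\<^bsub>base_alg B\<^esub> the_scalar x))\<rparr>"

definition comod_unit :: "('k, 'a, 'u) bialgebroid \<Rightarrow> ('a, 'u, 'v) ucomodule"
  where "comod_unit B = module.extend (comod_unit_module B) (comodule.fields
    (\<lambda>x. src B (the_scalar x)
       \<boxtimes>\<^bsub>UX B (comod_unit_module B :: ('a, ('a, 'v) univ) module)\<^esub> Scalar \<one>\<^bsub>base_alg B\<^esub>))"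

definition comod_cat ::
  "('k, 'a, 'u) bialgebroid \<Rightarrow> (('a, 'u, 'v) ucomodule, ('a, 'v) univ \<Rightarrow> ('a, 'v) univ) moncat"
  where "comod_cat B = \<lparr>
    Obj = {N. left_comodule B N},
    Arr = comod_hom B,
    ident = (\<lambda>X. \<lambda>x\<in>carrier X. x),
    cmp = (\<lambda>X Y Z g f. compose (carrier X) g f),
    tobj = comod_tensor B,
    tmor = (\<lambda>X X' Y Y' f g. \<lambda>z\<in>carrier (comod_tensor B X Y).
      sweedler (XX B X Y) (comod_tensor B X' Y')
        (\<lambda>x y. comod_pure B X' Y' (f x) (g y)) (dec (XX B X Y) z)),
    tunit = comod_unit B,
    assoc = (\<lambda>X Y Z. \<lambda>w\<in>carrier (comod_tensor B (comod_tensor B X Y) Z).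
      sweedler (XX B (comod_tensor B X Y) Z) (comod_tensor B X (comod_tensor B Y Z))
        (\<lambda>v z. sweedler (XX B X Y) (comod_tensor B X (comod_tensor B Y Z))
          (\<lambda>x y. comod_pure B X (comod_tensor B Y Z) x (comod_pure B Y Z y z))
          (dec (XX B X Y) v))
        (dec (XX B (comod_tensor B X Y) Z) w)),
    lunit = (\<lambda>X. \<lambda>z\<in>carrier (comod_tensor B (comod_unit B) X).
      sweedler (XX B (comod_unit B) X) X (\<lambda>a x. the_scalar a \<odot>\<^bsub>X\<^esub> x)
        (dec (XX B (comod_unit B) X) z)),
    runit = (\<lambda>X. \<lambda>z\<in>carrier (comod_tensor B X (comod_unit B)).
      sweedler (XX B X (comod_unit B)) X (\<lambda>x a. right_act B X x (the_scalar a))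
        (dec (XX B X (comod_unit B)) z))\<rparr>"

definition precompose ::
  "('a, 'u, 'm) comodule \<Rightarrow> ('a, 'u, 'm) comodule \<Rightarrow> ('m \<Rightarrow> 'm) \<Rightarrow> ('m \<Rightarrow> 'n) \<Rightarrow> ('m \<Rightarrow> 'n)"
  where "precompose X Y h f = compose (carrier X) f h"

end

theory Submission
  imports Defs
begin

text \<open>The trace is constructed through its inverse: for a colinear map \<open>g : P \<otimes> N \<rightarrow> M\<close> put
  \<open>g'(n \<otimes> p) = g(p\<^bsub>(0)\<^esub> \<otimes> n) p\<^bsub>(-1)\<^esub>\<close>, which is \<open>untrace\<close> below and involves only the left coaction of \<open>P\<close>.
  That \<open>g'\<close> is colinear (\<open>untr_coact\<close>) is the point of the anti Yetter-Drinfel'd condition: it expresses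
  the coaction of \<open>g(p\<^bsub>(0)\<^esub> \<otimes> n) p\<^bsub>(-1)\<^esub>\<close> by three successive coactions on \<open>p\<close>, of which two cancel by
  \<open>u\<^bsub>(1)+\<^esub> \<otimes> u\<^bsub>(1)-\<^esub> u\<^bsub>(2)\<^esub> = u \<otimes> 1\<close>. Naturality of \<open>untrace\<close> and the condition relating traces for
  \<open>Z \<otimes> (X \<otimes> Y)\<close>, \<open>(Y \<otimes> Z) \<otimes> X\<close> and \<open>(Z \<otimes> X) \<otimes> Y\<close> are comparisons on pure tensors
  (\<open>untrace_natural\<close>, \<open>untrace_hexagon\<close>).

  Let \<open>\<sigma>(m) = m\<^bsub>(0)\<^esub> m\<^bsub>(-1)\<^esub>\<close>, a colinear and \<open>U\<close>-linear endomorphism of \<open>M\<close>; stability of \<open>M\<close> says \<open>\<sigma> = id\<close>.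
  Applying \<open>untrace\<close> twice is composition with \<open>\<sigma>\<close> (\<open>untrace_untrace\<close>), and up to the unit constraints it is
  composition with \<open>\<sigma>\<close> if \<open>N\<close> is the unit comodule (\<open>untrace_unit\<close>). The second fact yields the
  equivalence of unitality and stability, once \<open>untrace\<close> is known to be bijective.

  Bijectivity uses the right Hopf structure. Let \<open>j, f\<^sub>j\<close> be a dual basis of the projective module
  \<open>\<^sub>\<triangleright>U\<close>, and put \<open>G\<^sub>j(u) = u\<^bsub>[+]\<^esub> s(f\<^sub>j(u\<^bsub>[-]\<^esub>))\<close> and \<open>K\<^sub>j(p) = \<epsilon>(G\<^sub>j(p\<^bsub>(-1)\<^esub>)) p\<^bsub>(0)\<^esub>\<close>. Then
  \<open>p\<^bsub>[0]\<^esub> \<otimes> p\<^bsub>[1]\<^esub> = \<Sum>\<^sub>j K\<^sub>j(p) \<otimes> j\<close> (\<open>right_coact_sum\<close>), the coaction of \<open>K\<^sub>j(p)\<close> is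
  \<open>G\<^sub>j(p\<^bsub>(-1)\<^esub>) \<otimes> p\<^bsub>(0)\<^esub>\<close> (\<open>csum_Kj\<close>), and \<open>\<Sum>\<^sub>j G\<^sub>j(u) j = u\<^bsub>[+]\<^esub> u\<^bsub>[-]\<^esub> = t(\<epsilon>(u))\<close> (\<open>Gf_sum\<close>). Together
  they give \<open>q(p\<^bsub>[0](0)\<^esub>) p\<^bsub>[0](-1)\<^esub> p\<^bsub>[1]\<^esub> = q(p)\<close> for every left \<open>A\<close>-linear \<open>q : P \<rightarrow> M\<close>
  (\<open>act_coact_right_coact_sum\<close>). With \<open>q = g(- \<otimes> n)\<close> this says that \<open>f(n \<otimes> p\<^bsub>[0]\<^esub>) p\<^bsub>[1]\<^esub>\<close> recovers \<open>g\<close> from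
  \<open>f = g'\<close> (\<open>untrace_right_coact\<close>), so \<open>untrace\<close> is injective and its inverse has the required form.
  With \<open>q = id\<close> it says that every \<open>m\<close> is \<open>\<Sum>\<^sub>j \<sigma>(K\<^sub>j(m)) j\<close>, and bijectivity of \<open>\<sigma>\<close> follows (\<open>sig_bij\<close>).
  Then \<open>untrace\<close> is surjective too, because \<open>f\<close> is the twofold \<open>untrace\<close> of \<open>\<sigma>\<^sup>-\<^sup>1 \<circ> f\<close>.

  The anti Yetter-Drinfel'd condition and the right coaction involve elements that are lifted along a map
  of tensor products induced by an inclusion. For
  \<open>u\<^bsub>+(1)\<^esub> \<otimes> (u\<^bsub>+(2)\<^esub> \<otimes> u\<^sub>-)\<close> the lift is \<open>u\<^bsub>(1)\<^esub> \<otimes> (u\<^bsub>(2)+\<^esub> \<otimes> u\<^bsub>(2)-\<^esub>)\<close>, and this map is injective since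
  \<open>U\<^sub>\<triangleleft>\<close> has a dual basis (\<open>balanced_incl_inj\<close>). For the right coaction a lift is \<open>\<Sum>\<^sub>j Y\<^sub>j \<otimes> j\<close> with
  \<open>Y\<^sub>j = G\<^sub>j(p\<^bsub>(-1)\<^esub>) \<otimes> p\<^bsub>(0)\<^esub>\<close>, and expanding any lift along the dual basis leads to the same result.

  Sums in Sweedler notation run over chosen representatives. The first sections show that on functions
  which are biadditive and balanced they compute the homomorphism given by the universal property of the
  tensor product, and derive the calculus of coactions, the tensor product of comodules and its
  coherence from that.\<close>

section \<open>Additive maps and list sums\<close>

definition additive_maps ::
  "('g, 'b) ring_scheme \<Rightarrow> ('h, 'c) ring_scheme \<Rightarrow> ('g \<Rightarrow> 'h) set"
  where "additive_maps G H = {h \<in> carrier G \<rightarrow> carrier H.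
    \<forall>x\<in>carrier G. \<forall>y\<in>carrier G. h (x \<oplus>\<^bsub>G\<^esub> y) = h x \<oplus>\<^bsub>H\<^esub> h y}"

lemma additive_mapsI:
  assumes "\<And>x. x \<in> carrier G \<Longrightarrow> h x \<in> carrier H"
    and "\<And>x y. x \<in> carrier G \<Longrightarrow> y \<in> carrier G \<Longrightarrow> h (x \<oplus>\<^bsub>G\<^esub> y) = h x \<oplus>\<^bsub>H\<^esub> h y"
  shows "h \<in> additive_maps G H"
  using assms by (auto simp: additive_maps_def)

lemma additive_maps_closed: "h \<in> additive_maps G H \<Longrightarrow> x \<in> carrier G \<Longrightarrow> h x \<in> carrier H"
  by (auto simp: additive_maps_def)

lemma additive_maps_add:
  "h \<in> additive_maps G H \<Longrightarrow> x \<in> carrier G \<Longrightarrow> y \<in> carrier G \<Longrightarrow>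
    h (x \<oplus>\<^bsub>G\<^esub> y) = h x \<oplus>\<^bsub>H\<^esub> h y"
  by (auto simp: additive_maps_def)

lemma additive_maps_zero:
  assumes "abelian_group G" "abelian_group H" "h \<in> additive_maps G H"
  shows "h \<zero>\<^bsub>G\<^esub> = \<zero>\<^bsub>H\<^esub>"
proof -
  interpret G: abelian_group G by fact
  interpret H: abelian_group H by fact
  have c: "h \<zero>\<^bsub>G\<^esub> \<in> carrier H" using assms(3) by (simp add: additive_maps_closed)
  have "h \<zero>\<^bsub>G\<^esub> \<oplus>\<^bsub>H\<^esub> h \<zero>\<^bsub>G\<^esub> = h \<zero>\<^bsub>G\<^esub>"
    using additive_maps_add[OF assms(3), of "\<zero>\<^bsub>G\<^esub>" "\<zero>\<^bsub>G\<^esub>"] by simp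
  then show ?thesis using c by simp
qed

lemma additive_maps_comp:
  assumes "h \<in> additive_maps G H" "g \<in> additive_maps H K"
  shows "(\<lambda>x. g (h x)) \<in> additive_maps G K"
  using assms by (auto simp: additive_maps_def Pi_iff)

lemma additive_maps_finsum:
  assumes "abelian_group G" "abelian_group H" "h \<in> additive_maps G H"
    and "finite J" "\<And>j. j \<in> J \<Longrightarrow> f j \<in> carrier G"
  shows "h (\<Oplus>\<^bsub>G\<^esub>j\<in>J. f j) = (\<Oplus>\<^bsub>H\<^esub>j\<in>J. h (f j))"
proof -
  interpret G: abelian_group G by fact
  interpret H: abelian_group H by fact
  show ?thesis using assms(4,5)
  proof (induction J)
    case empty
    then show ?case using additive_maps_zero[OF assms(1-3)] by simp
  next
    case (insert j J)
    then show ?case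
      using additive_maps_add[OF assms(3)] additive_maps_closed[OF assms(3)]
      by (simp add: Pi_iff)
  qed
qed

lemma list_sum_Nil [simp]: "list_sum G g [] = \<zero>\<^bsub>G\<^esub>"
  by (simp add: list_sum_def)

lemma list_sum_Cons [simp]: "list_sum G g ((x, y) # xs) = g x y \<oplus>\<^bsub>G\<^esub> list_sum G g xs"
  by (simp add: list_sum_def)

lemma list_sum_closed:
  assumes "abelian_group G" "\<And>x y. (x, y) \<in> set xs \<Longrightarrow> g x y \<in> carrier G"
  shows "list_sum G g xs \<in> carrier G"
proof -
  interpret abelian_group G by fact
  show ?thesis using assms(2) by (induction xs) auto
qed

lemma list_sum_append:
  assumes "abelian_group G" "\<And>x y. (x, y) \<in> set xs \<union> set ys \<Longrightarrow> g x y \<in> carrier G"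
  shows "list_sum G g (xs @ ys) = list_sum G g xs \<oplus>\<^bsub>G\<^esub> list_sum G g ys"
proof -
  interpret abelian_group G by fact
  show ?thesis using assms(2)
  proof (induction xs)
    case Nil
    then show ?case by (simp add: list_sum_closed[OF assms(1)])
  next
    case (Cons p xs)
    then show ?case by (cases p) (simp add: a_assoc list_sum_closed[OF assms(1)])
  qed
qed

lemma list_sum_cong:
  "(\<And>x y. (x, y) \<in> set xs \<Longrightarrow> g x y = h x y) \<Longrightarrow> list_sum G g xs = list_sum G h xs"
  by (induction xs) auto

lemma list_sum_zero:
  assumes "abelian_group G"
  shows "list_sum G (\<lambda>x y. \<zero>\<^bsub>G\<^esub>) xs = \<zero>\<^bsub>G\<^esub>"
proof -
  interpret abelian_group G by fact
  show ?thesis by (induction xs) auto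
qed

lemma list_sum_add:
  assumes "abelian_group G" "\<And>x y. (x, y) \<in> set xs \<Longrightarrow> g x y \<in> carrier G"
    "\<And>x y. (x, y) \<in> set xs \<Longrightarrow> h x y \<in> carrier G"
  shows "list_sum G (\<lambda>x y. g x y \<oplus>\<^bsub>G\<^esub> h x y) xs = list_sum G g xs \<oplus>\<^bsub>G\<^esub> list_sum G h xs"
proof -
  interpret abelian_group G by fact
  show ?thesis using assms(2,3)
  proof (induction xs)
    case (Cons p xs)
    obtain x y where [simp]: "p = (x, y)" by force
    have "g x y \<in> carrier G" "h x y \<in> carrier G" "list_sum G g xs \<in> carrier G"
      "list_sum G h xs \<in> carrier G"
      using Cons.prems by (auto intro: list_sum_closed[OF assms(1)])
    then show ?case using Cons by (simp add: a_ac)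
  qed simp
qed

lemma list_sum_hom:
  assumes "abelian_group G" "abelian_group H" "h \<in> additive_maps G H"
    "\<And>x y. (x, y) \<in> set xs \<Longrightarrow> g x y \<in> carrier G"
  shows "h (list_sum G g xs) = list_sum H (\<lambda>x y. h (g x y)) xs"
  using assms(4)
proof (induction xs)
  case Nil
  then show ?case by (simp add: additive_maps_zero[OF assms(1-3)])
next
  case (Cons p xs)
  then show ?case
    by (cases p) (simp add: additive_maps_add[OF assms(3)] list_sum_closed[OF assms(1)])
qed

lemma list_sum_swap:
  assumes "abelian_group G"
    "\<And>x y x' y'. (x, y) \<in> set xs \<Longrightarrow> (x', y') \<in> set ys \<Longrightarrow> g x y x' y' \<in> carrier G"
  shows "list_sum G (\<lambda>x y. list_sum G (g x y) ys) xs =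
    list_sum G (\<lambda>x' y'. list_sum G (\<lambda>x y. g x y x' y') xs) ys"
  using assms(2)
proof (induction xs)
  case Nil
  then show ?case by (simp add: list_sum_zero[OF assms(1)])
next
  case (Cons p xs)
  obtain x y where [simp]: "p = (x, y)" by force
  have "list_sum G (\<lambda>x' y'. list_sum G (\<lambda>x y. g x y x' y') (p # xs)) ys =
    list_sum G (\<lambda>x' y'. g x y x' y' \<oplus>\<^bsub>G\<^esub> list_sum G (\<lambda>x y. g x y x' y') xs) ys"
    by simp
  also have "\<dots> = list_sum G (g x y) ys \<oplus>\<^bsub>G\<^esub>
      list_sum G (\<lambda>x' y'. list_sum G (\<lambda>x y. g x y x' y') xs) ys"
    using Cons.prems
    by (intro list_sum_add[OF assms(1)] list_sum_closed[OF assms(1)]) auto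
  finally show ?case using Cons by simp
qed

lemma list_sum_finsum:
  assumes "abelian_group G" "finite J"
    "\<And>j x y. j \<in> J \<Longrightarrow> (x, y) \<in> set xs \<Longrightarrow> g x y j \<in> carrier G"
  shows "list_sum G (\<lambda>x y. \<Oplus>\<^bsub>G\<^esub>j\<in>J. g x y j) xs =
    (\<Oplus>\<^bsub>G\<^esub>j\<in>J. list_sum G (\<lambda>x y. g x y j) xs)"
proof -
  interpret abelian_group G by fact
  show ?thesis using assms(3)
  proof (induction xs)
    case (Cons p xs)
    obtain x y where [simp]: "p = (x, y)" by force
    have "(\<Oplus>\<^bsub>G\<^esub>j\<in>J. g x y j \<oplus>\<^bsub>G\<^esub> list_sum G (\<lambda>x y. g x y j) xs) =
        (\<Oplus>\<^bsub>G\<^esub>j\<in>J. g x y j) \<oplus>\<^bsub>G\<^esub> (\<Oplus>\<^bsub>G\<^esub>j\<in>J. list_sum G (\<lambda>x y. g x y j) xs)"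
      using Cons.prems by (intro finsum_addf) (auto intro!: list_sum_closed[OF assms(1)])
    then show ?case using Cons by simp
  qed simp
qed

section \<open>The universal property of tensor products\<close>

text \<open>Closure of the carriers under the two actions is all that the universal property rests on, so the same
  facts serve for every tensor product below.\<close>

definition tensor_data ::
  "'a set \<Rightarrow> ('x, 'b) ring_scheme \<Rightarrow> ('x \<Rightarrow> 'a \<Rightarrow> 'x) \<Rightarrow> ('a \<Rightarrow> 'y \<Rightarrow> 'y) \<Rightarrow> ('y, 'c) ring_scheme \<Rightarrow> bool"
  where "tensor_data S X r l Y \<longleftrightarrow> abelian_group X \<and> abelian_group Y \<and>
    (\<forall>a\<in>S. \<forall>x\<in>carrier X. r x a \<in> carrier X) \<and> (\<forall>a\<in>S. \<forall>y\<in>carrier Y. l a y \<in> carrier Y)"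

definition balanced ::
  "'a set \<Rightarrow> ('x, 'b) ring_scheme \<Rightarrow> ('x \<Rightarrow> 'a \<Rightarrow> 'x) \<Rightarrow> ('a \<Rightarrow> 'y \<Rightarrow> 'y) \<Rightarrow> ('y, 'c) ring_scheme \<Rightarrow>
    ('g, 'd) ring_scheme \<Rightarrow> ('x \<Rightarrow> 'y \<Rightarrow> 'g) \<Rightarrow> bool"
  where "balanced S X r l Y G g \<longleftrightarrow>
    (\<forall>x\<in>carrier X. \<forall>y\<in>carrier Y. g x y \<in> carrier G) \<and>
    (\<forall>x\<in>carrier X. \<forall>x'\<in>carrier X. \<forall>y\<in>carrier Y. g (x \<oplus>\<^bsub>X\<^esub> x') y = g x y \<oplus>\<^bsub>G\<^esub> g x' y) \<and>
    (\<forall>x\<in>carrier X. \<forall>y\<in>carrier Y. \<forall>y'\<in>carrier Y. g x (y \<oplus>\<^bsub>Y\<^esub> y') = g x y \<oplus>\<^bsub>G\<^esub> g x y') \<and>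
    (\<forall>a\<in>S. \<forall>x\<in>carrier X. \<forall>y\<in>carrier Y. g (r x a) y = g x (l a y))"

lemma balancedI:
  assumes "\<And>x y. x \<in> carrier X \<Longrightarrow> y \<in> carrier Y \<Longrightarrow> g x y \<in> carrier G"
    and "\<And>x x' y. x \<in> carrier X \<Longrightarrow> x' \<in> carrier X \<Longrightarrow> y \<in> carrier Y \<Longrightarrow>
      g (x \<oplus>\<^bsub>X\<^esub> x') y = g x y \<oplus>\<^bsub>G\<^esub> g x' y"
    and "\<And>x y y'. x \<in> carrier X \<Longrightarrow> y \<in> carrier Y \<Longrightarrow> y' \<in> carrier Y \<Longrightarrow>
      g x (y \<oplus>\<^bsub>Y\<^esub> y') = g x y \<oplus>\<^bsub>G\<^esub> g x y'"
    and "\<And>a x y. a \<in> S \<Longrightarrow> x \<in> carrier X \<Longrightarrow> y \<in> carrier Y \<Longrightarrow> g (r x a) y = g x (l a y)"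
  shows "balanced S X r l Y G g"
  using assms by (auto simp: balanced_def)

lemma tensor_fields [simp]:
  "factors (tensor S X r l Y) = carrier X \<times> carrier Y"
  by (simp add: tensor_def Let_def)

context
  fixes S :: "'a set" and X :: "('x, 'b) ring_scheme" and r and l
    and Y :: "('y, 'c) ring_scheme" and F H T
  assumes data: "tensor_data S X r l Y"
  defines "F \<equiv> free_Abelian_group (carrier X \<times> carrier Y)"
    and "H \<equiv> generate F (tensor_relations S X r l Y)"
    and "T \<equiv> tensor S X r l Y"
begin

interpretation X: abelian_group X using data by (simp add: tensor_data_def)
interpretation Y: abelian_group Y using data by (simp add: tensor_data_def)
interpretation F: comm_group F unfolding F_def by (rule abelian_free_Abelian_group)

lemma F_simps: "x \<otimes>\<^bsub>F\<^esub> y = x + y" "\<one>\<^bsub>F\<^esub> = 0" "x \<in> carrier F \<longleftrightarrow> Poly_Mapping.keys x \<subseteq> carrier X \<times> carrier Y"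
  by (simp_all add: F_def)

lemma frag_diff_in_F:
  assumes "x \<in> carrier F" "y \<in> carrier F" shows "x - y \<in> carrier F"
proof -
  have "inv\<^bsub>F\<^esub> y = - y" using assms by (simp add: F_def)
  then have "x - y = x \<otimes>\<^bsub>F\<^esub> inv\<^bsub>F\<^esub> y" by (simp add: F_simps)
  then show ?thesis using assms by simp
qed

lemma frag_of_in_F: "x \<in> carrier X \<Longrightarrow> y \<in> carrier Y \<Longrightarrow> frag_of (x, y) \<in> carrier F"
  by (simp add: F_def)

lemma relations_subset: "tensor_relations S X r l Y \<subseteq> carrier F"
  using data unfolding tensor_relations_def tensor_data_def
  by (auto simp del: frag_of_in_free_Abelian_group carrier_free_Abelian_group_iff
      intro!: frag_diff_in_F frag_of_in_F)

lemma subgroup_H: "subgroup H F"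
  unfolding H_def by (rule F.generate_is_subgroup[OF relations_subset])

lemma normal_H: "H \<lhd> F" using subgroup_H by (rule F.subgroup_imp_normal)

interpretation H: normal H F by (rule normal_H)
interpretation Q: comm_group "F Mod H" by (rule F.abelian_FactGroup[OF subgroup_H])

lemma T_simps: "carrier T = carrier (F Mod H)" "x \<oplus>\<^bsub>T\<^esub> y = x \<otimes>\<^bsub>F Mod H\<^esub> y" "\<zero>\<^bsub>T\<^esub> = \<one>\<^bsub>F Mod H\<^esub>"
    "pure T x' y' = H #>\<^bsub>F\<^esub> frag_of (x', y')"
  by (simp_all add: T_def tensor_def Let_def F_def H_def)

lemma abelian_group_T: "abelian_group T"
proof (rule abelian_groupI, unfold T_simps)
  show "x \<otimes>\<^bsub>F Mod H\<^esub> y = y \<otimes>\<^bsub>F Mod H\<^esub> x"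
    if "x \<in> carrier (F Mod H)" "y \<in> carrier (F Mod H)" for x y
    using that by (rule Q.m_comm)
  show "\<exists>y\<in>carrier (F Mod H). y \<otimes>\<^bsub>F Mod H\<^esub> x = \<one>\<^bsub>F Mod H\<^esub>"
    if "x \<in> carrier (F Mod H)" for x
    using that by (intro bexI[of _ "inv\<^bsub>F Mod H\<^esub> x"] Q.l_inv Q.inv_closed)
qed (rule Q.m_closed Q.one_closed Q.m_assoc Q.l_one; assumption)+

lemma pure_T_closed: "x \<in> carrier X \<Longrightarrow> y \<in> carrier Y \<Longrightarrow> pure T x y \<in> carrier T"
  using frag_of_in_F by (auto simp: T_simps carrier_FactGroup)

lemma coset_add:
  assumes "x \<in> carrier F" "y \<in> carrier F"
  shows "(H #>\<^bsub>F\<^esub> x) \<oplus>\<^bsub>T\<^esub> (H #>\<^bsub>F\<^esub> y) = H #>\<^bsub>F\<^esub> (x + y)"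
  using H.rcos_sum[OF assms] by (simp add: T_simps F_simps)

lemma coset_eqI:
  assumes "x \<in> carrier F" "y \<in> carrier F" "x - y \<in> H"
  shows "H #>\<^bsub>F\<^esub> x = H #>\<^bsub>F\<^esub> y"
proof -
  have "x = (x - y) \<otimes>\<^bsub>F\<^esub> y" by (simp add: F_simps)
  then have "x \<in> H #>\<^bsub>F\<^esub> y" using assms by (auto simp: r_coset_def)
  then show ?thesis using F.repr_independence assms subgroup_H by metis
qed

lemma relation_in_H: "z \<in> tensor_relations S X r l Y \<Longrightarrow> z \<in> H"
  unfolding H_def by (rule generate.incl)

lemma pure_T_add_left:
  assumes "x \<in> carrier X" "x' \<in> carrier X" "y \<in> carrier Y"
  shows "pure T (x \<oplus>\<^bsub>X\<^esub> x') y = pure T x y \<oplus>\<^bsub>T\<^esub> pure T x' y"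
proof -
  have "frag_of (x \<oplus>\<^bsub>X\<^esub> x', y) - (frag_of (x, y) + frag_of (x', y)) \<in> H"
    using assms by (intro relation_in_H) (auto simp: tensor_relations_def diff_diff_eq)
  moreover have "frag_of (x, y) + frag_of (x', y) \<in> carrier F"
    using F.m_closed[OF frag_of_in_F[of x y] frag_of_in_F[of x' y]] assms by (simp add: F_simps)
  ultimately have "H #>\<^bsub>F\<^esub> frag_of (x \<oplus>\<^bsub>X\<^esub> x', y) = H #>\<^bsub>F\<^esub> (frag_of (x, y) + frag_of (x', y))"
    using assms by (intro coset_eqI frag_of_in_F) auto
  then show ?thesis
    using coset_add[OF frag_of_in_F[of x y] frag_of_in_F[of x' y]] assms T_simps(4) by simp
qed

lemma pure_T_add_right:
  assumes "x \<in> carrier X" "y \<in> carrier Y" "y' \<in> carrier Y"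
  shows "pure T x (y \<oplus>\<^bsub>Y\<^esub> y') = pure T x y \<oplus>\<^bsub>T\<^esub> pure T x y'"
proof -
  have "frag_of (x, y \<oplus>\<^bsub>Y\<^esub> y') - (frag_of (x, y) + frag_of (x, y')) \<in> H"
    using assms by (intro relation_in_H) (auto simp: tensor_relations_def diff_diff_eq)
  moreover have "frag_of (x, y) + frag_of (x, y') \<in> carrier F"
    using F.m_closed[OF frag_of_in_F[of x y] frag_of_in_F[of x y']] assms by (simp add: F_simps)
  ultimately have "H #>\<^bsub>F\<^esub> frag_of (x, y \<oplus>\<^bsub>Y\<^esub> y') = H #>\<^bsub>F\<^esub> (frag_of (x, y) + frag_of (x, y'))"
    using assms by (intro coset_eqI frag_of_in_F) auto
  then show ?thesis
    using coset_add[OF frag_of_in_F[of x y] frag_of_in_F[of x y']] assms T_simps(4) by simp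
qed

lemma pure_T_balanced:
  assumes "a \<in> S" "x \<in> carrier X" "y \<in> carrier Y"
  shows "pure T (r x a) y = pure T x (l a y)"
  unfolding T_simps(4)
  using assms data unfolding tensor_data_def
  by (intro coset_eqI frag_of_in_F relation_in_H) (auto simp: tensor_relations_def)

lemma frag_sum_in_F: "set xs \<subseteq> carrier X \<times> carrier Y \<Longrightarrow> sum_list (map frag_of xs) \<in> carrier F"
proof (induction xs)
  case Nil
  then show ?case using F.one_closed by (simp add: F_simps)
next
  case (Cons p xs)
  then have "frag_of p \<in> carrier F" "sum_list (map frag_of xs) \<in> carrier F"
    by (auto simp: F_def)
  from F.m_closed[OF this] show ?case by (simp add: F_simps)
qed

lemma list_sum_pure:
  "set xs \<subseteq> carrier X \<times> carrier Y \<Longrightarrow> list_sum T (pure T) xs = H #>\<^bsub>F\<^esub> sum_list (map frag_of xs)"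
proof (induction xs)
  case Nil
  have "H #>\<^bsub>F\<^esub> 0 = H"
    using F.coset_mult_one[OF subgroup.subset[OF subgroup_H]] by (simp add: F_simps)
  then show ?case by (simp add: T_simps)
next
  case (Cons p xs)
  obtain x y where [simp]: "p = (x, y)" by force
  have "frag_of (x, y) \<in> carrier F" "sum_list (map frag_of xs) \<in> carrier F"
    using Cons.prems frag_sum_in_F by (auto intro: frag_of_in_F)
  from coset_add[OF this] show ?case using Cons by (simp add: T_simps(4))
qed

text \<open>A negative multiple of a pure tensor is again a pure tensor, so sums without coefficients suffice.\<close>

lemma T_generated:
  assumes "c \<in> carrier T"
  shows "\<exists>xs. set xs \<subseteq> carrier X \<times> carrier Y \<and> list_sum T (pure T) xs = c"
proof -
  interpret T: abelian_group T by (rule abelian_group_T)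
  \<comment> \<open>Elements of the free abelian group are reached by differences, hence negatives of sums are needed first.\<close>
  have neg: "\<exists>ys. set ys \<subseteq> carrier X \<times> carrier Y \<and>
      list_sum T (pure T) ys = \<ominus>\<^bsub>T\<^esub> list_sum T (pure T) xs" if "set xs \<subseteq> carrier X \<times> carrier Y" for xs
    using that
  proof (induction xs)
    case Nil
    then show ?case by (intro exI[of _ "[]"]) (simp add: T.minus_equality[OF T.l_zero[OF T.zero_closed]])
  next
    case (Cons p xs)
    then obtain ys where ys: "set ys \<subseteq> carrier X \<times> carrier Y"
      "list_sum T (pure T) ys = \<ominus>\<^bsub>T\<^esub> list_sum T (pure T) xs" by auto
    obtain x y where p [simp]: "p = (x, y)" by force
    have xy: "x \<in> carrier X" "y \<in> carrier Y" using Cons by auto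
    have "pure T (\<ominus>\<^bsub>X\<^esub> x) y \<oplus>\<^bsub>T\<^esub> pure T x y = pure T \<zero>\<^bsub>X\<^esub> y"
      using pure_T_add_left[of "\<ominus>\<^bsub>X\<^esub> x" x y] xy by (simp add: X.l_neg)
    also have "\<dots> = \<zero>\<^bsub>T\<^esub>"
      using pure_T_add_left[of "\<zero>\<^bsub>X\<^esub>" "\<zero>\<^bsub>X\<^esub>" y] xy pure_T_closed[of "\<zero>\<^bsub>X\<^esub>" y] by simp
    finally have "pure T (\<ominus>\<^bsub>X\<^esub> x) y = \<ominus>\<^bsub>T\<^esub> pure T x y"
      using xy by (intro T.minus_equality[symmetric]) (auto intro!: pure_T_closed)
    moreover have "list_sum T (pure T) xs \<in> carrier T"
      using Cons.prems by (intro list_sum_closed abelian_group_T) (auto intro!: pure_T_closed)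
    ultimately show ?case using ys xy pure_T_closed[OF xy]
      by (intro exI[of _ "(\<ominus>\<^bsub>X\<^esub> x, y) # ys"]) (simp add: T.minus_add)
  qed
  have "\<exists>xs. set xs \<subseteq> carrier X \<times> carrier Y \<and> list_sum T (pure T) xs = H #>\<^bsub>F\<^esub> x"
    if "Poly_Mapping.keys x \<subseteq> carrier X \<times> carrier Y" for x
    using that
  proof (induction rule: free_Abelian_group_induct[consumes 1, case_names zero diff frag])
    case zero
    then show ?case using list_sum_pure[of "[]"] by (intro exI[of _ "[]"]) simp
  next
    case (diff x y)
    then obtain xs ys where *: "set xs \<subseteq> carrier X \<times> carrier Y" "list_sum T (pure T) xs = H #>\<^bsub>F\<^esub> x"
      "set ys \<subseteq> carrier X \<times> carrier Y" "list_sum T (pure T) ys = H #>\<^bsub>F\<^esub> y" by auto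
    from neg[OF *(3)] obtain zs where zs: "set zs \<subseteq> carrier X \<times> carrier Y"
      "list_sum T (pure T) zs = \<ominus>\<^bsub>T\<^esub> (H #>\<^bsub>F\<^esub> y)" using * by auto
    have xyF: "x \<in> carrier F" "y \<in> carrier F" "x - y \<in> carrier F"
      using diff frag_diff_in_F by (auto simp: F_simps)
    have co: "H #>\<^bsub>F\<^esub> z \<in> carrier T" if "z \<in> carrier F" for z
      using that by (auto simp: T_simps carrier_FactGroup)
    have "(H #>\<^bsub>F\<^esub> (x - y)) \<oplus>\<^bsub>T\<^esub> (H #>\<^bsub>F\<^esub> y) = H #>\<^bsub>F\<^esub> x"
      using coset_add[OF xyF(3,2)] by simp
    then have "H #>\<^bsub>F\<^esub> (x - y) = (H #>\<^bsub>F\<^esub> x) \<oplus>\<^bsub>T\<^esub> \<ominus>\<^bsub>T\<^esub> (H #>\<^bsub>F\<^esub> y)"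
      using co[OF xyF(1)] co[OF xyF(2)] co[OF xyF(3)]
      by (metis (no_types) T.minus_eq T.add.inv_solve_right)
    also have "\<dots> = list_sum T (pure T) (xs @ zs)"
      using * zs by (subst list_sum_append[OF abelian_group_T]) (auto intro!: pure_T_closed)
    finally show ?case using * zs by (intro exI[of _ "xs @ zs"]) simp
  next
    case (frag p)
    then show ?case using list_sum_pure[of "[p]"] by (intro exI[of _ "[p]"]) simp
  qed
  moreover obtain x where "x \<in> carrier F" "c = H #>\<^bsub>F\<^esub> x"
    using assms by (auto simp: T_simps carrier_FactGroup)
  ultimately show ?thesis by (simp add: F_simps)
qed

text \<open>The homomorphism from the free abelian group that \<open>g\<close> induces kills the relations. Hence a value
  computed from an expression only depends on the element of the tensor product it represents.\<close>

lemma balanced_list_sum_eq: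
  assumes G: "abelian_group G" and g: "balanced S X r l Y G g"
    and xs: "set xs \<subseteq> carrier X \<times> carrier Y" and ys: "set ys \<subseteq> carrier X \<times> carrier Y"
    and eq: "list_sum T (pure T) xs = list_sum T (pure T) ys"
  shows "list_sum G g xs = list_sum G g ys"
proof -
  interpret G: abelian_group G by (rule G)
  note data' = data[unfolded tensor_data_def]
  have im: "(\<lambda>(x, y). g x y) ` (carrier X \<times> carrier Y) \<subseteq> carrier (add_monoid G)"
    using g by (auto simp: balanced_def)
  from comm_group.free_Abelian_group_universal[OF G.a_comm_group im]
  obtain h where h: "h \<in> hom F (add_monoid G)"
      "\<And>p. p \<in> carrier X \<times> carrier Y \<Longrightarrow> h (frag_of p) = (\<lambda>(x, y). g x y) p"
    unfolding F_def by metis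
  interpret h: group_hom F "add_monoid G" h
    by (intro group_hom.intro group_hom_axioms.intro F.is_group G.a_group h)
  have h_add: "h (x + y) = h x \<oplus>\<^bsub>G\<^esub> h y" if "x \<in> carrier F" "y \<in> carrier F" for x y
    using h.hom_mult[OF that] by (simp add: F_simps)
  have h_closed: "h x \<in> carrier G" if "x \<in> carrier F" for x
    using h.hom_closed[OF that] by simp
  have h_diff: "h (x - y) = h x \<ominus>\<^bsub>G\<^esub> h y" if "x \<in> carrier F" "y \<in> carrier F" for x y
  proof -
    have "h x = h (x - y) \<oplus>\<^bsub>G\<^esub> h y" using h_add[OF frag_diff_in_F[OF that] that(2)] by simp
    then show ?thesis using h_closed that frag_diff_in_F[OF that]
      by (simp add: G.minus_eq G.a_assoc G.r_neg)
  qed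
  have "h z = \<zero>\<^bsub>G\<^esub>" if "z \<in> tensor_relations S X r l Y" for z
  proof -
    have hf: "h (frag_of (x, y)) = g x y" if "x \<in> carrier X" "y \<in> carrier Y" for x y
      using h(2) that by simp
    \<comment> \<open>The two additivity relations have this form.\<close>
    have h_diff3: "h (u - v - w) = \<zero>\<^bsub>G\<^esub>"
      if "u \<in> carrier F" "v \<in> carrier F" "w \<in> carrier F" "h u = h v \<oplus>\<^bsub>G\<^esub> h w" for u v w
    proof -
      have "h (u - v - w) = (h v \<oplus>\<^bsub>G\<^esub> h w) \<ominus>\<^bsub>G\<^esub> h v \<ominus>\<^bsub>G\<^esub> h w"
        using that by (simp add: h_diff frag_diff_in_F)
      also have "\<dots> = h v \<oplus>\<^bsub>G\<^esub> \<ominus>\<^bsub>G\<^esub> h v \<oplus>\<^bsub>G\<^esub> (h w \<oplus>\<^bsub>G\<^esub> \<ominus>\<^bsub>G\<^esub> h w)"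
        using that h_closed unfolding G.minus_eq by (simp add: G.a_ac)
      finally show ?thesis using that h_closed by (simp add: G.r_neg)
    qed
    consider x x' y where "z = frag_of (x \<oplus>\<^bsub>X\<^esub> x', y) - frag_of (x, y) - frag_of (x', y)"
        "x \<in> carrier X" "x' \<in> carrier X" "y \<in> carrier Y"
      | x y y' where "z = frag_of (x, y \<oplus>\<^bsub>Y\<^esub> y') - frag_of (x, y) - frag_of (x, y')"
        "x \<in> carrier X" "y \<in> carrier Y" "y' \<in> carrier Y"
      | a x y where "z = frag_of (r x a, y) - frag_of (x, l a y)"
        "x \<in> carrier X" "a \<in> S" "y \<in> carrier Y"
      using \<open>z \<in> tensor_relations S X r l Y\<close> unfolding tensor_relations_def by blast
    then show ?thesis
    proof cases
      case 1
      then show ?thesis using g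
        by (auto intro!: h_diff3 frag_of_in_F simp: hf balanced_def)
    next
      case 2
      then show ?thesis using g
        by (auto intro!: h_diff3 frag_of_in_F simp: hf balanced_def)
    next
      case 3
      then have "h z = g (r x a) y \<ominus>\<^bsub>G\<^esub> g x (l a y)"
        using data' by (auto simp: h_diff frag_of_in_F hf)
      then show ?thesis using g 3 data' by (auto simp: balanced_def G.minus_eq G.r_neg)
    qed
  qed
  then have "tensor_relations S X r l Y \<subseteq> kernel F (add_monoid G) h"
    using relations_subset by (auto simp: kernel_def)
  then have "H \<subseteq> kernel F (add_monoid G) h"
    unfolding H_def by (rule F.generate_subgroup_incl[OF _ h.subgroup_kernel])
  then have ker: "h z = \<zero>\<^bsub>G\<^esub>" if "z \<in> H" for z using that by (auto simp: kernel_def)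
  have sum: "h (sum_list (map frag_of zs)) = list_sum G g zs"
    if "set zs \<subseteq> carrier X \<times> carrier Y" for zs
    using that
  proof (induction zs)
    case Nil
    then show ?case using h.hom_one by (simp add: F_simps)
  next
    case (Cons p zs)
    then show ?case using frag_sum_in_F[of zs] by (cases p) (auto simp: h_add frag_of_in_F h(2))
  qed
  let ?x = "sum_list (map frag_of xs)" and ?y = "sum_list (map frag_of ys)"
  have xy: "?x \<in> carrier F" "?y \<in> carrier F" using xs ys frag_sum_in_F by auto
  have "H #>\<^bsub>F\<^esub> ?x = H #>\<^bsub>F\<^esub> ?y" using eq xs ys by (simp add: list_sum_pure)
  then have "?x \<in> H #>\<^bsub>F\<^esub> ?y" using F.rcos_self[OF xy(1) subgroup_H] by simp
  then obtain z where z: "z \<in> H" "?x = z + ?y" by (auto simp: r_coset_def F_simps)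
  have "h ?x = h z \<oplus>\<^bsub>G\<^esub> h ?y"
    using z h_add xy subgroup.subset[OF subgroup_H] by auto
  then show ?thesis
    using ker[OF z(1)] sum[OF xs] sum[OF ys] h_closed[OF xy(2)] by (simp add: G.l_zero)
qed

end

text \<open>Stated as a property of \<open>T\<close>, so that the defining arguments are found by unification with a rule
  of the form \<open>is_tensor T \<dots>\<close> and need not be repeated.\<close>

definition is_tensor ::
  "('x, 'y) tprod \<Rightarrow> 'a set \<Rightarrow> ('x, 'b) ring_scheme \<Rightarrow> ('x \<Rightarrow> 'a \<Rightarrow> 'x) \<Rightarrow> ('a \<Rightarrow> 'y \<Rightarrow> 'y) \<Rightarrow>
    ('y, 'c) ring_scheme \<Rightarrow> bool"
  where "is_tensor T S X r l Y \<longleftrightarrow> tensor_data S X r l Y \<and> T = tensor S X r l Y"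

lemma sweedler_cong:
  assumes "\<And>x y. (x, y) \<in> set (representative T c) \<Longrightarrow> g x y = h x y"
  shows "sweedler T G g c = sweedler T G h c"
  unfolding sweedler_def using assms by (rule list_sum_cong)

context
  fixes T :: "('x, 'y) tprod" and S :: "'a set" and X :: "('x, 'b) ring_scheme" and r and l
    and Y :: "('y, 'c) ring_scheme"
  assumes T: "is_tensor T S X r l Y"
begin

lemma tensor_data: "tensor_data S X r l Y" and tensor_eq: "T = tensor S X r l Y"
  using T by (simp_all add: is_tensor_def)

lemma tensor_abelian_group: "abelian_group T"
  unfolding tensor_eq by (rule abelian_group_T[OF tensor_data])

lemma tensor_factors: "factors T = carrier X \<times> carrier Y"
  unfolding tensor_eq by simp

lemma pure_closed: "x \<in> carrier X \<Longrightarrow> y \<in> carrier Y \<Longrightarrow> x \<boxtimes>\<^bsub>T\<^esub> y \<in> carrier T"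
  unfolding tensor_eq by (rule pure_T_closed[OF tensor_data])

lemma pure_balanced: "balanced S X r l Y T (pure T)"
  unfolding tensor_eq
  by (intro balancedI pure_T_closed[OF tensor_data] pure_T_add_left[OF tensor_data]
      pure_T_add_right[OF tensor_data] pure_T_balanced[OF tensor_data])

lemma pure_add_left: "x \<in> carrier X \<Longrightarrow> x' \<in> carrier X \<Longrightarrow> y \<in> carrier Y \<Longrightarrow>
    (x \<oplus>\<^bsub>X\<^esub> x') \<boxtimes>\<^bsub>T\<^esub> y = x \<boxtimes>\<^bsub>T\<^esub> y \<oplus>\<^bsub>T\<^esub> x' \<boxtimes>\<^bsub>T\<^esub> y"
  and pure_add_right: "x \<in> carrier X \<Longrightarrow> y \<in> carrier Y \<Longrightarrow> y' \<in> carrier Y \<Longrightarrow>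
    x \<boxtimes>\<^bsub>T\<^esub> (y \<oplus>\<^bsub>Y\<^esub> y') = x \<boxtimes>\<^bsub>T\<^esub> y \<oplus>\<^bsub>T\<^esub> x \<boxtimes>\<^bsub>T\<^esub> y'"
  and pure_move: "a \<in> S \<Longrightarrow> x \<in> carrier X \<Longrightarrow> y \<in> carrier Y \<Longrightarrow>
    r x a \<boxtimes>\<^bsub>T\<^esub> y = x \<boxtimes>\<^bsub>T\<^esub> l a y"
  using pure_balanced by (auto simp: balanced_def)

lemma representative:
  assumes "c \<in> carrier T"
  shows "set (representative T c) \<subseteq> carrier X \<times> carrier Y"
    and "list_sum T (pure T) (representative T c) = c"
proof -
  have "\<exists>xs. set xs \<subseteq> factors T \<and> list_sum T (pure T) xs = c"
    using T_generated[OF tensor_data] assms unfolding tensor_eq by simp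
  from someI_ex[OF this]
  show "set (representative T c) \<subseteq> carrier X \<times> carrier Y"
    and "list_sum T (pure T) (representative T c) = c"
    unfolding representative_def by (auto simp: tensor_factors)
qed

lemma representativeD:
  assumes "c \<in> carrier T" "(x, y) \<in> set (representative T c)"
  shows "x \<in> carrier X" "y \<in> carrier Y"
  using representative(1)[OF assms(1)] assms(2) by auto

lemma sweedler_congT:
  assumes "c \<in> carrier T" "\<And>x y. x \<in> carrier X \<Longrightarrow> y \<in> carrier Y \<Longrightarrow> g x y = h x y"
  shows "sweedler T G g c = sweedler T G h c"
  by (rule sweedler_cong) (auto intro!: assms dest: representativeD[OF assms(1)])

lemma sweedler_closed:
  assumes "abelian_group G" "c \<in> carrier T"
    "\<And>x y. x \<in> carrier X \<Longrightarrow> y \<in> carrier Y \<Longrightarrow> g x y \<in> carrier G"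
  shows "sweedler T G g c \<in> carrier G"
  unfolding sweedler_def
  by (intro list_sum_closed assms) (auto dest: representativeD[OF assms(2)])

lemma sweedler_fun_add:
  assumes "abelian_group G" "c \<in> carrier T"
    "\<And>x y. x \<in> carrier X \<Longrightarrow> y \<in> carrier Y \<Longrightarrow> g x y \<in> carrier G"
    "\<And>x y. x \<in> carrier X \<Longrightarrow> y \<in> carrier Y \<Longrightarrow> h x y \<in> carrier G"
  shows "sweedler T G (\<lambda>x y. g x y \<oplus>\<^bsub>G\<^esub> h x y) c = sweedler T G g c \<oplus>\<^bsub>G\<^esub> sweedler T G h c"
  unfolding sweedler_def
  by (intro list_sum_add assms) (auto dest: representativeD[OF assms(2)])

lemma sweedler_hom:
  assumes "abelian_group G" "abelian_group H" "h \<in> additive_maps G H" "c \<in> carrier T"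
    "\<And>x y. x \<in> carrier X \<Longrightarrow> y \<in> carrier Y \<Longrightarrow> g x y \<in> carrier G"
  shows "h (sweedler T G g c) = sweedler T H (\<lambda>x y. h (g x y)) c"
  unfolding sweedler_def
  by (intro list_sum_hom assms) (auto dest: representativeD[OF assms(4)])

lemma sweedler_finsum:
  assumes "abelian_group G" "finite J" "c \<in> carrier T"
    "\<And>j x y. j \<in> J \<Longrightarrow> x \<in> carrier X \<Longrightarrow> y \<in> carrier Y \<Longrightarrow> g x y j \<in> carrier G"
  shows "sweedler T G (\<lambda>x y. \<Oplus>\<^bsub>G\<^esub>j\<in>J. g x y j) c = (\<Oplus>\<^bsub>G\<^esub>j\<in>J. sweedler T G (\<lambda>x y. g x y j) c)"
  unfolding sweedler_def
  by (intro list_sum_finsum assms) (auto dest: representativeD[OF assms(3)])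

text \<open>A homomorphism that is known on pure tensors computes the sum, without a check that the summand is
  balanced.\<close>

lemma sweedler_eq_hom:
  assumes "abelian_group G" "h \<in> additive_maps T G" "c \<in> carrier T"
    "\<And>x y. x \<in> carrier X \<Longrightarrow> y \<in> carrier Y \<Longrightarrow> h (x \<boxtimes>\<^bsub>T\<^esub> y) = g x y"
  shows "sweedler T G g c = h c"
proof -
  have "h c = h (list_sum T (pure T) (representative T c))"
    by (simp add: representative(2)[OF assms(3)])
  also have "\<dots> = list_sum G (\<lambda>x y. h (x \<boxtimes>\<^bsub>T\<^esub> y)) (representative T c)"
    by (intro list_sum_hom tensor_abelian_group assms)
      (auto intro!: pure_closed dest: representativeD[OF assms(3)])
  also have "\<dots> = sweedler T G g c"
    unfolding sweedler_def
    by (intro list_sum_cong assms) (auto dest: representativeD[OF assms(3)])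
  finally show ?thesis by simp
qed

lemma tensor_ext:
  assumes "abelian_group G" "h \<in> additive_maps T G" "h' \<in> additive_maps T G"
    "\<And>x y. x \<in> carrier X \<Longrightarrow> y \<in> carrier Y \<Longrightarrow> h (x \<boxtimes>\<^bsub>T\<^esub> y) = h' (x \<boxtimes>\<^bsub>T\<^esub> y)" "c \<in> carrier T"
  shows "h c = h' c"
  using sweedler_eq_hom[OF assms(1,2,5), of "\<lambda>x y. h (x \<boxtimes>\<^bsub>T\<^esub> y)"]
    sweedler_eq_hom[OF assms(1,3,5), of "\<lambda>x y. h (x \<boxtimes>\<^bsub>T\<^esub> y)"] assms(4) by simp

lemma sweedler_list:
  assumes "abelian_group G" "balanced S X r l Y G g" "set xs \<subseteq> carrier X \<times> carrier Y"
  shows "sweedler T G g (list_sum T (pure T) xs) = list_sum G g xs"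
proof -
  have c: "list_sum T (pure T) xs \<in> carrier T"
    using assms(3) by (intro list_sum_closed tensor_abelian_group) (auto intro: pure_closed)
  show ?thesis
    using balanced_list_sum_eq[OF tensor_data assms(1,2) representative(1)[OF c] assms(3)]
      representative(2)[OF c] unfolding sweedler_def tensor_eq by simp
qed

lemma sweedler_pure:
  assumes "abelian_group G" "balanced S X r l Y G g" "x \<in> carrier X" "y \<in> carrier Y"
  shows "sweedler T G g (x \<boxtimes>\<^bsub>T\<^esub> y) = g x y"
proof -
  interpret T: abelian_group T by (rule tensor_abelian_group)
  interpret G: abelian_group G by fact
  have "g x y \<in> carrier G" using assms by (simp add: balanced_def)
  then show ?thesis
    using sweedler_list[OF assms(1,2), of "[(x, y)]"] assms(3,4) pure_closed by simp
qed

text \<open>Concatenating representatives of \<open>c\<close> and \<open>d\<close> gives an expression for the sum, which need not be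
  the chosen one.\<close>

lemma sweedler_additive:
  assumes "abelian_group G" "balanced S X r l Y G g"
  shows "sweedler T G g \<in> additive_maps T G"
proof (rule additive_mapsI)
  have g: "g x y \<in> carrier G" if "x \<in> carrier X" "y \<in> carrier Y" for x y
    using assms(2) that by (simp add: balanced_def)
  show "sweedler T G g c \<in> carrier G" if "c \<in> carrier T" for c
    using that g by (intro sweedler_closed assms)
  show "sweedler T G g (c \<oplus>\<^bsub>T\<^esub> d) = sweedler T G g c \<oplus>\<^bsub>G\<^esub> sweedler T G g d"
    if "c \<in> carrier T" "d \<in> carrier T" for c d
  proof -
    have "c \<oplus>\<^bsub>T\<^esub> d = list_sum T (pure T) (representative T c @ representative T d)"
      using representative[OF that(1)] representative[OF that(2)]
      by (subst list_sum_append[OF tensor_abelian_group]) (auto intro!: pure_closed)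
    then have "sweedler T G g (c \<oplus>\<^bsub>T\<^esub> d) = list_sum G g (representative T c @ representative T d)"
      using representative(1)[OF that(1)] representative(1)[OF that(2)]
      by (simp add: sweedler_list[OF assms])
    also have "\<dots> = sweedler T G g c \<oplus>\<^bsub>G\<^esub> sweedler T G g d"
      unfolding sweedler_def using representative(1)[OF that(1)] representative(1)[OF that(2)] g
      by (intro list_sum_append assms) auto
    finally show ?thesis .
  qed
qed

lemma sweedler_add:
  assumes "abelian_group G" "balanced S X r l Y G g" "c \<in> carrier T" "d \<in> carrier T"
  shows "sweedler T G g (c \<oplus>\<^bsub>T\<^esub> d) = sweedler T G g c \<oplus>\<^bsub>G\<^esub> sweedler T G g d"
  using additive_maps_add[OF sweedler_additive[OF assms(1,2)]] assms by simp

lemma sweedler_id: "c \<in> carrier T \<Longrightarrow> sweedler T T (pure T) c = c"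
  unfolding sweedler_def by (rule representative)

end

lemma sweedler_sweedler:
  assumes "is_tensor T S X r l Y" "is_tensor T' S' X' r' l' Y'" "abelian_group G"
    "balanced S' X' r' l' Y' G g" "c \<in> carrier T"
    "\<And>x y. x \<in> carrier X \<Longrightarrow> y \<in> carrier Y \<Longrightarrow> q x y \<in> carrier T'"
  shows "sweedler T' G g (sweedler T T' q c) = sweedler T G (\<lambda>x y. sweedler T' G g (q x y)) c"
  by (intro sweedler_hom[OF assms(1)] tensor_abelian_group[OF assms(2)]
      sweedler_additive[OF assms(2)] assms)

lemma sweedler_swap:
  assumes "is_tensor T S X r l Y" "is_tensor T' S' X' r' l' Y'" "abelian_group G"
    "c \<in> carrier T" "c' \<in> carrier T'"
    "\<And>x y x' y'. x \<in> carrier X \<Longrightarrow> y \<in> carrier Y \<Longrightarrow> x' \<in> carrier X' \<Longrightarrow> y' \<in> carrier Y' \<Longrightarrow>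
      g x y x' y' \<in> carrier G"
  shows "sweedler T G (\<lambda>x y. sweedler T' G (g x y) c') c =
    sweedler T' G (\<lambda>x' y'. sweedler T G (\<lambda>x y. g x y x' y') c) c'"
  unfolding sweedler_def
  by (intro list_sum_swap assms)
    (auto dest: representativeD[OF assms(1,4)] representativeD[OF assms(2,5)])

text \<open>Substitution of an element whose expression is itself a sum of pure tensors; the form in which
  coactions and comultiplications are composed.\<close>

lemma sweedler_push:
  assumes "is_tensor T S X r l Y" "is_tensor T' S' X' r' l' Y'" "abelian_group G"
    "balanced S' X' r' l' Y' G q" "c \<in> carrier T"
    "\<And>x y. x \<in> carrier X \<Longrightarrow> y \<in> carrier Y \<Longrightarrow> f x y \<in> carrier X'"
    "\<And>x y. x \<in> carrier X \<Longrightarrow> y \<in> carrier Y \<Longrightarrow> g x y \<in> carrier Y'"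
  shows "sweedler T' G q (sweedler T T' (\<lambda>x y. f x y \<boxtimes>\<^bsub>T'\<^esub> g x y) c) =
    sweedler T G (\<lambda>x y. q (f x y) (g x y)) c"
proof -
  have "sweedler T' G q (sweedler T T' (\<lambda>x y. f x y \<boxtimes>\<^bsub>T'\<^esub> g x y) c) =
      sweedler T G (\<lambda>x y. sweedler T' G q (f x y \<boxtimes>\<^bsub>T'\<^esub> g x y)) c"
    by (intro sweedler_sweedler[OF assms(1,2)] assms(3-5) pure_closed[OF assms(2)] assms(6,7))
  also have "\<dots> = sweedler T G (\<lambda>x y. q (f x y) (g x y)) c"
    by (intro sweedler_congT[OF assms(1)] assms(5) sweedler_pure[OF assms(2)] assms(3,4,6,7))
  finally show ?thesis .
qed

lemma balancedD:
  assumes "balanced S X r l Y G g"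
  shows "x \<in> carrier X \<Longrightarrow> y \<in> carrier Y \<Longrightarrow> g x y \<in> carrier G"
    and "x \<in> carrier X \<Longrightarrow> x' \<in> carrier X \<Longrightarrow> y \<in> carrier Y \<Longrightarrow>
      g (x \<oplus>\<^bsub>X\<^esub> x') y = g x y \<oplus>\<^bsub>G\<^esub> g x' y"
    and "x \<in> carrier X \<Longrightarrow> y \<in> carrier Y \<Longrightarrow> y' \<in> carrier Y \<Longrightarrow>
      g x (y \<oplus>\<^bsub>Y\<^esub> y') = g x y \<oplus>\<^bsub>G\<^esub> g x y'"
    and "a \<in> S \<Longrightarrow> x \<in> carrier X \<Longrightarrow> y \<in> carrier Y \<Longrightarrow> g (r x a) y = g x (l a y)"
  using assms by (auto simp: balanced_def)

lemma balanced_additive_left: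
  assumes "balanced S X r l Y G g" "y \<in> carrier Y"
  shows "(\<lambda>x. g x y) \<in> additive_maps X G"
  using assms by (auto simp: balanced_def intro!: additive_mapsI)

lemma balanced_additive_right:
  assumes "balanced S X r l Y G g" "x \<in> carrier X"
  shows "g x \<in> additive_maps Y G"
  using assms by (auto simp: balanced_def intro!: additive_mapsI)

section \<open>Left bialgebroids\<close>

lemmas [simp] = lwhite_def rwhite_def lblack_def rblack_def

lemma U_left_simps [simp]:
  "carrier (U_left B) = carrier (total_alg B)"
  "add (U_left B) = add (total_alg B)"
  "zero (U_left B) = zero (total_alg B)"
  "a \<odot>\<^bsub>U_left B\<^esub> u = src B a \<otimes>\<^bsub>total_alg B\<^esub> u"
  by (simp_all add: U_left_def)

lemma left_module_imp_abelian_group: "left_module R M \<Longrightarrow> abelian_group M"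
  by (simp add: left_module_def)

context left_bialgebroid
begin

abbreviation A where "A \<equiv> base_alg B"
abbreviation U where "U \<equiv> total_alg B"
abbreviation umult (infixl \<open>\<cdot>\<close> 70) where "u \<cdot> v \<equiv> u \<otimes>\<^bsub>total_alg B\<^esub> v"
abbreviation s where "s \<equiv> src B"
abbreviation t where "t \<equiv> tgt B"
abbreviation eps where "eps \<equiv> counit B"
abbreviation dsum where "dsum G q u \<equiv> sweedler (UU B) G q (comul B u)"
abbreviation csum where "csum N G q n \<equiv> sweedler (UX B N) G q (coact N n)"
abbreviation bal where "bal N G q \<equiv> balanced (carrier A) U (rwhite B) (smult N) N G q"

sublocale A: ring "base_alg B" using base_algebra by (rule k_algebra.axioms)
sublocale U: ring "total_alg B" using total_algebra by (rule k_algebra.axioms)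

lemma U_ab [simp]: "abelian_group U" by (rule U.is_abelian_group)

lemma s_closed [simp]: "a \<in> carrier A \<Longrightarrow> s a \<in> carrier U"
  and s_add: "a \<in> carrier A \<Longrightarrow> b \<in> carrier A \<Longrightarrow> s (a \<oplus>\<^bsub>A\<^esub> b) = s a \<oplus>\<^bsub>U\<^esub> s b"
  and s_mult: "a \<in> carrier A \<Longrightarrow> b \<in> carrier A \<Longrightarrow> s (a \<otimes>\<^bsub>A\<^esub> b) = s a \<cdot> s b"
  and s_one [simp]: "s \<one>\<^bsub>A\<^esub> = \<one>\<^bsub>U\<^esub>"
  using src_hom by (auto simp: ring_hom_def)

lemma t_closed [simp]: "a \<in> carrier A \<Longrightarrow> t a \<in> carrier U"
  and t_add: "a \<in> carrier A \<Longrightarrow> b \<in> carrier A \<Longrightarrow> t (a \<oplus>\<^bsub>A\<^esub> b) = t a \<oplus>\<^bsub>U\<^esub> t b"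
  and t_mult: "a \<in> carrier A \<Longrightarrow> b \<in> carrier A \<Longrightarrow> t (a \<otimes>\<^bsub>A\<^esub> b) = t b \<cdot> t a"
  and t_one [simp]: "t \<one>\<^bsub>A\<^esub> = \<one>\<^bsub>U\<^esub>"
  using tgt_antihom by (auto simp: ring_hom_def opposite_def)

lemma ts: "a \<in> carrier A \<Longrightarrow> b \<in> carrier A \<Longrightarrow> t b \<cdot> s a = s a \<cdot> t b"
  by (simp add: src_tgt_commute)

lemma ts_left: "a \<in> carrier A \<Longrightarrow> b \<in> carrier A \<Longrightarrow> u \<in> carrier U \<Longrightarrow> t b \<cdot> (s a \<cdot> u) = s a \<cdot> (t b \<cdot> u)"
  by (simp add: U.m_assoc[symmetric] ts)

lemma eps_closed [simp]: "u \<in> carrier U \<Longrightarrow> eps u \<in> carrier A"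
  by (rule counit_closed)

lemma eps_s [simp]: "a \<in> carrier A \<Longrightarrow> u \<in> carrier U \<Longrightarrow> eps (s a \<cdot> u) = a \<otimes>\<^bsub>A\<^esub> eps u"
  and eps_t [simp]: "a \<in> carrier A \<Longrightarrow> u \<in> carrier U \<Longrightarrow> eps (t a \<cdot> u) = eps u \<otimes>\<^bsub>A\<^esub> a"
  using counit_left counit_right by simp_all

lemmas distribs = U.l_distr U.r_distr counit_add s_add t_add A.l_distr A.r_distr

lemma left_module_U_left: "left_module A (U_left B)"
proof (intro left_module.intro left_module_axioms.intro)
  show "ring A" by (rule A.ring_axioms)
  show "abelian_group (U_left B)"
    by (rule abelian_groupI) (auto simp: U.a_ac intro!: bexI[of _ "\<ominus>\<^bsub>U\<^esub> x" for x] U.l_neg)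
qed (simp_all add: distribs s_mult U.m_assoc)

lemma UX_tensor: "left_module A N \<Longrightarrow> is_tensor (UX B N) (carrier A) U (rwhite B) (smult N) N"
  by (simp add: is_tensor_def tensor_data_def UX_def left_module.lsmult_closed
      left_module_imp_abelian_group)

lemma balI:
  assumes "\<And>u n. u \<in> carrier U \<Longrightarrow> n \<in> carrier N \<Longrightarrow> q u n \<in> carrier G"
    and "\<And>u u' n. u \<in> carrier U \<Longrightarrow> u' \<in> carrier U \<Longrightarrow> n \<in> carrier N \<Longrightarrow>
      q (u \<oplus>\<^bsub>U\<^esub> u') n = q u n \<oplus>\<^bsub>G\<^esub> q u' n"
    and "\<And>u n n'. u \<in> carrier U \<Longrightarrow> n \<in> carrier N \<Longrightarrow> n' \<in> carrier N \<Longrightarrow>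
      q u (n \<oplus>\<^bsub>N\<^esub> n') = q u n \<oplus>\<^bsub>G\<^esub> q u n'"
    and "\<And>a u n. a \<in> carrier A \<Longrightarrow> u \<in> carrier U \<Longrightarrow> n \<in> carrier N \<Longrightarrow>
      q (t a \<cdot> u) n = q u (a \<odot>\<^bsub>N\<^esub> n)"
  shows "bal N G q"
  using assms by (intro balancedI) simp_all

lemma bal_move: "bal N G q \<Longrightarrow> a \<in> carrier A \<Longrightarrow> u \<in> carrier U \<Longrightarrow> n \<in> carrier N \<Longrightarrow>
    q (t a \<cdot> u) n = q u (a \<odot>\<^bsub>N\<^esub> n)"
  by (simp add: balanced_def)

lemmas UU_tensor = UX_tensor[OF left_module_U_left]

lemmas UX_ab [simp] = tensor_abelian_group[OF UX_tensor]
lemmas UX_pure_closed [simp] = pure_closed[OF UX_tensor]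
lemmas UX_pure_add_left = pure_add_left[OF UX_tensor]
lemmas UX_pure_add_right = pure_add_right[OF UX_tensor]
lemmas UX_move = pure_move[OF UX_tensor, simplified]

lemmas UU_ab [simp] = tensor_abelian_group[OF UU_tensor]
lemmas UU_pure_closed [simp] = pure_closed[OF UU_tensor, simplified]
lemmas UU_pure_add_left = pure_add_left[OF UU_tensor, simplified]
lemmas UU_pure_add_right = pure_add_right[OF UU_tensor, simplified]
lemmas UU_move = pure_move[OF UU_tensor, simplified]

lemma comul_closed' [simp]: "u \<in> carrier U \<Longrightarrow> comul B u \<in> carrier (UU B)"
  by (rule comul_closed)

lemma dsum_cong:
  assumes "u \<in> carrier U"
    "\<And>x y. x \<in> carrier U \<Longrightarrow> y \<in> carrier U \<Longrightarrow> g x y = h x y"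
  shows "dsum G g u = dsum G h u"
  using assms by (intro sweedler_congT[OF UU_tensor]) auto

lemma dsum_closed:
  assumes "abelian_group G" "u \<in> carrier U"
    "\<And>x y. x \<in> carrier U \<Longrightarrow> y \<in> carrier U \<Longrightarrow> g x y \<in> carrier G"
  shows "dsum G g u \<in> carrier G"
  using assms by (intro sweedler_closed[OF UU_tensor]) auto

lemma dsum_hom:
  assumes "abelian_group G" "abelian_group H" "h \<in> additive_maps G H" "u \<in> carrier U"
    "\<And>x y. x \<in> carrier U \<Longrightarrow> y \<in> carrier U \<Longrightarrow> g x y \<in> carrier G"
  shows "h (dsum G g u) = dsum H (\<lambda>x y. h (g x y)) u"
  using assms by (intro sweedler_hom[OF UU_tensor]) auto

context
  fixes G :: "('g, 'd) ring_scheme" and q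
  assumes G: "abelian_group G" and q: "bal (U_left B) G q"
begin

lemma dsum_add: "u \<in> carrier U \<Longrightarrow> v \<in> carrier U \<Longrightarrow> dsum G q (u \<oplus>\<^bsub>U\<^esub> v) = dsum G q u \<oplus>\<^bsub>G\<^esub> dsum G q v"
  using sweedler_add[OF UU_tensor G q] by (simp add: comul_add)

lemma dsum_q_closed: "u \<in> carrier U \<Longrightarrow> dsum G q u \<in> carrier G"
  using balancedD(1)[OF q] by (intro dsum_closed G) auto

lemma dsum_additive: "dsum G q \<in> additive_maps U G"
  by (intro additive_mapsI dsum_add dsum_q_closed)

lemma dsum_s_left: "a \<in> carrier A \<Longrightarrow> u \<in> carrier U \<Longrightarrow>
    dsum G q (s a \<cdot> u) = dsum G (\<lambda>u1 u2. q (s a \<cdot> u1) u2) u"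
  using comul_left[of a u] sweedler_push[OF UU_tensor UU_tensor G q, of "comul B u" "\<lambda>x y. s a \<cdot> x" "\<lambda>x y. y"]
  by simp

lemma dsum_t_left: "a \<in> carrier A \<Longrightarrow> u \<in> carrier U \<Longrightarrow>
    dsum G q (t a \<cdot> u) = dsum G (\<lambda>u1 u2. q u1 (t a \<cdot> u2)) u"
  using comul_right[of a u] sweedler_push[OF UU_tensor UU_tensor G q, of "comul B u" "\<lambda>x y. x" "\<lambda>x y. t a \<cdot> y"]
  by simp

lemma dsum_takeuchi: "a \<in> carrier A \<Longrightarrow> u \<in> carrier U \<Longrightarrow>
    dsum G (\<lambda>u1 u2. q (u1 \<cdot> t a) u2) u = dsum G (\<lambda>u1 u2. q u1 (u2 \<cdot> s a)) u"
  using comul_takeuchi[of a u]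
    sweedler_push[OF UU_tensor UU_tensor G q, of "comul B u" "\<lambda>x y. x" "\<lambda>x y. y \<cdot> s a"]
    sweedler_push[OF UU_tensor UU_tensor G q, of "comul B u" "\<lambda>x y. x \<cdot> t a" "\<lambda>x y. y"]
  by simp

lemma dsum_s: "a \<in> carrier A \<Longrightarrow> dsum G q (s a) = q (s a) \<one>\<^bsub>U\<^esub>"
  using comul_left[of a "\<one>\<^bsub>U\<^esub>"] sweedler_pure[OF UU_tensor UU_ab, of "\<lambda>x y. (s a \<cdot> x) \<boxtimes>\<^bsub>UU B\<^esub> y"]
    sweedler_pure[OF UU_tensor G q]
  apply (simp add: comul_one)
  apply (subst sweedler_pure[OF UU_tensor UU_ab])
     apply (rule balI)
        apply (simp_all add: UU_pure_add_left UU_pure_add_right UU_move[symmetric] distribs ts_left)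
  done

lemma dsum_t: "a \<in> carrier A \<Longrightarrow> dsum G q (t a) = q \<one>\<^bsub>U\<^esub> (t a)"
  using comul_right[of a "\<one>\<^bsub>U\<^esub>"] sweedler_pure[OF UU_tensor G q]
  apply (simp add: comul_one)
  apply (subst sweedler_pure[OF UU_tensor UU_ab])
     apply (rule balI)
        apply (simp_all add: UU_pure_add_left UU_pure_add_right UU_move distribs ts_left)
  done

lemma dsum_mult: "u \<in> carrier U \<Longrightarrow> v \<in> carrier U \<Longrightarrow>
    dsum G q (u \<cdot> v) = dsum G (\<lambda>u1 u2. dsum G (\<lambda>v1 v2. q (u1 \<cdot> v1) (u2 \<cdot> v2)) v) u"
  apply (simp add: comul_mult)
  apply (subst sweedler_sweedler[OF UU_tensor UU_tensor G q])
    apply (simp_all add: dsum_closed)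
  apply (rule dsum_cong, simp)
  apply (subst sweedler_push[OF UU_tensor UU_tensor G q])
  apply simp_all
  done

end

lemma dsum_fun_add:
  assumes "abelian_group G" "u \<in> carrier U"
    "\<And>x y. x \<in> carrier U \<Longrightarrow> y \<in> carrier U \<Longrightarrow> g x y \<in> carrier G"
    "\<And>x y. x \<in> carrier U \<Longrightarrow> y \<in> carrier U \<Longrightarrow> h x y \<in> carrier G"
  shows "dsum G (\<lambda>x y. g x y \<oplus>\<^bsub>G\<^esub> h x y) u = dsum G g u \<oplus>\<^bsub>G\<^esub> dsum G h u"
  using assms by (intro sweedler_fun_add[OF UU_tensor]) auto

lemma bal_right_mult:
  assumes q: "bal (U_left B) G q" and "v \<in> carrier U" "w \<in> carrier U"
  shows "bal (U_left B) G (\<lambda>u1 u2. q (u1 \<cdot> v) (u2 \<cdot> w))"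
proof (rule balI)
  note [simp] = balancedD(1-3)[OF q, simplified] bal_move[OF q, simplified]
  show "q (t a \<cdot> u \<cdot> v) (n \<cdot> w) = q (u \<cdot> v) ((a \<odot>\<^bsub>U_left B\<^esub> n) \<cdot> w)"
    if "a \<in> carrier A" "u \<in> carrier U" "n \<in> carrier (U_left B)" for a u n
    using that assms by (simp add: U.m_assoc)
qed (use assms balancedD(1-3)[OF q, simplified] in \<open>simp_all add: distribs\<close>)

text \<open>Multiplicativity of \<open>\<Delta>\<close> in the form in which the inner sum runs over the left factor:
  by the Takeuchi condition it is a balanced function of the legs of the right factor.\<close>

lemma dsum_mult_bal:
  assumes G: "abelian_group G" and q: "bal (U_left B) G q" and u: "u \<in> carrier U"
  shows "bal (U_left B) G (\<lambda>v1 v2. dsum G (\<lambda>u1 u2. q (u1 \<cdot> v1) (u2 \<cdot> v2)) u)"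
proof (rule balI)
  note [simp] = balancedD(1-3)[OF q, simplified]
  show "dsum G (\<lambda>u1 u2. q (u1 \<cdot> (t a \<cdot> v)) (u2 \<cdot> w)) u =
      dsum G (\<lambda>u1 u2. q (u1 \<cdot> v) (u2 \<cdot> (a \<odot>\<^bsub>U_left B\<^esub> w))) u"
    if "a \<in> carrier A" "v \<in> carrier U" "w \<in> carrier (U_left B)" for a v w
  proof -
    have "dsum G (\<lambda>u1 u2. q (u1 \<cdot> (t a \<cdot> v)) (u2 \<cdot> w)) u =
        dsum G (\<lambda>u1 u2. q (u1 \<cdot> t a \<cdot> v) (u2 \<cdot> w)) u"
      using that by (intro dsum_cong u) (simp add: U.m_assoc)
    also have "\<dots> = dsum G (\<lambda>u1 u2. q (u1 \<cdot> v) (u2 \<cdot> s a \<cdot> w)) u"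
      using dsum_takeuchi[OF G bal_right_mult[OF q] that(1) u] that by simp
    also have "\<dots> = dsum G (\<lambda>u1 u2. q (u1 \<cdot> v) (u2 \<cdot> (a \<odot>\<^bsub>U_left B\<^esub> w))) u"
      using that by (intro dsum_cong u) (simp add: U.m_assoc)
    finally show ?thesis .
  qed
qed (use assms balancedD(1-3)[OF q, simplified] in
    \<open>simp_all add: distribs dsum_closed dsum_fun_add[OF G u, symmetric] cong: dsum_cong\<close>)

lemma dsum_mult_right:
  assumes G: "abelian_group G" and q: "bal (U_left B) G q" and "u \<in> carrier U" "v \<in> carrier U"
  shows "dsum G q (u \<cdot> v) = dsum G (\<lambda>v1 v2. dsum G (\<lambda>u1 u2. q (u1 \<cdot> v1) (u2 \<cdot> v2)) u) v"
  unfolding dsum_mult[OF assms]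
  using assms balancedD(1)[OF q] by (intro sweedler_swap[OF UU_tensor UU_tensor]) auto

lemma dsum_s_right:
  assumes G: "abelian_group G" and q: "bal (U_left B) G q" and "a \<in> carrier A" "u \<in> carrier U"
  shows "dsum G q (u \<cdot> s a) = dsum G (\<lambda>u1 u2. q (u1 \<cdot> s a) u2) u"
proof -
  have "dsum G q (u \<cdot> s a) = dsum G (\<lambda>u1 u2. q (u1 \<cdot> s a) (u2 \<cdot> \<one>\<^bsub>U\<^esub>)) u"
    using assms dsum_mult_right[OF G q, of u "s a"] dsum_s[OF G dsum_mult_bal[OF G q], of u a] by simp
  also have "\<dots> = dsum G (\<lambda>u1 u2. q (u1 \<cdot> s a) u2) u" using assms by (intro dsum_cong) auto
  finally show ?thesis .
qed

lemma dsum_t_right: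
  assumes G: "abelian_group G" and q: "bal (U_left B) G q" and "a \<in> carrier A" "u \<in> carrier U"
  shows "dsum G q (u \<cdot> t a) = dsum G (\<lambda>u1 u2. q u1 (u2 \<cdot> t a)) u"
proof -
  have "dsum G q (u \<cdot> t a) = dsum G (\<lambda>u1 u2. q (u1 \<cdot> \<one>\<^bsub>U\<^esub>) (u2 \<cdot> t a)) u"
    using assms dsum_mult_right[OF G q, of u "t a"] dsum_t[OF G dsum_mult_bal[OF G q], of u a] by simp
  also have "\<dots> = dsum G (\<lambda>u1 u2. q u1 (u2 \<cdot> t a)) u" using assms by (intro dsum_cong) auto
  finally show ?thesis .
qed

lemma counit_l: "u \<in> carrier U \<Longrightarrow> dsum U (\<lambda>u1 u2. s (eps u1) \<cdot> u2) u = u"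
  and counit_r: "u \<in> carrier U \<Longrightarrow> dsum U (\<lambda>u1 u2. t (eps u2) \<cdot> u1) u = u"
  using counital_left[of u] counital_right[of u] by simp_all

lemma counit_l_bal: "bal (U_left B) U (\<lambda>u1 u2. s (eps u1) \<cdot> u2)"
  by (rule balI) (simp_all add: distribs s_mult U.m_assoc)

lemma counit_r_bal: "bal (U_left B) U (\<lambda>u1 u2. t (eps u2) \<cdot> u1)"
  by (rule balI) (simp_all add: distribs t_mult U.m_assoc)

text \<open>Counitality for \<open>u s(a)\<close> and \<open>u t(a)\<close>; in the second case the Takeuchi condition trades \<open>u\<^bsub>(1)\<^esub> t(a)\<close> for
  \<open>u\<^bsub>(2)\<^esub> s(a)\<close>. These identities make coactions right \<open>A\<close>-linear and give them the Takeuchi property.\<close>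

lemma counit_l_s: "a \<in> carrier A \<Longrightarrow> u \<in> carrier U \<Longrightarrow>
    dsum U (\<lambda>u1 u2. s (eps (u1 \<cdot> s a)) \<cdot> u2) u = u \<cdot> s a"
  using counit_l[of "u \<cdot> s a"] dsum_s_right[OF U_ab counit_l_bal, of a u] by simp

lemma counit_r_t: "a \<in> carrier A \<Longrightarrow> u \<in> carrier U \<Longrightarrow>
    dsum U (\<lambda>u1 u2. t (eps (u2 \<cdot> s a)) \<cdot> u1) u = u \<cdot> t a"
proof -
  assume a: "a \<in> carrier A" "u \<in> carrier U"
  have "dsum U (\<lambda>u1 u2. t (eps (u2 \<cdot> s a)) \<cdot> u1) u = dsum U (\<lambda>u1 u2. t (eps u2) \<cdot> (u1 \<cdot> t a)) u"
    using dsum_takeuchi[OF U_ab counit_r_bal a] by simp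
  also have "\<dots> = dsum U (\<lambda>u1 u2. (t (eps u2) \<cdot> u1) \<cdot> t a) u"
    using a by (intro dsum_cong) (simp_all add: U.m_assoc)
  also have "\<dots> = dsum U (\<lambda>u1 u2. t (eps u2) \<cdot> u1) u \<cdot> t a"
    using a by (intro dsum_hom[symmetric, of U U "\<lambda>x. x \<cdot> t a"]) (auto intro!: additive_mapsI simp: distribs)
  finally show ?thesis using a by (simp add: counit_r)
qed

end

section \<open>Comodules\<close>

context left_bialgebroid
begin

lemma UX_left_bal:
  assumes N: "left_module A N" and a: "a \<in> carrier A"
  shows "bal N (UX B N) (\<lambda>u n. (s a \<cdot> u) \<boxtimes>\<^bsub>UX B N\<^esub> n)"
proof (rule balI)
  show "(s a \<cdot> (t b \<cdot> u)) \<boxtimes>\<^bsub>UX B N\<^esub> n = (s a \<cdot> u) \<boxtimes>\<^bsub>UX B N\<^esub> (b \<odot>\<^bsub>N\<^esub> n)"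
    if "b \<in> carrier A" "u \<in> carrier U" "n \<in> carrier N" for b u n
    using a that UX_move[OF N, of b "s a \<cdot> u" n] by (simp add: ts_left)
qed (use assms in \<open>simp_all add: distribs UX_pure_add_left UX_pure_add_right\<close>)

lemma UX_left_pure [simp]:
  assumes "left_module A N" "a \<in> carrier A" "u \<in> carrier U" "n \<in> carrier N"
  shows "UX_left B N a (u \<boxtimes>\<^bsub>UX B N\<^esub> n) = (s a \<cdot> u) \<boxtimes>\<^bsub>UX B N\<^esub> n"
  using sweedler_pure[OF UX_tensor UX_ab UX_left_bal] assms by (simp add: UX_left_def)

lemma UX_left_additive:
  "left_module A N \<Longrightarrow> a \<in> carrier A \<Longrightarrow> UX_left B N a \<in> additive_maps (UX B N) (UX B N)"
  using sweedler_additive[OF UX_tensor UX_ab UX_left_bal] by (simp add: UX_left_def[abs_def])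

lemma UX_left_closed [simp]: "left_module A N \<Longrightarrow> a \<in> carrier A \<Longrightarrow> c \<in> carrier (UX B N) \<Longrightarrow>
    UX_left B N a c \<in> carrier (UX B N)"
  by (rule additive_maps_closed[OF UX_left_additive])

lemma UUX_tensor:
  "left_module A N \<Longrightarrow> is_tensor (UUX B N) (carrier A) U (rwhite B) (UX_left B N) (UX B N)"
  by (simp add: is_tensor_def tensor_data_def UUX_def)

lemmas UUX_ab [simp] = tensor_abelian_group[OF UUX_tensor]
lemmas UUX_pure_closed [simp] = pure_closed[OF UUX_tensor]

text \<open>Three-legged functions that are balanced at both tensor signs of \<open>U \<otimes> (U \<otimes> N)\<close>.\<close>

definition balanced3 ::
  "('a, 'n, 'z) module_scheme \<Rightarrow> ('g, 'd) ring_scheme \<Rightarrow> ('u \<Rightarrow> 'u \<Rightarrow> 'n \<Rightarrow> 'g) \<Rightarrow> bool"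
  where "balanced3 N G q \<longleftrightarrow> (\<forall>u\<in>carrier U. bal N G (q u)) \<and>
    (\<forall>n\<in>carrier N. bal (U_left B) G (\<lambda>u v. q u v n))"

lemma balanced3I:
  assumes "\<And>u v n. u \<in> carrier U \<Longrightarrow> v \<in> carrier U \<Longrightarrow> n \<in> carrier N \<Longrightarrow> q u v n \<in> carrier G"
    and "\<And>u u' v n. u \<in> carrier U \<Longrightarrow> u' \<in> carrier U \<Longrightarrow> v \<in> carrier U \<Longrightarrow> n \<in> carrier N \<Longrightarrow>
      q (u \<oplus>\<^bsub>U\<^esub> u') v n = q u v n \<oplus>\<^bsub>G\<^esub> q u' v n"
    and "\<And>u v v' n. u \<in> carrier U \<Longrightarrow> v \<in> carrier U \<Longrightarrow> v' \<in> carrier U \<Longrightarrow> n \<in> carrier N \<Longrightarrow>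
      q u (v \<oplus>\<^bsub>U\<^esub> v') n = q u v n \<oplus>\<^bsub>G\<^esub> q u v' n"
    and "\<And>u v n n'. u \<in> carrier U \<Longrightarrow> v \<in> carrier U \<Longrightarrow> n \<in> carrier N \<Longrightarrow> n' \<in> carrier N \<Longrightarrow>
      q u v (n \<oplus>\<^bsub>N\<^esub> n') = q u v n \<oplus>\<^bsub>G\<^esub> q u v n'"
    and "\<And>a u v n. a \<in> carrier A \<Longrightarrow> u \<in> carrier U \<Longrightarrow> v \<in> carrier U \<Longrightarrow> n \<in> carrier N \<Longrightarrow>
      q (t a \<cdot> u) v n = q u (s a \<cdot> v) n"
    and "\<And>a u v n. a \<in> carrier A \<Longrightarrow> u \<in> carrier U \<Longrightarrow> v \<in> carrier U \<Longrightarrow> n \<in> carrier N \<Longrightarrow>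
      q u (t a \<cdot> v) n = q u v (a \<odot>\<^bsub>N\<^esub> n)"
  shows "balanced3 N G q"
  unfolding balanced3_def using assms by (auto intro!: balI)

text \<open>A balanced function of three legs extends to \<open>U \<otimes> (U \<otimes> N)\<close>, on which coassociativity is
  an identity.\<close>

lemma balanced3_extend:
  assumes G: "abelian_group G" and N: "left_module A N" and q: "balanced3 N G q"
  shows "balanced (carrier A) U (rwhite B) (UX_left B N) (UX B N) G
    (\<lambda>u. sweedler (UX B N) G (q u))"
proof (rule balancedI)
  have q1: "bal N G (q u)" if "u \<in> carrier U" for u using q that by (simp add: balanced3_def)
  have q2: "bal (U_left B) G (\<lambda>u v. q u v n)" if "n \<in> carrier N" for n
    using q that by (simp add: balanced3_def)
  note hom = sweedler_additive[OF UX_tensor[OF N] G q1]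
  show "sweedler (UX B N) G (q u) c \<in> carrier G" if "u \<in> carrier U" "c \<in> carrier (UX B N)" for u c
    using that additive_maps_closed[OF hom] by simp
  show "sweedler (UX B N) G (q u) (c \<oplus>\<^bsub>UX B N\<^esub> d) =
      sweedler (UX B N) G (q u) c \<oplus>\<^bsub>G\<^esub> sweedler (UX B N) G (q u) d"
    if "u \<in> carrier U" "c \<in> carrier (UX B N)" "d \<in> carrier (UX B N)" for u c d
    using that additive_maps_add[OF hom] by simp
  show "sweedler (UX B N) G (q (u \<oplus>\<^bsub>U\<^esub> u')) c =
      sweedler (UX B N) G (q u) c \<oplus>\<^bsub>G\<^esub> sweedler (UX B N) G (q u') c"
    if "u \<in> carrier U" "u' \<in> carrier U" "c \<in> carrier (UX B N)" for u u' c
    using that q1 balancedD(1)[OF q1] balancedD(2)[OF q2]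
    by (subst sweedler_fun_add[OF UX_tensor[OF N] G, symmetric])
      (auto intro!: sweedler_congT[OF UX_tensor[OF N]])
  show "sweedler (UX B N) G (q (rwhite B u a)) c = sweedler (UX B N) G (q u) (UX_left B N a c)"
    if "a \<in> carrier A" "u \<in> carrier U" "c \<in> carrier (UX B N)" for a u c
    unfolding UX_left_def using that q1[of u] bal_move[OF q2]
    by (simp, subst sweedler_push[OF UX_tensor[OF N] UX_tensor[OF N] G])
      (auto intro!: sweedler_congT[OF UX_tensor[OF N]])
qed

lemma coassociativeD:
  assumes G: "abelian_group G" and N: "left_module A N" and q: "balanced3 N G q"
    and co: "coassociative B N lam" and lam: "\<And>n. n \<in> carrier N \<Longrightarrow> lam n \<in> carrier (UX B N)"
    and n: "n \<in> carrier N"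
  shows "sweedler (UX B N) G (\<lambda>u n'. dsum G (\<lambda>u1 u2. q u1 u2 n') u) (lam n) =
    sweedler (UX B N) G (\<lambda>u n'. sweedler (UX B N) G (q u) (lam n')) (lam n)"
proof -
  let ?Q = "sweedler (UUX B N) G (\<lambda>u. sweedler (UX B N) G (q u))"
  note ext = balanced3_extend[OF G N q]
  have q1: "bal N G (q u)" if "u \<in> carrier U" for u using q that by (simp add: balanced3_def)
  have hom: "?Q \<in> additive_maps (UUX B N) G" by (rule sweedler_additive[OF UUX_tensor[OF N] G ext])
  have Q: "?Q (u \<boxtimes>\<^bsub>UUX B N\<^esub> c) = sweedler (UX B N) G (q u) c"
    if "u \<in> carrier U" "c \<in> carrier (UX B N)" for u c
    using that by (rule sweedler_pure[OF UUX_tensor[OF N] G ext])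
  have eq: "sweedler (UX B N) (UUX B N)
      (\<lambda>u m'. dsum (UUX B N) (\<lambda>u1 u2. u1 \<boxtimes>\<^bsub>UUX B N\<^esub> (u2 \<boxtimes>\<^bsub>UX B N\<^esub> m')) u) (lam n) =
    sweedler (UX B N) (UUX B N) (\<lambda>u m'. u \<boxtimes>\<^bsub>UUX B N\<^esub> lam m') (lam n)"
    using co n by (simp add: coassociative_def)
  have "?Q (sweedler (UX B N) (UUX B N)
      (\<lambda>u m'. dsum (UUX B N) (\<lambda>u1 u2. u1 \<boxtimes>\<^bsub>UUX B N\<^esub> (u2 \<boxtimes>\<^bsub>UX B N\<^esub> m')) u) (lam n)) =
    sweedler (UX B N) G
      (\<lambda>u m'. ?Q (dsum (UUX B N) (\<lambda>u1 u2. u1 \<boxtimes>\<^bsub>UUX B N\<^esub> (u2 \<boxtimes>\<^bsub>UX B N\<^esub> m')) u)) (lam n)"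
    using N lam[OF n] by (intro sweedler_hom[OF UX_tensor[OF N] _ G hom]) (auto intro!: dsum_closed)
  also have "\<dots> = sweedler (UX B N) G (\<lambda>u n'. dsum G (\<lambda>u1 u2. q u1 u2 n') u) (lam n)"
  proof (intro sweedler_congT[OF UX_tensor[OF N]] lam n)
    fix u m assume um: "u \<in> carrier U" "m \<in> carrier N"
    have "?Q (dsum (UUX B N) (\<lambda>u1 u2. u1 \<boxtimes>\<^bsub>UUX B N\<^esub> (u2 \<boxtimes>\<^bsub>UX B N\<^esub> m)) u) =
        dsum G (\<lambda>u1 u2. ?Q (u1 \<boxtimes>\<^bsub>UUX B N\<^esub> (u2 \<boxtimes>\<^bsub>UX B N\<^esub> m))) u"
      using um N by (intro dsum_hom[OF _ G hom]) auto
    also have "\<dots> = dsum G (\<lambda>u1 u2. q u1 u2 m) u"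
      using um N q1 by (intro dsum_cong) (auto simp: Q sweedler_pure[OF UX_tensor[OF N] G])
    finally show "?Q (dsum (UUX B N) (\<lambda>u1 u2. u1 \<boxtimes>\<^bsub>UUX B N\<^esub> (u2 \<boxtimes>\<^bsub>UX B N\<^esub> m)) u) =
        dsum G (\<lambda>u1 u2. q u1 u2 m) u" .
  qed
  also have "?Q (sweedler (UX B N) (UUX B N)
      (\<lambda>u m'. dsum (UUX B N) (\<lambda>u1 u2. u1 \<boxtimes>\<^bsub>UUX B N\<^esub> (u2 \<boxtimes>\<^bsub>UX B N\<^esub> m')) u) (lam n)) =
    sweedler (UX B N) G (\<lambda>u m'. ?Q (u \<boxtimes>\<^bsub>UUX B N\<^esub> lam m')) (lam n)"
    unfolding eq using N lam n by (intro sweedler_hom[OF UX_tensor[OF N] _ G hom]) auto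
  also have "\<dots> = sweedler (UX B N) G (\<lambda>u n'. sweedler (UX B N) G (q u) (lam n')) (lam n)"
    by (intro sweedler_congT[OF UX_tensor[OF N]] lam n) (simp add: Q lam)
  finally show ?thesis by simp
qed

lemma dsum_coassoc:
  assumes "abelian_group G" "balanced3 (U_left B) G q" "u \<in> carrier U"
  shows "dsum G (\<lambda>u v. dsum G (\<lambda>u1 u2. q u1 u2 v) u) u = dsum G (\<lambda>u v. dsum G (q u) v) u"
  using coassociativeD[OF assms(1) left_module_U_left assms(2) comul_coassoc] assms(3) by simp

end

context left_bialgebroid
begin

lemma comodule_module [simp]: "left_comodule B N \<Longrightarrow> left_module A N"
  by (rule left_comodule.left_module)

lemma comodule_ab [simp]: "left_comodule B N \<Longrightarrow> abelian_group N"
  by (rule left_module_imp_abelian_group[OF comodule_module])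

lemma comodule_simps [simp]:
  assumes "left_comodule B N"
  shows "a \<in> carrier A \<Longrightarrow> n \<in> carrier N \<Longrightarrow> a \<odot>\<^bsub>N\<^esub> n \<in> carrier N"
    and "n \<in> carrier N \<Longrightarrow> n' \<in> carrier N \<Longrightarrow> n \<oplus>\<^bsub>N\<^esub> n' \<in> carrier N"
    and "\<zero>\<^bsub>N\<^esub> \<in> carrier N"
    and "n \<in> carrier N \<Longrightarrow> \<one>\<^bsub>A\<^esub> \<odot>\<^bsub>N\<^esub> n = n"
    and "n \<in> carrier N \<Longrightarrow> coact N n \<in> carrier (UX B N)"
    and "n \<in> carrier N \<Longrightarrow> \<zero>\<^bsub>N\<^esub> \<oplus>\<^bsub>N\<^esub> n = n"
proof -
  interpret left_comodule B N by fact
  interpret left_module A N by (rule left_module)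
  show "a \<in> carrier A \<Longrightarrow> n \<in> carrier N \<Longrightarrow> a \<odot>\<^bsub>N\<^esub> n \<in> carrier N"
    and "n \<in> carrier N \<Longrightarrow> n' \<in> carrier N \<Longrightarrow> n \<oplus>\<^bsub>N\<^esub> n' \<in> carrier N"
    and "\<zero>\<^bsub>N\<^esub> \<in> carrier N"
    and "n \<in> carrier N \<Longrightarrow> \<one>\<^bsub>A\<^esub> \<odot>\<^bsub>N\<^esub> n = n"
    and "n \<in> carrier N \<Longrightarrow> coact N n \<in> carrier (UX B N)"
    and "n \<in> carrier N \<Longrightarrow> \<zero>\<^bsub>N\<^esub> \<oplus>\<^bsub>N\<^esub> n = n"
    by (auto intro: lsmult_closed lsmult_one coact_closed)
qed

lemma comodule_distribs:
  assumes "left_comodule B N"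
  shows "a \<in> carrier A \<Longrightarrow> b \<in> carrier A \<Longrightarrow> n \<in> carrier N \<Longrightarrow>
      (a \<oplus>\<^bsub>A\<^esub> b) \<odot>\<^bsub>N\<^esub> n = a \<odot>\<^bsub>N\<^esub> n \<oplus>\<^bsub>N\<^esub> b \<odot>\<^bsub>N\<^esub> n"
    and "a \<in> carrier A \<Longrightarrow> n \<in> carrier N \<Longrightarrow> n' \<in> carrier N \<Longrightarrow>
      a \<odot>\<^bsub>N\<^esub> (n \<oplus>\<^bsub>N\<^esub> n') = a \<odot>\<^bsub>N\<^esub> n \<oplus>\<^bsub>N\<^esub> a \<odot>\<^bsub>N\<^esub> n'"
  using left_module.lsmult_l_distr left_module.lsmult_r_distr comodule_module[OF assms] by metis+

lemma comodule_assoc: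
  "left_comodule B N \<Longrightarrow> a \<in> carrier A \<Longrightarrow> b \<in> carrier A \<Longrightarrow> n \<in> carrier N \<Longrightarrow>
      (a \<otimes>\<^bsub>A\<^esub> b) \<odot>\<^bsub>N\<^esub> n = a \<odot>\<^bsub>N\<^esub> (b \<odot>\<^bsub>N\<^esub> n)"
  using left_module.lsmult_assoc comodule_module by metis

context
  fixes N :: "('a, 'u, 'n) comodule"
  assumes N: "left_comodule B N"
begin

interpretation left_comodule B N by (rule N)

lemmas T = UX_tensor[OF comodule_module[OF N]]

lemma csum_cong:
  assumes "n \<in> carrier N" "\<And>u n'. u \<in> carrier U \<Longrightarrow> n' \<in> carrier N \<Longrightarrow> g u n' = h u n'"
  shows "csum N G g n = csum N G h n"
  using assms N by (intro sweedler_congT[OF T]) auto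

lemma csum_closed:
  assumes "abelian_group G" "n \<in> carrier N"
    "\<And>x y. x \<in> carrier U \<Longrightarrow> y \<in> carrier N \<Longrightarrow> g x y \<in> carrier G"
  shows "csum N G g n \<in> carrier G"
  using assms N by (intro sweedler_closed[OF T]) auto

lemma csum_fun_add:
  assumes "abelian_group G" "n \<in> carrier N"
    "\<And>x y. x \<in> carrier U \<Longrightarrow> y \<in> carrier N \<Longrightarrow> g x y \<in> carrier G"
    "\<And>x y. x \<in> carrier U \<Longrightarrow> y \<in> carrier N \<Longrightarrow> h x y \<in> carrier G"
  shows "csum N G (\<lambda>x y. g x y \<oplus>\<^bsub>G\<^esub> h x y) n = csum N G g n \<oplus>\<^bsub>G\<^esub> csum N G h n"
  using assms N by (intro sweedler_fun_add[OF T]) auto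

lemma csum_hom:
  assumes "abelian_group G" "abelian_group H" "h \<in> additive_maps G H" "n \<in> carrier N"
    "\<And>x y. x \<in> carrier U \<Longrightarrow> y \<in> carrier N \<Longrightarrow> g x y \<in> carrier G"
  shows "h (csum N G g n) = csum N H (\<lambda>x y. h (g x y)) n"
  using assms N by (intro sweedler_hom[OF T]) auto

lemma coact_additive: "coact N \<in> additive_maps N (UX B N)"
  using N by (intro additive_mapsI) (simp_all add: coact_add)

context
  fixes G :: "('g, 'd) ring_scheme" and q
  assumes G: "abelian_group G" and q: "bal N G q"
begin

lemma csum_add: "n \<in> carrier N \<Longrightarrow> n' \<in> carrier N \<Longrightarrow>
    csum N G q (n \<oplus>\<^bsub>N\<^esub> n') = csum N G q n \<oplus>\<^bsub>G\<^esub> csum N G q n'"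
  using sweedler_add[OF T G q] N by (simp add: coact_add)

lemma csum_q_closed: "n \<in> carrier N \<Longrightarrow> csum N G q n \<in> carrier G"
  using balancedD(1)[OF q] by (intro csum_closed G) auto

lemma csum_additive: "csum N G q \<in> additive_maps N G"
  by (intro additive_mapsI csum_add csum_q_closed)

lemma csum_smult: "a \<in> carrier A \<Longrightarrow> n \<in> carrier N \<Longrightarrow>
    csum N G q (a \<odot>\<^bsub>N\<^esub> n) = csum N G (\<lambda>u n'. q (s a \<cdot> u) n') n"
  using sweedler_push[OF T T G q, of "coact N n" "\<lambda>x y. s a \<cdot> x" "\<lambda>x y. y"] N
  by (simp add: coact_smult UX_left_def)

end

lemma csum_coassoc:
  assumes "abelian_group G" "balanced3 N G q" "n \<in> carrier N"
  shows "csum N G (\<lambda>u n'. dsum G (\<lambda>u1 u2. q u1 u2 n') u) n = csum N G (\<lambda>u n'. csum N G (q u) n') n"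
  using coassociativeD[OF assms(1) comodule_module[OF N] assms(2) coact_coassoc] assms(3) N by simp

lemma csum_counit: "n \<in> carrier N \<Longrightarrow> csum N N (\<lambda>u n'. eps u \<odot>\<^bsub>N\<^esub> n') n = n"
  by (rule coact_counital)

lemma ra_bal: "a \<in> carrier A \<Longrightarrow> bal N N (\<lambda>u n'. eps (u \<cdot> s a) \<odot>\<^bsub>N\<^esub> n')"
  by (rule balI) (simp_all add: N distribs comodule_distribs[OF N] comodule_assoc[OF N] U.m_assoc)

lemma ra_closed [simp]: "a \<in> carrier A \<Longrightarrow> n \<in> carrier N \<Longrightarrow> right_act B N n a \<in> carrier N"
  unfolding right_act_def using csum_q_closed[OF _ ra_bal] N by simp

lemma ra_add: "a \<in> carrier A \<Longrightarrow> n \<in> carrier N \<Longrightarrow> n' \<in> carrier N \<Longrightarrow>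
    right_act B N (n \<oplus>\<^bsub>N\<^esub> n') a = right_act B N n a \<oplus>\<^bsub>N\<^esub> right_act B N n' a"
  unfolding right_act_def using csum_add[OF _ ra_bal] N by simp

lemma ra_add_right: "a \<in> carrier A \<Longrightarrow> b \<in> carrier A \<Longrightarrow> n \<in> carrier N \<Longrightarrow>
    right_act B N n (a \<oplus>\<^bsub>A\<^esub> b) = right_act B N n a \<oplus>\<^bsub>N\<^esub> right_act B N n b"
  unfolding right_act_def
  by (subst csum_fun_add[symmetric])
    (auto simp: N distribs comodule_distribs[OF N] intro!: csum_cong)

lemma ra_one [simp]: "n \<in> carrier N \<Longrightarrow> right_act B N n \<one>\<^bsub>A\<^esub> = n"
  unfolding right_act_def
  by (subst csum_cong[of _ _ "\<lambda>u n'. eps u \<odot>\<^bsub>N\<^esub> n'"]) (auto simp: csum_counit)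

lemma smult_additive: "a \<in> carrier A \<Longrightarrow> (\<lambda>n. a \<odot>\<^bsub>N\<^esub> n) \<in> additive_maps N N"
  using N by (intro additive_mapsI) (auto simp: comodule_distribs)

lemma ra_smult: "a \<in> carrier A \<Longrightarrow> b \<in> carrier A \<Longrightarrow> n \<in> carrier N \<Longrightarrow>
    right_act B N (a \<odot>\<^bsub>N\<^esub> n) b = a \<odot>\<^bsub>N\<^esub> right_act B N n b"
  unfolding right_act_def
  by (subst csum_smult[OF _ ra_bal], simp_all add: N, subst csum_hom[OF _ _ smult_additive[of a]])
    (auto simp: N U.m_assoc comodule_assoc[OF N] intro!: csum_cong)

text \<open>The coaction is right \<open>A\<close>-linear: \<open>n a \<mapsto> n\<^bsub>(-1)\<^esub> s(a) \<otimes> n\<^bsub>(0)\<^esub>\<close>. By coassociativity the coaction of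
  \<open>\<epsilon>(n\<^bsub>(-1)\<^esub> s(a)) n\<^bsub>(0)\<^esub>\<close> only involves \<open>\<Sum> s(\<epsilon>(u\<^bsub>(1)\<^esub> s(a))) u\<^bsub>(2)\<^esub> = u s(a)\<close>.\<close>

lemma csum_ra:
  assumes G: "abelian_group G" and q: "bal N G q" and a: "a \<in> carrier A" and n: "n \<in> carrier N"
  shows "csum N G q (right_act B N n a) = csum N G (\<lambda>u n'. q (u \<cdot> s a) n') n"
proof -
  note q' = balancedD[OF q, simplified]
  have q3: "balanced3 N G (\<lambda>u v n. q (s (eps (u \<cdot> s a)) \<cdot> v) n)"
    using a N q' by (intro balanced3I) (simp_all add: distribs s_mult U.m_assoc ts_left[symmetric])
  have "csum N G q (right_act B N n a) = csum N G (\<lambda>u m'. csum N G q (eps (u \<cdot> s a) \<odot>\<^bsub>N\<^esub> m')) n"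
    unfolding right_act_def using N n a
    by (intro csum_hom[OF _ G csum_additive[OF G q]]) auto
  also have "\<dots> = csum N G (\<lambda>u m'. csum N G (\<lambda>v m''. q (s (eps (u \<cdot> s a)) \<cdot> v) m'') m') n"
    using a by (intro csum_cong n csum_smult[OF G q]) auto
  also have "\<dots> = csum N G (\<lambda>u m'. dsum G (\<lambda>u1 u2. q (s (eps (u1 \<cdot> s a)) \<cdot> u2) m') u) n"
    by (rule csum_coassoc[OF G q3 n, symmetric])
  also have "\<dots> = csum N G (\<lambda>u n'. q (u \<cdot> s a) n') n"
  proof (intro csum_cong n)
    fix u m assume um: "u \<in> carrier U" "m \<in> carrier N"
    have "dsum G (\<lambda>u1 u2. q (s (eps (u1 \<cdot> s a)) \<cdot> u2) m) u =
        q (dsum U (\<lambda>u1 u2. s (eps (u1 \<cdot> s a)) \<cdot> u2) u) m"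
      using um a by (intro dsum_hom[OF _ G balanced_additive_left[OF q], symmetric]) auto
    then show "dsum G (\<lambda>u1 u2. q (s (eps (u1 \<cdot> s a)) \<cdot> u2) m) u = q (u \<cdot> s a) m"
      using um a by (simp add: counit_l_s)
  qed
  finally show ?thesis .
qed

text \<open>The coaction takes values in the Takeuchi product: by coassociativity \<open>\<epsilon>(n\<^bsub>(-1)\<^esub> s(a)) n\<^bsub>(0)\<^esub>\<close> in the right leg
  can be moved to the left one, where \<open>\<Sum> t(\<epsilon>(u\<^bsub>(2)\<^esub> s(a))) u\<^bsub>(1)\<^esub> = u t(a)\<close> applies.\<close>

lemma csum_takeuchi:
  assumes G: "abelian_group G" and q: "bal N G q" and a: "a \<in> carrier A" and n: "n \<in> carrier N"
  shows "csum N G (\<lambda>u n'. q (u \<cdot> t a) n') n = csum N G (\<lambda>u n'. q u (right_act B N n' a)) n"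
proof -
  note q' = balancedD(1-3)[OF q, simplified]
  have q3: "balanced3 N G (\<lambda>u v n. q u (eps (v \<cdot> s a) \<odot>\<^bsub>N\<^esub> n))"
    using a N q' bal_move[OF q]
    by (intro balanced3I) (simp_all add: distribs comodule_distribs comodule_assoc U.m_assoc)
  have "csum N G (\<lambda>u n'. q u (right_act B N n' a)) n =
      csum N G (\<lambda>u n'. csum N G (\<lambda>v n''. q u (eps (v \<cdot> s a) \<odot>\<^bsub>N\<^esub> n'')) n') n"
    unfolding right_act_def using N n a
    by (intro csum_cong n csum_hom[OF _ G balanced_additive_right[OF q]]) auto
  also have "\<dots> = csum N G (\<lambda>u n'. dsum G (\<lambda>u1 u2. q u1 (eps (u2 \<cdot> s a) \<odot>\<^bsub>N\<^esub> n')) u) n"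
    by (rule csum_coassoc[OF G q3 n, symmetric])
  also have "\<dots> = csum N G (\<lambda>u n'. q (u \<cdot> t a) n') n"
  proof (intro csum_cong n)
    fix u m assume um: "u \<in> carrier U" "m \<in> carrier N"
    have "dsum G (\<lambda>u1 u2. q u1 (eps (u2 \<cdot> s a) \<odot>\<^bsub>N\<^esub> m)) u =
        dsum G (\<lambda>u1 u2. q (t (eps (u2 \<cdot> s a)) \<cdot> u1) m) u"
      using um a bal_move[OF q] by (intro dsum_cong) auto
    also have "\<dots> = q (dsum U (\<lambda>u1 u2. t (eps (u2 \<cdot> s a)) \<cdot> u1) u) m"
      using um a by (intro dsum_hom[OF _ G balanced_additive_left[OF q], symmetric]) auto
    finally show "dsum G (\<lambda>u1 u2. q u1 (eps (u2 \<cdot> s a) \<odot>\<^bsub>N\<^esub> m)) u = q (u \<cdot> t a) m"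
      using um a by (simp add: counit_r_t)
  qed
  finally show ?thesis by simp
qed

lemma ra_ra: "a \<in> carrier A \<Longrightarrow> b \<in> carrier A \<Longrightarrow> n \<in> carrier N \<Longrightarrow>
    right_act B N (right_act B N n a) b = right_act B N n (a \<otimes>\<^bsub>A\<^esub> b)"
  unfolding right_act_def[of B N "right_act B N n a"]
  by (subst csum_ra[OF _ ra_bal]) (auto simp: N right_act_def U.m_assoc s_mult intro!: csum_cong)

end

section \<open>Colinear maps\<close>

lemma comod_hom_simps:
  assumes "f \<in> comod_hom B N P"
  shows "n \<in> carrier N \<Longrightarrow> f n \<in> carrier P"
    and "n \<in> carrier N \<Longrightarrow> n' \<in> carrier N \<Longrightarrow> f (n \<oplus>\<^bsub>N\<^esub> n') = f n \<oplus>\<^bsub>P\<^esub> f n'"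
    and "a \<in> carrier A \<Longrightarrow> n \<in> carrier N \<Longrightarrow> f (a \<odot>\<^bsub>N\<^esub> n) = a \<odot>\<^bsub>P\<^esub> f n"
    and "f \<in> extensional (carrier N)"
  using assms by (auto simp: comod_hom_def linear_maps_def PiE_def)

lemma comod_hom_additive: "f \<in> comod_hom B N P \<Longrightarrow> f \<in> additive_maps N P"
  by (auto intro!: additive_mapsI simp: comod_hom_simps)

lemma comod_hom_coact:
  "f \<in> comod_hom B N P \<Longrightarrow> n \<in> carrier N \<Longrightarrow>
    coact P (f n) = csum N (UX B P) (\<lambda>u n'. u \<boxtimes>\<^bsub>UX B P\<^esub> f n') n"
  by (auto simp: comod_hom_def)

lemma comod_homI:
  assumes "\<And>n. n \<in> carrier N \<Longrightarrow> f n \<in> carrier P" "f \<in> extensional (carrier N)"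
    "\<And>n n'. n \<in> carrier N \<Longrightarrow> n' \<in> carrier N \<Longrightarrow> f (n \<oplus>\<^bsub>N\<^esub> n') = f n \<oplus>\<^bsub>P\<^esub> f n'"
    "\<And>a n. a \<in> carrier A \<Longrightarrow> n \<in> carrier N \<Longrightarrow> f (a \<odot>\<^bsub>N\<^esub> n) = a \<odot>\<^bsub>P\<^esub> f n"
    "\<And>n. n \<in> carrier N \<Longrightarrow> coact P (f n) = csum N (UX B P) (\<lambda>u n'. u \<boxtimes>\<^bsub>UX B P\<^esub> f n') n"
  shows "f \<in> comod_hom B N P"
  using assms by (auto simp: comod_hom_def linear_maps_def PiE_def)

context
  fixes N :: "('a, 'u, 'n) comodule" and P :: "('a, 'u, 'p) comodule" and f
  assumes N: "left_comodule B N" and P: "left_comodule B P" and f: "f \<in> comod_hom B N P"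
begin

text \<open>Colinearity, as a rule for moving a colinear map inside a sum over the coaction.\<close>

lemma csum_colinear:
  assumes "abelian_group G" "bal P G q" "n \<in> carrier N"
  shows "csum P G q (f n) = csum N G (\<lambda>u n'. q u (f n')) n"
  using sweedler_push[OF UX_tensor[OF comodule_module[OF N]] UX_tensor[OF comodule_module[OF P]]
      assms(1,2), of "coact N n" "\<lambda>u n. u" "\<lambda>u n. f n"] assms(3) N
  by (simp add: comod_hom_coact[OF f] comod_hom_simps[OF f])

lemma comod_hom_ra: "a \<in> carrier A \<Longrightarrow> n \<in> carrier N \<Longrightarrow> f (right_act B N n a) = right_act B P (f n) a"
  unfolding right_act_def
  by (subst csum_colinear[OF _ ra_bal[OF P]], simp_all add: P,
      subst csum_hom[OF N _ _ comod_hom_additive[OF f]])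
    (auto simp: N P comod_hom_simps[OF f] intro!: csum_cong[OF N])

end

lemma comod_hom_restrict_comp:
  assumes N: "left_comodule B N" and P: "left_comodule B P" and Q: "left_comodule B Q"
    and f: "f \<in> comod_hom B N P" and g: "g \<in> comod_hom B P Q"
  shows "compose (carrier N) g f \<in> comod_hom B N Q"
proof (rule comod_homI)
  note [simp] = comod_hom_simps(1-3)[OF f] comod_hom_simps(1-3)[OF g] N P Q
  have "bal P (UX B Q) (\<lambda>u n'. u \<boxtimes>\<^bsub>UX B Q\<^esub> g n')"
    by (rule balI) (simp_all add: UX_pure_add_left UX_pure_add_right UX_move)
  then show "coact Q (compose (carrier N) g f n) =
      csum N (UX B Q) (\<lambda>u n'. u \<boxtimes>\<^bsub>UX B Q\<^esub> compose (carrier N) g f n') n" if "n \<in> carrier N" for n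
    using that
    by (simp add: compose_eq comod_hom_coact[OF g] csum_colinear[OF N P f] cong: csum_cong[OF N])
qed (use comod_hom_simps[OF f] comod_hom_simps[OF g] N P in \<open>auto simp: compose_def\<close>)

lemma comod_hom_ident:
  assumes N: "left_comodule B N"
  shows "(\<lambda>x\<in>carrier N. x) \<in> comod_hom B N N"
proof (rule comod_homI)
  show "coact N ((\<lambda>x\<in>carrier N. x) n) = csum N (UX B N) (\<lambda>u n'. u \<boxtimes>\<^bsub>UX B N\<^esub> (\<lambda>x\<in>carrier N. x) n') n"
    if "n \<in> carrier N" for n
    using that sweedler_id[OF UX_tensor[OF comodule_module[OF N]], of "coact N n"] N
    by (simp cong: csum_cong[OF N])
qed (use N in auto)

text \<open>The coaction of \<open>f\<^sup>-\<^sup>1(p)\<close> is found by applying \<open>id \<otimes> f\<^sup>-\<^sup>1\<close> to the coaction of \<open>p = f(f\<^sup>-\<^sup>1(p))\<close>.\<close>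

lemma comod_hom_inverse:
  assumes N: "left_comodule B N" and P: "left_comodule B P" and f: "f \<in> comod_hom B N P"
    and bij: "bij_betw f (carrier N) (carrier P)"
  shows "restrict (inv_into (carrier N) f) (carrier P) \<in> comod_hom B P N"
proof (rule comod_homI)
  let ?g = "inv_into (carrier N) f"
  note [simp] = comod_hom_simps(1-3)[OF f] N P
  have gf [simp]: "?g (f n) = n" if "n \<in> carrier N" for n
    using bij that by (rule bij_betw_inv_into_left)
  have fg [simp]: "f (?g p) = p" if "p \<in> carrier P" for p
    using bij that by (rule bij_betw_inv_into_right)
  have g [simp]: "?g p \<in> carrier N" if "p \<in> carrier P" for p
    using bij that by (metis bij_betw_def inv_into_into)
  have ga: "?g (p \<oplus>\<^bsub>P\<^esub> p') = ?g p \<oplus>\<^bsub>N\<^esub> ?g p'" if "p \<in> carrier P" "p' \<in> carrier P" for p p'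
    using gf[of "?g p \<oplus>\<^bsub>N\<^esub> ?g p'"] that by simp
  have gs: "?g (a \<odot>\<^bsub>P\<^esub> p) = a \<odot>\<^bsub>N\<^esub> ?g p" if "p \<in> carrier P" "a \<in> carrier A" for a p
    using gf[of "a \<odot>\<^bsub>N\<^esub> ?g p"] that by simp
  show "restrict ?g (carrier P) (p \<oplus>\<^bsub>P\<^esub> p') = restrict ?g (carrier P) p \<oplus>\<^bsub>N\<^esub> restrict ?g (carrier P) p'"
    if "p \<in> carrier P" "p' \<in> carrier P" for p p' using that ga by simp
  show "restrict ?g (carrier P) (a \<odot>\<^bsub>P\<^esub> p) = a \<odot>\<^bsub>N\<^esub> restrict ?g (carrier P) p"
    if "a \<in> carrier A" "p \<in> carrier P" for a p using that gs by simp
  have b: "bal P (UX B N) (\<lambda>u p. u \<boxtimes>\<^bsub>UX B N\<^esub> ?g p)"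
    by (rule balI) (simp_all add: UX_pure_add_left UX_pure_add_right UX_move ga gs)
  show "coact N (restrict ?g (carrier P) p) = csum P (UX B N) (\<lambda>u n'. u \<boxtimes>\<^bsub>UX B N\<^esub> restrict ?g (carrier P) n') p"
    if p: "p \<in> carrier P" for p
  proof -
    have "csum P (UX B N) (\<lambda>u n'. u \<boxtimes>\<^bsub>UX B N\<^esub> ?g n') (f (?g p)) =
        csum N (UX B N) (\<lambda>u n'. u \<boxtimes>\<^bsub>UX B N\<^esub> ?g (f n')) (?g p)"
      using p by (intro csum_colinear[OF N P f _ b]) auto
    also have "\<dots> = coact N (?g p)"
      using p sweedler_id[OF UX_tensor[OF comodule_module[OF N]], of "coact N (?g p)"]
      by (simp cong: csum_cong[OF N])
    finally show ?thesis using p unfolding fg[OF p] by (simp cong: csum_cong[OF P])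
  qed
qed (use bij in \<open>auto simp: bij_betw_def inv_into_into\<close>)

end

section \<open>The tensor product of comodules\<close>

context left_bialgebroid
begin

abbreviation comod_tensor_infix (infixl "\<star>" 75) where "N \<star> P \<equiv> comod_tensor B N P"

lemma csum_swap:
  assumes "left_comodule B N" "left_comodule B P" "abelian_group G" "n \<in> carrier N" "p \<in> carrier P"
    "\<And>u n' v p'. u \<in> carrier U \<Longrightarrow> n' \<in> carrier N \<Longrightarrow> v \<in> carrier U \<Longrightarrow> p' \<in> carrier P \<Longrightarrow>
      q u n' v p' \<in> carrier G"
  shows "csum N G (\<lambda>u n'. csum P G (q u n') p) n = csum P G (\<lambda>v p'. csum N G (\<lambda>u n'. q u n' v p') n) p"
  using assms by (intro sweedler_swap[OF UX_tensor UX_tensor]) auto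

lemma csum_dsum_swap:
  assumes "left_comodule B N" "abelian_group G" "n \<in> carrier N" "v \<in> carrier U"
    "\<And>u n' v p'. u \<in> carrier U \<Longrightarrow> n' \<in> carrier N \<Longrightarrow> v \<in> carrier U \<Longrightarrow> p' \<in> carrier U \<Longrightarrow>
      q u n' v p' \<in> carrier G"
  shows "csum N G (\<lambda>u n'. dsum G (q u n') v) n = dsum G (\<lambda>v1 v2. csum N G (\<lambda>u n'. q u n' v1 v2) n) v"
  using assms by (intro sweedler_swap[OF UX_tensor UU_tensor]) auto

lemma balanced3D:
  assumes "balanced3 N G q"
  shows "u \<in> carrier U \<Longrightarrow> v \<in> carrier U \<Longrightarrow> n \<in> carrier N \<Longrightarrow> q u v n \<in> carrier G"
    and "u \<in> carrier U \<Longrightarrow> u' \<in> carrier U \<Longrightarrow> v \<in> carrier U \<Longrightarrow> n \<in> carrier N \<Longrightarrow>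
      q (u \<oplus>\<^bsub>U\<^esub> u') v n = q u v n \<oplus>\<^bsub>G\<^esub> q u' v n"
    and "u \<in> carrier U \<Longrightarrow> v \<in> carrier U \<Longrightarrow> v' \<in> carrier U \<Longrightarrow> n \<in> carrier N \<Longrightarrow>
      q u (v \<oplus>\<^bsub>U\<^esub> v') n = q u v n \<oplus>\<^bsub>G\<^esub> q u v' n"
    and "u \<in> carrier U \<Longrightarrow> v \<in> carrier U \<Longrightarrow> n \<in> carrier N \<Longrightarrow> n' \<in> carrier N \<Longrightarrow>
      q u v (n \<oplus>\<^bsub>N\<^esub> n') = q u v n \<oplus>\<^bsub>G\<^esub> q u v n'"
    and "a \<in> carrier A \<Longrightarrow> u \<in> carrier U \<Longrightarrow> v \<in> carrier U \<Longrightarrow> n \<in> carrier N \<Longrightarrow>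
      q (t a \<cdot> u) v n = q u (s a \<cdot> v) n"
    and "a \<in> carrier A \<Longrightarrow> u \<in> carrier U \<Longrightarrow> v \<in> carrier U \<Longrightarrow> n \<in> carrier N \<Longrightarrow>
      q u (t a \<cdot> v) n = q u v (a \<odot>\<^bsub>N\<^esub> n)"
proof -
  have q1: "bal N G (q u)" if "u \<in> carrier U" for u using assms that by (simp add: balanced3_def)
  have q2: "bal (U_left B) G (\<lambda>u v. q u v n)" if "n \<in> carrier N" for n
    using assms that by (simp add: balanced3_def)
  show "u \<in> carrier U \<Longrightarrow> v \<in> carrier U \<Longrightarrow> n \<in> carrier N \<Longrightarrow> q u v n \<in> carrier G"
    using balancedD(1)[OF q1] .
  show "u \<in> carrier U \<Longrightarrow> u' \<in> carrier U \<Longrightarrow> v \<in> carrier U \<Longrightarrow> n \<in> carrier N \<Longrightarrow>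
      q (u \<oplus>\<^bsub>U\<^esub> u') v n = q u v n \<oplus>\<^bsub>G\<^esub> q u' v n"
    using balancedD(2)[OF q2] by simp
  show "u \<in> carrier U \<Longrightarrow> v \<in> carrier U \<Longrightarrow> v' \<in> carrier U \<Longrightarrow> n \<in> carrier N \<Longrightarrow>
      q u (v \<oplus>\<^bsub>U\<^esub> v') n = q u v n \<oplus>\<^bsub>G\<^esub> q u v' n"
    using balancedD(2)[OF q1] by simp
  show "u \<in> carrier U \<Longrightarrow> v \<in> carrier U \<Longrightarrow> n \<in> carrier N \<Longrightarrow> n' \<in> carrier N \<Longrightarrow>
      q u v (n \<oplus>\<^bsub>N\<^esub> n') = q u v n \<oplus>\<^bsub>G\<^esub> q u v n'"
    using balancedD(3)[OF q1] by simp
  show "a \<in> carrier A \<Longrightarrow> u \<in> carrier U \<Longrightarrow> v \<in> carrier U \<Longrightarrow> n \<in> carrier N \<Longrightarrow>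
      q (t a \<cdot> u) v n = q u (s a \<cdot> v) n"
    using bal_move[OF q2] by simp
  show "a \<in> carrier A \<Longrightarrow> u \<in> carrier U \<Longrightarrow> v \<in> carrier U \<Longrightarrow> n \<in> carrier N \<Longrightarrow>
      q u (t a \<cdot> v) n = q u v (a \<odot>\<^bsub>N\<^esub> n)"
    using bal_move[OF q1] by simp
qed

lemma balanced3_dsum:
  assumes G: "abelian_group G" and q: "balanced3 N G q" and N: "left_module A N"
  shows "bal N G (\<lambda>u n. dsum G (\<lambda>u1 u2. q u1 u2 n) u)"
proof (rule balI)
  note [simp] = balanced3D[OF q]
  have q2: "bal (U_left B) G (\<lambda>u v. q u v n)" if "n \<in> carrier N" for n
    using q that by (simp add: balanced3_def)
  show "dsum G (\<lambda>u1 u2. q u1 u2 n) (t a \<cdot> u) = dsum G (\<lambda>u1 u2. q u1 u2 (a \<odot>\<^bsub>N\<^esub> n)) u"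
    if "a \<in> carrier A" "u \<in> carrier U" "n \<in> carrier N" for a u n
    using that by (auto simp: dsum_t_left[OF G q2] intro!: dsum_cong)
  show "dsum G (\<lambda>u1 u2. q u1 u2 n) (u \<oplus>\<^bsub>U\<^esub> u') =
      dsum G (\<lambda>u1 u2. q u1 u2 n) u \<oplus>\<^bsub>G\<^esub> dsum G (\<lambda>u1 u2. q u1 u2 n) u'"
    if "u \<in> carrier U" "u' \<in> carrier U" "n \<in> carrier N" for u u' n
    using that by (intro dsum_add[OF G q2]) auto
  show "dsum G (\<lambda>u1 u2. q u1 u2 (n \<oplus>\<^bsub>N\<^esub> n')) u =
      dsum G (\<lambda>u1 u2. q u1 u2 n) u \<oplus>\<^bsub>G\<^esub> dsum G (\<lambda>u1 u2. q u1 u2 n') u"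
    if "u \<in> carrier U" "n \<in> carrier N" "n' \<in> carrier N" for u n n'
    using that by (simp add: dsum_fun_add[OF G, symmetric] cong: dsum_cong)
qed (auto intro!: dsum_closed G balanced3D[OF q])

lemma balanced3_csum:
  assumes G: "abelian_group G" and q: "balanced3 N G q" and N: "left_comodule B N"
  shows "bal N G (\<lambda>u n. csum N G (q u) n)"
proof (rule balI)
  note [simp] = balanced3D[OF q]
  have q1: "bal N G (q u)" if "u \<in> carrier U" for u using q that by (simp add: balanced3_def)
  show "csum N G (q (t a \<cdot> u)) n = csum N G (q u) (a \<odot>\<^bsub>N\<^esub> n)"
    if "a \<in> carrier A" "u \<in> carrier U" "n \<in> carrier N" for a u n
    using that by (auto simp: csum_smult[OF N G q1] intro!: csum_cong[OF N])
  show "csum N G (q (u \<oplus>\<^bsub>U\<^esub> u')) n = csum N G (q u) n \<oplus>\<^bsub>G\<^esub> csum N G (q u') n"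
    if "u \<in> carrier U" "u' \<in> carrier U" "n \<in> carrier N" for u u' n
    using that by (simp add: csum_fun_add[OF N G, symmetric] cong: csum_cong[OF N])
  show "csum N G (q u) (n \<oplus>\<^bsub>N\<^esub> n') = csum N G (q u) n \<oplus>\<^bsub>G\<^esub> csum N G (q u) n'"
    if "u \<in> carrier U" "n \<in> carrier N" "n' \<in> carrier N" for u n n'
    using that by (intro csum_add[OF N G q1]) auto
qed (auto intro!: csum_closed[OF N] G balanced3D[OF q])

lemma pure3_balanced3:
  "left_module A N \<Longrightarrow> balanced3 N (UUX B N) (\<lambda>u v n. u \<boxtimes>\<^bsub>UUX B N\<^esub> (v \<boxtimes>\<^bsub>UX B N\<^esub> n))"
  using pure_move[OF UUX_tensor[of N]]
  by (intro balanced3I)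
    (simp_all add: UX_pure_add_left UX_pure_add_right UX_move pure_add_left[OF UUX_tensor]
      pure_add_right[OF UUX_tensor])

abbreviation tsum where
  "tsum N P G q z \<equiv> sweedler (XX B N P) G q (dec (XX B N P) z)"
abbreviation balN where
  "balN N P G q \<equiv> balanced (carrier A) N (right_act B N) (smult P) P G q"

context
  fixes N P :: "('a, 'u, 'v) ucomodule"
  assumes N [simp]: "left_comodule B N" and P [simp]: "left_comodule B P"
begin

abbreviation CT where "CT \<equiv> N \<star> P"
abbreviation cp where "cp \<equiv> comod_pure B N P"

lemma XX_tensor: "is_tensor (XX B N P) (carrier A) N (right_act B N) (smult P) P"
  by (simp add: is_tensor_def tensor_data_def XX_def)

lemma dec_enc: "c \<in> carrier (XX B N P) \<Longrightarrow> dec (XX B N P) (enc (XX B N P) c) = c"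
  unfolding dec_def enc_def using representative(2)[OF XX_tensor] by simp

lemma CT_simps:
  "carrier CT = enc (XX B N P) ` carrier (XX B N P)"
  "x \<oplus>\<^bsub>CT\<^esub> y = enc (XX B N P) (dec (XX B N P) x \<oplus>\<^bsub>XX B N P\<^esub> dec (XX B N P) y)"
  "\<zero>\<^bsub>CT\<^esub> = enc (XX B N P) \<zero>\<^bsub>XX B N P\<^esub>"
  "a \<odot>\<^bsub>CT\<^esub> x = enc (XX B N P) (sweedler (XX B N P) (XX B N P)
    (\<lambda>n p. (a \<odot>\<^bsub>N\<^esub> n) \<boxtimes>\<^bsub>XX B N P\<^esub> p) (dec (XX B N P) x))"
  by (simp_all add: comod_tensor_def comod_tensor_module_def Let_def module.defs comodule.defs)

lemma CT_fields:
  "UX B (comod_tensor_module B N P) = UX B CT"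
  "coact CT = (\<lambda>x. tsum N P (UX B CT) (\<lambda>n p. csum N (UX B CT) (\<lambda>u n'. csum P (UX B CT)
      (\<lambda>v p'. (u \<cdot> v) \<boxtimes>\<^bsub>UX B CT\<^esub> cp n' p') p) n) x)"
proof -
  show *: "UX B (comod_tensor_module B N P) = UX B CT"
    by (simp add: UX_def tensor_def tensor_relations_def comod_tensor_def Let_def
        module.defs comodule.defs)
  show "coact CT = (\<lambda>x. tsum N P (UX B CT) (\<lambda>n p. csum N (UX B CT) (\<lambda>u n'. csum P (UX B CT)
      (\<lambda>v p'. (u \<cdot> v) \<boxtimes>\<^bsub>UX B CT\<^esub> cp n' p') p) n) x)"
    unfolding *[symmetric]
    by (subst comod_tensor_def) (simp add: Let_def module.defs comodule.defs)
qed

interpretation X: abelian_group "XX B N P" by (rule tensor_abelian_group[OF XX_tensor])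

lemma CT_ab [simp]: "abelian_group CT"
proof (rule abelian_groupI)
  show "\<exists>y\<in>carrier CT. y \<oplus>\<^bsub>CT\<^esub> x = \<zero>\<^bsub>CT\<^esub>" if x: "x \<in> carrier CT" for x
  proof -
    obtain c where c: "c \<in> carrier (XX B N P)" "x = enc (XX B N P) c"
      using x by (auto simp: CT_simps)
    show ?thesis
      using c by (intro bexI[of _ "enc (XX B N P) (\<ominus>\<^bsub>XX B N P\<^esub> c)"])
        (simp_all add: CT_simps dec_enc X.l_neg)
  qed
qed (auto simp: CT_simps dec_enc X.a_ac)

lemma dec_additive: "dec (XX B N P) \<in> additive_maps CT (XX B N P)"
  by (rule additive_mapsI) (auto simp: CT_simps dec_enc)

lemma enc_additive: "enc (XX B N P) \<in> additive_maps (XX B N P) CT"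
  by (rule additive_mapsI) (auto simp: CT_simps dec_enc)

lemma cp_bal: "balN N P CT cp"
proof -
  have "balN N P CT (\<lambda>n p. enc (XX B N P) (n \<boxtimes>\<^bsub>XX B N P\<^esub> p))"
    using pure_balanced[OF XX_tensor] enc_additive
    by (auto simp: balanced_def additive_maps_add additive_maps_closed)
  then show ?thesis by (simp add: comod_pure_def[abs_def])
qed

lemma cp_closed [simp]: "n \<in> carrier N \<Longrightarrow> p \<in> carrier P \<Longrightarrow> cp n p \<in> carrier CT"
  and cp_add_left: "n \<in> carrier N \<Longrightarrow> n' \<in> carrier N \<Longrightarrow> p \<in> carrier P \<Longrightarrow>
    cp (n \<oplus>\<^bsub>N\<^esub> n') p = cp n p \<oplus>\<^bsub>CT\<^esub> cp n' p"
  and cp_add_right: "n \<in> carrier N \<Longrightarrow> p \<in> carrier P \<Longrightarrow> p' \<in> carrier P \<Longrightarrow>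
    cp n (p \<oplus>\<^bsub>P\<^esub> p') = cp n p \<oplus>\<^bsub>CT\<^esub> cp n p'"
  and cp_move: "a \<in> carrier A \<Longrightarrow> n \<in> carrier N \<Longrightarrow> p \<in> carrier P \<Longrightarrow>
    cp (right_act B N n a) p = cp n (a \<odot>\<^bsub>P\<^esub> p)"
  using cp_bal by (auto simp: balanced_def)

lemma tsum_additive:
  assumes "abelian_group G" "balN N P G q"
  shows "tsum N P G q \<in> additive_maps CT G"
  using additive_maps_comp[OF dec_additive sweedler_additive[OF XX_tensor assms]] .

lemma tsum_pure:
  assumes "abelian_group G" "balN N P G q" "n \<in> carrier N" "p \<in> carrier P"
  shows "tsum N P G q (cp n p) = q n p"
  using assms
  by (simp add: comod_pure_def dec_enc pure_closed[OF XX_tensor] sweedler_pure[OF XX_tensor assms(1,2)])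

lemma CT_ext:
  assumes "abelian_group G" "h \<in> additive_maps CT G" "h' \<in> additive_maps CT G"
    "\<And>n p. n \<in> carrier N \<Longrightarrow> p \<in> carrier P \<Longrightarrow> h (cp n p) = h' (cp n p)" "z \<in> carrier CT"
  shows "h z = h' z"
proof -
  obtain c where c: "c \<in> carrier (XX B N P)" "z = enc (XX B N P) c"
    using assms(5) by (auto simp: CT_simps)
  have "h (enc (XX B N P) c) = h' (enc (XX B N P) c)"
    using assms(4) c(1) unfolding comod_pure_def
    by (rule tensor_ext[OF XX_tensor assms(1) additive_maps_comp[OF enc_additive assms(2)]
          additive_maps_comp[OF enc_additive assms(3)]])
  then show ?thesis by (simp add: c)
qed

lemma CT_smult_tsum: "a \<in> carrier A \<Longrightarrow> z \<in> carrier CT \<Longrightarrow> a \<odot>\<^bsub>CT\<^esub> z = tsum N P CT (\<lambda>n p. cp (a \<odot>\<^bsub>N\<^esub> n) p) z"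
  unfolding CT_simps(4)
  by (subst sweedler_hom[OF XX_tensor _ _ enc_additive])
    (auto simp: comod_pure_def[abs_def] X.abelian_group_axioms additive_maps_closed[OF dec_additive]
      intro!: pure_closed[OF XX_tensor])

lemma CT_smult_bal: "a \<in> carrier A \<Longrightarrow> balN N P CT (\<lambda>n p. cp (a \<odot>\<^bsub>N\<^esub> n) p)"
  by (rule balancedI)
    (simp_all add: comodule_distribs cp_add_left cp_add_right cp_move ra_smult[symmetric])

lemma CT_smult_additive: "a \<in> carrier A \<Longrightarrow> (\<lambda>z. a \<odot>\<^bsub>CT\<^esub> z) \<in> additive_maps CT CT"
proof (rule additive_mapsI)
  interpret CT: abelian_group CT by simp
  assume a: "a \<in> carrier A"
  note h = tsum_additive[OF CT_ab CT_smult_bal[OF a]]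
  show "a \<odot>\<^bsub>CT\<^esub> x \<in> carrier CT" if "x \<in> carrier CT" for x
    using additive_maps_closed[OF h that] CT_smult_tsum[OF a that] by simp
  show "a \<odot>\<^bsub>CT\<^esub> (x \<oplus>\<^bsub>CT\<^esub> y) = a \<odot>\<^bsub>CT\<^esub> x \<oplus>\<^bsub>CT\<^esub> a \<odot>\<^bsub>CT\<^esub> y"
    if "x \<in> carrier CT" "y \<in> carrier CT" for x y
    using additive_maps_add[OF h that] CT_smult_tsum[OF a] that CT.a_closed by simp
qed

lemma CT_smult_pure [simp]: "a \<in> carrier A \<Longrightarrow> n \<in> carrier N \<Longrightarrow> p \<in> carrier P \<Longrightarrow>
    a \<odot>\<^bsub>CT\<^esub> cp n p = cp (a \<odot>\<^bsub>N\<^esub> n) p"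
  using tsum_pure[OF _ CT_smult_bal] by (simp add: CT_smult_tsum)

lemma left_module_CT [simp]: "left_module A CT"
proof (intro left_module.intro left_module_axioms.intro)
  interpret CT: abelian_group CT by simp
  note cl = additive_maps_closed[OF CT_smult_additive]
  show "abelian_group CT" by simp
  show "ring A" by (rule A.ring_axioms)
  show "a \<odot>\<^bsub>CT\<^esub> z \<in> carrier CT" if "a \<in> carrier A" "z \<in> carrier CT" for a z
    using that by (rule cl)
  show "a \<odot>\<^bsub>CT\<^esub> (z \<oplus>\<^bsub>CT\<^esub> w) = a \<odot>\<^bsub>CT\<^esub> z \<oplus>\<^bsub>CT\<^esub> a \<odot>\<^bsub>CT\<^esub> w"
    if "a \<in> carrier A" "z \<in> carrier CT" "w \<in> carrier CT" for a z w
    using that by (intro additive_maps_add[OF CT_smult_additive])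
  show "(a \<oplus>\<^bsub>A\<^esub> b) \<odot>\<^bsub>CT\<^esub> z = a \<odot>\<^bsub>CT\<^esub> z \<oplus>\<^bsub>CT\<^esub> b \<odot>\<^bsub>CT\<^esub> z"
    if a: "a \<in> carrier A" "b \<in> carrier A" and z: "z \<in> carrier CT" for a b z
  proof (rule CT_ext[OF CT_ab CT_smult_additive _ _ z])
    show "(\<lambda>z. a \<odot>\<^bsub>CT\<^esub> z \<oplus>\<^bsub>CT\<^esub> b \<odot>\<^bsub>CT\<^esub> z) \<in> additive_maps CT CT"
      using a by (intro additive_mapsI) (simp_all add: cl additive_maps_add[OF CT_smult_additive] CT.a_ac)
  qed (use a in \<open>simp_all add: comodule_distribs cp_add_left\<close>)
  show "(a \<otimes>\<^bsub>A\<^esub> b) \<odot>\<^bsub>CT\<^esub> z = a \<odot>\<^bsub>CT\<^esub> (b \<odot>\<^bsub>CT\<^esub> z)"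
    if a: "a \<in> carrier A" "b \<in> carrier A" and z: "z \<in> carrier CT" for a b z
    using a by (intro CT_ext[OF CT_ab CT_smult_additive
          additive_maps_comp[OF CT_smult_additive[of b] CT_smult_additive[of a]] _ z])
      (simp_all add: comodule_assoc)
  show "\<one>\<^bsub>A\<^esub> \<odot>\<^bsub>CT\<^esub> z = z" if z: "z \<in> carrier CT" for z
    by (rule CT_ext[OF CT_ab CT_smult_additive _ _ z]) (auto intro!: additive_mapsI)
qed

lemmas CT_UX = UX_tensor[OF left_module_CT]

text \<open>The function that defines the codiagonal coaction is balanced: in the left factor because
  \<open>N \<rightarrow> U \<otimes> N\<close> is right \<open>A\<close>-linear, in the right factor because it has the Takeuchi property.\<close>

context
  fixes Z :: "('a, 'z, 'c) module_scheme" and r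
  assumes r: "balN N P Z r"
    and r_smult: "\<And>a n p. a \<in> carrier A \<Longrightarrow> n \<in> carrier N \<Longrightarrow> p \<in> carrier P \<Longrightarrow>
      r (a \<odot>\<^bsub>N\<^esub> n) p = a \<odot>\<^bsub>Z\<^esub> r n p"
begin

lemma r_closed: "n \<in> carrier N \<Longrightarrow> p \<in> carrier P \<Longrightarrow> r n p \<in> carrier Z"
  and r_add_left: "n \<in> carrier N \<Longrightarrow> n' \<in> carrier N \<Longrightarrow> p \<in> carrier P \<Longrightarrow>
    r (n \<oplus>\<^bsub>N\<^esub> n') p = r n p \<oplus>\<^bsub>Z\<^esub> r n' p"
  and r_add_right: "n \<in> carrier N \<Longrightarrow> p \<in> carrier P \<Longrightarrow> p' \<in> carrier P \<Longrightarrow>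
    r n (p \<oplus>\<^bsub>P\<^esub> p') = r n p \<oplus>\<^bsub>Z\<^esub> r n p'"
  and r_move: "a \<in> carrier A \<Longrightarrow> n \<in> carrier N \<Longrightarrow> p \<in> carrier P \<Longrightarrow>
    r (right_act B N n a) p = r n (a \<odot>\<^bsub>P\<^esub> p)"
  using r by (auto simp: balanced_def)

lemma codiagonal_bal_left:
  assumes G: "abelian_group G" and q: "bal Z G q" and p: "p \<in> carrier P"
  shows "bal N G (\<lambda>u n'. csum P G (\<lambda>v p'. q (u \<cdot> v) (r n' p')) p)"
proof (rule balI)
  note [simp] = balancedD(1-3)[OF q, simplified] bal_move[OF q] r_closed r_smult
  show "csum P G (\<lambda>v p'. q (t a \<cdot> u \<cdot> v) (r n p')) p = csum P G (\<lambda>v p'. q (u \<cdot> v) (r (a \<odot>\<^bsub>N\<^esub> n) p')) p"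
    if "a \<in> carrier A" "u \<in> carrier U" "n \<in> carrier N" for a u n
    using that p by (auto intro!: csum_cong[OF P] simp: U.m_assoc)
qed (use p G balancedD(1-3)[OF q, simplified] in \<open>simp_all add: distribs r_closed r_add_left
      csum_fun_add[OF P G, symmetric] csum_closed[OF P] cong: csum_cong[OF P]\<close>)

lemma codiagonal_bal_right:
  assumes G: "abelian_group G" and q: "bal Z G q" and n: "n \<in> carrier N"
  shows "bal P G (\<lambda>v p'. csum N G (\<lambda>u n'. q (u \<cdot> v) (r n' p')) n)"
proof (rule balI)
  note [simp] = balancedD(1-3)[OF q, simplified] bal_move[OF q] r_closed r_smult
  show "csum N G (\<lambda>u n'. q (u \<cdot> (t a \<cdot> v)) (r n' p)) n = csum N G (\<lambda>u n'. q (u \<cdot> v) (r n' (a \<odot>\<^bsub>P\<^esub> p))) n"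
    if "a \<in> carrier A" "v \<in> carrier U" "p \<in> carrier P" for a v p
  proof -
    have b: "bal N G (\<lambda>u n'. q (u \<cdot> v) (r n' p))"
      by (rule balI) (use that in \<open>simp_all add: distribs r_closed r_add_left U.m_assoc\<close>)
    have "csum N G (\<lambda>u n'. q (u \<cdot> (t a \<cdot> v)) (r n' p)) n = csum N G (\<lambda>u n'. q (u \<cdot> t a \<cdot> v) (r n' p)) n"
      using that by (intro csum_cong[OF N] n) (simp add: U.m_assoc)
    also have "\<dots> = csum N G (\<lambda>u n'. q (u \<cdot> v) (r (right_act B N n' a) p)) n"
      using csum_takeuchi[OF N G b that(1) n] .
    also have "\<dots> = csum N G (\<lambda>u n'. q (u \<cdot> v) (r n' (a \<odot>\<^bsub>P\<^esub> p))) n"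
      using that by (intro csum_cong[OF N] n) (simp add: r_move)
    finally show ?thesis .
  qed
qed (use n G balancedD(1-3)[OF q, simplified] in \<open>simp_all add: distribs r_closed r_add_right
      csum_fun_add[OF N G, symmetric] csum_closed[OF N] cong: csum_cong[OF N]\<close>)

lemma codiagonal_swap:
  assumes "abelian_group G" "bal Z G q" "n \<in> carrier N" "p \<in> carrier P"
  shows "csum N G (\<lambda>u n'. csum P G (\<lambda>v p'. q (u \<cdot> v) (r n' p')) p) n =
    csum P G (\<lambda>v p'. csum N G (\<lambda>u n'. q (u \<cdot> v) (r n' p')) n) p"
  using assms by (intro csum_swap) (auto intro!: balancedD(1)[OF assms(2), simplified] r_closed)

lemma codiagonal_balN:
  assumes G: "abelian_group G" and q: "bal Z G q"
  shows "balN N P G (\<lambda>n p. csum N G (\<lambda>u n'. csum P G (\<lambda>v p'. q (u \<cdot> v) (r n' p')) p) n)"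
proof (rule balancedI)
  note l = codiagonal_bal_left[OF G q] and r = codiagonal_bal_right[OF G q]
  show "csum N G (\<lambda>u n'. csum P G (\<lambda>v p'. q (u \<cdot> v) (r n' p')) p) n \<in> carrier G"
    if "n \<in> carrier N" "p \<in> carrier P" for n p
    using that by (intro csum_q_closed[OF N G l])
  show "csum N G (\<lambda>u n'. csum P G (\<lambda>v p'. q (u \<cdot> v) (r n' p')) p) (n1 \<oplus>\<^bsub>N\<^esub> n2) =
      csum N G (\<lambda>u n'. csum P G (\<lambda>v p'. q (u \<cdot> v) (r n' p')) p) n1 \<oplus>\<^bsub>G\<^esub>
      csum N G (\<lambda>u n'. csum P G (\<lambda>v p'. q (u \<cdot> v) (r n' p')) p) n2"
    if "n1 \<in> carrier N" "n2 \<in> carrier N" "p \<in> carrier P" for n1 n2 p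
    using that by (intro csum_add[OF N G l])
  show "csum N G (\<lambda>u n'. csum P G (\<lambda>v p'. q (u \<cdot> v) (r n' p')) (p1 \<oplus>\<^bsub>P\<^esub> p2)) n =
      csum N G (\<lambda>u n'. csum P G (\<lambda>v p'. q (u \<cdot> v) (r n' p')) p1) n \<oplus>\<^bsub>G\<^esub>
      csum N G (\<lambda>u n'. csum P G (\<lambda>v p'. q (u \<cdot> v) (r n' p')) p2) n"
    if "n \<in> carrier N" "p1 \<in> carrier P" "p2 \<in> carrier P" for n p1 p2
    using that csum_add[OF P G r] by (simp add: codiagonal_swap[OF G q])
  show "csum N G (\<lambda>u n'. csum P G (\<lambda>v p'. q (u \<cdot> v) (r n' p')) p) (right_act B N n a) =
      csum N G (\<lambda>u n'. csum P G (\<lambda>v p'. q (u \<cdot> v) (r n' p')) (a \<odot>\<^bsub>P\<^esub> p)) n"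
    if "a \<in> carrier A" "n \<in> carrier N" "p \<in> carrier P" for a n p
  proof -
    have "csum N G (\<lambda>u n'. csum P G (\<lambda>v p'. q (u \<cdot> v) (r n' p')) p) (right_act B N n a) =
        csum N G (\<lambda>u n'. csum P G (\<lambda>v p'. q (u \<cdot> s a \<cdot> v) (r n' p')) p) n"
      using that by (intro csum_ra[OF N G l])
    also have "\<dots> = csum N G (\<lambda>u n'. csum P G (\<lambda>v p'. q (u \<cdot> (s a \<cdot> v)) (r n' p')) p) n"
      using that by (intro csum_cong[OF N] csum_cong[OF P]) (auto simp: U.m_assoc)
    also have "\<dots> = csum P G (\<lambda>v p'. csum N G (\<lambda>u n'. q (u \<cdot> (s a \<cdot> v)) (r n' p')) n) p"
      using that by (intro csum_swap) (auto intro!: balancedD(1)[OF q, simplified] G r_closed)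
    also have "\<dots> = csum P G (\<lambda>v p'. csum N G (\<lambda>u n'. q (u \<cdot> v) (r n' p')) n) (a \<odot>\<^bsub>P\<^esub> p)"
      using that by (intro csum_smult[OF P G r, symmetric])
    finally show ?thesis using that by (simp add: codiagonal_swap[OF G q])
  qed
qed

end

lemma CT_pure_bal: "bal CT (UX B CT) (\<lambda>u z. u \<boxtimes>\<^bsub>UX B CT\<^esub> z)"
  using pure_balanced[OF CT_UX] by simp

lemma coact_CT_additive: "coact CT \<in> additive_maps CT (UX B CT)"
  unfolding CT_fields
  by (rule tsum_additive[OF UX_ab[OF left_module_CT] codiagonal_balN[OF cp_bal CT_smult_pure[symmetric] UX_ab[OF left_module_CT] CT_pure_bal]])

lemma coact_CT_pure:
  assumes "n \<in> carrier N" "p \<in> carrier P"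
  shows "coact CT (cp n p) = csum N (UX B CT) (\<lambda>u n'. csum P (UX B CT)
      (\<lambda>v p'. (u \<cdot> v) \<boxtimes>\<^bsub>UX B CT\<^esub> cp n' p') p) n"
  unfolding CT_fields
  by (rule tsum_pure[OF UX_ab[OF left_module_CT] codiagonal_balN[OF cp_bal CT_smult_pure[symmetric] UX_ab[OF left_module_CT] CT_pure_bal] assms])

text \<open>The rule by which all computations with codiagonal coactions are done; elements of \<open>comod_tensor\<close>
  are codes of tensors and are accessed only through pure tensors.\<close>

lemma csum_CT_pure:
  assumes G: "abelian_group G" and q: "bal CT G q" and n: "n \<in> carrier N" and p: "p \<in> carrier P"
  shows "csum CT G q (cp n p) = csum N G (\<lambda>u n'. csum P G (\<lambda>v p'. q (u \<cdot> v) (cp n' p')) p) n"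
proof -
  let ?W = "UX B CT"
  note h = sweedler_additive[OF CT_UX G q]
  have "csum CT G q (cp n p) = csum N G (\<lambda>u n'. sweedler ?W G q (csum P ?W
      (\<lambda>v p'. (u \<cdot> v) \<boxtimes>\<^bsub>?W\<^esub> cp n' p') p)) n"
    unfolding coact_CT_pure[OF n p]
    by (rule csum_hom[OF N _ G h n]) (auto intro!: csum_closed[OF P] p)
  also have "\<dots> = csum N G (\<lambda>u n'. csum P G (\<lambda>v p'. sweedler ?W G q ((u \<cdot> v) \<boxtimes>\<^bsub>?W\<^esub> cp n' p')) p) n"
    by (intro csum_cong[OF N] n, rule csum_hom[OF P _ G h p]) auto
  also have "\<dots> = csum N G (\<lambda>u n'. csum P G (\<lambda>v p'. q (u \<cdot> v) (cp n' p')) p) n"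
    by (intro csum_cong[OF N] csum_cong[OF P] n p sweedler_pure[OF CT_UX G q]) auto
  finally show ?thesis .
qed

lemma csum_CT_additive:
  assumes "abelian_group G" "bal CT G q"
  shows "(\<lambda>z. csum CT G q z) \<in> additive_maps CT G"
  by (rule additive_maps_comp[OF coact_CT_additive sweedler_additive[OF CT_UX assms]])

lemma CT_right_act_pure:
  assumes a: "a \<in> carrier A" and n: "n \<in> carrier N" and p: "p \<in> carrier P"
  shows "csum CT CT (\<lambda>u z. eps (u \<cdot> s a) \<odot>\<^bsub>CT\<^esub> z) (cp n p) = cp n (right_act B P p a)"
proof -
  have b: "bal CT CT (\<lambda>u z. eps (u \<cdot> s a) \<odot>\<^bsub>CT\<^esub> z)"
    using a left_module.lsmult_l_distr[OF left_module_CT] left_module.lsmult_r_distr[OF left_module_CT]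
      left_module.lsmult_assoc[OF left_module_CT] left_module.lsmult_closed[OF left_module_CT]
    by (intro balI) (simp_all add: distribs U.m_assoc)
  have "csum CT CT (\<lambda>u z. eps (u \<cdot> s a) \<odot>\<^bsub>CT\<^esub> z) (cp n p) =
      csum P CT (\<lambda>v p'. csum N CT (\<lambda>u n'. eps (u \<cdot> v \<cdot> s a) \<odot>\<^bsub>CT\<^esub> cp n' p') n) p"
    using csum_CT_pure[OF CT_ab b n p] codiagonal_swap[OF cp_bal CT_smult_pure[symmetric] CT_ab b n p] by simp
  also have "\<dots> = csum P CT (\<lambda>v p'. cp n (eps (v \<cdot> s a) \<odot>\<^bsub>P\<^esub> p')) p"
  proof (intro csum_cong[OF P] p)
    fix v p' assume v: "v \<in> carrier U" "p' \<in> carrier P"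
    have "csum N CT (\<lambda>u n'. eps (u \<cdot> v \<cdot> s a) \<odot>\<^bsub>CT\<^esub> cp n' p') n =
        csum N CT (\<lambda>u n'. cp (eps (u \<cdot> s (eps (v \<cdot> s a))) \<odot>\<^bsub>N\<^esub> n') p') n"
      using v a counit_mult_src[of _ "v \<cdot> s a"] by (intro csum_cong[OF N] n) (simp add: U.m_assoc)
    also have "\<dots> = cp (right_act B N n (eps (v \<cdot> s a))) p'"
      unfolding right_act_def using v a
      by (intro csum_hom[OF N _ _ balanced_additive_left[OF cp_bal], symmetric] n) auto
    finally show "csum N CT (\<lambda>u n'. eps (u \<cdot> v \<cdot> s a) \<odot>\<^bsub>CT\<^esub> cp n' p') n = cp n (eps (v \<cdot> s a) \<odot>\<^bsub>P\<^esub> p')"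
      using v a n by (simp add: cp_move)
  qed
  also have "\<dots> = cp n (right_act B P p a)"
    unfolding right_act_def using n p a
    by (intro csum_hom[OF P _ _ balanced_additive_right[OF cp_bal n], symmetric]) auto
  finally show ?thesis .
qed

end

end

context left_bialgebroid
begin

context
  fixes N P :: "('a, 'u, 'v) ucomodule"
  assumes N [simp]: "left_comodule B N" and P [simp]: "left_comodule B P"
begin

lemmas cps [simp] = left_module_CT[OF N P] CT_ab[OF N P] cp_closed[OF N P] CT_smult_pure[OF N P]

lemma CT_smult_closed [simp]: "a \<in> carrier A \<Longrightarrow> z \<in> carrier (CT N P) \<Longrightarrow> a \<odot>\<^bsub>(CT N P)\<^esub> z \<in> carrier (CT N P)"
  by (rule additive_maps_closed[OF CT_smult_additive[OF N P]])

lemma coact_CT_smult: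
  assumes a: "a \<in> carrier A" and z: "z \<in> carrier (CT N P)"
  shows "coact (CT N P) (a \<odot>\<^bsub>(CT N P)\<^esub> z) = UX_left B (CT N P) a (coact (CT N P) z)"
proof (rule CT_ext[OF N P _ additive_maps_comp[OF CT_smult_additive[OF N P a] coact_CT_additive[OF N P]]
      additive_maps_comp[OF coact_CT_additive[OF N P] UX_left_additive[OF _ a]] _ z])
  let ?W = "UX B (CT N P)"
  fix n p assume np: "n \<in> carrier N" "p \<in> carrier P"
  have h: "UX_left B (CT N P) a \<in> additive_maps ?W ?W" using a by (simp add: UX_left_additive)
  have "UX_left B (CT N P) a (coact (CT N P) (cp N P n p)) =
      csum N ?W (\<lambda>u n'. UX_left B (CT N P) a (csum P ?W (\<lambda>v p'. (u \<cdot> v) \<boxtimes>\<^bsub>?W\<^esub> cp N P n' p') p)) n"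
    unfolding coact_CT_pure[OF N P np]
    by (rule csum_hom[OF N _ _ h]) (auto intro!: csum_closed[OF P] np)
  also have "\<dots> = csum N ?W (\<lambda>u n'. csum P ?W (\<lambda>v p'. UX_left B (CT N P) a ((u \<cdot> v) \<boxtimes>\<^bsub>?W\<^esub> cp N P n' p')) p) n"
    by (intro csum_cong[OF N] np, rule csum_hom[OF P _ _ h]) (use np in auto)
  also have "\<dots> = csum N ?W (\<lambda>u n'. csum P ?W (\<lambda>v p'. (s a \<cdot> u \<cdot> v) \<boxtimes>\<^bsub>?W\<^esub> cp N P n' p') p) n"
    using a by (intro csum_cong[OF N] csum_cong[OF P] np) (auto simp: U.m_assoc)
  also have "\<dots> = csum N ?W (\<lambda>u n'. csum P ?W (\<lambda>v p'. (u \<cdot> v) \<boxtimes>\<^bsub>?W\<^esub> cp N P n' p') p) (a \<odot>\<^bsub>N\<^esub> n)"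
    by (rule csum_smult[OF N _ codiagonal_bal_left[OF N P cp_bal[OF N P] _ _ CT_pure_bal[OF N P] np(2)] a np(1),
          symmetric]) auto
  finally show "coact (CT N P) (a \<odot>\<^bsub>(CT N P)\<^esub> cp N P n p) = UX_left B (CT N P) a (coact (CT N P) (cp N P n p))"
    using a np by (simp add: coact_CT_pure)
qed auto

lemma csum_CT_smult:
  assumes "abelian_group G" "bal (CT N P) G q" "a \<in> carrier A" "z \<in> carrier (CT N P)"
  shows "csum (CT N P) G q (a \<odot>\<^bsub>(CT N P)\<^esub> z) = csum (CT N P) G (\<lambda>u z'. q (s a \<cdot> u) z') z"
  using sweedler_push[OF CT_UX[OF N P] CT_UX[OF N P] assms(1,2), of "coact (CT N P) z" "\<lambda>x y. s a \<cdot> x" "\<lambda>x y. y"]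
    assms additive_maps_closed[OF coact_CT_additive[OF N P]]
  by (simp add: coact_CT_smult UX_left_def)

lemma balanced3_csum_CT:
  assumes G: "abelian_group G" and q: "balanced3 (CT N P) G q"
  shows "bal (CT N P) G (\<lambda>u z. csum (CT N P) G (q u) z)"
proof (rule balI)
  note [simp] = balanced3D[OF q]
  have cl [simp]: "coact (CT N P) z \<in> carrier (UX B (CT N P))" if "z \<in> carrier (CT N P)" for z
    using additive_maps_closed[OF coact_CT_additive[OF N P] that] .
  have q1: "bal (CT N P) G (q u)" if "u \<in> carrier U" for u using q that by (simp add: balanced3_def)
  note hom = csum_CT_additive[OF N P G q1]
  show "csum (CT N P) G (q (t a \<cdot> u)) z = csum (CT N P) G (q u) (a \<odot>\<^bsub>(CT N P)\<^esub> z)"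
    if "a \<in> carrier A" "u \<in> carrier U" "z \<in> carrier (CT N P)" for a u z
    using that by (auto simp: csum_CT_smult[OF G q1] intro!: sweedler_congT[OF CT_UX[OF N P]])
  show "csum (CT N P) G (q (u \<oplus>\<^bsub>U\<^esub> u')) z = csum (CT N P) G (q u) z \<oplus>\<^bsub>G\<^esub> csum (CT N P) G (q u') z"
    if "u \<in> carrier U" "u' \<in> carrier U" "z \<in> carrier (CT N P)" for u u' z
    using that by (subst sweedler_fun_add[OF CT_UX[OF N P] G, symmetric])
      (auto intro!: sweedler_congT[OF CT_UX[OF N P]])
  show "csum (CT N P) G (q u) (z \<oplus>\<^bsub>(CT N P)\<^esub> z') = csum (CT N P) G (q u) z \<oplus>\<^bsub>G\<^esub> csum (CT N P) G (q u) z'"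
    if "u \<in> carrier U" "z \<in> carrier (CT N P)" "z' \<in> carrier (CT N P)" for u z z'
    using additive_maps_add[OF hom] that .
  show "csum (CT N P) G (q u) z \<in> carrier G" if "u \<in> carrier U" "z \<in> carrier (CT N P)" for u z
    using additive_maps_closed[OF hom] that .
qed

text \<open>Coassociativity of the codiagonal coaction. Both sides are brought to a sum over two
  successive coactions on \<open>n\<close> and on \<open>p\<close>; multiplicativity of \<open>\<Delta>\<close> has to be used with the sum over
  the left factor inside, since that sum is a balanced function of the legs of the right factor.\<close>

lemma CT_coassoc_pure:
  assumes G: "abelian_group G" and q: "balanced3 (CT N P) G q" and n: "n \<in> carrier N" and p: "p \<in> carrier P"
  shows "csum (CT N P) G (\<lambda>u z. dsum G (\<lambda>u1 u2. q u1 u2 z) u) (cp N P n p) =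
    csum (CT N P) G (\<lambda>u z. csum (CT N P) G (q u) z) (cp N P n p)"
proof -
  note qD = balanced3D[OF q]
  note [simp] = qD(1)
  have q1: "bal (CT N P) G (q u)" if "u \<in> carrier U" for u using q that by (simp add: balanced3_def)
  have q2: "bal (U_left B) G (\<lambda>u v. q u v z)" if "z \<in> carrier (CT N P)" for z
    using q that by (simp add: balanced3_def)
  \<comment> \<open>The inner double sum over the coaction of \<open>n\<close>, as a three-legged function on the side of \<open>P\<close>.\<close>
  define R where "R v1 v2 p' = csum N G (\<lambda>u n'. csum N G (\<lambda>u' n''. q (u \<cdot> v1) (u' \<cdot> v2) (cp N P n'' p')) n') n"
    for v1 v2 p'
  have bN: "balanced3 N G (\<lambda>u u' n'. q (u \<cdot> v1) (u' \<cdot> v2) (cp N P n' p'))"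
    if "v1 \<in> carrier U" "v2 \<in> carrier U" "p' \<in> carrier P" for v1 v2 p'
    using that by (intro balanced3I) (simp_all add: qD distribs U.m_assoc cp_add_left)
  have b2: "bal N G (\<lambda>u' n''. q w (u' \<cdot> v2) (cp N P n'' p'))"
    if "w \<in> carrier U" "v2 \<in> carrier U" "p' \<in> carrier P" for w v2 p'
    using that by (intro balI) (simp_all add: qD distribs U.m_assoc cp_add_left)
  have R: "balanced3 P G R"
  proof (rule balanced3I)
    show "R (t a \<cdot> v1) v2 p' = R v1 (s a \<cdot> v2) p'"
      if a: "a \<in> carrier A" and v: "v1 \<in> carrier U" "v2 \<in> carrier U" "p' \<in> carrier P" for a v1 v2 p'
    proof -
      have "R (t a \<cdot> v1) v2 p' = csum N G (\<lambda>u n'. csum N G (\<lambda>u' n''. q (u \<cdot> t a \<cdot> v1) (u' \<cdot> v2) (cp N P n'' p')) n') n"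
        unfolding R_def using a v by (intro csum_cong[OF N] n) (auto simp: U.m_assoc)
      also have "\<dots> = csum N G (\<lambda>u n'. csum N G (\<lambda>u' n''. q (u \<cdot> v1) (u' \<cdot> v2) (cp N P n'' p')) (right_act B N n' a)) n"
        by (rule csum_takeuchi[OF N G balanced3_csum[OF G bN[OF v] N] a n])
      also have "\<dots> = csum N G (\<lambda>u n'. csum N G (\<lambda>u' n''. q (u \<cdot> v1) (u' \<cdot> s a \<cdot> v2) (cp N P n'' p')) n') n"
        using a v by (intro csum_cong[OF N] n csum_ra[OF N G b2]) auto
      also have "\<dots> = R v1 (s a \<cdot> v2) p'"
        unfolding R_def using a v by (intro csum_cong[OF N] n) (auto simp: U.m_assoc)
      finally show ?thesis .
    qed
    show "R v1 (t a \<cdot> v2) p' = R v1 v2 (a \<odot>\<^bsub>P\<^esub> p')"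
      if a: "a \<in> carrier A" and v: "v1 \<in> carrier U" "v2 \<in> carrier U" "p' \<in> carrier P" for a v1 v2 p'
      unfolding R_def
    proof (rule csum_cong[OF N n])
      fix u n' assume u: "u \<in> carrier U" "n' \<in> carrier N"
      have "csum N G (\<lambda>u' n''. q (u \<cdot> v1) (u' \<cdot> (t a \<cdot> v2)) (cp N P n'' p')) n' =
          csum N G (\<lambda>u' n''. q (u \<cdot> v1) (u' \<cdot> t a \<cdot> v2) (cp N P n'' p')) n'"
        using a v u by (intro csum_cong[OF N] u) (auto simp: U.m_assoc)
      also have "\<dots> = csum N G (\<lambda>u' n''. q (u \<cdot> v1) (u' \<cdot> v2) (cp N P (right_act B N n'' a) p')) n'"
        using u v by (intro csum_takeuchi[OF N G b2 a]) auto
      also have "\<dots> = csum N G (\<lambda>u' n''. q (u \<cdot> v1) (u' \<cdot> v2) (cp N P n'' (a \<odot>\<^bsub>P\<^esub> p'))) n'"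
        using a v u by (intro csum_cong[OF N] u) (auto simp: cp_move)
      finally show "csum N G (\<lambda>u' n''. q (u \<cdot> v1) (u' \<cdot> (t a \<cdot> v2)) (cp N P n'' p')) n' =
          csum N G (\<lambda>u' n''. q (u \<cdot> v1) (u' \<cdot> v2) (cp N P n'' (a \<odot>\<^bsub>P\<^esub> p'))) n'" .
    qed
  qed (use n G in \<open>simp_all add: R_def qD distribs cp_add_right csum_closed[OF N]
        csum_fun_add[OF N G, symmetric] cong: csum_cong[OF N]\<close>)
  have "csum (CT N P) G (\<lambda>u z. dsum G (\<lambda>u1 u2. q u1 u2 z) u) (cp N P n p) =
      csum N G (\<lambda>u n'. csum P G (\<lambda>v p'. dsum G (\<lambda>w1 w2. q w1 w2 (cp N P n' p')) (u \<cdot> v)) p) n"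
    by (rule csum_CT_pure[OF N P G balanced3_dsum[OF G q] n p]) simp
  also have "\<dots> = csum N G (\<lambda>u n'. csum P G (\<lambda>v p'. dsum G (\<lambda>v1 v2.
      dsum G (\<lambda>u1 u2. q (u1 \<cdot> v1) (u2 \<cdot> v2) (cp N P n' p')) u) v) p) n"
    by (intro csum_cong[OF N] csum_cong[OF P] n p dsum_mult_right[OF G q2]) auto
  also have "\<dots> = csum P G (\<lambda>v p'. csum N G (\<lambda>u n'. dsum G (\<lambda>v1 v2.
      dsum G (\<lambda>u1 u2. q (u1 \<cdot> v1) (u2 \<cdot> v2) (cp N P n' p')) u) v) n) p"
    using n p by (intro csum_swap G) (auto intro!: dsum_closed G)
  also have "\<dots> = csum P G (\<lambda>v p'. dsum G (\<lambda>v1 v2. csum N G (\<lambda>u n'.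
      dsum G (\<lambda>u1 u2. q (u1 \<cdot> v1) (u2 \<cdot> v2) (cp N P n' p')) u) n) v) p"
    using n p by (intro csum_cong[OF P] csum_dsum_swap G) (auto intro!: dsum_closed G)
  also have "\<dots> = csum P G (\<lambda>v p'. dsum G (\<lambda>v1 v2. R v1 v2 p') v) p"
    unfolding R_def by (intro csum_cong[OF P] dsum_cong p csum_coassoc[OF N G bN n])
  also have "\<dots> = csum P G (\<lambda>v p'. csum P G (R v) p') p"
    by (rule csum_coassoc[OF P G R p])
  finally have L: "csum (CT N P) G (\<lambda>u z. dsum G (\<lambda>u1 u2. q u1 u2 z) u) (cp N P n p) =
    csum P G (\<lambda>v p'. csum P G (R v) p') p" .
  have "csum (CT N P) G (\<lambda>u z. csum (CT N P) G (q u) z) (cp N P n p) =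
      csum N G (\<lambda>u n'. csum P G (\<lambda>v p'. csum (CT N P) G (q (u \<cdot> v)) (cp N P n' p')) p) n"
    by (rule csum_CT_pure[OF N P G balanced3_csum_CT[OF G q] n p])
  also have "\<dots> = csum N G (\<lambda>u n'. csum P G (\<lambda>v p'. csum N G (\<lambda>u' n''. csum P G (\<lambda>v' p''.
      q (u \<cdot> v) (u' \<cdot> v') (cp N P n'' p'')) p') n') p) n"
    by (intro csum_cong[OF N] csum_cong[OF P] n p csum_CT_pure[OF N P G q1]) auto
  also have "\<dots> = csum P G (\<lambda>v p'. csum N G (\<lambda>u n'. csum N G (\<lambda>u' n''. csum P G (\<lambda>v' p''.
      q (u \<cdot> v) (u' \<cdot> v') (cp N P n'' p'')) p') n') n) p"
    using n p by (intro csum_swap G) (auto intro!: csum_closed[OF N] csum_closed[OF P] G)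
  also have "\<dots> = csum P G (\<lambda>v p'. csum N G (\<lambda>u n'. csum P G (\<lambda>v' p''. csum N G (\<lambda>u' n''.
      q (u \<cdot> v) (u' \<cdot> v') (cp N P n'' p'')) n') p') n) p"
    by (intro csum_cong[OF P] csum_cong[OF N] n p csum_swap[OF N P G]) auto
  also have "\<dots> = csum P G (\<lambda>v p'. csum P G (R v) p') p"
    unfolding R_def
    by (intro csum_cong[OF P] n p csum_swap[OF N P G]) (auto intro!: csum_closed[OF N] G)
  finally show ?thesis using L by simp
qed

lemma left_comodule_CT [simp]: "left_comodule B (CT N P)"
proof (rule left_comodule.intro)
  show "left_module A (CT N P)" by simp
  show "coact (CT N P) z \<in> carrier (UX B (CT N P))" if "z \<in> carrier (CT N P)" for z
    using additive_maps_closed[OF coact_CT_additive[OF N P] that] .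
  show "coact (CT N P) (z \<oplus>\<^bsub>(CT N P)\<^esub> z') = coact (CT N P) z \<oplus>\<^bsub>UX B (CT N P)\<^esub> coact (CT N P) z'"
    if "z \<in> carrier (CT N P)" "z' \<in> carrier (CT N P)" for z z'
    using additive_maps_add[OF coact_CT_additive[OF N P] that] .
  show "coact (CT N P) (a \<odot>\<^bsub>(CT N P)\<^esub> z) = UX_left B (CT N P) a (coact (CT N P) z)"
    if "a \<in> carrier A" "z \<in> carrier (CT N P)" for a z
    using that by (rule coact_CT_smult)
  let ?W = "UUX B (CT N P)"
  let ?q = "\<lambda>u v z. u \<boxtimes>\<^bsub>?W\<^esub> (v \<boxtimes>\<^bsub>UX B (CT N P)\<^esub> z)"
  note b3 = pure3_balanced3[OF left_module_CT[OF N P]]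
  have W [simp]: "abelian_group ?W" by simp
  have "csum (CT N P) ?W (\<lambda>u z. dsum ?W (\<lambda>u1 u2. ?q u1 u2 z) u) z = csum (CT N P) ?W (\<lambda>u z. csum (CT N P) ?W (?q u) z) z"
    if z: "z \<in> carrier (CT N P)" for z
    by (rule CT_ext[OF N P W csum_CT_additive[OF N P W balanced3_dsum[OF W b3]]
          csum_CT_additive[OF N P W balanced3_csum_CT[OF W b3]] CT_coassoc_pure[OF W b3] z]) simp_all
  moreover have "csum (CT N P) ?W (\<lambda>u z. csum (CT N P) ?W (?q u) z) z = csum (CT N P) ?W (\<lambda>u z. u \<boxtimes>\<^bsub>?W\<^esub> coact (CT N P) z) z"
    if z: "z \<in> carrier (CT N P)" for z
  proof (intro sweedler_congT[OF CT_UX[OF N P]])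
    show "coact (CT N P) z \<in> carrier (UX B (CT N P))" using additive_maps_closed[OF coact_CT_additive[OF N P] z] .
    fix u c assume uc: "u \<in> carrier U" "c \<in> carrier (CT N P)"
    have c: "coact (CT N P) c \<in> carrier (UX B (CT N P))" using additive_maps_closed[OF coact_CT_additive[OF N P] uc(2)] .
    have "csum (CT N P) ?W (?q u) c = u \<boxtimes>\<^bsub>?W\<^esub> sweedler (UX B (CT N P)) (UX B (CT N P)) (pure (UX B (CT N P))) (coact (CT N P) c)"
      by (rule sweedler_hom[OF CT_UX[OF N P] _ W balanced_additive_right[OF pure_balanced[OF UUX_tensor[OF left_module_CT[OF N P]]] uc(1)] c, symmetric]) auto
    then show "csum (CT N P) ?W (?q u) c = u \<boxtimes>\<^bsub>?W\<^esub> coact (CT N P) c"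
      using sweedler_id[OF CT_UX[OF N P] c] by simp
  qed
  ultimately show "coassociative B (CT N P) (coact (CT N P))"
    by (simp add: coassociative_def)
  have b: "bal (CT N P) (CT N P) (\<lambda>u z. eps u \<odot>\<^bsub>(CT N P)\<^esub> z)"
    using left_module.lsmult_l_distr[OF left_module_CT[OF N P]] left_module.lsmult_r_distr[OF left_module_CT[OF N P]]
      left_module.lsmult_assoc[OF left_module_CT[OF N P]]
    by (intro balI) (simp_all add: distribs)
  show "csum (CT N P) (CT N P) (\<lambda>u z. eps u \<odot>\<^bsub>(CT N P)\<^esub> z) z = z" if z: "z \<in> carrier (CT N P)" for z
  proof (rule CT_ext[OF N P _ csum_CT_additive[OF N P _ b] _ _ z])
    show "(\<lambda>z. z) \<in> additive_maps (CT N P) (CT N P)" by (auto intro!: additive_mapsI)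
    fix n p assume np: "n \<in> carrier N" "p \<in> carrier P"
    have "csum (CT N P) (CT N P) (\<lambda>u z. eps u \<odot>\<^bsub>(CT N P)\<^esub> z) (cp N P n p) =
        csum (CT N P) (CT N P) (\<lambda>u z. eps (u \<cdot> s \<one>\<^bsub>A\<^esub>) \<odot>\<^bsub>(CT N P)\<^esub> z) (cp N P n p)"
      using np additive_maps_closed[OF coact_CT_additive[OF N P]]
      by (intro sweedler_congT[OF CT_UX[OF N P]]) auto
    then show "csum (CT N P) (CT N P) (\<lambda>u z. eps u \<odot>\<^bsub>(CT N P)\<^esub> z) (cp N P n p) = cp N P n p"
      using CT_right_act_pure[OF N P A.one_closed np] np by simp
  qed simp_all
qed

lemma CT_ra_pure [simp]:
  "a \<in> carrier A \<Longrightarrow> n \<in> carrier N \<Longrightarrow> p \<in> carrier P \<Longrightarrow>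
    right_act B (CT N P) (cp N P n p) a = cp N P n (right_act B P p a)"
  unfolding right_act_def[of B "CT N P"] by (rule CT_right_act_pure[OF N P])

text \<open>Colinear maps out of a tensor product. In the colinearity hypothesis the sum over the coaction of \<open>p\<close>
  is outside, the order in which it arises for \<open>untr\<close>; \<open>codiagonal_swap\<close> relates it to the order in the
  codiagonal coaction.\<close>

lemma CT_homI:
  assumes Z: "left_comodule B Z" and r: "balN N P Z r"
    and r_smult: "\<And>a n p. a \<in> carrier A \<Longrightarrow> n \<in> carrier N \<Longrightarrow> p \<in> carrier P \<Longrightarrow>
      r (a \<odot>\<^bsub>N\<^esub> n) p = a \<odot>\<^bsub>Z\<^esub> r n p"
    and co: "\<And>n p. n \<in> carrier N \<Longrightarrow> p \<in> carrier P \<Longrightarrow>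
      coact Z (r n p) = csum P (UX B Z) (\<lambda>v p'. csum N (UX B Z) (\<lambda>u n'. (u \<cdot> v) \<boxtimes>\<^bsub>UX B Z\<^esub> r n' p') n) p"
  shows "(\<lambda>z\<in>carrier (CT N P). tsum N P Z r z) \<in> comod_hom B (CT N P) Z"
proof (rule comod_homI)
  note [simp] = Z
  have Zg [simp]: "abelian_group Z" using Z by simp
  let ?F = "tsum N P Z r"
  note hom = tsum_additive[OF N P Zg r] and pure [simp] = tsum_pure[OF N P Zg r]
  note [simp] = additive_maps_closed[OF hom] additive_maps_add[OF hom] balancedD(1)[OF r]
  have sm: "?F (a \<odot>\<^bsub>(CT N P)\<^esub> z) = a \<odot>\<^bsub>Z\<^esub> ?F z" if "a \<in> carrier A" "z \<in> carrier (CT N P)" for a z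
    by (rule CT_ext[OF N P Zg additive_maps_comp[OF CT_smult_additive[OF N P] hom]
          additive_maps_comp[OF hom smult_additive[OF Z]]]) (use that r_smult in auto)
  then show "(\<lambda>z\<in>carrier (CT N P). ?F z) (a \<odot>\<^bsub>(CT N P)\<^esub> z) = a \<odot>\<^bsub>Z\<^esub> (\<lambda>z\<in>carrier (CT N P). ?F z) z"
    if "a \<in> carrier A" "z \<in> carrier (CT N P)" for a z using that by simp
  have b: "bal (CT N P) (UX B Z) (\<lambda>u z. u \<boxtimes>\<^bsub>UX B Z\<^esub> ?F z)"
    by (rule balI) (simp_all add: UX_pure_add_left UX_pure_add_right UX_move sm)
  have "coact Z (?F z) = csum (CT N P) (UX B Z) (\<lambda>u z. u \<boxtimes>\<^bsub>UX B Z\<^esub> ?F z) z"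
    if z: "z \<in> carrier (CT N P)" for z
  proof (rule CT_ext[OF N P _ additive_maps_comp[OF hom coact_additive[OF Z]]
        csum_CT_additive[OF N P _ b] _ z])
    fix n p assume np: "n \<in> carrier N" "p \<in> carrier P"
    have "csum (CT N P) (UX B Z) (\<lambda>u z. u \<boxtimes>\<^bsub>UX B Z\<^esub> ?F z) (cp N P n p) =
        csum N (UX B Z) (\<lambda>u n'. csum P (UX B Z) (\<lambda>v p'. (u \<cdot> v) \<boxtimes>\<^bsub>UX B Z\<^esub> ?F (cp N P n' p')) p) n"
      using np by (intro csum_CT_pure[OF N P _ b]) auto
    also have "\<dots> = csum P (UX B Z) (\<lambda>v p'. csum N (UX B Z) (\<lambda>u n'. (u \<cdot> v) \<boxtimes>\<^bsub>UX B Z\<^esub> ?F (cp N P n' p')) n) p"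
      using np by (intro csum_swap) auto
    also have "\<dots> = coact Z (?F (cp N P n p))"
      using np by (auto simp: co intro!: csum_cong[OF P] csum_cong[OF N])
    finally show "coact Z (?F (cp N P n p)) = csum (CT N P) (UX B Z) (\<lambda>u z. u \<boxtimes>\<^bsub>UX B Z\<^esub> ?F z) (cp N P n p)" by simp
  qed auto
  then show "coact Z ((\<lambda>z\<in>carrier (CT N P). ?F z) z) =
      csum (CT N P) (UX B Z) (\<lambda>u z. u \<boxtimes>\<^bsub>UX B Z\<^esub> (\<lambda>z\<in>carrier (CT N P). ?F z) z) z" if "z \<in> carrier (CT N P)" for z
    using that by (simp cong: csum_cong[OF left_comodule_CT])
next
  interpret CT: abelian_group "CT N P" by simp
  have Zg [simp]: "abelian_group Z" using Z by simp
  note hom = tsum_additive[OF N P Zg r]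
  show "(\<lambda>z\<in>carrier (CT N P). tsum N P Z r z) (z \<oplus>\<^bsub>(CT N P)\<^esub> z') =
      (\<lambda>z\<in>carrier (CT N P). tsum N P Z r z) z \<oplus>\<^bsub>Z\<^esub> (\<lambda>z\<in>carrier (CT N P). tsum N P Z r z) z'"
    if "z \<in> carrier (CT N P)" "z' \<in> carrier (CT N P)" for z z'
    using that additive_maps_add[OF hom] by simp
  show "(\<lambda>z\<in>carrier (CT N P). tsum N P Z r z) z \<in> carrier Z" if "z \<in> carrier (CT N P)" for z
    using that additive_maps_closed[OF hom] by simp
qed simp

lemma comod_hom_CT_ext:
  assumes "left_comodule B Z" "f \<in> comod_hom B (CT N P) Z" "g \<in> comod_hom B (CT N P) Z"
    "\<And>n p. n \<in> carrier N \<Longrightarrow> p \<in> carrier P \<Longrightarrow> f (cp N P n p) = g (cp N P n p)"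
  shows "f = g"
proof (rule extensionalityI)
  show "f \<in> extensional (carrier (CT N P))" "g \<in> extensional (carrier (CT N P))"
    using assms by (auto simp: comod_hom_simps)
  show "f z = g z" if "z \<in> carrier (CT N P)" for z
    by (rule CT_ext[OF N P comodule_ab[OF assms(1)] comod_hom_additive[OF assms(2)]
          comod_hom_additive[OF assms(3)] assms(4) that])
qed

end

section \<open>The unit comodule\<close>

abbreviation CU :: "('a, 'u, 'v) ucomodule" where "CU \<equiv> comod_unit B"

lemma CU_simps [simp]:
  "carrier (CU :: ('a, 'u, 'v) ucomodule) = Scalar ` carrier A"
  "Scalar a \<oplus>\<^bsub>CU :: ('a, 'u, 'v) ucomodule\<^esub> Scalar b = Scalar (a \<oplus>\<^bsub>A\<^esub> b)"
  "\<zero>\<^bsub>CU :: ('a, 'u, 'v) ucomodule\<^esub> = Scalar \<zero>\<^bsub>A\<^esub>"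
  "a \<odot>\<^bsub>CU :: ('a, 'u, 'v) ucomodule\<^esub> Scalar b = Scalar (a \<otimes>\<^bsub>A\<^esub> b)"
  by (simp_all add: comod_unit_def comod_unit_module_def module.defs comodule.defs)

lemma Scalar_image_iff [simp]: "Scalar a \<in> Scalar ` S \<longleftrightarrow> a \<in> S"
  by auto

lemma CU_coact [simp]: "coact (CU :: ('a, 'u, 'v) ucomodule) (Scalar a) =
    s a \<boxtimes>\<^bsub>UX B (CU :: ('a, 'u, 'v) ucomodule)\<^esub> Scalar \<one>\<^bsub>A\<^esub>"
proof -
  have "UX B (comod_unit_module B :: ('a, ('a, 'v) univ) module) = UX B (CU :: ('a, 'u, 'v) ucomodule)"
    by (simp add: UX_def tensor_def tensor_relations_def comod_unit_def module.defs comodule.defs)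
  then show ?thesis by (simp add: comod_unit_def module.defs comodule.defs)
qed

lemma left_module_CU [simp]: "left_module A (CU :: ('a, 'u, 'v) ucomodule)"
proof (intro left_module.intro left_module_axioms.intro)
  show "ring A" by (rule A.ring_axioms)
  show "abelian_group (CU :: ('a, 'u, 'v) ucomodule)"
    by (rule abelian_groupI) (auto simp: A.a_ac intro!: bexI[of _ "Scalar (\<ominus>\<^bsub>A\<^esub> x)" for x] A.l_neg)
qed (auto simp: A.l_distr A.r_distr A.m_assoc)

lemmas CU_UX = UX_tensor[OF left_module_CU]

lemma csum_CU:
  assumes "abelian_group G" "bal (CU :: ('a, 'u, 'v) ucomodule) G q" "a \<in> carrier A"
  shows "csum (CU :: ('a, 'u, 'v) ucomodule) G q (Scalar a) = q (s a) (Scalar \<one>\<^bsub>A\<^esub>)"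
  using sweedler_pure[OF CU_UX assms(1,2)] assms(3) by simp

lemma left_comodule_CU [simp]: "left_comodule B (CU :: ('a, 'u, 'v) ucomodule)"
proof (rule left_comodule.intro)
  let ?C = "CU :: ('a, 'u, 'v) ucomodule"
  let ?W = "UUX B ?C"
  let ?q = "\<lambda>u v z. u \<boxtimes>\<^bsub>?W\<^esub> (v \<boxtimes>\<^bsub>UX B ?C\<^esub> z)"
  have eps_s': "eps (s a) = a" if "a \<in> carrier A" for a
    using eps_s[OF that U.one_closed] that by (simp add: counit_one)
  show "left_module A ?C" by simp
  show "coact ?C z \<in> carrier (UX B ?C)" if "z \<in> carrier ?C" for z
    using that by auto
  show "coact ?C (z \<oplus>\<^bsub>?C\<^esub> z') = coact ?C z \<oplus>\<^bsub>UX B ?C\<^esub> coact ?C z'"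
    if "z \<in> carrier ?C" "z' \<in> carrier ?C" for z z'
    using that by (auto simp: s_add UX_pure_add_left)
  show "coact ?C (a \<odot>\<^bsub>?C\<^esub> z) = UX_left B ?C a (coact ?C z)"
    if "a \<in> carrier A" "z \<in> carrier ?C" for a z
    using that by (auto simp: s_mult)
  note b3 = pure3_balanced3[OF left_module_CU]
  have W [simp]: "abelian_group ?W" by simp
  have b: "bal (U_left B) ?W (\<lambda>u1 u2. ?q u1 u2 (Scalar \<one>\<^bsub>A\<^esub>))"
    using b3 A.one_closed by (auto simp: balanced3_def)
  have b': "bal ?C ?W (\<lambda>u z. u \<boxtimes>\<^bsub>?W\<^esub> coact ?C z)"
    by (intro balI) (auto simp: pure_move[OF UUX_tensor[OF left_module_CU], simplified] s_add s_mult UX_pure_add_left pure_add_left[OF UUX_tensor[OF left_module_CU]]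
        pure_add_right[OF UUX_tensor[OF left_module_CU]])
  have "csum ?C ?W (\<lambda>u z. dsum ?W (\<lambda>u1 u2. ?q u1 u2 z) u) (Scalar a) = csum ?C ?W (\<lambda>u z. u \<boxtimes>\<^bsub>?W\<^esub> coact ?C z) (Scalar a)"
    if a: "a \<in> carrier A" for a
    unfolding csum_CU[OF W balanced3_dsum[OF W b3 left_module_CU] a] csum_CU[OF W b' a]
    using a by (subst dsum_s[OF W b]) simp_all
  then show "coassociative B ?C (coact ?C)"
    by (auto simp: coassociative_def)
  have be: "bal ?C ?C (\<lambda>u m'. eps u \<odot>\<^bsub>?C\<^esub> m')"
    by (rule balI) (auto simp: distribs A.m_assoc)
  show "csum ?C ?C (\<lambda>u m'. eps u \<odot>\<^bsub>?C\<^esub> m') z = z" if z: "z \<in> carrier ?C" for z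
  proof -
    obtain a where a: "a \<in> carrier A" "z = Scalar a" using z by auto
    show ?thesis unfolding a(2) using a(1)
      by (subst csum_CU[OF left_module_imp_abelian_group[OF left_module_CU] be]) (simp_all add: eps_s')
  qed
qed

lemma CU_ra [simp]:
  assumes "a \<in> carrier A" "b \<in> carrier A"
  shows "right_act B (CU :: ('a, 'u, 'v) ucomodule) (Scalar b) a = Scalar (b \<otimes>\<^bsub>A\<^esub> a)"
proof -
  have "eps (s b \<cdot> s a) = b \<otimes>\<^bsub>A\<^esub> a"
    using assms eps_s[of a "\<one>\<^bsub>U\<^esub>"] by (simp add: counit_one)
  then show ?thesis
    unfolding right_act_def using assms
    by (subst csum_CU[OF comodule_ab[OF left_comodule_CU] ra_bal[OF left_comodule_CU]]) simp_all
qed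

end

section \<open>The monoidal category of comodules\<close>

context left_bialgebroid
begin

lemma comod_cat_simps [simp]:
  "X \<in> Obj (comod_cat B) \<longleftrightarrow> left_comodule B X"
  "Arr (comod_cat B) = comod_hom B"
  "ident (comod_cat B) X = (\<lambda>x\<in>carrier X. x)"
  "cmp (comod_cat B) X Y Z g f = compose (carrier X) g f"
  "tobj (comod_cat B) = comod_tensor B"
  "tunit (comod_cat B) = comod_unit B"
  by (simp_all add: comod_cat_def)

abbreviation tm where "tm \<equiv> tmor (comod_cat B)"
abbreviation as where "as \<equiv> assoc (comod_cat B)"
abbreviation lu where "lu \<equiv> lunit (comod_cat B)"
abbreviation ru where "ru \<equiv> runit (comod_cat B)"

context
  fixes X X' Y Y' :: "('a, 'u, 'v) ucomodule" and f g
  assumes X [simp]: "left_comodule B X" and X' [simp]: "left_comodule B X'"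
    and Y [simp]: "left_comodule B Y" and Y' [simp]: "left_comodule B Y'"
    and f: "f \<in> comod_hom B X X'" and g: "g \<in> comod_hom B Y Y'"
begin

lemma tmor_bal: "balN X Y (X' \<star> Y') (\<lambda>x y. comod_pure B X' Y' (f x) (g y))"
  by (rule balancedI)
    (simp_all add: comod_hom_simps[OF f] comod_hom_simps[OF g] cp_add_left cp_add_right cp_move
      comod_hom_ra[OF X X' f])

lemma tmor_pure [simp]:
  assumes "x \<in> carrier X" "y \<in> carrier Y"
  shows "tm X X' Y Y' f g (comod_pure B X Y x y) = comod_pure B X' Y' (f x) (g y)"
  using tsum_pure[OF X Y CT_ab[OF X' Y'] tmor_bal assms] assms by (simp add: comod_cat_def)

lemma tmor_hom: "tm X X' Y Y' f g \<in> comod_hom B (X \<star> Y) (X' \<star> Y')"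
proof -
  let ?T = "(X' \<star> Y')"
  let ?W = "UX B ?T"
  note [simp] = comod_hom_simps(1-3)[OF f] comod_hom_simps(1-3)[OF g]
  note bal = CT_pure_bal[OF X' Y'] and cb = cp_bal[OF X' Y'] CT_smult_pure[OF X' Y', symmetric]
  have "(\<lambda>z\<in>carrier (X \<star> Y). tsum X Y ?T (\<lambda>x y. comod_pure B X' Y' (f x) (g y)) z)
      \<in> comod_hom B (X \<star> Y) ?T"
  proof (rule CT_homI[OF X Y left_comodule_CT[OF X' Y'] tmor_bal])
    fix x y assume xy: "x \<in> carrier X" "y \<in> carrier Y"
    have "coact ?T (comod_pure B X' Y' (f x) (g y)) =
        csum Y' ?W (\<lambda>v y'. csum X' ?W (\<lambda>u x'. (u \<cdot> v) \<boxtimes>\<^bsub>?W\<^esub> comod_pure B X' Y' x' y') (f x)) (g y)"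
      using xy coact_CT_pure[OF X' Y', of "f x" "g y"] codiagonal_swap[OF X' Y' cb _ bal, of "f x" "g y"] by simp
    also have "\<dots> = csum Y ?W (\<lambda>v y'. csum X' ?W (\<lambda>u x'. (u \<cdot> v) \<boxtimes>\<^bsub>?W\<^esub> comod_pure B X' Y' x' (g y')) (f x)) y"
      using xy by (intro csum_colinear[OF Y Y' g _ codiagonal_bal_right[OF X' Y' cb _ bal]]) auto
    also have "\<dots> = csum Y ?W (\<lambda>v y'. csum X ?W (\<lambda>u x'. (u \<cdot> v) \<boxtimes>\<^bsub>?W\<^esub> comod_pure B X' Y' (f x') (g y')) x) y"
    proof (rule csum_cong[OF Y xy(2)])
      fix v y' assume v: "v \<in> carrier U" "y' \<in> carrier Y"
      have "bal X' ?W (\<lambda>u x'. (u \<cdot> v) \<boxtimes>\<^bsub>?W\<^esub> comod_pure B X' Y' x' (g y'))"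
        using v by (intro balI)
          (simp_all add: distribs U.m_assoc cp_add_left UX_pure_add_left UX_pure_add_right UX_move)
      then show "csum X' ?W (\<lambda>u x'. (u \<cdot> v) \<boxtimes>\<^bsub>?W\<^esub> comod_pure B X' Y' x' (g y')) (f x) =
          csum X ?W (\<lambda>u x'. (u \<cdot> v) \<boxtimes>\<^bsub>?W\<^esub> comod_pure B X' Y' (f x') (g y')) x"
        using xy by (intro csum_colinear[OF X X' f]) auto
    qed
    finally show "coact ?T (comod_pure B X' Y' (f x) (g y)) =
        csum Y ?W (\<lambda>v y'. csum X ?W (\<lambda>u x'. (u \<cdot> v) \<boxtimes>\<^bsub>?W\<^esub> comod_pure B X' Y' (f x') (g y')) x) y" .
  qed simp
  then show ?thesis by (simp add: comod_cat_def)
qed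

end

lemma CT_ext3:
  fixes X Y Z :: "('a, 'u, 'v) ucomodule"
  assumes X: "left_comodule B X" and Y: "left_comodule B Y" and Z: "left_comodule B Z"
    and G: "abelian_group G" and h: "h \<in> additive_maps ((X \<star> Y) \<star> Z) G"
    and h': "h' \<in> additive_maps ((X \<star> Y) \<star> Z) G"
    and eq: "\<And>x y z. x \<in> carrier X \<Longrightarrow> y \<in> carrier Y \<Longrightarrow> z \<in> carrier Z \<Longrightarrow>
      h (comod_pure B (X \<star> Y) Z (comod_pure B X Y x y) z) =
      h' (comod_pure B (X \<star> Y) Z (comod_pure B X Y x y) z)"
    and c: "c \<in> carrier ((X \<star> Y) \<star> Z)"
  shows "h c = h' c"
proof (rule CT_ext[OF left_comodule_CT[OF X Y] Z G h h' _ c])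
  fix v z assume v: "v \<in> carrier (X \<star> Y)" and z: "z \<in> carrier Z"
  note b = balanced_additive_left[OF cp_bal[OF left_comodule_CT[OF X Y] Z] z]
  show "h (comod_pure B (X \<star> Y) Z v z) = h' (comod_pure B (X \<star> Y) Z v z)"
    by (rule CT_ext[OF X Y G additive_maps_comp[OF b h] additive_maps_comp[OF b h'] eq[OF _ _ z] v])
qed

lemma comod_hom_CT_ext3:
  fixes X Y Z :: "('a, 'u, 'v) ucomodule"
  assumes X: "left_comodule B X" and Y: "left_comodule B Y" and Z: "left_comodule B Z"
    and W: "left_comodule B W"
    and f: "f \<in> comod_hom B ((X \<star> Y) \<star> Z) W"
    and g: "g \<in> comod_hom B ((X \<star> Y) \<star> Z) W"
    and eq: "\<And>x y z. x \<in> carrier X \<Longrightarrow> y \<in> carrier Y \<Longrightarrow> z \<in> carrier Z \<Longrightarrow>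
      f (comod_pure B (X \<star> Y) Z (comod_pure B X Y x y) z) =
      g (comod_pure B (X \<star> Y) Z (comod_pure B X Y x y) z)"
  shows "f = g"
proof (rule extensionalityI)
  let ?C = "carrier ((X \<star> Y) \<star> Z)"
  show "f \<in> extensional ?C" "g \<in> extensional ?C"
    using f g by (auto simp: comod_hom_simps)
  show "f c = g c" if "c \<in> ?C" for c
    by (rule CT_ext3[OF X Y Z comodule_ab[OF W] comod_hom_additive[OF f] comod_hom_additive[OF g] eq that])
qed

lemma comod_hom_CT_ext4:
  fixes W X Y Z :: "('a, 'u, 'v) ucomodule"
  assumes W: "left_comodule B W" and X: "left_comodule B X" and Y: "left_comodule B Y"
    and Z: "left_comodule B Z" and V: "left_comodule B V"
    and f: "f \<in> comod_hom B (((W \<star> X) \<star> Y) \<star> Z) V"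
    and g: "g \<in> comod_hom B (((W \<star> X) \<star> Y) \<star> Z) V"
    and eq: "\<And>w x y z. w \<in> carrier W \<Longrightarrow> x \<in> carrier X \<Longrightarrow> y \<in> carrier Y \<Longrightarrow> z \<in> carrier Z \<Longrightarrow>
      f (comod_pure B ((W \<star> X) \<star> Y) Z
        (comod_pure B (W \<star> X) Y (comod_pure B W X w x) y) z) =
      g (comod_pure B ((W \<star> X) \<star> Y) Z
        (comod_pure B (W \<star> X) Y (comod_pure B W X w x) y) z)"
  shows "f = g"
proof (rule comod_hom_CT_ext[OF left_comodule_CT[OF left_comodule_CT[OF W X] Y] Z V f g])
  let ?C = "((W \<star> X) \<star> Y)"
  have C: "left_comodule B ?C" using W X Y by simp
  fix v z assume v: "v \<in> carrier ?C" and z: "z \<in> carrier Z"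
  note b = balanced_additive_left[OF cp_bal[OF C Z] z]
  show "f (comod_pure B ?C Z v z) = g (comod_pure B ?C Z v z)"
    by (rule CT_ext3[OF W X Y comodule_ab[OF V] additive_maps_comp[OF b comod_hom_additive[OF f]]
          additive_maps_comp[OF b comod_hom_additive[OF g]] eq[OF _ _ _ z] v])
qed

text \<open>A set-theoretic inverse suffices, since it is automatically colinear.\<close>

lemma iso_arrI:
  fixes X Y :: "('a, 'u, 'v) ucomodule"
  assumes X: "left_comodule B X" and Y: "left_comodule B Y" and f: "f \<in> comod_hom B X Y"
    and g: "g \<in> carrier Y \<rightarrow> carrier X" and gf: "\<And>x. x \<in> carrier X \<Longrightarrow> g (f x) = x"
    and fg: "\<And>y. y \<in> carrier Y \<Longrightarrow> f (g y) = y"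
  shows "iso_arr (comod_cat B) X Y f"
proof -
  have bij: "bij_betw f (carrier X) (carrier Y)"
    using comod_hom_simps(1)[OF f] g gf fg
    by (intro bij_betw_byWitness[where f'=g]) auto
  let ?h = "restrict (inv_into (carrier X) f) (carrier Y)"
  have "?h \<in> comod_hom B Y X" by (rule comod_hom_inverse[OF X Y f bij])
  moreover have "compose (carrier X) ?h f = (\<lambda>x\<in>carrier X. x)"
    using comod_hom_simps(1)[OF f] bij
    by (auto simp: compose_def restrict_def fun_eq_iff bij_betw_inv_into_left)
  moreover have "compose (carrier Y) f ?h = (\<lambda>x\<in>carrier Y. x)"
    using bij by (auto simp: compose_def restrict_def fun_eq_iff bij_betw_inv_into_right)
  ultimately show ?thesis using f by (auto simp: iso_arr_def)
qed

lemma additive_sum: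
  assumes "abelian_group H" "h \<in> additive_maps G H" "h' \<in> additive_maps G H"
  shows "(\<lambda>x. h x \<oplus>\<^bsub>H\<^esub> h' x) \<in> additive_maps G H"
proof -
  interpret abelian_group H by fact
  show ?thesis
    by (rule additive_mapsI)
      (simp_all add: additive_maps_closed[OF assms(2)] additive_maps_closed[OF assms(3)]
        additive_maps_add[OF assms(2)] additive_maps_add[OF assms(3)] a_ac)
qed

lemma ra_additive: "left_comodule B N \<Longrightarrow> a \<in> carrier A \<Longrightarrow> (\<lambda>n. right_act B N n a) \<in> additive_maps N N"
  by (intro additive_mapsI) (simp_all add: ra_add)

context
  fixes X Y Z :: "('a, 'u, 'v) ucomodule"
  assumes X [simp]: "left_comodule B X" and Y [simp]: "left_comodule B Y"
    and Z [simp]: "left_comodule B Z"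
begin

private abbreviation "XY \<equiv> (X \<star> Y)"
private abbreviation "YZ \<equiv> (Y \<star> Z)"
private abbreviation "XYZ \<equiv> (X \<star> (Y \<star> Z))"
private abbreviation "XYZ' \<equiv> ((X \<star> Y) \<star> Z)"
private abbreviation "r \<equiv> (\<lambda>v z. tsum X Y XYZ
  (\<lambda>x y. comod_pure B X YZ x (comod_pure B Y Z y z)) v)"
private abbreviation "r' \<equiv> (\<lambda>x w. tsum Y Z XYZ'
  (\<lambda>y z. comod_pure B XY Z (comod_pure B X Y x y) z) w)"

lemma assoc_bal_inner: "z \<in> carrier Z \<Longrightarrow>
    balN X Y XYZ (\<lambda>x y. comod_pure B X YZ x (comod_pure B Y Z y z))"
  by (rule balancedI) (simp_all add: cp_add_left cp_add_right cp_move)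

lemma assoc_bal_inner': "x \<in> carrier X \<Longrightarrow>
    balN Y Z XYZ' (\<lambda>y z. comod_pure B XY Z (comod_pure B X Y x y) z)"
  by (rule balancedI) (simp_all add: cp_add_left cp_add_right cp_move[symmetric])

lemma r_pure [simp]: "x \<in> carrier X \<Longrightarrow> y \<in> carrier Y \<Longrightarrow> z \<in> carrier Z \<Longrightarrow>
    r (comod_pure B X Y x y) z = comod_pure B X YZ x (comod_pure B Y Z y z)"
  by (rule tsum_pure[OF X Y _ assoc_bal_inner]) simp_all

lemma r'_pure [simp]: "x \<in> carrier X \<Longrightarrow> y \<in> carrier Y \<Longrightarrow> z \<in> carrier Z \<Longrightarrow>
    r' x (comod_pure B Y Z y z) = comod_pure B XY Z (comod_pure B X Y x y) z"
  by (rule tsum_pure[OF Y Z _ assoc_bal_inner']) simp_all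

lemmas r_additive = tsum_additive[OF X Y CT_ab[OF X left_comodule_CT[OF Y Z]] assoc_bal_inner]
lemmas r'_additive = tsum_additive[OF Y Z CT_ab[OF left_comodule_CT[OF X Y] Z] assoc_bal_inner']

lemma assoc_bal: "balN XY Z XYZ r"
proof (rule balancedI)
  note cl = additive_maps_closed[OF r_additive] and ad = additive_maps_add[OF r_additive]
  show "r v z \<in> carrier XYZ" if "v \<in> carrier XY" "z \<in> carrier Z" for v z
    using cl[OF that(2,1)] .
  show "r (v \<oplus>\<^bsub>XY\<^esub> v') z = r v z \<oplus>\<^bsub>XYZ\<^esub> r v' z"
    if "v \<in> carrier XY" "v' \<in> carrier XY" "z \<in> carrier Z" for v v' z
    using ad[OF that(3,1,2)] .
  show "r v (z \<oplus>\<^bsub>Z\<^esub> z') = r v z \<oplus>\<^bsub>XYZ\<^esub> r v z'"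
    if v: "v \<in> carrier XY" and z: "z \<in> carrier Z" "z' \<in> carrier Z" for v z z'
    by (rule CT_ext[OF X Y _ r_additive additive_sum[OF _ r_additive r_additive] _ v])
      (use z in \<open>simp_all add: cp_add_right\<close>)
  show "r (right_act B XY v a) z = r v (a \<odot>\<^bsub>Z\<^esub> z)"
    if a: "a \<in> carrier A" and v: "v \<in> carrier XY" and z: "z \<in> carrier Z" for a v z
    by (rule CT_ext[OF X Y _ additive_maps_comp[OF ra_additive[OF _ a] r_additive[OF z]] r_additive _ v])
      (use a z in \<open>simp_all add: cp_move\<close>)
qed

lemma assoc_bal': "balN X YZ XYZ' r'"
proof (rule balancedI)
  note cl = additive_maps_closed[OF r'_additive] and ad = additive_maps_add[OF r'_additive]
  show "r' x w \<in> carrier XYZ'" if "x \<in> carrier X" "w \<in> carrier YZ" for x w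
    using cl[OF that] .
  show "r' x (w \<oplus>\<^bsub>YZ\<^esub> w') = r' x w \<oplus>\<^bsub>XYZ'\<^esub> r' x w'"
    if "x \<in> carrier X" "w \<in> carrier YZ" "w' \<in> carrier YZ" for x w w'
    using ad[OF that] .
  show "r' (x \<oplus>\<^bsub>X\<^esub> x') w = r' x w \<oplus>\<^bsub>XYZ'\<^esub> r' x' w"
    if x: "x \<in> carrier X" "x' \<in> carrier X" and w: "w \<in> carrier YZ" for x x' w
    by (rule CT_ext[OF Y Z _ r'_additive additive_sum[OF _ r'_additive r'_additive] _ w])
      (use x in \<open>simp_all add: cp_add_left\<close>)
  show "r' (right_act B X x a) w = r' x (a \<odot>\<^bsub>YZ\<^esub> w)"
    if a: "a \<in> carrier A" and x: "x \<in> carrier X" and w: "w \<in> carrier YZ" for a x w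
    by (rule CT_ext[OF Y Z _ r'_additive additive_maps_comp[OF smult_additive[OF _ a] r'_additive[OF x]] _ w])
      (use a x in \<open>simp_all add: cp_move\<close>)
qed

lemma r_smult:
  assumes a: "a \<in> carrier A" and v: "v \<in> carrier XY" and z: "z \<in> carrier Z"
  shows "r (a \<odot>\<^bsub>XY\<^esub> v) z = a \<odot>\<^bsub>XYZ\<^esub> r v z"
  by (rule CT_ext[OF X Y _ additive_maps_comp[OF smult_additive[OF _ a] r_additive[OF z]]
        additive_maps_comp[OF r_additive[OF z] smult_additive[OF _ a]] _ v])
    (use a z in simp_all)

lemma assoc_coact:
  assumes v: "v \<in> carrier XY" and z: "z \<in> carrier Z"
  shows "coact XYZ (r v z) = csum Z (UX B XYZ) (\<lambda>w z'. csum XY (UX B XYZ)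
      (\<lambda>u v'. (u \<cdot> w) \<boxtimes>\<^bsub>UX B XYZ\<^esub> r v' z') v) z"
proof -
  let ?W = "UX B XYZ"
  have W: "abelian_group ?W" by simp
  note rD = balancedD(1-3)[OF assoc_bal]
  note bal = CT_pure_bal[OF X left_comodule_CT[OF Y Z]]
    and cb = cp_bal[OF X left_comodule_CT[OF Y Z]] CT_smult_pure[OF X left_comodule_CT[OF Y Z], symmetric]
  have b: "bal XY ?W (\<lambda>u v'. csum Z ?W (\<lambda>w z'. (u \<cdot> w) \<boxtimes>\<^bsub>?W\<^esub> r v' z') z)"
    by (rule codiagonal_bal_left[OF left_comodule_CT[OF X Y] Z assoc_bal r_smult[symmetric, symmetric] W bal z])
  have "coact XYZ (r v z) = csum XY ?W (\<lambda>u v'. csum Z ?W (\<lambda>w z'. (u \<cdot> w) \<boxtimes>\<^bsub>?W\<^esub> r v' z') z) v"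
  proof (rule CT_ext[OF X Y W additive_maps_comp[OF r_additive[OF z] coact_additive]
        csum_additive[OF _ W b] _ v])
    fix x y assume xy: "x \<in> carrier X" "y \<in> carrier Y"
    let ?c = "\<lambda>x y z. comod_pure B X YZ x (comod_pure B Y Z y z)"
    have "coact XYZ (r (comod_pure B X Y x y) z) =
        csum YZ ?W (\<lambda>w c. csum X ?W (\<lambda>u x'. (u \<cdot> w) \<boxtimes>\<^bsub>?W\<^esub> comod_pure B X YZ x' c) x) (comod_pure B Y Z y z)"
      using xy z coact_CT_pure[OF X left_comodule_CT[OF Y Z], of x "comod_pure B Y Z y z"]
        codiagonal_swap[OF X left_comodule_CT[OF Y Z] cb W bal, of x "comod_pure B Y Z y z"] by simp
    also have "\<dots> = csum Y ?W (\<lambda>v y'. csum Z ?W (\<lambda>w z'. csum X ?W (\<lambda>u x'. (u \<cdot> (v \<cdot> w)) \<boxtimes>\<^bsub>?W\<^esub> ?c x' y' z') x) z) y"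
      by (rule csum_CT_pure[OF Y Z W codiagonal_bal_right[OF X left_comodule_CT[OF Y Z] cb W bal xy(1)] xy(2) z])
    also have "\<dots> = csum Y ?W (\<lambda>v y'. csum X ?W (\<lambda>u x'. csum Z ?W (\<lambda>w z'. (u \<cdot> (v \<cdot> w)) \<boxtimes>\<^bsub>?W\<^esub> ?c x' y' z') z) x) y"
      by (rule csum_cong[OF Y xy(2)], rule csum_swap[OF Z X W z xy(1)]) simp
    also have "\<dots> = csum X ?W (\<lambda>u x'. csum Y ?W (\<lambda>v y'. csum Z ?W (\<lambda>w z'. (u \<cdot> (v \<cdot> w)) \<boxtimes>\<^bsub>?W\<^esub> ?c x' y' z') z) y) x"
      by (rule csum_swap[OF Y X W xy(2) xy(1)]) (auto intro!: csum_closed[OF Z W z])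
    also have "\<dots> = csum X ?W (\<lambda>u x'. csum Y ?W (\<lambda>v y'. csum Z ?W (\<lambda>w z'. (u \<cdot> v \<cdot> w) \<boxtimes>\<^bsub>?W\<^esub> r (comod_pure B X Y x' y') z') z) y) x"
      using xy z by (intro csum_cong[OF X] csum_cong[OF Y] csum_cong[OF Z]) (auto simp: U.m_assoc)
    also have "\<dots> = csum XY ?W (\<lambda>u v'. csum Z ?W (\<lambda>w z'. (u \<cdot> w) \<boxtimes>\<^bsub>?W\<^esub> r v' z') z) (comod_pure B X Y x y)"
      by (rule csum_CT_pure[OF X Y W b xy, symmetric])
    finally show "coact XYZ (r (comod_pure B X Y x y) z) =
      csum XY ?W (\<lambda>u v'. csum Z ?W (\<lambda>w z'. (u \<cdot> w) \<boxtimes>\<^bsub>?W\<^esub> r v' z') z) (comod_pure B X Y x y)" .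
  qed simp_all
  also have "\<dots> = csum Z ?W (\<lambda>w z'. csum XY ?W (\<lambda>u v'. (u \<cdot> w) \<boxtimes>\<^bsub>?W\<^esub> r v' z') v) z"
    by (rule csum_swap[OF left_comodule_CT[OF X Y] Z W v z]) (simp add: rD)
  finally show ?thesis .
qed

lemma assoc_hom: "as X Y Z \<in> comod_hom B XYZ' XYZ"
  using CT_homI[OF left_comodule_CT[OF X Y] Z _ assoc_bal r_smult assoc_coact]
  by (simp add: comod_cat_def)

lemma assoc_pure [simp]:
  "x \<in> carrier X \<Longrightarrow> y \<in> carrier Y \<Longrightarrow> z \<in> carrier Z \<Longrightarrow>
    as X Y Z (comod_pure B XY Z (comod_pure B X Y x y) z) = comod_pure B X YZ x (comod_pure B Y Z y z)"
  using tsum_pure[OF left_comodule_CT[OF X Y] Z _ assoc_bal] by (simp add: comod_cat_def)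

lemma assoc_iso: "iso_arr (comod_cat B) XYZ' XYZ (as X Y Z)"
proof -
  let ?g = "tsum X YZ XYZ' r'"
  have g: "?g \<in> additive_maps XYZ XYZ'" by (rule tsum_additive[OF X _ _ assoc_bal']) simp_all
  have gp: "?g (comod_pure B X YZ x (comod_pure B Y Z y z)) = comod_pure B XY Z (comod_pure B X Y x y) z"
    if "x \<in> carrier X" "y \<in> carrier Y" "z \<in> carrier Z" for x y z
    using that tsum_pure[OF X _ _ assoc_bal'] by simp
  have idt: "(\<lambda>x. x) \<in> additive_maps G G" for G :: "('a, 'u, 'v) ucomodule"
    by (auto intro!: additive_mapsI)
  show ?thesis
  proof (rule iso_arrI[OF _ _ assoc_hom])
    show "?g \<in> carrier XYZ \<rightarrow> carrier XYZ'" using additive_maps_closed[OF g] by auto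
    show "?g (as X Y Z w) = w" if "w \<in> carrier XYZ'" for w
      by (rule CT_ext3[OF X Y Z _ additive_maps_comp[OF comod_hom_additive[OF assoc_hom] g] idt _ that])
        (simp_all add: gp)
    show "as X Y Z (?g w) = w" if "w \<in> carrier XYZ" for w
    proof (rule CT_ext[OF X _ _ additive_maps_comp[OF g comod_hom_additive[OF assoc_hom]] idt _ that])
      fix x c assume x: "x \<in> carrier X" and c: "c \<in> carrier YZ"
      note b = balanced_additive_right[OF cp_bal[OF X left_comodule_CT[OF Y Z]] x]
      show "as X Y Z (?g (comod_pure B X YZ x c)) = comod_pure B X YZ x c"
        by (rule CT_ext[OF Y Z _ additive_maps_comp[OF b additive_maps_comp[OF g comod_hom_additive[OF assoc_hom]]] b _ c])
          (use x in \<open>simp_all add: gp\<close>)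
    qed simp_all
  qed simp_all
qed

end

end

context left_bialgebroid
begin

lemma coact_csum: "left_comodule B N \<Longrightarrow> n \<in> carrier N \<Longrightarrow>
    csum N (UX B N) (pure (UX B N)) n = coact N n"
  by (rule sweedler_id[OF UX_tensor[OF comodule_module]]) simp_all

lemma UX_pure_bal: "left_module A N \<Longrightarrow> bal N (UX B N) (pure (UX B N))"
  by (rule pure_balanced[OF UX_tensor])

context
  fixes X :: "('a, 'u, 'v) ucomodule"
  assumes X [simp]: "left_comodule B X"
begin

abbreviation CUv :: "('a, 'u, 'v) ucomodule" where "CUv \<equiv> CU"

lemma lunit_bal: "balN CUv X X (\<lambda>a x. the_scalar a \<odot>\<^bsub>X\<^esub> x)"
  by (rule balancedI) (auto simp: comodule_distribs comodule_assoc)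

lemma runit_bal: "balN X CUv X (\<lambda>x a. right_act B X x (the_scalar a))"
  by (rule balancedI) (auto simp: ra_add ra_add_right ra_ra)

lemma lunit_pure [simp]: "a \<in> carrier A \<Longrightarrow> x \<in> carrier X \<Longrightarrow>
    lu X (comod_pure B CUv X (Scalar a) x) = a \<odot>\<^bsub>X\<^esub> x"
  using tsum_pure[OF left_comodule_CU X comodule_ab[OF X] lunit_bal, of "Scalar a" x]
  by (simp add: comod_cat_def)

lemma runit_pure [simp]: "a \<in> carrier A \<Longrightarrow> x \<in> carrier X \<Longrightarrow>
    ru X (comod_pure B X CUv x (Scalar a)) = right_act B X x a"
  using tsum_pure[OF X left_comodule_CU comodule_ab[OF X] runit_bal, of x "Scalar a"]
  by (simp add: comod_cat_def)

lemma lunit_hom: "lu X \<in> comod_hom B (CUv \<star> X) X"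
proof -
  let ?W = "UX B X"
  have "(\<lambda>z\<in>carrier (CUv \<star> X). tsum CUv X X (\<lambda>a x. the_scalar a \<odot>\<^bsub>X\<^esub> x) z)
    \<in> comod_hom B (CUv \<star> X) X"
  proof (rule CT_homI[OF left_comodule_CU X X lunit_bal])
    fix c x assume "c \<in> carrier CUv" and x: "x \<in> carrier X"
    then obtain b where b: "b \<in> carrier A" "c = Scalar b" by auto
    have inner: "csum CUv ?W (\<lambda>u a'. (u \<cdot> v) \<boxtimes>\<^bsub>?W\<^esub> (the_scalar a' \<odot>\<^bsub>X\<^esub> x')) (Scalar b) = (s b \<cdot> v) \<boxtimes>\<^bsub>?W\<^esub> x'"
      if v: "v \<in> carrier U" "x' \<in> carrier X" for v x'
    proof -
      have bl: "bal CUv ?W (\<lambda>u a'. (u \<cdot> v) \<boxtimes>\<^bsub>?W\<^esub> (the_scalar a' \<odot>\<^bsub>X\<^esub> x'))"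
        using v by (intro balI)
          (auto simp: distribs comodule_distribs comodule_assoc UX_pure_add_left UX_pure_add_right U.m_assoc UX_move)
      show ?thesis using v b by (subst csum_CU[OF _ bl b(1)]) simp_all
    qed
    have "coact X (b \<odot>\<^bsub>X\<^esub> x) = csum X ?W (\<lambda>v x'. (s b \<cdot> v) \<boxtimes>\<^bsub>?W\<^esub> x') x"
      using csum_smult[OF X _ UX_pure_bal[OF comodule_module[OF X]] b(1) x] b x by (simp add: coact_csum)
    also have "\<dots> = csum X ?W (\<lambda>v x'. csum CUv ?W (\<lambda>u a'. (u \<cdot> v) \<boxtimes>\<^bsub>?W\<^esub> (the_scalar a' \<odot>\<^bsub>X\<^esub> x')) (Scalar b)) x"
      by (rule csum_cong[OF X x], rule inner[symmetric])
    finally show "coact X (the_scalar c \<odot>\<^bsub>X\<^esub> x) =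
        csum X ?W (\<lambda>v x'. csum CUv ?W (\<lambda>u a'. (u \<cdot> v) \<boxtimes>\<^bsub>?W\<^esub> (the_scalar a' \<odot>\<^bsub>X\<^esub> x')) c) x"
      by (simp add: b)
  qed (auto simp: comodule_assoc)
  then show ?thesis by (simp add: comod_cat_def)
qed

lemma runit_hom: "ru X \<in> comod_hom B (X \<star> CUv) X"
proof -
  let ?W = "UX B X"
  have sm: "right_act B X (a \<odot>\<^bsub>X\<^esub> x) (the_scalar c) = a \<odot>\<^bsub>X\<^esub> right_act B X x (the_scalar c)"
    if "a \<in> carrier A" "x \<in> carrier X" "c \<in> carrier CUv" for a x c
    using that by (auto simp: ra_smult)
  have "(\<lambda>z\<in>carrier (X \<star> CUv). tsum X CUv X (\<lambda>x a. right_act B X x (the_scalar a)) z)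
    \<in> comod_hom B (X \<star> CUv) X"
  proof (rule CT_homI[OF X left_comodule_CU X runit_bal sm])
    fix c x assume "c \<in> carrier CUv" and x: "x \<in> carrier X"
    then obtain b where b: "b \<in> carrier A" "c = Scalar b" by auto
    have W: "abelian_group ?W" by simp
    note bl = codiagonal_bal_right[OF X left_comodule_CU runit_bal sm W UX_pure_bal[OF comodule_module[OF X]] x]
    have "coact X (right_act B X x b) = csum X ?W (\<lambda>u x'. (u \<cdot> s b) \<boxtimes>\<^bsub>?W\<^esub> x') x"
      using csum_ra[OF X _ UX_pure_bal[OF comodule_module[OF X]] b(1) x] b x by (simp add: coact_csum)
    also have "\<dots> = csum X ?W (\<lambda>u x'. (u \<cdot> s b) \<boxtimes>\<^bsub>?W\<^esub> right_act B X x' (the_scalar (Scalar \<one>\<^bsub>A\<^esub> :: ('a, 'v) univ))) x"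
      by (rule csum_cong[OF X x]) simp
    also have "\<dots> = csum CUv ?W (\<lambda>v a'. csum X ?W (\<lambda>u x'. (u \<cdot> v) \<boxtimes>\<^bsub>?W\<^esub> right_act B X x' (the_scalar a')) x) (Scalar b)"
      by (rule csum_CU[OF W bl b(1), symmetric])
    finally show "coact X (right_act B X x (the_scalar c)) =
        csum CUv ?W (\<lambda>v a'. csum X ?W (\<lambda>u x'. (u \<cdot> v) \<boxtimes>\<^bsub>?W\<^esub> right_act B X x' (the_scalar a')) x) c"
      by (simp add: b)
  qed
  then show ?thesis by (simp add: comod_cat_def)
qed

lemma lunit_inverse:
  assumes "z \<in> carrier (CUv \<star> X)"
  shows "comod_pure B CUv X (Scalar \<one>\<^bsub>A\<^esub>) (lu X z) = z"
proof -
  have one: "Scalar \<one>\<^bsub>A\<^esub> \<in> carrier CUv" by simp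
  show ?thesis
  proof (rule CT_ext[OF left_comodule_CU X _ additive_maps_comp[OF comod_hom_additive[OF lunit_hom]
        balanced_additive_right[OF cp_bal[OF left_comodule_CU X] one]] _ _ assms])
    show "(\<lambda>z. z) \<in> additive_maps (CUv \<star> X) (CUv \<star> X)"
      by (auto intro!: additive_mapsI)
    fix c x assume "c \<in> carrier CUv" and x: "x \<in> carrier X"
    then obtain b where b: "b \<in> carrier A" "c = Scalar b" by auto
    show "comod_pure B CUv X (Scalar \<one>\<^bsub>A\<^esub>) (lu X (comod_pure B CUv X c x)) = comod_pure B CUv X c x"
      using b x cp_move[OF left_comodule_CU X, of b "Scalar \<one>\<^bsub>A\<^esub>" x] by simp
  qed simp
qed

lemma runit_inverse:
  assumes "z \<in> carrier (X \<star> CUv)"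
  shows "comod_pure B X CUv (ru X z) (Scalar \<one>\<^bsub>A\<^esub>) = z"
proof -
  have one: "Scalar \<one>\<^bsub>A\<^esub> \<in> carrier CUv" by simp
  show ?thesis
  proof (rule CT_ext[OF X left_comodule_CU _ additive_maps_comp[OF comod_hom_additive[OF runit_hom]
        balanced_additive_left[OF cp_bal[OF X left_comodule_CU] one]] _ _ assms])
    show "(\<lambda>z. z) \<in> additive_maps (X \<star> CUv) (X \<star> CUv)"
      by (auto intro!: additive_mapsI)
    fix x c assume "c \<in> carrier CUv" and x: "x \<in> carrier X"
    then obtain b where b: "b \<in> carrier A" "c = Scalar b" by auto
    show "comod_pure B X CUv (ru X (comod_pure B X CUv x c)) (Scalar \<one>\<^bsub>A\<^esub>) = comod_pure B X CUv x c"
      using b x cp_move[OF X left_comodule_CU, of b x "Scalar \<one>\<^bsub>A\<^esub>"] by simp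
  qed simp
qed

lemma lunit_iso: "iso_arr (comod_cat B) (CUv \<star> X) X (lu X)"
  using lunit_inverse by (intro iso_arrI[OF _ _ lunit_hom, of "\<lambda>x. comod_pure B CUv X (Scalar \<one>\<^bsub>A\<^esub>) x"]) auto

lemma runit_iso: "iso_arr (comod_cat B) (X \<star> CUv) X (ru X)"
  using runit_inverse by (intro iso_arrI[OF _ _ runit_hom, of "\<lambda>x. comod_pure B X CUv x (Scalar \<one>\<^bsub>A\<^esub>)"]) auto

end

lemma compose_apply [simp]: "x \<in> S \<Longrightarrow> compose S g f x = g (f x)"
  by (simp add: compose_eq)

lemmas arrs = comod_hom_restrict_comp tmor_hom assoc_hom lunit_hom runit_hom comod_hom_ident
  left_comodule_CT left_comodule_CU

text \<open>Both sides of each coherence condition are colinear maps out of iterated tensor products, so they are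
  compared on pure tensors, where the constraints act by the obvious formulas.\<close>

theorem monoidal_category_comodules:
  "monoidal_category (comod_cat B :: (('a, 'u, 'v) ucomodule, ('a, 'v) univ \<Rightarrow> ('a, 'v) univ) moncat)"
proof (rule monoidal_category.intro, unfold comod_cat_simps)
  fix W X Y Z X' Y' Z' X'' Y'' :: "('a, 'u, 'v) ucomodule" and f g h f' g'
  show "left_comodule B X \<Longrightarrow> (\<lambda>x\<in>carrier X. x) \<in> comod_hom B X X"
    by (rule comod_hom_ident)
  show "left_comodule B X \<Longrightarrow> left_comodule B Y \<Longrightarrow> left_comodule B Z \<Longrightarrow> f \<in> comod_hom B X Y \<Longrightarrow>
      g \<in> comod_hom B Y Z \<Longrightarrow> compose (carrier X) g f \<in> comod_hom B X Z"
    by (rule comod_hom_restrict_comp)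
  show "left_comodule B X \<Longrightarrow> left_comodule B Y \<Longrightarrow> f \<in> comod_hom B X Y \<Longrightarrow>
      compose (carrier X) f (\<lambda>x\<in>carrier X. x) = f"
    by (intro extensionalityI[of _ "carrier X"]) (auto simp: comod_hom_simps)
  show "left_comodule B X \<Longrightarrow> left_comodule B Y \<Longrightarrow> f \<in> comod_hom B X Y \<Longrightarrow>
      compose (carrier X) (\<lambda>x\<in>carrier Y. x) f = f"
    by (intro extensionalityI[of _ "carrier X"]) (auto simp: comod_hom_simps)
  show "left_comodule B W \<Longrightarrow> left_comodule B X \<Longrightarrow> left_comodule B Y \<Longrightarrow> left_comodule B Z \<Longrightarrow>
      f \<in> comod_hom B W X \<Longrightarrow> g \<in> comod_hom B X Y \<Longrightarrow> h \<in> comod_hom B Y Z \<Longrightarrow>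
      compose (carrier W) (compose (carrier X) h g) f = compose (carrier W) h (compose (carrier W) g f)"
    by (intro extensionalityI[of _ "carrier W"]) (auto simp: comod_hom_simps)
  show "left_comodule B X \<Longrightarrow> left_comodule B Y \<Longrightarrow> left_comodule B (X \<star> Y)" by simp
  show "left_comodule B (CU :: ('a, 'u, 'v) ucomodule)" by simp
  show "left_comodule B X \<Longrightarrow> left_comodule B X' \<Longrightarrow> left_comodule B Y \<Longrightarrow> left_comodule B Y' \<Longrightarrow>
      f \<in> comod_hom B X X' \<Longrightarrow> g \<in> comod_hom B Y Y' \<Longrightarrow>
      tm X X' Y Y' f g \<in> comod_hom B (X \<star> Y) (X' \<star> Y')"
    by (rule tmor_hom)
  show "tm X X Y Y (\<lambda>x\<in>carrier X. x) (\<lambda>x\<in>carrier Y. x) = (\<lambda>x\<in>carrier (X \<star> Y). x)"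
    if [simp]: "left_comodule B X" "left_comodule B Y"
    by (rule comod_hom_CT_ext[where N=X and P=Y and Z="(X \<star> Y)"])
      (simp_all add: arrs)
  show "tm X X'' Y Y'' (compose (carrier X) f' f) (compose (carrier Y) g' g) =
      compose (carrier (X \<star> Y)) (tm X' X'' Y' Y'' f' g') (tm X X' Y Y' f g)"
    if [simp]: "left_comodule B X" "left_comodule B X'" "left_comodule B X''" "left_comodule B Y"
      "left_comodule B Y'" "left_comodule B Y''" and
      h: "f \<in> comod_hom B X X'" "f' \<in> comod_hom B X' X''" "g \<in> comod_hom B Y Y'" "g' \<in> comod_hom B Y' Y''"
  proof (rule comod_hom_CT_ext[where N=X and P=Y and Z="(X'' \<star> Y'')"])
    show "tm X X'' Y Y'' (compose (carrier X) f' f) (compose (carrier Y) g' g)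
        \<in> comod_hom B (X \<star> Y) (X'' \<star> Y'')"
      by (rule tmor_hom) (use h in \<open>auto intro: comod_hom_restrict_comp[where P=X'] comod_hom_restrict_comp[where P=Y']\<close>)
    show "compose (carrier (X \<star> Y)) (tm X' X'' Y' Y'' f' g') (tm X X' Y Y' f g)
        \<in> comod_hom B (X \<star> Y) (X'' \<star> Y'')"
      by (rule comod_hom_restrict_comp[where P="(X' \<star> Y')"]) (use h in \<open>auto intro: tmor_hom\<close>)
    fix x y assume xy: "x \<in> carrier X" "y \<in> carrier Y"
    have c: "compose (carrier X) f' f \<in> comod_hom B X X''" "compose (carrier Y) g' g \<in> comod_hom B Y Y''"
      by (use h in \<open>auto intro: comod_hom_restrict_comp[where P=X'] comod_hom_restrict_comp[where P=Y']\<close>)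
    show "tm X X'' Y Y'' (compose (carrier X) f' f) (compose (carrier Y) g' g) (comod_pure B X Y x y) =
        compose (carrier (X \<star> Y)) (tm X' X'' Y' Y'' f' g') (tm X X' Y Y' f g) (comod_pure B X Y x y)"
      using xy h c by (simp add: comod_hom_simps(1)[OF h(1)] comod_hom_simps(1)[OF h(3)])
  qed simp_all
  show "left_comodule B X \<Longrightarrow> left_comodule B Y \<Longrightarrow> left_comodule B Z \<Longrightarrow>
      iso_arr (comod_cat B) ((X \<star> Y) \<star> Z) (X \<star> (Y \<star> Z)) (as X Y Z)"
    by (rule assoc_iso)
  show "left_comodule B X \<Longrightarrow> iso_arr (comod_cat B) (CU \<star> X) X (lu X)"
    by (rule lunit_iso)
  show "left_comodule B X \<Longrightarrow> iso_arr (comod_cat B) (X \<star> CU) X (ru X)"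
    by (rule runit_iso)
  show "compose (carrier ((X \<star> Y) \<star> Z)) (as X' Y' Z')
        (tm (X \<star> Y) (X' \<star> Y') Z Z' (tm X X' Y Y' f g) h) =
      compose (carrier ((X \<star> Y) \<star> Z))
        (tm X X' (Y \<star> Z) (Y' \<star> Z') f (tm Y Y' Z Z' g h)) (as X Y Z)"
    if [simp]: "left_comodule B X" "left_comodule B X'" "left_comodule B Y" "left_comodule B Y'"
      "left_comodule B Z" "left_comodule B Z'" and
      h: "f \<in> comod_hom B X X'" "g \<in> comod_hom B Y Y'" "h \<in> comod_hom B Z Z'"
  proof (rule comod_hom_CT_ext3[where X=X and Y=Y and Z=Z and W="(X' \<star> (Y' \<star> Z'))"])
    note t1 = tmor_hom[OF that(1-4) h(1,2)] and t2 = tmor_hom[OF that(3-6) h(2,3)]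
    show "compose (carrier ((X \<star> Y) \<star> Z)) (as X' Y' Z')
        (tm (X \<star> Y) (X' \<star> Y') Z Z' (tm X X' Y Y' f g) h)
      \<in> comod_hom B ((X \<star> Y) \<star> Z) (X' \<star> (Y' \<star> Z'))"
      by (rule comod_hom_restrict_comp[OF _ _ _ tmor_hom assoc_hom]) (use h t1 in auto)
    show "compose (carrier ((X \<star> Y) \<star> Z))
        (tm X X' (Y \<star> Z) (Y' \<star> Z') f (tm Y Y' Z Z' g h)) (as X Y Z)
      \<in> comod_hom B ((X \<star> Y) \<star> Z) (X' \<star> (Y' \<star> Z'))"
      by (rule comod_hom_restrict_comp[OF _ _ _ assoc_hom tmor_hom]) (use h t2 in auto)
    fix x y z assume "x \<in> carrier X" "y \<in> carrier Y" "z \<in> carrier Z"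
    then show "compose (carrier ((X \<star> Y) \<star> Z)) (as X' Y' Z')
        (tm (X \<star> Y) (X' \<star> Y') Z Z' (tm X X' Y Y' f g) h)
          (comod_pure B (X \<star> Y) Z (comod_pure B X Y x y) z) =
      compose (carrier ((X \<star> Y) \<star> Z))
        (tm X X' (Y \<star> Z) (Y' \<star> Z') f (tm Y Y' Z Z' g h)) (as X Y Z)
          (comod_pure B (X \<star> Y) Z (comod_pure B X Y x y) z)"
      using h t1 t2 by (simp add: comod_hom_simps(1)[OF h(1)] comod_hom_simps(1)[OF h(2)] comod_hom_simps(1)[OF h(3)])
  qed simp_all
  show "compose (carrier (CU \<star> X)) (lu X') (tm CU CU X X' (\<lambda>x\<in>carrier CU. x) f) =
      compose (carrier (CU \<star> X)) f (lu X)"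
    if [simp]: "left_comodule B X" "left_comodule B X'" and h: "f \<in> comod_hom B X X'"
  proof (rule comod_hom_CT_ext[where N="CU" and P=X and Z=X'])
    have i: "(\<lambda>x\<in>carrier CU. x) \<in> comod_hom B (CU :: ('a, 'u, 'v) ucomodule) CU" by (rule comod_hom_ident) simp
    show "compose (carrier (CU \<star> X)) (lu X') (tm CU CU X X' (\<lambda>x\<in>carrier CU. x) f)
        \<in> comod_hom B (CU \<star> X) X'"
      by (rule comod_hom_restrict_comp[OF _ _ _ tmor_hom lunit_hom]) (use h i in auto)
    show "compose (carrier (CU \<star> X)) f (lu X) \<in> comod_hom B (CU \<star> X) X'"
      by (rule comod_hom_restrict_comp[OF _ _ _ lunit_hom h]) auto
    fix c x assume "c \<in> carrier (CU :: ('a, 'u, 'v) ucomodule)" and x: "x \<in> carrier X"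
    then obtain b where b: "b \<in> carrier A" "c = Scalar b" by auto
    show "compose (carrier (CU \<star> X)) (lu X') (tm CU CU X X' (\<lambda>x\<in>carrier CU. x) f) (comod_pure B CU X c x) =
        compose (carrier (CU \<star> X)) f (lu X) (comod_pure B CU X c x)"
      using b x h i by (simp add: comod_hom_simps(1,3)[OF h])
  qed simp_all
  show "compose (carrier (X \<star> CU)) (ru X') (tm X X' CU CU f (\<lambda>x\<in>carrier CU. x)) =
      compose (carrier (X \<star> CU)) f (ru X)"
    if [simp]: "left_comodule B X" "left_comodule B X'" and h: "f \<in> comod_hom B X X'"
  proof (rule comod_hom_CT_ext[where N=X and P=CU and Z=X'])
    have i: "(\<lambda>x\<in>carrier CU. x) \<in> comod_hom B (CU :: ('a, 'u, 'v) ucomodule) CU" by (rule comod_hom_ident) simp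
    show "compose (carrier (X \<star> CU)) (ru X') (tm X X' CU CU f (\<lambda>x\<in>carrier CU. x))
        \<in> comod_hom B (X \<star> CU) X'"
      by (rule comod_hom_restrict_comp[OF _ _ _ tmor_hom runit_hom]) (use h i in auto)
    show "compose (carrier (X \<star> CU)) f (ru X) \<in> comod_hom B (X \<star> CU) X'"
      by (rule comod_hom_restrict_comp[OF _ _ _ runit_hom h]) auto
    fix c x assume "c \<in> carrier (CU :: ('a, 'u, 'v) ucomodule)" and x: "x \<in> carrier X"
    then obtain b where b: "b \<in> carrier A" "c = Scalar b" by auto
    show "compose (carrier (X \<star> CU)) (ru X') (tm X X' CU CU f (\<lambda>x\<in>carrier CU. x)) (comod_pure B X CU x c) =
        compose (carrier (X \<star> CU)) f (ru X) (comod_pure B X CU x c)"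
      using b x h i by (simp add: comod_hom_simps(1)[OF h] comod_hom_ra[OF _ _ h])
  qed simp_all
  show "compose (carrier (((W \<star> X) \<star> Y) \<star> Z))
        (as W X (Y \<star> Z)) (as (W \<star> X) Y Z) =
      compose (carrier (((W \<star> X) \<star> Y) \<star> Z))
        (tm W W ((X \<star> Y) \<star> Z) (X \<star> (Y \<star> Z)) (\<lambda>x\<in>carrier W. x) (as X Y Z))
        (compose (carrier (((W \<star> X) \<star> Y) \<star> Z)) (as W (X \<star> Y) Z)
          (tm ((W \<star> X) \<star> Y) (W \<star> (X \<star> Y)) Z Z (as W X Y) (\<lambda>x\<in>carrier Z. x)))"
    (is "?l = ?r")
    if [simp]: "left_comodule B W" "left_comodule B X" "left_comodule B Y" "left_comodule B Z"
  proof (rule comod_hom_CT_ext4[where W=W and X=X and Y=Y and Z=Z and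
        V="(W \<star> (X \<star> (Y \<star> Z)))"])
    have i: "(\<lambda>x\<in>carrier W. x) \<in> comod_hom B W W" "(\<lambda>x\<in>carrier Z. x) \<in> comod_hom B Z Z"
      by (simp_all add: comod_hom_ident)
    have a: "as X Y Z \<in> comod_hom B ((X \<star> Y) \<star> Z) (X \<star> (Y \<star> Z))"
      "as W X Y \<in> comod_hom B ((W \<star> X) \<star> Y) (W \<star> (X \<star> Y))"
      by (simp_all add: assoc_hom)
    let ?D = "(((W \<star> X) \<star> Y) \<star> Z)"
    let ?V = "(W \<star> (X \<star> (Y \<star> Z)))"
    show "?l \<in> comod_hom B ?D ?V"
      by (rule comod_hom_restrict_comp[OF _ _ _ assoc_hom assoc_hom]) simp_all
    have "compose (carrier ?D) (as W (X \<star> Y) Z)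
        (tm ((W \<star> X) \<star> Y) (W \<star> (X \<star> Y)) Z Z (as W X Y) (\<lambda>x\<in>carrier Z. x))
        \<in> comod_hom B ?D (W \<star> ((X \<star> Y) \<star> Z))"
      by (rule comod_hom_restrict_comp[OF _ _ _ tmor_hom assoc_hom]) (use a i in simp_all)
    then show "?r \<in> comod_hom B ?D ?V"
      by (rule comod_hom_restrict_comp[OF _ _ _ _ tmor_hom, rotated 3]) (use a i in simp_all)
    fix w x y z assume "w \<in> carrier W" "x \<in> carrier X" "y \<in> carrier Y" "z \<in> carrier Z"
    then show "?l (comod_pure B ((W \<star> X) \<star> Y) Z
          (comod_pure B (W \<star> X) Y (comod_pure B W X w x) y) z) =
        ?r (comod_pure B ((W \<star> X) \<star> Y) Z
          (comod_pure B (W \<star> X) Y (comod_pure B W X w x) y) z)"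
      using a i by simp
  qed simp_all
  show "compose (carrier ((X \<star> CU) \<star> Y))
        (tm X X (CU \<star> Y) Y (\<lambda>x\<in>carrier X. x) (lu Y)) (as X CU Y) =
      tm (X \<star> CU) X Y Y (ru X) (\<lambda>x\<in>carrier Y. x)" (is "?l = ?r")
    if [simp]: "left_comodule B X" "left_comodule B Y"
  proof (rule comod_hom_CT_ext3[where X=X and Y=CU and Z=Y and W="(X \<star> Y)"])
    have i: "(\<lambda>x\<in>carrier X. x) \<in> comod_hom B X X" "(\<lambda>x\<in>carrier Y. x) \<in> comod_hom B Y Y"
      by (simp_all add: comod_hom_ident)
    have a: "lu Y \<in> comod_hom B (CU \<star> Y) Y" "ru X \<in> comod_hom B (X \<star> CU) X"
      by (simp_all add: lunit_hom runit_hom)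
    show "?l \<in> comod_hom B ((X \<star> CU) \<star> Y) (X \<star> Y)"
      by (rule comod_hom_restrict_comp[OF _ _ _ assoc_hom tmor_hom]) (use a i in simp_all)
    show "?r \<in> comod_hom B ((X \<star> CU) \<star> Y) (X \<star> Y)"
      by (rule tmor_hom) (use a i in simp_all)
    fix x c y assume x: "x \<in> carrier X" "c \<in> carrier (CU :: ('a, 'u, 'v) ucomodule)" "y \<in> carrier Y"
    then obtain b where b: "b \<in> carrier A" "c = Scalar b" by auto
    show "?l (comod_pure B (X \<star> CU) Y (comod_pure B X CU x c) y) =
        ?r (comod_pure B (X \<star> CU) Y (comod_pure B X CU x c) y)"
      using a i x b by (simp add: cp_move)
  qed simp_all
qed

end

section \<open>Left Hopf algebroids\<close>

context left_bialgebroid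
begin

abbreviation balL where
  "balL G q \<equiv> balanced (carrier A) U (\<lambda>u a. lblack B a u) (\<lambda>a v. rwhite B v a) U G q"
abbreviation lsum where "lsum G q u \<equiv> sweedler (UopU B) G q (transl_l B u)"

lemma UopU_tensor: "is_tensor (UopU B) (carrier A) U (\<lambda>u a. lblack B a u) (\<lambda>a v. rwhite B v a) U"
  by (simp add: is_tensor_def tensor_data_def UopU_def)

lemmas UopU_ab [simp] = tensor_abelian_group[OF UopU_tensor]
lemmas UopU_pure_closed [simp] = pure_closed[OF UopU_tensor]
lemmas UopU_pure_add_left = pure_add_left[OF UopU_tensor]
lemmas UopU_pure_add_right = pure_add_right[OF UopU_tensor]
lemmas UopU_move = pure_move[OF UopU_tensor, simplified]

lemma balLI:
  assumes "\<And>u v. u \<in> carrier U \<Longrightarrow> v \<in> carrier U \<Longrightarrow> q u v \<in> carrier G"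
    and "\<And>u u' v. u \<in> carrier U \<Longrightarrow> u' \<in> carrier U \<Longrightarrow> v \<in> carrier U \<Longrightarrow>
      q (u \<oplus>\<^bsub>U\<^esub> u') v = q u v \<oplus>\<^bsub>G\<^esub> q u' v"
    and "\<And>u v v'. u \<in> carrier U \<Longrightarrow> v \<in> carrier U \<Longrightarrow> v' \<in> carrier U \<Longrightarrow>
      q u (v \<oplus>\<^bsub>U\<^esub> v') = q u v \<oplus>\<^bsub>G\<^esub> q u v'"
    and "\<And>a u v. a \<in> carrier A \<Longrightarrow> u \<in> carrier U \<Longrightarrow> v \<in> carrier U \<Longrightarrow> q (u \<cdot> t a) v = q u (t a \<cdot> v)"
  shows "balL G q"
  using assms by (intro balancedI) simp_all

text \<open>The map \<open>\<alpha>\<^sub>\<ell>\<close> is right \<open>U\<close>-linear for multiplication on the second leg, and it intertwines the two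
  left actions of \<open>A\<close>. Therefore the same holds for its inverse, which turns the values on \<open>u \<otimes> 1\<close> into
  values on all of \<open>U \<otimes>\<^sub>A U\<close>.\<close>

definition UU_rmult where "UU_rmult w = sweedler (UU B) (UU B) (\<lambda>x y. x \<boxtimes>\<^bsub>UU B\<^esub> (y \<cdot> w))"
definition UopU_rmult where "UopU_rmult w = sweedler (UopU B) (UopU B) (\<lambda>x y. x \<boxtimes>\<^bsub>UopU B\<^esub> (y \<cdot> w))"

lemma UU_rmult_bal: "w \<in> carrier U \<Longrightarrow> bal (U_left B) (UU B) (\<lambda>x y. x \<boxtimes>\<^bsub>UU B\<^esub> (y \<cdot> w))"
  by (rule balI) (simp_all add: UU_pure_add_left UU_pure_add_right UU_move distribs U.m_assoc)

lemma UopU_rmult_bal: "w \<in> carrier U \<Longrightarrow> balL (UopU B) (\<lambda>x y. x \<boxtimes>\<^bsub>UopU B\<^esub> (y \<cdot> w))"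
  by (rule balLI) (simp_all add: UopU_pure_add_left UopU_pure_add_right UopU_move distribs U.m_assoc)

lemma UU_rmult_pure [simp]: "w \<in> carrier U \<Longrightarrow> x \<in> carrier U \<Longrightarrow> y \<in> carrier U \<Longrightarrow>
    UU_rmult w (x \<boxtimes>\<^bsub>UU B\<^esub> y) = x \<boxtimes>\<^bsub>UU B\<^esub> (y \<cdot> w)"
  unfolding UU_rmult_def by (rule sweedler_pure[OF UU_tensor UU_ab UU_rmult_bal, simplified])

lemma UopU_rmult_pure [simp]: "w \<in> carrier U \<Longrightarrow> x \<in> carrier U \<Longrightarrow> y \<in> carrier U \<Longrightarrow>
    UopU_rmult w (x \<boxtimes>\<^bsub>UopU B\<^esub> y) = x \<boxtimes>\<^bsub>UopU B\<^esub> (y \<cdot> w)"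
  unfolding UopU_rmult_def by (rule sweedler_pure[OF UopU_tensor UopU_ab UopU_rmult_bal])

lemma UU_rmult_additive: "w \<in> carrier U \<Longrightarrow> UU_rmult w \<in> additive_maps (UU B) (UU B)"
  unfolding UU_rmult_def by (rule sweedler_additive[OF UU_tensor UU_ab UU_rmult_bal])

lemma UopU_rmult_additive: "w \<in> carrier U \<Longrightarrow> UopU_rmult w \<in> additive_maps (UopU B) (UopU B)"
  unfolding UopU_rmult_def by (rule sweedler_additive[OF UopU_tensor UopU_ab UopU_rmult_bal])

lemma alpha_l_bal: "balL (UU B) (\<lambda>u v. dsum (UU B) (\<lambda>u1 u2. u1 \<boxtimes>\<^bsub>UU B\<^esub> (u2 \<cdot> v)) u)"
proof (rule balLI)
  note b = UU_rmult_bal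
  show "dsum (UU B) (\<lambda>u1 u2. u1 \<boxtimes>\<^bsub>UU B\<^esub> (u2 \<cdot> v)) (u \<cdot> t a) =
      dsum (UU B) (\<lambda>u1 u2. u1 \<boxtimes>\<^bsub>UU B\<^esub> (u2 \<cdot> (t a \<cdot> v))) u"
    if "a \<in> carrier A" "u \<in> carrier U" "v \<in> carrier U" for a u v
    using that by (auto simp: dsum_t_right[OF UU_ab b] U.m_assoc intro!: dsum_cong)
qed (simp_all add: dsum_add[OF UU_ab UU_rmult_bal] dsum_closed distribs UU_pure_add_right
    dsum_fun_add[symmetric] cong: dsum_cong)

lemma alpha_l_pure: "u \<in> carrier U \<Longrightarrow> v \<in> carrier U \<Longrightarrow>
    alpha_l B (u \<boxtimes>\<^bsub>UopU B\<^esub> v) = dsum (UU B) (\<lambda>u1 u2. u1 \<boxtimes>\<^bsub>UU B\<^esub> (u2 \<cdot> v)) u"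
  unfolding alpha_l_def by (rule sweedler_pure[OF UopU_tensor UU_ab alpha_l_bal])

lemma alpha_l_additive: "alpha_l B \<in> additive_maps (UopU B) (UU B)"
  unfolding alpha_l_def by (rule sweedler_additive[OF UopU_tensor UU_ab alpha_l_bal])

lemma alpha_l_rmult:
  assumes "w \<in> carrier U" "c \<in> carrier (UopU B)"
  shows "alpha_l B (UopU_rmult w c) = UU_rmult w (alpha_l B c)"
proof (rule tensor_ext[OF UopU_tensor UU_ab additive_maps_comp[OF UopU_rmult_additive[OF assms(1)] alpha_l_additive]
      additive_maps_comp[OF alpha_l_additive UU_rmult_additive[OF assms(1)]] _ assms(2)])
  fix u v assume uv: "u \<in> carrier U" "v \<in> carrier U"
  have "UU_rmult w (alpha_l B (u \<boxtimes>\<^bsub>UopU B\<^esub> v)) =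
      dsum (UU B) (\<lambda>u1 u2. UU_rmult w (u1 \<boxtimes>\<^bsub>UU B\<^esub> (u2 \<cdot> v))) u"
    unfolding alpha_l_pure[OF uv] using uv
    by (intro dsum_hom[OF _ _ UU_rmult_additive[OF assms(1)]]) auto
  also have "\<dots> = dsum (UU B) (\<lambda>u1 u2. u1 \<boxtimes>\<^bsub>UU B\<^esub> (u2 \<cdot> (v \<cdot> w))) u"
    using uv assms(1) by (intro dsum_cong) (auto simp: U.m_assoc)
  finally show "alpha_l B (UopU_rmult w (u \<boxtimes>\<^bsub>UopU B\<^esub> v)) = UU_rmult w (alpha_l B (u \<boxtimes>\<^bsub>UopU B\<^esub> v))"
    using uv assms(1) by (simp add: alpha_l_pure)
qed

lemma UopU_left_bal: "a \<in> carrier A \<Longrightarrow> balL (UopU B) (\<lambda>v y. (s a \<cdot> v) \<boxtimes>\<^bsub>UopU B\<^esub> y)"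
  by (rule balLI) (simp_all add: UopU_pure_add_left UopU_pure_add_right UopU_move distribs U.m_assoc[symmetric])

lemma UopU_left_pure [simp]: "a \<in> carrier A \<Longrightarrow> x \<in> carrier U \<Longrightarrow> y \<in> carrier U \<Longrightarrow>
    UopU_left B a (x \<boxtimes>\<^bsub>UopU B\<^esub> y) = (s a \<cdot> x) \<boxtimes>\<^bsub>UopU B\<^esub> y"
  using sweedler_pure[OF UopU_tensor UopU_ab UopU_left_bal] by (simp add: UopU_left_def)

lemma UopU_left_additive: "a \<in> carrier A \<Longrightarrow> UopU_left B a \<in> additive_maps (UopU B) (UopU B)"
  using sweedler_additive[OF UopU_tensor UopU_ab UopU_left_bal] by (simp add: UopU_left_def[abs_def])

lemma UopU_left_closed [simp]: "a \<in> carrier A \<Longrightarrow> c \<in> carrier (UopU B) \<Longrightarrow> UopU_left B a c \<in> carrier (UopU B)"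
  by (rule additive_maps_closed[OF UopU_left_additive])

lemma alpha_l_left:
  assumes "a \<in> carrier A" "c \<in> carrier (UopU B)"
  shows "alpha_l B (UopU_left B a c) = UX_left B (U_left B) a (alpha_l B c)"
proof (rule tensor_ext[OF UopU_tensor UU_ab additive_maps_comp[OF UopU_left_additive[OF assms(1)] alpha_l_additive]
      additive_maps_comp[OF alpha_l_additive UX_left_additive[OF left_module_U_left assms(1)]] _ assms(2)])
  fix u v assume uv: "u \<in> carrier U" "v \<in> carrier U"
  have "UX_left B (U_left B) a (alpha_l B (u \<boxtimes>\<^bsub>UopU B\<^esub> v)) =
      dsum (UU B) (\<lambda>u1 u2. UX_left B (U_left B) a (u1 \<boxtimes>\<^bsub>UU B\<^esub> (u2 \<cdot> v))) u"
    unfolding alpha_l_pure[OF uv] using uv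
    by (intro dsum_hom[OF _ _ UX_left_additive[OF left_module_U_left assms(1)]]) auto
  also have "\<dots> = dsum (UU B) (\<lambda>u1 u2. (s a \<cdot> u1) \<boxtimes>\<^bsub>UU B\<^esub> (u2 \<cdot> v)) u"
    using uv assms(1) by (intro dsum_cong) (auto simp: left_module_U_left)
  finally show "alpha_l B (UopU_left B a (u \<boxtimes>\<^bsub>UopU B\<^esub> v)) = UX_left B (U_left B) a (alpha_l B (u \<boxtimes>\<^bsub>UopU B\<^esub> v))"
    using uv assms(1) dsum_s_left[OF UU_ab UU_rmult_bal] by (simp add: alpha_l_pure)
qed

lemma UU_tgt_bal: "a \<in> carrier A \<Longrightarrow> bal (U_left B) (UU B) (\<lambda>x y. x \<boxtimes>\<^bsub>UU B\<^esub> (t a \<cdot> y))"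
  by (rule balI) (simp_all add: UU_pure_add_left UU_pure_add_right UU_move distribs ts_left)

lemma UopU_tgt_bal: "a \<in> carrier A \<Longrightarrow> balL (UopU B) (\<lambda>x y. (t a \<cdot> x) \<boxtimes>\<^bsub>UopU B\<^esub> y)"
  by (rule balLI) (simp_all add: UopU_pure_add_left UopU_pure_add_right UopU_move distribs U.m_assoc[symmetric])

lemma UopU_tgt_additive: "a \<in> carrier A \<Longrightarrow>
    sweedler (UopU B) (UopU B) (\<lambda>x y. (t a \<cdot> x) \<boxtimes>\<^bsub>UopU B\<^esub> y) \<in> additive_maps (UopU B) (UopU B)"
  by (rule sweedler_additive[OF UopU_tensor UopU_ab UopU_tgt_bal])

lemma alpha_l_tgt:
  assumes a: "a \<in> carrier A" and c: "c \<in> carrier (UopU B)"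
  shows "alpha_l B (sweedler (UopU B) (UopU B) (\<lambda>x y. (t a \<cdot> x) \<boxtimes>\<^bsub>UopU B\<^esub> y) c) =
    sweedler (UU B) (UU B) (\<lambda>x y. x \<boxtimes>\<^bsub>UU B\<^esub> (t a \<cdot> y)) (alpha_l B c)"
proof -
  note h = sweedler_additive[OF UU_tensor UU_ab UU_tgt_bal[OF a]]
  show ?thesis
  proof (rule tensor_ext[OF UopU_tensor UU_ab additive_maps_comp[OF UopU_tgt_additive[OF a] alpha_l_additive]
        additive_maps_comp[OF alpha_l_additive h] _ c])
    fix u v assume uv: "u \<in> carrier U" "v \<in> carrier U"
    have "sweedler (UU B) (UU B) (\<lambda>x y. x \<boxtimes>\<^bsub>UU B\<^esub> (t a \<cdot> y)) (alpha_l B (u \<boxtimes>\<^bsub>UopU B\<^esub> v)) =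
        dsum (UU B) (\<lambda>u1 u2. u1 \<boxtimes>\<^bsub>UU B\<^esub> (t a \<cdot> (u2 \<cdot> v))) u"
      unfolding alpha_l_pure[OF uv] using uv a
      by (subst sweedler_push[OF UU_tensor UU_tensor UU_ab UU_tgt_bal[OF a]]) auto
    also have "\<dots> = dsum (UU B) (\<lambda>u1 u2. u1 \<boxtimes>\<^bsub>UU B\<^esub> (t a \<cdot> u2 \<cdot> v)) u"
      using uv a by (intro dsum_cong) (auto simp: U.m_assoc)
    finally show "alpha_l B (sweedler (UopU B) (UopU B) (\<lambda>x y. (t a \<cdot> x) \<boxtimes>\<^bsub>UopU B\<^esub> y) (u \<boxtimes>\<^bsub>UopU B\<^esub> v)) =
        sweedler (UU B) (UU B) (\<lambda>x y. x \<boxtimes>\<^bsub>UU B\<^esub> (t a \<cdot> y)) (alpha_l B (u \<boxtimes>\<^bsub>UopU B\<^esub> v))"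
      using uv a sweedler_pure[OF UopU_tensor UopU_ab UopU_tgt_bal[OF a] uv] dsum_t_left[OF UU_ab UU_rmult_bal]
      by (simp add: alpha_l_pure)
  qed
qed

end

locale left_hopf_algebroid = left_bialgebroid k B
  for k :: "('k, 'r) ring_scheme" and B :: "('k, 'a, 'u) bialgebroid" +
  assumes left_hopf: "left_hopf B"
begin

abbreviation tau where "tau \<equiv> inv_into (carrier (UopU B)) (alpha_l B)"

lemma tau_alpha: "c \<in> carrier (UopU B) \<Longrightarrow> tau (alpha_l B c) = c"
  using left_hopf unfolding left_hopf_def by (rule bij_betw_inv_into_left)

lemma alpha_tau: "c \<in> carrier (UU B) \<Longrightarrow> alpha_l B (tau c) = c"
  using left_hopf unfolding left_hopf_def by (rule bij_betw_inv_into_right)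

lemma tau_closed [simp]: "c \<in> carrier (UU B) \<Longrightarrow> tau c \<in> carrier (UopU B)"
  using left_hopf unfolding left_hopf_def by (metis bij_betw_def inv_into_into)

lemma alpha_l_inj: "c \<in> carrier (UopU B) \<Longrightarrow> d \<in> carrier (UopU B) \<Longrightarrow> alpha_l B c = alpha_l B d \<Longrightarrow> c = d"
  using tau_alpha by metis

lemma tau_additive: "tau \<in> additive_maps (UU B) (UopU B)"
proof (rule additive_mapsI)
  interpret V: abelian_group "UopU B" by simp
  interpret W: abelian_group "UU B" by simp
  show "tau (c \<oplus>\<^bsub>UU B\<^esub> d) = tau c \<oplus>\<^bsub>UopU B\<^esub> tau d"
    if "c \<in> carrier (UU B)" "d \<in> carrier (UU B)" for c d
    using that by - (rule alpha_l_inj, simp_all add: alpha_tau additive_maps_add[OF alpha_l_additive])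
qed simp

lemma transl_l_tau: "transl_l B u = tau (u \<boxtimes>\<^bsub>UU B\<^esub> \<one>\<^bsub>U\<^esub>)"
  by (simp add: transl_l_def)

lemma transl_l_closed [simp]: "u \<in> carrier U \<Longrightarrow> transl_l B u \<in> carrier (UopU B)"
  by (simp add: transl_l_tau)

lemma alpha_transl: "u \<in> carrier U \<Longrightarrow> alpha_l B (transl_l B u) = u \<boxtimes>\<^bsub>UU B\<^esub> \<one>\<^bsub>U\<^esub>"
  by (simp add: transl_l_tau alpha_tau)

lemma transl_l_add: "u \<in> carrier U \<Longrightarrow> v \<in> carrier U \<Longrightarrow>
    transl_l B (u \<oplus>\<^bsub>U\<^esub> v) = transl_l B u \<oplus>\<^bsub>UopU B\<^esub> transl_l B v"
  by (simp add: transl_l_tau UU_pure_add_left additive_maps_add[OF tau_additive])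

lemma transl_l_s: "a \<in> carrier A \<Longrightarrow> u \<in> carrier U \<Longrightarrow> transl_l B (s a \<cdot> u) = UopU_left B a (transl_l B u)"
  by (rule alpha_l_inj) (simp_all add: alpha_transl alpha_l_left left_module_U_left)

lemma transl_l_t: "a \<in> carrier A \<Longrightarrow> u \<in> carrier U \<Longrightarrow> transl_l B (t a \<cdot> u) = UopU_rmult (s a) (transl_l B u)"
  by (rule alpha_l_inj)
    (simp_all add: alpha_transl alpha_l_rmult UU_move additive_maps_closed[OF UopU_rmult_additive])

lemma transl_l_tgt: "a \<in> carrier A \<Longrightarrow> u \<in> carrier U \<Longrightarrow>
    sweedler (UopU B) (UopU B) (\<lambda>x y. (t a \<cdot> x) \<boxtimes>\<^bsub>UopU B\<^esub> y) (transl_l B u) = UopU_rmult (t a) (transl_l B u)"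
  by (rule alpha_l_inj)
    (simp_all add: alpha_transl alpha_l_rmult alpha_l_tgt additive_maps_closed[OF UopU_rmult_additive]
      additive_maps_closed[OF UopU_tgt_additive] sweedler_pure[OF UU_tensor UU_ab UU_tgt_bal])

lemma tau_pure: "u \<in> carrier U \<Longrightarrow> v \<in> carrier U \<Longrightarrow> tau (u \<boxtimes>\<^bsub>UU B\<^esub> v) = UopU_rmult v (transl_l B u)"
  by (rule alpha_l_inj)
    (simp_all add: alpha_tau alpha_transl alpha_l_rmult additive_maps_closed[OF UopU_rmult_additive])

lemma lsum_cong:
  assumes "u \<in> carrier U" "\<And>x y. x \<in> carrier U \<Longrightarrow> y \<in> carrier U \<Longrightarrow> g x y = h x y"
  shows "lsum G g u = lsum G h u"
  using assms by (intro sweedler_congT[OF UopU_tensor]) auto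

lemma lsum_closed:
  assumes "abelian_group G" "u \<in> carrier U"
    "\<And>x y. x \<in> carrier U \<Longrightarrow> y \<in> carrier U \<Longrightarrow> g x y \<in> carrier G"
  shows "lsum G g u \<in> carrier G"
  using assms by (intro sweedler_closed[OF UopU_tensor]) auto

lemma lsum_hom:
  assumes "abelian_group G" "abelian_group H" "h \<in> additive_maps G H" "u \<in> carrier U"
    "\<And>x y. x \<in> carrier U \<Longrightarrow> y \<in> carrier U \<Longrightarrow> g x y \<in> carrier G"
  shows "h (lsum G g u) = lsum H (\<lambda>x y. h (g x y)) u"
  using assms by (intro sweedler_hom[OF UopU_tensor]) auto

lemma lsum_fun_add:
  assumes "abelian_group G" "u \<in> carrier U"
    "\<And>x y. x \<in> carrier U \<Longrightarrow> y \<in> carrier U \<Longrightarrow> g x y \<in> carrier G"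
    "\<And>x y. x \<in> carrier U \<Longrightarrow> y \<in> carrier U \<Longrightarrow> h x y \<in> carrier G"
  shows "lsum G (\<lambda>x y. g x y \<oplus>\<^bsub>G\<^esub> h x y) u = lsum G g u \<oplus>\<^bsub>G\<^esub> lsum G h u"
  using assms by (intro sweedler_fun_add[OF UopU_tensor]) auto

lemma UopU_rmult_sweedler:
  assumes "abelian_group G" "balL G q" "w \<in> carrier U" "c \<in> carrier (UopU B)"
  shows "sweedler (UopU B) G q (UopU_rmult w c) = sweedler (UopU B) G (\<lambda>x y. q x (y \<cdot> w)) c"
  unfolding UopU_rmult_def using assms by (subst sweedler_push[OF UopU_tensor UopU_tensor]) auto

context
  fixes G :: "('g, 'd) ring_scheme" and q
  assumes G: "abelian_group G" and q: "balL G q"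
begin

lemma lsum_add: "u \<in> carrier U \<Longrightarrow> v \<in> carrier U \<Longrightarrow> lsum G q (u \<oplus>\<^bsub>U\<^esub> v) = lsum G q u \<oplus>\<^bsub>G\<^esub> lsum G q v"
  using sweedler_add[OF UopU_tensor G q] by (simp add: transl_l_add)

lemma lsum_t: "a \<in> carrier A \<Longrightarrow> u \<in> carrier U \<Longrightarrow> lsum G q (t a \<cdot> u) = lsum G (\<lambda>x y. q x (y \<cdot> s a)) u"
  using G q by (simp add: transl_l_t UopU_rmult_sweedler)

lemma lsum_tgt: "a \<in> carrier A \<Longrightarrow> u \<in> carrier U \<Longrightarrow>
    lsum G (\<lambda>x y. q (t a \<cdot> x) y) u = lsum G (\<lambda>x y. q x (y \<cdot> t a)) u"
  using transl_l_tgt[of a u] UopU_rmult_sweedler[OF G q, of "t a" "transl_l B u"]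
    sweedler_push[OF UopU_tensor UopU_tensor G q, of "transl_l B u" "\<lambda>x y. t a \<cdot> x" "\<lambda>x y. y"]
  by simp

text \<open>\<open>u\<^bsub>(1)+\<^esub> \<otimes> u\<^bsub>(1)-\<^esub> u\<^bsub>(2)\<^esub> = u \<otimes> 1\<close>: apply \<open>\<alpha>\<^sub>\<ell>\<^sup>-\<^sup>1\<close> to \<open>\<alpha>\<^sub>\<ell>(u \<otimes> 1) = u\<^bsub>(1)\<^esub> \<otimes> u\<^bsub>(2)\<^esub>\<close>.\<close>

lemma lsum_dsum:
  assumes u: "u \<in> carrier U"
  shows "dsum G (\<lambda>u1 u2. lsum G (\<lambda>x y. q x (y \<cdot> u2)) u1) u = q u \<one>\<^bsub>U\<^esub>"
proof -
  note h = sweedler_additive[OF UopU_tensor G q]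
  have "q u \<one>\<^bsub>U\<^esub> = sweedler (UopU B) G q (tau (alpha_l B (u \<boxtimes>\<^bsub>UopU B\<^esub> \<one>\<^bsub>U\<^esub>)))"
    using u by (simp add: tau_alpha sweedler_pure[OF UopU_tensor G q])
  also have "\<dots> = dsum G (\<lambda>u1 u2. sweedler (UopU B) G q (tau (u1 \<boxtimes>\<^bsub>UU B\<^esub> (u2 \<cdot> \<one>\<^bsub>U\<^esub>)))) u"
    unfolding alpha_l_pure[OF u U.one_closed] using u
    by (intro dsum_hom[OF UU_ab G additive_maps_comp[OF tau_additive h]]) auto
  also have "\<dots> = dsum G (\<lambda>u1 u2. lsum G (\<lambda>x y. q x (y \<cdot> u2)) u1) u"
    using u by (intro dsum_cong) (auto simp: tau_pure UopU_rmult_sweedler[OF G q])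
  finally show ?thesis by simp
qed

end

text \<open>\<open>u\<^sub>+ u\<^sub>- = s(\<epsilon>(u))\<close>: by counitality \<open>x \<otimes> y \<mapsto> x y\<close> is \<open>\<alpha>\<^sub>\<ell>\<close> followed by \<open>u\<^sub>1 \<otimes> u\<^sub>2 \<mapsto> s(\<epsilon>(u\<^sub>1)) u\<^sub>2\<close>.\<close>

lemma lsum_mult:
  assumes u: "u \<in> carrier U"
  shows "lsum U (\<lambda>x y. x \<cdot> y) u = s (eps u)"
proof -
  note h = sweedler_additive[OF UU_tensor U_ab counit_l_bal]
  let ?h = "sweedler (UU B) U (\<lambda>u1 u2. s (eps u1) \<cdot> u2)"
  have "lsum U (\<lambda>x y. x \<cdot> y) u = ?h (alpha_l B (transl_l B u))"
  proof (rule sweedler_eq_hom[OF UopU_tensor U_ab additive_maps_comp[OF alpha_l_additive h]])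
    fix x y assume xy: "x \<in> carrier U" "y \<in> carrier U"
    have "?h (alpha_l B (x \<boxtimes>\<^bsub>UopU B\<^esub> y)) = dsum U (\<lambda>u1 u2. s (eps u1) \<cdot> (u2 \<cdot> y)) x"
      unfolding alpha_l_pure[OF xy] using xy
      by (subst sweedler_push[OF UU_tensor UU_tensor U_ab counit_l_bal]) auto
    also have "\<dots> = dsum U (\<lambda>u1 u2. (s (eps u1) \<cdot> u2) \<cdot> y) x"
      using xy by (intro dsum_cong) (auto simp: U.m_assoc)
    also have "\<dots> = dsum U (\<lambda>u1 u2. s (eps u1) \<cdot> u2) x \<cdot> y"
      using xy by (intro dsum_hom[symmetric, of U U "\<lambda>x. x \<cdot> y"]) (auto intro!: additive_mapsI simp: distribs)
    finally show "?h (alpha_l B (x \<boxtimes>\<^bsub>UopU B\<^esub> y)) = x \<cdot> y" using xy by (simp add: counit_l)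
  qed (use u in simp)
  then show ?thesis
    using u by (simp add: alpha_transl sweedler_pure[OF UU_tensor U_ab counit_l_bal])
qed

end

section \<open>Dual bases of projective modules\<close>

text \<open>The free module on the carrier of \<open>P\<close>, with elements in the type over which the lifting property of a
  projective module ranges.\<close>

definition free_module :: "('r, 'b) ring_scheme \<Rightarrow> ('r, 'p, 'c) module_scheme \<Rightarrow> ('r, 'p \<Rightarrow> 'r) module"
  where "free_module R P = \<lparr>carrier = {\<phi>. (\<forall>j. \<phi> j \<in> carrier R) \<and> {j. \<phi> j \<noteq> \<zero>\<^bsub>R\<^esub>} \<subseteq> carrier P \<and>
      finite {j. \<phi> j \<noteq> \<zero>\<^bsub>R\<^esub>}},
    mult = undefined, one = undefined, zero = (\<lambda>_. \<zero>\<^bsub>R\<^esub>), add = (\<lambda>\<phi> \<psi> j. \<phi> j \<oplus>\<^bsub>R\<^esub> \<psi> j),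
    smult = (\<lambda>a \<phi> j. a \<otimes>\<^bsub>R\<^esub> \<phi> j)\<rparr>"

lemma left_module_free_module:
  assumes "ring R"
  shows "left_module R (free_module R P)"
proof -
  interpret R: ring R by fact
  show ?thesis
  proof (intro left_module.intro left_module_axioms.intro)
    show "ring R" by fact
    show "abelian_group (free_module R P)"
    proof (rule abelian_groupI)
      show "\<phi> \<oplus>\<^bsub>free_module R P\<^esub> \<psi> \<in> carrier (free_module R P)"
        if "\<phi> \<in> carrier (free_module R P)" "\<psi> \<in> carrier (free_module R P)" for \<phi> \<psi>
      proof -
        have "{j. \<phi> j \<oplus>\<^bsub>R\<^esub> \<psi> j \<noteq> \<zero>\<^bsub>R\<^esub>} \<subseteq> {j. \<phi> j \<noteq> \<zero>\<^bsub>R\<^esub>} \<union> {j. \<psi> j \<noteq> \<zero>\<^bsub>R\<^esub>}" by auto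
        with that show ?thesis by (auto simp: free_module_def intro: finite_subset)
      qed
      show "\<exists>\<psi>\<in>carrier (free_module R P). \<psi> \<oplus>\<^bsub>free_module R P\<^esub> \<phi> = \<zero>\<^bsub>free_module R P\<^esub>"
        if "\<phi> \<in> carrier (free_module R P)" for \<phi>
      proof (rule bexI)
        have "{j. \<ominus>\<^bsub>R\<^esub> \<phi> j \<noteq> \<zero>\<^bsub>R\<^esub>} = {j. \<phi> j \<noteq> \<zero>\<^bsub>R\<^esub>}"
          using that by (auto simp: free_module_def)
        then show "(\<lambda>j. \<ominus>\<^bsub>R\<^esub> \<phi> j) \<in> carrier (free_module R P)"
          using that by (auto simp: free_module_def)
        show "(\<lambda>j. \<ominus>\<^bsub>R\<^esub> \<phi> j) \<oplus>\<^bsub>free_module R P\<^esub> \<phi> = \<zero>\<^bsub>free_module R P\<^esub>"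
          using that by (auto simp: free_module_def R.l_neg)
      qed
    qed (auto simp: free_module_def R.a_ac fun_eq_iff)
    show "a \<odot>\<^bsub>free_module R P\<^esub> \<phi> \<in> carrier (free_module R P)"
      if "a \<in> carrier R" "\<phi> \<in> carrier (free_module R P)" for a \<phi>
    proof -
      have "{j. a \<otimes>\<^bsub>R\<^esub> \<phi> j \<noteq> \<zero>\<^bsub>R\<^esub>} \<subseteq> {j. \<phi> j \<noteq> \<zero>\<^bsub>R\<^esub>}" using that by auto
      with that show ?thesis by (auto simp: free_module_def intro: finite_subset)
    qed
  qed (auto simp: free_module_def fun_eq_iff R.l_distr R.r_distr R.m_assoc)
qed

text \<open>A section of the canonical surjection from the free module, read off coordinatewise. The expansion is
  stated for any finite index set containing the support, so that several elements can share one index set.\<close>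

theorem dual_basis:
  fixes R :: "('r, 'b) ring_scheme" and P :: "('r, 'p, 'c) module_scheme"
  assumes proj: "projective_module R P"
  obtains f :: "'p \<Rightarrow> 'p \<Rightarrow> 'r" where "\<And>j. f j \<in> linear_maps R P \<lparr>carrier = carrier R,
      mult = undefined, one = undefined, zero = \<zero>\<^bsub>R\<^esub>, add = add R, smult = mult R\<rparr>"
    "\<And>x. x \<in> carrier P \<Longrightarrow> finite {j. f j x \<noteq> \<zero>\<^bsub>R\<^esub>}"
    "\<And>x. x \<in> carrier P \<Longrightarrow> {j. f j x \<noteq> \<zero>\<^bsub>R\<^esub>} \<subseteq> carrier P"
    "\<And>x J. x \<in> carrier P \<Longrightarrow> finite J \<Longrightarrow> J \<subseteq> carrier P \<Longrightarrow> {j. f j x \<noteq> \<zero>\<^bsub>R\<^esub>} \<subseteq> J \<Longrightarrow>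
      x = (\<Oplus>\<^bsub>P\<^esub>j\<in>J. f j x \<odot>\<^bsub>P\<^esub> j)"
proof -
  interpret P: left_module R P using proj by (simp add: projective_module_def)
  let ?Y = "free_module R P"
  let ?Z = "\<lparr>carrier = carrier P, mult = mult P, one = one P, zero = zero P, add = add P,
      smult = smult P\<rparr> :: ('r, 'p) module"
  have Y: "left_module R ?Y" by (rule left_module_free_module[OF P.R.ring_axioms])
  have Z: "left_module R ?Z"
  proof (intro left_module.intro left_module_axioms.intro)
    show "abelian_group ?Z"
      by (rule abelian_groupI) (auto simp: P.M.a_ac intro!: bexI[of _ "\<ominus>\<^bsub>P\<^esub> x" for x] P.M.l_neg)
  qed (auto simp: P.R.ring_axioms P.lsmult_closed P.lsmult_l_distr P.lsmult_r_distr P.lsmult_assoc P.lsmult_one)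
  have smz: "\<zero>\<^bsub>R\<^esub> \<odot>\<^bsub>P\<^esub> x = \<zero>\<^bsub>P\<^esub>" if "x \<in> carrier P" for x
  proof -
    have "\<zero>\<^bsub>R\<^esub> \<odot>\<^bsub>P\<^esub> x \<oplus>\<^bsub>P\<^esub> \<zero>\<^bsub>R\<^esub> \<odot>\<^bsub>P\<^esub> x = \<zero>\<^bsub>R\<^esub> \<odot>\<^bsub>P\<^esub> x"
      using P.lsmult_l_distr[of "\<zero>\<^bsub>R\<^esub>" "\<zero>\<^bsub>R\<^esub>" x] that by simp
    then show ?thesis using that P.lsmult_closed[of "\<zero>\<^bsub>R\<^esub>" x] by simp
  qed
  \<comment> \<open>The canonical surjection, as a sum over the support; \<open>g_eq\<close> allows larger index sets.\<close>
  define g where "g \<phi> = (\<Oplus>\<^bsub>P\<^esub>j\<in>{j. \<phi> j \<noteq> \<zero>\<^bsub>R\<^esub>}. \<phi> j \<odot>\<^bsub>P\<^esub> j)" for \<phi>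
  have g_eq: "g \<phi> = (\<Oplus>\<^bsub>P\<^esub>j\<in>J. \<phi> j \<odot>\<^bsub>P\<^esub> j)"
    if "\<phi> \<in> carrier ?Y" "finite J" "J \<subseteq> carrier P" "{j. \<phi> j \<noteq> \<zero>\<^bsub>R\<^esub>} \<subseteq> J" for \<phi> J
    unfolding g_def using that
    by (intro P.M.add.finprod_mono_neutral_cong_left)
      (auto simp: free_module_def P.lsmult_closed smz subset_iff)
  have g_add: "g (\<phi> \<oplus>\<^bsub>?Y\<^esub> \<psi>) = g \<phi> \<oplus>\<^bsub>P\<^esub> g \<psi>" if "\<phi> \<in> carrier ?Y" "\<psi> \<in> carrier ?Y" for \<phi> \<psi>
  proof -
    interpret Y: abelian_group ?Y using Y by (rule left_module_imp_abelian_group)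
    let ?J = "{j. \<phi> j \<noteq> \<zero>\<^bsub>R\<^esub>} \<union> {j. \<psi> j \<noteq> \<zero>\<^bsub>R\<^esub>}"
    have J: "finite ?J" "?J \<subseteq> carrier P" and c: "\<phi> j \<in> carrier R" "\<psi> j \<in> carrier R" for j
      using that by (auto simp: free_module_def)
    have s: "\<phi> \<oplus>\<^bsub>?Y\<^esub> \<psi> = (\<lambda>j. \<phi> j \<oplus>\<^bsub>R\<^esub> \<psi> j)" by (simp add: free_module_def)
    have "g (\<phi> \<oplus>\<^bsub>?Y\<^esub> \<psi>) = (\<Oplus>\<^bsub>P\<^esub>j\<in>?J. (\<phi> \<oplus>\<^bsub>?Y\<^esub> \<psi>) j \<odot>\<^bsub>P\<^esub> j)"
      using J that by (intro g_eq Y.a_closed) (auto simp: s)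
    also have "\<dots> = (\<Oplus>\<^bsub>P\<^esub>j\<in>?J. \<phi> j \<odot>\<^bsub>P\<^esub> j \<oplus>\<^bsub>P\<^esub> \<psi> j \<odot>\<^bsub>P\<^esub> j)"
      using J(2) c by (intro P.M.finsum_cong') (auto simp: s P.lsmult_l_distr P.lsmult_closed subset_iff)
    also have "\<dots> = (\<Oplus>\<^bsub>P\<^esub>j\<in>?J. \<phi> j \<odot>\<^bsub>P\<^esub> j) \<oplus>\<^bsub>P\<^esub> (\<Oplus>\<^bsub>P\<^esub>j\<in>?J. \<psi> j \<odot>\<^bsub>P\<^esub> j)"
      using J(2) c by (intro P.M.finsum_addf) (auto simp: P.lsmult_closed subset_iff)
    also have "\<dots> = g \<phi> \<oplus>\<^bsub>P\<^esub> g \<psi>" using g_eq[OF that(1) J] g_eq[OF that(2) J] by simp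
    finally show ?thesis .
  qed
  have g_closed: "g \<phi> \<in> carrier P" if "\<phi> \<in> carrier ?Y" for \<phi>
    unfolding g_def using that
    by (intro P.M.finsum_closed) (auto simp: free_module_def P.lsmult_closed)
  have g_smult: "g (a \<odot>\<^bsub>?Y\<^esub> \<phi>) = a \<odot>\<^bsub>P\<^esub> g \<phi>" if a: "a \<in> carrier R" and \<phi>: "\<phi> \<in> carrier ?Y" for a \<phi>
  proof -
    let ?J = "{j. \<phi> j \<noteq> \<zero>\<^bsub>R\<^esub>}"
    have J: "finite ?J" "?J \<subseteq> carrier P" and c: "\<phi> j \<in> carrier R" for j
      using \<phi> by (auto simp: free_module_def)
    have s: "a \<odot>\<^bsub>?Y\<^esub> \<phi> = (\<lambda>j. a \<otimes>\<^bsub>R\<^esub> \<phi> j)" by (simp add: free_module_def)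
    have h: "(\<lambda>x. a \<odot>\<^bsub>P\<^esub> x) \<in> additive_maps P P"
      using a by (intro additive_mapsI) (auto simp: P.lsmult_closed P.lsmult_r_distr)
    have "g (a \<odot>\<^bsub>?Y\<^esub> \<phi>) = (\<Oplus>\<^bsub>P\<^esub>j\<in>?J. (a \<odot>\<^bsub>?Y\<^esub> \<phi>) j \<odot>\<^bsub>P\<^esub> j)"
      using J a \<phi> left_module.lsmult_closed[OF Y a \<phi>] by (intro g_eq) (auto simp: s)
    also have "\<dots> = (\<Oplus>\<^bsub>P\<^esub>j\<in>?J. a \<odot>\<^bsub>P\<^esub> (\<phi> j \<odot>\<^bsub>P\<^esub> j))"
      using J(2) c a by (intro P.M.finsum_cong') (auto simp: s P.lsmult_assoc P.lsmult_closed subset_iff)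
    also have "\<dots> = a \<odot>\<^bsub>P\<^esub> (\<Oplus>\<^bsub>P\<^esub>j\<in>?J. \<phi> j \<odot>\<^bsub>P\<^esub> j)"
      using J c a by (intro additive_maps_finsum[OF P.M.abelian_group_axioms P.M.abelian_group_axioms h, symmetric])
        (auto simp: P.lsmult_closed subset_iff)
    finally show ?thesis by (simp add: g_def)
  qed
  have "g \<in> linear_maps R ?Y ?Z"
    by (auto simp: linear_maps_def g_add g_closed g_smult)
  moreover have "g ` carrier ?Y = carrier ?Z"
  proof
    show "g ` carrier ?Y \<subseteq> carrier ?Z" using g_closed by auto
    show "carrier ?Z \<subseteq> g ` carrier ?Y"
    proof
      fix x assume "x \<in> carrier ?Z"
      then have x: "x \<in> carrier P" by simp
      let ?d = "\<lambda>j. if j = x then \<one>\<^bsub>R\<^esub> else \<zero>\<^bsub>R\<^esub>"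
      have d: "?d \<in> carrier ?Y" using x by (auto simp: free_module_def)
      have "g ?d = (\<Oplus>\<^bsub>P\<^esub>j\<in>{x}. ?d j \<odot>\<^bsub>P\<^esub> j)" using x by (intro g_eq d) auto
      also have "\<dots> = x" using x by (simp add: P.lsmult_one)
      finally show "x \<in> g ` carrier ?Y" using d by (metis imageI)
    qed
  qed
  moreover have "(\<lambda>x. x) \<in> linear_maps R P ?Z" by (auto simp: linear_maps_def)
  ultimately obtain h where h: "h \<in> linear_maps R P ?Y" "\<And>x. x \<in> carrier P \<Longrightarrow> g (h x) = x"
    using proj Y Z unfolding projective_module_def by blast
  have hY: "h x \<in> carrier ?Y" if "x \<in> carrier P" for x
    using h(1) that by (auto simp: linear_maps_def)
  show ?thesis
  proof (rule that[of "\<lambda>j x. h x j"])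
    show "(\<lambda>x. h x j) \<in> linear_maps R P \<lparr>carrier = carrier R,
      mult = undefined, one = undefined, zero = \<zero>\<^bsub>R\<^esub>, add = add R, smult = mult R\<rparr>" for j
      using h(1) by (auto simp: linear_maps_def free_module_def Pi_iff)
    show "finite {j. h x j \<noteq> \<zero>\<^bsub>R\<^esub>}" "{j. h x j \<noteq> \<zero>\<^bsub>R\<^esub>} \<subseteq> carrier P" if "x \<in> carrier P" for x
      using hY[OF that] by (auto simp: free_module_def)
    show "x = (\<Oplus>\<^bsub>P\<^esub>j\<in>J. h x j \<odot>\<^bsub>P\<^esub> j)"
      if "x \<in> carrier P" "finite J" "J \<subseteq> carrier P" "{j. h x j \<noteq> \<zero>\<^bsub>R\<^esub>} \<subseteq> J" for x J
      using g_eq[OF hY[OF that(1)] that(2-4)] h(2)[OF that(1)] by simp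
  qed
qed

text \<open>The two carriers cut out by balancing equations, inside \<open>U \<otimes> U\<close> and inside \<open>U \<otimes> P\<close>, are of this
  form.\<close>

lemma abelian_group_equalizer:
  assumes "abelian_group G" "abelian_group H"
    "\<And>a. a \<in> S \<Longrightarrow> h a \<in> additive_maps G H" "\<And>a. a \<in> S \<Longrightarrow> h' a \<in> additive_maps G H"
  shows "abelian_group (G\<lparr>carrier := {c \<in> carrier G. \<forall>a\<in>S. h a c = h' a c}\<rparr>)"
proof -
  interpret G: abelian_group G by fact
  interpret H: abelian_group H by fact
  have neg: "f (\<ominus>\<^bsub>G\<^esub> x) = \<ominus>\<^bsub>H\<^esub> f x" if "f \<in> additive_maps G H" "x \<in> carrier G" for f x
  proof -
    have "f (\<ominus>\<^bsub>G\<^esub> x) \<oplus>\<^bsub>H\<^esub> f x = \<zero>\<^bsub>H\<^esub>"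
      using additive_maps_add[OF that(1), of "\<ominus>\<^bsub>G\<^esub> x" x] that(2) additive_maps_zero[OF assms(1,2) that(1)]
      by (simp add: G.l_neg)
    then show ?thesis
      using additive_maps_closed[OF that(1)] that(2) by (intro H.minus_equality[symmetric]) auto
  qed
  show ?thesis
    by (rule abelian_groupI)
      (auto simp: G.a_ac additive_maps_add[OF assms(3)] additive_maps_add[OF assms(4)]
        additive_maps_zero[OF assms(1,2) assms(3)] additive_maps_zero[OF assms(1,2) assms(4)]
        neg[OF assms(3)] neg[OF assms(4)]
        intro!: exI[of _ "\<ominus>\<^bsub>G\<^esub> x" for x] G.r_neg)
qed

lemma list_sum_carrier_update [simp]:
  "list_sum (G\<lparr>carrier := S\<rparr>) = list_sum G"
  by (intro ext) (simp add: list_sum_def)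

lemma sweedler_carrier_update [simp]: "sweedler T (G\<lparr>carrier := S\<rparr>) = sweedler T G"
  by (intro ext) (simp add: sweedler_def)

section \<open>The element \<open>u\<^bsub>(1)\<^esub> \<otimes> (u\<^bsub>(2)+\<^esub> \<otimes> u\<^bsub>(2)-\<^esub>)\<close>\<close>

context left_bialgebroid
begin

lemma UopU_lblack_additive:
  "a \<in> carrier A \<Longrightarrow> sweedler (UopU B) (UopU B) (\<lambda>v y. v \<boxtimes>\<^bsub>UopU B\<^esub> lblack B a y) \<in> additive_maps (UopU B) (UopU B)"
  using UopU_rmult_additive[of "t a"] by (simp add: UopU_rmult_def)

lemma UopU_rwhite_additive:
  "a \<in> carrier A \<Longrightarrow> sweedler (UopU B) (UopU B) (\<lambda>v y. rwhite B v a \<boxtimes>\<^bsub>UopU B\<^esub> y) \<in> additive_maps (UopU B) (UopU B)"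
  using UopU_tgt_additive by simp

lemma UopU_balanced_ab [simp]: "abelian_group (UopU_balanced B)"
  unfolding UopU_balanced_def
  by (rule abelian_group_equalizer[OF UopU_ab UopU_ab UopU_rwhite_additive UopU_lblack_additive])

lemma UopU_balanced_simps [simp]:
  "add (UopU_balanced B) = add (UopU B)" "zero (UopU_balanced B) = zero (UopU B)"
  "sweedler T (UopU_balanced B) = sweedler T (UopU B)"
  by (simp_all add: UopU_balanced_def)

lemma UopU_balanced_iff: "c \<in> carrier (UopU_balanced B) \<longleftrightarrow> c \<in> carrier (UopU B) \<and>
    (\<forall>a\<in>carrier A. sweedler (UopU B) (UopU B) (\<lambda>v y. (t a \<cdot> v) \<boxtimes>\<^bsub>UopU B\<^esub> y) c = UopU_rmult (t a) c)"
  by (simp add: UopU_balanced_def UopU_rmult_def)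

lemma UopU_balancedD:
  assumes "abelian_group G" "balL G q" "c \<in> carrier (UopU_balanced B)" "a \<in> carrier A"
  shows "sweedler (UopU B) G (\<lambda>v y. q (t a \<cdot> v) y) c = sweedler (UopU B) G (\<lambda>v y. q v (y \<cdot> t a)) c"
  using sweedler_push[OF UopU_tensor UopU_tensor assms(1,2), of c "\<lambda>v y. t a \<cdot> v" "\<lambda>v y. y"]
    sweedler_push[OF UopU_tensor UopU_tensor assms(1,2), of c "\<lambda>v y. v" "\<lambda>v y. y \<cdot> t a"] assms(3,4)
  by (simp add: UopU_balanced_iff UopU_rmult_def)

lemma UopU_left_balanced:
  assumes a: "a \<in> carrier A" and c: "c \<in> carrier (UopU_balanced B)"
  shows "UopU_left B a c \<in> carrier (UopU_balanced B)"
proof -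
  have c': "c \<in> carrier (UopU B)" using c by (simp add: UopU_balanced_iff)
  have "sweedler (UopU B) (UopU B) (\<lambda>v y. (t b \<cdot> v) \<boxtimes>\<^bsub>UopU B\<^esub> y) (UopU_left B a c) =
      UopU_rmult (t b) (UopU_left B a c)" if b: "b \<in> carrier A" for b
  proof -
    have "sweedler (UopU B) (UopU B) (\<lambda>v y. (t b \<cdot> v) \<boxtimes>\<^bsub>UopU B\<^esub> y) (UopU_left B a c) =
        sweedler (UopU B) (UopU B) (\<lambda>v y. (t b \<cdot> (s a \<cdot> v)) \<boxtimes>\<^bsub>UopU B\<^esub> y) c"
      unfolding UopU_left_def using a b c'
      by (simp, subst sweedler_push[OF UopU_tensor UopU_tensor UopU_ab UopU_tgt_bal]) auto
    also have "\<dots> = sweedler (UopU B) (UopU B) (\<lambda>v y. (s a \<cdot> (t b \<cdot> v)) \<boxtimes>\<^bsub>UopU B\<^esub> y) c"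
      using a b by (intro sweedler_congT[OF UopU_tensor c']) (simp add: ts_left)
    also have "\<dots> = sweedler (UopU B) (UopU B) (\<lambda>v y. (s a \<cdot> v) \<boxtimes>\<^bsub>UopU B\<^esub> (y \<cdot> t b)) c"
      by (rule UopU_balancedD[OF UopU_ab UopU_left_bal[OF a] c b])
    also have "\<dots> = UopU_rmult (t b) (UopU_left B a c)"
      unfolding UopU_left_def UopU_rmult_def using a b c' UopU_rmult_bal[of "t b"]
      by (simp, subst sweedler_push[OF UopU_tensor UopU_tensor UopU_ab]) auto
    finally show ?thesis .
  qed
  then show ?thesis using a c' by (simp add: UopU_balanced_iff)
qed

lemma U_balanced_tensor:
  "is_tensor (U_balanced B) (carrier A) U (rwhite B) (UopU_left B) (UopU_balanced B)"
  by (simp add: is_tensor_def tensor_data_def U_balanced_def UopU_left_balanced)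

lemma UUopU_tensor: "is_tensor (UUopU B) (carrier A) U (rwhite B) (UopU_left B) (UopU B)"
  by (simp add: is_tensor_def tensor_data_def UUopU_def)

lemmas U_balanced_ab [simp] = tensor_abelian_group[OF U_balanced_tensor]
lemmas UUopU_ab [simp] = tensor_abelian_group[OF UUopU_tensor]

lemma UopU_balanced_closed: "c \<in> carrier (UopU_balanced B) \<Longrightarrow> c \<in> carrier (UopU B)"
  by (simp add: UopU_balanced_iff)

lemma balanced_incl_bal: "balanced (carrier A) U (rwhite B) (UopU_left B) (UopU_balanced B) (UUopU B)
    (\<lambda>w c. w \<boxtimes>\<^bsub>UUopU B\<^esub> c)"
  using pure_balanced[OF UUopU_tensor] by (auto simp: balanced_def UopU_balanced_closed)

lemma balanced_incl_additive: "balanced_incl B \<in> additive_maps (U_balanced B) (UUopU B)"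
  unfolding balanced_incl_def by (rule sweedler_additive[OF U_balanced_tensor UUopU_ab balanced_incl_bal])

lemma balanced_incl_pure: "w \<in> carrier U \<Longrightarrow> c \<in> carrier (UopU_balanced B) \<Longrightarrow>
    balanced_incl B (w \<boxtimes>\<^bsub>U_balanced B\<^esub> c) = w \<boxtimes>\<^bsub>UUopU B\<^esub> c"
  unfolding balanced_incl_def by (rule sweedler_pure[OF U_balanced_tensor UUopU_ab balanced_incl_bal])

lemma UopU_left_add: "a \<in> carrier A \<Longrightarrow> b \<in> carrier A \<Longrightarrow> c \<in> carrier (UopU B) \<Longrightarrow>
    UopU_left B (a \<oplus>\<^bsub>A\<^esub> b) c = UopU_left B a c \<oplus>\<^bsub>UopU B\<^esub> UopU_left B b c"
  unfolding UopU_left_def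
  by (subst sweedler_fun_add[OF UopU_tensor UopU_ab, symmetric])
    (auto simp: distribs UopU_pure_add_left intro!: sweedler_congT[OF UopU_tensor])

lemma UopU_left_mult: "a \<in> carrier A \<Longrightarrow> b \<in> carrier A \<Longrightarrow> c \<in> carrier (UopU B) \<Longrightarrow>
    UopU_left B (a \<otimes>\<^bsub>A\<^esub> b) c = UopU_left B a (UopU_left B b c)"
  by (rule tensor_ext[OF UopU_tensor UopU_ab UopU_left_additive
        additive_maps_comp[OF UopU_left_additive[of b] UopU_left_additive[of a]]])
    (auto simp: s_mult U.m_assoc)

text \<open>An instance of flatness of \<open>U\<^sub>\<triangleleft>\<close>. Let \<open>j, g\<^sub>j\<close> be a dual basis of \<open>U\<^sub>\<triangleleft>\<close> and \<open>F\<close> the carrier of \<open>UopU_balanced\<close>. An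
  element \<open>d\<close> of \<open>U \<otimes> F\<close> is \<open>\<Sum>\<^sub>j j \<otimes> (g\<^sub>j \<otimes> id)(d)\<close>, and the second factor only depends on the image of \<open>d\<close>
  in \<open>U \<otimes> (U \<otimes> U)\<close>.\<close>

lemma balanced_incl_inj:
  assumes proj: "projective_module (opposite A) (U_right B)"
  shows "inj_on (balanced_incl B) (carrier (U_balanced B))"
proof (rule inj_onI)
  let ?T = "U_balanced B" and ?F = "UopU_balanced B"
  interpret T: abelian_group ?T by simp
  obtain f :: "'u \<Rightarrow> 'u \<Rightarrow> 'a" where f: "\<And>j. f j \<in> linear_maps (opposite A) (U_right B)
      \<lparr>carrier = carrier (opposite A), mult = undefined, one = undefined, zero = \<zero>\<^bsub>opposite A\<^esub>,
        add = add (opposite A), smult = mult (opposite A)\<rparr>"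
    "\<And>x. x \<in> carrier (U_right B) \<Longrightarrow> finite {j. f j x \<noteq> \<zero>\<^bsub>opposite A\<^esub>}"
    "\<And>x. x \<in> carrier (U_right B) \<Longrightarrow> {j. f j x \<noteq> \<zero>\<^bsub>opposite A\<^esub>} \<subseteq> carrier (U_right B)"
    "\<And>x J. x \<in> carrier (U_right B) \<Longrightarrow> finite J \<Longrightarrow> J \<subseteq> carrier (U_right B) \<Longrightarrow>
      {j. f j x \<noteq> \<zero>\<^bsub>opposite A\<^esub>} \<subseteq> J \<Longrightarrow> x = (\<Oplus>\<^bsub>U_right B\<^esub>j\<in>J. f j x \<odot>\<^bsub>U_right B\<^esub> j)"
    using dual_basis[OF proj] by blast
  have f_simps: "x \<in> carrier U \<Longrightarrow> f j x \<in> carrier A"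
    "x \<in> carrier U \<Longrightarrow> y \<in> carrier U \<Longrightarrow> f j (x \<oplus>\<^bsub>U\<^esub> y) = f j x \<oplus>\<^bsub>A\<^esub> f j y"
    "a \<in> carrier A \<Longrightarrow> x \<in> carrier U \<Longrightarrow> f j (t a \<cdot> x) = f j x \<otimes>\<^bsub>A\<^esub> a" for a x y j
    using f(1)[of j] by (auto simp: linear_maps_def opposite_def U_right_def Pi_iff)
  have f_fin: "finite {j. f j x \<noteq> \<zero>\<^bsub>A\<^esub>}" "{j. f j x \<noteq> \<zero>\<^bsub>A\<^esub>} \<subseteq> carrier U" if "x \<in> carrier U" for x
    using f(2,3)[of x] that by (auto simp: opposite_def U_right_def)
  have f_sum: "x = (\<Oplus>\<^bsub>U\<^esub>j\<in>J. t (f j x) \<cdot> j)"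
    if "x \<in> carrier U" "finite J" "J \<subseteq> carrier U" "{j. f j x \<noteq> \<zero>\<^bsub>A\<^esub>} \<subseteq> J" for x J
  proof -
    have "abelian_group (U_right B)"
      using proj left_module_imp_abelian_group unfolding projective_module_def by blast
    moreover have "(\<lambda>x. x) \<in> additive_maps (U_right B) U"
      by (rule additive_mapsI) (simp_all add: U_right_def)
    ultimately have "(\<Oplus>\<^bsub>U_right B\<^esub>j\<in>J. t (f j x) \<cdot> j) = (\<Oplus>\<^bsub>U\<^esub>j\<in>J. t (f j x) \<cdot> j)"
      using that by (intro additive_maps_finsum[of "U_right B" U "\<lambda>x. x"]) (auto simp: U_right_def f_simps)
    then show ?thesis using f(4)[of x J] that by (simp add: opposite_def U_right_def)
  qed
  have bf: "balanced (carrier A) U (rwhite B) (UopU_left B) (UopU B) (UopU B) (\<lambda>w c. UopU_left B (f j w) c)" for j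
    by (rule balancedI) (simp_all add: f_simps UopU_left_add UopU_left_mult additive_maps_add[OF UopU_left_additive])
  \<comment> \<open>The right hand side depends on \<open>d\<close> only through its image.\<close>
  have expand: "d = (\<Oplus>\<^bsub>?T\<^esub>j\<in>J. j \<boxtimes>\<^bsub>?T\<^esub> sweedler (UUopU B) (UopU B) (\<lambda>w c. UopU_left B (f j w) c) (balanced_incl B d))"
    if d: "d \<in> carrier ?T" and J: "finite J" "J \<subseteq> carrier U"
      "\<And>w c. (w, c) \<in> set (representative ?T d) \<Longrightarrow> {j. f j w \<noteq> \<zero>\<^bsub>A\<^esub>} \<subseteq> J" for d J
  proof -
    have "d = sweedler ?T ?T (\<lambda>w c. w \<boxtimes>\<^bsub>?T\<^esub> c) d" by (rule sweedler_id[OF U_balanced_tensor d, symmetric])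
    also have "\<dots> = sweedler ?T ?T (\<lambda>w c. \<Oplus>\<^bsub>?T\<^esub>j\<in>J. j \<boxtimes>\<^bsub>?T\<^esub> UopU_left B (f j w) c) d"
    proof (rule sweedler_cong)
      fix w c assume wc: "(w, c) \<in> set (representative ?T d)"
      note [simp] = representativeD[OF U_balanced_tensor d wc]
      have "w \<boxtimes>\<^bsub>?T\<^esub> c = (\<Oplus>\<^bsub>U\<^esub>j\<in>J. t (f j w) \<cdot> j) \<boxtimes>\<^bsub>?T\<^esub> c"
        using f_sum[of w J] J wc by simp
      also have "\<dots> = (\<Oplus>\<^bsub>?T\<^esub>j\<in>J. (t (f j w) \<cdot> j) \<boxtimes>\<^bsub>?T\<^esub> c)"
        using J by (intro additive_maps_finsum[OF U_ab U_balanced_ab balanced_additive_left[OF pure_balanced[OF U_balanced_tensor]]])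
          (auto simp: f_simps subset_iff)
      also have "\<dots> = (\<Oplus>\<^bsub>?T\<^esub>j\<in>J. j \<boxtimes>\<^bsub>?T\<^esub> UopU_left B (f j w) c)"
        using J pure_move[OF U_balanced_tensor, of "f j w" j c for j] pure_closed[OF U_balanced_tensor]
        by (intro T.finsum_cong') (auto simp: f_simps subset_iff UopU_left_balanced)
      finally show "w \<boxtimes>\<^bsub>?T\<^esub> c = (\<Oplus>\<^bsub>?T\<^esub>j\<in>J. j \<boxtimes>\<^bsub>?T\<^esub> UopU_left B (f j w) c)" .
    qed
    also have "\<dots> = (\<Oplus>\<^bsub>?T\<^esub>j\<in>J. sweedler ?T ?T (\<lambda>w c. j \<boxtimes>\<^bsub>?T\<^esub> UopU_left B (f j w) c) d)"
      using J(1,2) d by (intro sweedler_finsum[OF U_balanced_tensor])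
        (auto intro!: pure_closed[OF U_balanced_tensor] UopU_left_balanced f_simps)
    also have "\<dots> = (\<Oplus>\<^bsub>?T\<^esub>j\<in>J. j \<boxtimes>\<^bsub>?T\<^esub> sweedler (UUopU B) (UopU B) (\<lambda>w c. UopU_left B (f j w) c) (balanced_incl B d))"
    proof (rule T.finsum_cong'[OF refl])
      have cl: "sweedler ?T ?F (\<lambda>w c. UopU_left B (f j w) c) d \<in> carrier ?F" for j
        by (rule sweedler_closed[OF U_balanced_tensor UopU_balanced_ab d]) (simp add: UopU_left_balanced f_simps)
      have incl: "sweedler ?T ?F (\<lambda>w c. UopU_left B (f j w) c) d =
          sweedler (UUopU B) (UopU B) (\<lambda>w c. UopU_left B (f j w) c) (balanced_incl B d)" for j
        unfolding balanced_incl_def using d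
        by (subst sweedler_push[OF U_balanced_tensor UUopU_tensor UopU_ab bf])
          (auto simp: UopU_balanced_closed)
      show "(\<lambda>j. j \<boxtimes>\<^bsub>?T\<^esub> sweedler (UUopU B) (UopU B) (\<lambda>w c. UopU_left B (f j w) c) (balanced_incl B d)) \<in> J \<rightarrow> carrier ?T"
        using J(2) cl unfolding incl by (auto intro!: pure_closed[OF U_balanced_tensor])
      show "sweedler ?T ?T (\<lambda>w c. j \<boxtimes>\<^bsub>?T\<^esub> UopU_left B (f j w) c) d =
          j \<boxtimes>\<^bsub>?T\<^esub> sweedler (UUopU B) (UopU B) (\<lambda>w c. UopU_left B (f j w) c) (balanced_incl B d)" if "j \<in> J" for j
        unfolding incl[symmetric] using that J(2)
        by (intro sweedler_hom[OF U_balanced_tensor UopU_balanced_ab U_balanced_ab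
              balanced_additive_right[OF pure_balanced[OF U_balanced_tensor]] d, symmetric])
          (auto simp: UopU_left_balanced f_simps)
    qed
    finally show ?thesis .
  qed
  let ?supp = "\<lambda>d. \<Union>p\<in>set (representative ?T d). {j. f j (fst p) \<noteq> \<zero>\<^bsub>A\<^esub>}"
  have supp: "finite (?supp d)" "?supp d \<subseteq> carrier U" if d: "d \<in> carrier ?T" for d
  proof -
    have "finite {j. f j (fst p) \<noteq> \<zero>\<^bsub>A\<^esub>} \<and> {j. f j (fst p) \<noteq> \<zero>\<^bsub>A\<^esub>} \<subseteq> carrier U"
      if "p \<in> set (representative ?T d)" for p
      using f_fin[of "fst p"] representativeD(1)[OF U_balanced_tensor d, of "fst p" "snd p"] that by simp
    then show "finite (?supp d)" "?supp d \<subseteq> carrier U" by blast+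
  qed
  fix d e assume d: "d \<in> carrier ?T" and e: "e \<in> carrier ?T" and eq: "balanced_incl B d = balanced_incl B e"
  \<comment> \<open>One index set for both elements, so that equal images give equal expansions.\<close>
  let ?J = "?supp d \<union> ?supp e"
  have J: "finite ?J" "?J \<subseteq> carrier U" using supp[OF d] supp[OF e] by simp_all
  have Jd: "{j. f j w \<noteq> \<zero>\<^bsub>A\<^esub>} \<subseteq> ?J" if "(w, c) \<in> set (representative ?T d)" for w c
    using that by force
  have Je: "{j. f j w \<noteq> \<zero>\<^bsub>A\<^esub>} \<subseteq> ?J" if "(w, c) \<in> set (representative ?T e)" for w c
    using that by force
  show "d = e"
    by (subst expand[OF d J Jd], assumption, subst expand[OF e J Je], assumption, simp add: eq)
qed

end

context left_hopf_algebroid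
begin

lemma transl_l_balanced: "u \<in> carrier U \<Longrightarrow> transl_l B u \<in> carrier (UopU_balanced B)"
  by (simp add: UopU_balanced_iff transl_l_tgt)

lemma tau_left:
  "a \<in> carrier A \<Longrightarrow> c \<in> carrier (UU B) \<Longrightarrow> tau (UX_left B (U_left B) a c) = UopU_left B a (tau c)"
  by (rule alpha_l_inj) (simp_all add: alpha_tau alpha_l_left left_module_U_left)

lemma UUopU_tau_balanced3:
  assumes y: "y \<in> carrier U"
  shows "balanced3 (U_left B) (UUopU B) (\<lambda>p1 p2 q. p1 \<boxtimes>\<^bsub>UUopU B\<^esub> tau (p2 \<boxtimes>\<^bsub>UU B\<^esub> (q \<cdot> y)))"
proof (rule balanced3I)
  show "(t a \<cdot> u) \<boxtimes>\<^bsub>UUopU B\<^esub> tau (v \<boxtimes>\<^bsub>UU B\<^esub> (n \<cdot> y)) = u \<boxtimes>\<^bsub>UUopU B\<^esub> tau ((s a \<cdot> v) \<boxtimes>\<^bsub>UU B\<^esub> (n \<cdot> y))"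
    if "a \<in> carrier A" "u \<in> carrier U" "v \<in> carrier U" "n \<in> carrier (U_left B)" for a u v n
    using that y pure_move[OF UUopU_tensor, of a u "tau (v \<boxtimes>\<^bsub>UU B\<^esub> (n \<cdot> y))"]
      tau_left[of a "v \<boxtimes>\<^bsub>UU B\<^esub> (n \<cdot> y)"] by (simp add: left_module_U_left)
qed (use y in \<open>simp_all add: distribs UU_pure_add_left UU_pure_add_right UU_move U.m_assoc
      additive_maps_add[OF tau_additive] pure_closed[OF UUopU_tensor] pure_add_left[OF UUopU_tensor]
      pure_add_right[OF UUopU_tensor]\<close>)

text \<open>\<open>u\<^bsub>+(1)\<^esub> \<otimes> (u\<^bsub>+(2)\<^esub> \<otimes> u\<^sub>-) = u\<^bsub>(1)\<^esub> \<otimes> (u\<^bsub>(2)+\<^esub> \<otimes> u\<^bsub>(2)-\<^esub>)\<close>: after \<open>id \<otimes> \<alpha>\<^sub>\<ell>\<close> both sides become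
  \<open>u\<^bsub>(1)\<^esub> \<otimes> (u\<^bsub>(2)\<^esub> \<otimes> 1)\<close>, the first one by coassociativity.\<close>

lemma lsum_comul:
  assumes u: "u \<in> carrier U"
  shows "lsum (UUopU B) (\<lambda>x y. dsum (UUopU B) (\<lambda>x1 x2. x1 \<boxtimes>\<^bsub>UUopU B\<^esub> (x2 \<boxtimes>\<^bsub>UopU B\<^esub> y)) x) u =
    dsum (UUopU B) (\<lambda>u1 u2. u1 \<boxtimes>\<^bsub>UUopU B\<^esub> transl_l B u2) u"
proof -
  let ?W = "UUopU B"
  \<comment> \<open>\<open>?X\<close> is \<open>p \<otimes> q \<mapsto> p\<^bsub>(1)\<^esub> \<otimes> \<alpha>\<^sub>\<ell>\<^sup>-\<^sup>1(p\<^bsub>(2)\<^esub> \<otimes> q)\<close>; the factor \<open>1\<close> makes the instance of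
    \<open>UUopU_tau_balanced3\<close> apply.\<close>
  let ?X = "sweedler (UU B) ?W (\<lambda>p q. dsum ?W (\<lambda>p1 p2. p1 \<boxtimes>\<^bsub>?W\<^esub> tau (p2 \<boxtimes>\<^bsub>UU B\<^esub> (q \<cdot> \<one>\<^bsub>U\<^esub>))) p)"
  note b = balanced3_dsum[OF UUopU_ab UUopU_tau_balanced3[OF U.one_closed] left_module_U_left]
  note h = sweedler_additive[OF UU_tensor UUopU_ab b]
  have "lsum ?W (\<lambda>x y. dsum ?W (\<lambda>x1 x2. x1 \<boxtimes>\<^bsub>?W\<^esub> (x2 \<boxtimes>\<^bsub>UopU B\<^esub> y)) x) u = ?X (alpha_l B (transl_l B u))"
  proof (rule sweedler_eq_hom[OF UopU_tensor UUopU_ab additive_maps_comp[OF alpha_l_additive h]])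
    fix x y assume xy: "x \<in> carrier U" "y \<in> carrier U"
    have "?X (alpha_l B (x \<boxtimes>\<^bsub>UopU B\<^esub> y)) =
        dsum ?W (\<lambda>x1 x2. dsum ?W (\<lambda>p1 p2. p1 \<boxtimes>\<^bsub>?W\<^esub> tau (p2 \<boxtimes>\<^bsub>UU B\<^esub> (x2 \<cdot> y \<cdot> \<one>\<^bsub>U\<^esub>))) x1) x"
      unfolding alpha_l_pure[OF xy] using xy
      by (subst sweedler_push[OF UU_tensor UU_tensor UUopU_ab b]) auto
    also have "\<dots> = dsum ?W (\<lambda>x1 x2. dsum ?W (\<lambda>p1 p2. p1 \<boxtimes>\<^bsub>?W\<^esub> tau (p2 \<boxtimes>\<^bsub>UU B\<^esub> (x2 \<cdot> y))) x1) x"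
      using xy by (intro dsum_cong) auto
    also have "\<dots> = dsum ?W (\<lambda>x1 x2. dsum ?W (\<lambda>p2 x3. x1 \<boxtimes>\<^bsub>?W\<^esub> tau (p2 \<boxtimes>\<^bsub>UU B\<^esub> (x3 \<cdot> y))) x2) x"
      by (rule dsum_coassoc[OF UUopU_ab UUopU_tau_balanced3[OF xy(2)] xy(1)])
    also have "\<dots> = dsum ?W (\<lambda>x1 x2. x1 \<boxtimes>\<^bsub>?W\<^esub> (x2 \<boxtimes>\<^bsub>UopU B\<^esub> y)) x"
    proof (rule dsum_cong[OF xy(1)])
      fix x1 x2 assume x: "x1 \<in> carrier U" "x2 \<in> carrier U"
      note hh = additive_maps_comp[OF tau_additive balanced_additive_right[OF pure_balanced[OF UUopU_tensor] x(1)]]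
      have "dsum ?W (\<lambda>p2 x3. x1 \<boxtimes>\<^bsub>?W\<^esub> tau (p2 \<boxtimes>\<^bsub>UU B\<^esub> (x3 \<cdot> y))) x2 =
          x1 \<boxtimes>\<^bsub>?W\<^esub> tau (alpha_l B (x2 \<boxtimes>\<^bsub>UopU B\<^esub> y))"
        unfolding alpha_l_pure[OF x(2) xy(2)] using x xy
        by (intro dsum_hom[OF UU_ab UUopU_ab hh, symmetric]) auto
      then show "dsum ?W (\<lambda>p2 x3. x1 \<boxtimes>\<^bsub>?W\<^esub> tau (p2 \<boxtimes>\<^bsub>UU B\<^esub> (x3 \<cdot> y))) x2 = x1 \<boxtimes>\<^bsub>?W\<^esub> (x2 \<boxtimes>\<^bsub>UopU B\<^esub> y)"
        using x xy by (simp add: tau_alpha)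
    qed
    finally show "?X (alpha_l B (x \<boxtimes>\<^bsub>UopU B\<^esub> y)) = dsum ?W (\<lambda>x1 x2. x1 \<boxtimes>\<^bsub>?W\<^esub> (x2 \<boxtimes>\<^bsub>UopU B\<^esub> y)) x" .
  qed (use u in simp)
  also have "\<dots> = dsum ?W (\<lambda>u1 u2. u1 \<boxtimes>\<^bsub>?W\<^esub> tau (u2 \<boxtimes>\<^bsub>UU B\<^esub> (\<one>\<^bsub>U\<^esub> \<cdot> \<one>\<^bsub>U\<^esub>))) u"
    using u sweedler_pure[OF UU_tensor UUopU_ab b, of u "\<one>\<^bsub>U\<^esub>"] by (simp add: alpha_transl)
  also have "\<dots> = dsum ?W (\<lambda>u1 u2. u1 \<boxtimes>\<^bsub>?W\<^esub> transl_l B u2) u"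
    using u by (intro dsum_cong) (auto simp: transl_l_tau)
  finally show ?thesis .
qed

text \<open>The lift in the definition of \<open>comul_transl_l\<close> exists by \<open>lsum_comul\<close> and is unique by
  \<open>balanced_incl_inj\<close>.\<close>

lemma comul_transl_l_eq:
  assumes proj: "projective_module (opposite A) (U_right B)" and u: "u \<in> carrier U"
  shows "comul_transl_l B u = dsum (U_balanced B) (\<lambda>u1 u2. u1 \<boxtimes>\<^bsub>U_balanced B\<^esub> transl_l B u2) u"
proof -
  let ?d = "dsum (U_balanced B) (\<lambda>u1 u2. u1 \<boxtimes>\<^bsub>U_balanced B\<^esub> transl_l B u2) u"
  have cl: "u1 \<boxtimes>\<^bsub>U_balanced B\<^esub> transl_l B u2 \<in> carrier (U_balanced B)"
    if "u1 \<in> carrier U" "u2 \<in> carrier U" for u1 u2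
    using that by (intro pure_closed[OF U_balanced_tensor] transl_l_balanced)
  have d: "?d \<in> carrier (U_balanced B)" using u cl by (intro dsum_closed) auto
  have "balanced_incl B ?d = dsum (UUopU B) (\<lambda>u1 u2. balanced_incl B (u1 \<boxtimes>\<^bsub>U_balanced B\<^esub> transl_l B u2)) u"
    using u cl by (intro dsum_hom[OF _ _ balanced_incl_additive]) auto
  also have "\<dots> = dsum (UUopU B) (\<lambda>u1 u2. u1 \<boxtimes>\<^bsub>UUopU B\<^esub> transl_l B u2) u"
    using u by (intro dsum_cong) (auto simp: balanced_incl_pure transl_l_balanced)
  finally have "comul_transl_l B u = inv_into (carrier (U_balanced B)) (balanced_incl B) (balanced_incl B ?d)"
    by (simp add: comul_transl_l_def lsum_comul[OF u])
  then show ?thesis using inv_into_f_f[OF balanced_incl_inj[OF proj] d] by simp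
qed

end

section \<open>Anti Yetter-Drinfel'd modules\<close>

locale aYD_module = left_hopf_algebroid k B
  for k :: "('k, 'r) ring_scheme" and B :: "('k, 'a, 'u) bialgebroid" +
  fixes M :: "('a, 'u, 'v) ucomodule" and act :: "('a, 'v) univ \<Rightarrow> 'u \<Rightarrow> ('a, 'v) univ"
  assumes proj_right: "projective_module (opposite A) (U_right B)"
    and aYD: "anti_Yetter_Drinfeld B M act"
begin

lemma M [simp]: "left_comodule B M"
  using aYD by (rule anti_Yetter_Drinfeld.axioms)

lemmas actD = anti_Yetter_Drinfeld.act_closed[OF aYD] anti_Yetter_Drinfeld.act_add_left[OF aYD]
  anti_Yetter_Drinfeld.act_add_right[OF aYD] anti_Yetter_Drinfeld.act_mult[OF aYD]
  anti_Yetter_Drinfeld.act_one[OF aYD]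

lemma act_closed [simp]: "m \<in> carrier M \<Longrightarrow> u \<in> carrier U \<Longrightarrow> act m u \<in> carrier M"
  and act_one [simp]: "m \<in> carrier M \<Longrightarrow> act m \<one>\<^bsub>U\<^esub> = m"
  by (simp_all add: actD)

lemmas act_add = actD(2,3)
lemmas act_mult = actD(4)

lemma act_t: "m \<in> carrier M \<Longrightarrow> a \<in> carrier A \<Longrightarrow> act m (t a) = a \<odot>\<^bsub>M\<^esub> m"
  using anti_Yetter_Drinfeld.act_bimodule[OF aYD, of m a "\<one>\<^bsub>A\<^esub>"] by simp

lemma act_s: "m \<in> carrier M \<Longrightarrow> a \<in> carrier A \<Longrightarrow> act m (s a) = right_act B M m a"
  using anti_Yetter_Drinfeld.act_bimodule[OF aYD, of m "\<one>\<^bsub>A\<^esub>" a] by simp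

lemma act_t_mult: "m \<in> carrier M \<Longrightarrow> a \<in> carrier A \<Longrightarrow> u \<in> carrier U \<Longrightarrow>
    act m (t a \<cdot> u) = act (a \<odot>\<^bsub>M\<^esub> m) u"
  by (simp add: act_mult act_t)

lemma act_s_mult: "m \<in> carrier M \<Longrightarrow> a \<in> carrier A \<Longrightarrow> u \<in> carrier U \<Longrightarrow>
    act m (s a \<cdot> u) = act (right_act B M m a) u"
  by (simp add: act_mult act_s)

lemma act_mult_t: "m \<in> carrier M \<Longrightarrow> a \<in> carrier A \<Longrightarrow> u \<in> carrier U \<Longrightarrow>
    act m (u \<cdot> t a) = a \<odot>\<^bsub>M\<^esub> act m u"
  by (simp add: act_mult act_t)

abbreviation W where "W \<equiv> UX B M"

lemma W_ab [simp]: "abelian_group W" by simp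

text \<open>The summand of the anti Yetter-Drinfel'd condition, with the sum over \<open>c = \<Sum> v \<otimes> y\<close> inside the sum over the
  coaction of \<open>m\<close>: for \<open>c\<close> in \<open>UopU_balanced\<close> it is a balanced function of \<open>x\<close> and \<open>m\<close>, to which coassociativity
  and colinearity can be applied.\<close>

definition phi where
  "phi w c x m = sweedler (UopU B) W (\<lambda>v y. (y \<cdot> x \<cdot> w) \<boxtimes>\<^bsub>W\<^esub> act m v) c"

lemma phi_balL: "x \<in> carrier U \<Longrightarrow> w \<in> carrier U \<Longrightarrow> m \<in> carrier M \<Longrightarrow>
    balL W (\<lambda>v y. (y \<cdot> x \<cdot> w) \<boxtimes>\<^bsub>W\<^esub> act m v)"
  by (rule balLI)
    (simp_all add: distribs act_add act_mult_t UX_pure_add_left UX_pure_add_right U.m_assoc UX_move)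

lemma phi_bal:
  assumes w: "w \<in> carrier U" and c: "c \<in> carrier (UopU_balanced B)"
  shows "bal M W (phi w c)"
proof (rule balI)
  have c' [simp]: "c \<in> carrier (UopU B)" using c by (rule UopU_balanced_closed)
  show "phi w c (t a \<cdot> x) m = phi w c x (a \<odot>\<^bsub>M\<^esub> m)"
    if a: "a \<in> carrier A" and x: "x \<in> carrier U" and m: "m \<in> carrier M" for a x m
  proof -
    have "phi w c (t a \<cdot> x) m = sweedler (UopU B) W (\<lambda>v y. (y \<cdot> t a \<cdot> x \<cdot> w) \<boxtimes>\<^bsub>W\<^esub> act m v) c"
      unfolding phi_def using a x w by (intro sweedler_congT[OF UopU_tensor c']) (simp add: U.m_assoc)
    also have "\<dots> = sweedler (UopU B) W (\<lambda>v y. (y \<cdot> x \<cdot> w) \<boxtimes>\<^bsub>W\<^esub> act m (t a \<cdot> v)) c"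
      by (rule UopU_balancedD[OF W_ab phi_balL[OF x w m] c a, symmetric])
    also have "\<dots> = phi w c x (a \<odot>\<^bsub>M\<^esub> m)"
      unfolding phi_def using a m by (intro sweedler_congT[OF UopU_tensor c']) (simp add: act_t_mult)
    finally show ?thesis .
  qed
  show "phi w c x m \<in> carrier W" if "x \<in> carrier U" "m \<in> carrier M" for x m
    unfolding phi_def using that w by (intro sweedler_closed[OF UopU_tensor]) auto
  show "phi w c (x \<oplus>\<^bsub>U\<^esub> x') m = phi w c x m \<oplus>\<^bsub>W\<^esub> phi w c x' m"
    if "x \<in> carrier U" "x' \<in> carrier U" "m \<in> carrier M" for x x' m
    unfolding phi_def using that w
    by (subst sweedler_fun_add[OF UopU_tensor W_ab c', symmetric])
      (auto simp: distribs UX_pure_add_left intro!: sweedler_congT[OF UopU_tensor])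
  show "phi w c x (m \<oplus>\<^bsub>M\<^esub> m') = phi w c x m \<oplus>\<^bsub>W\<^esub> phi w c x m'"
    if "x \<in> carrier U" "m' \<in> carrier M" "m \<in> carrier M" for x m m'
    unfolding phi_def using that w
    by (subst sweedler_fun_add[OF UopU_tensor W_ab c', symmetric])
      (auto simp: act_add UX_pure_add_right intro!: sweedler_congT[OF UopU_tensor])
qed

text \<open>Moving \<open>t(a)\<close> from \<open>w\<close> to \<open>c\<close> uses the Takeuchi property of the coaction on \<open>M\<close>.\<close>

lemma phi_balanced:
  assumes m: "m \<in> carrier M"
  shows "balanced (carrier A) U (rwhite B) (UopU_left B) (UopU_balanced B) W (\<lambda>w c. csum M W (phi w c) m)"
proof (rule balancedI)
  note cl = balancedD(1)[OF phi_bal]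
  show "csum M W (phi w c) m \<in> carrier W" if "w \<in> carrier U" "c \<in> carrier (UopU_balanced B)" for w c
    using that cl m by (intro csum_closed[OF M]) auto
  show "csum M W (phi (w \<oplus>\<^bsub>U\<^esub> w') c) m = csum M W (phi w c) m \<oplus>\<^bsub>W\<^esub> csum M W (phi w' c) m"
    if w: "w \<in> carrier U" "w' \<in> carrier U" and c: "c \<in> carrier (UopU_balanced B)" for w w' c
  proof -
    have "phi (w \<oplus>\<^bsub>U\<^esub> w') c x m = phi w c x m \<oplus>\<^bsub>W\<^esub> phi w' c x m"
      if "x \<in> carrier U" "m \<in> carrier M" for x m
      unfolding phi_def using that w c UopU_balanced_closed[OF c]
      by (subst sweedler_fun_add[OF UopU_tensor W_ab, symmetric])
        (auto simp: distribs UX_pure_add_left intro!: sweedler_congT[OF UopU_tensor])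
    then show ?thesis
      using m w c cl by (subst csum_fun_add[OF M W_ab, symmetric]) (auto intro!: csum_cong[OF M])
  qed
  show "csum M W (phi w (c \<oplus>\<^bsub>UopU_balanced B\<^esub> c')) m = csum M W (phi w c) m \<oplus>\<^bsub>W\<^esub> csum M W (phi w c') m"
    if w: "w \<in> carrier U" and c: "c \<in> carrier (UopU_balanced B)" "c' \<in> carrier (UopU_balanced B)" for w c c'
  proof -
    have "phi w (c \<oplus>\<^bsub>UopU_balanced B\<^esub> c') x m = phi w c x m \<oplus>\<^bsub>W\<^esub> phi w c' x m"
      if "x \<in> carrier U" "m \<in> carrier M" for x m
      unfolding phi_def using that w c UopU_balanced_closed
      by (simp add: sweedler_add[OF UopU_tensor W_ab phi_balL])
    then show ?thesis
      using m w c cl by (subst csum_fun_add[OF M W_ab, symmetric]) (auto intro!: csum_cong[OF M])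
  qed
  show "csum M W (phi (rwhite B w a) c) m = csum M W (phi w (UopU_left B a c)) m"
    if a: "a \<in> carrier A" and w: "w \<in> carrier U" and c: "c \<in> carrier (UopU_balanced B)" for a w c
  proof -
    have c' [simp]: "c \<in> carrier (UopU B)" using c by (rule UopU_balanced_closed)
    have "csum M W (phi (rwhite B w a) c) m = csum M W (\<lambda>x m'. phi w c (x \<cdot> t a) m') m"
      unfolding phi_def using a w
      by (intro csum_cong[OF M m] sweedler_congT[OF UopU_tensor]) (auto simp: U.m_assoc)
    also have "\<dots> = csum M W (\<lambda>x m'. phi w c x (right_act B M m' a)) m"
      by (rule csum_takeuchi[OF M W_ab phi_bal[OF w c] a m])
    also have "\<dots> = csum M W (phi w (UopU_left B a c)) m"
    proof (rule csum_cong[OF M m])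
      fix x m' assume xm: "x \<in> carrier U" "m' \<in> carrier M"
      have "phi w (UopU_left B a c) x m' = sweedler (UopU B) W (\<lambda>v y. (y \<cdot> x \<cdot> w) \<boxtimes>\<^bsub>W\<^esub> act m' (s a \<cdot> v)) c"
        unfolding phi_def UopU_left_def using a xm w
        by (simp, subst sweedler_push[OF UopU_tensor UopU_tensor W_ab phi_balL]) auto
      also have "\<dots> = phi w c x (right_act B M m' a)"
        unfolding phi_def using a xm by (intro sweedler_congT[OF UopU_tensor c']) (simp add: act_s_mult)
      finally show "phi w c x (right_act B M m' a) = phi w (UopU_left B a c) x m'" by simp
    qed
    finally show ?thesis .
  qed
qed

text \<open>The anti Yetter-Drinfel'd condition with \<open>u\<^bsub>(1)\<^esub> \<otimes> (u\<^bsub>(2)+\<^esub> \<otimes> u\<^bsub>(2)-\<^esub>)\<close> in place of the lifted element: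
  \<open>(m u)\<^bsub>(-1)\<^esub> \<otimes> (m u)\<^bsub>(0)\<^esub> = u\<^bsub>(2)-\<^esub> m\<^bsub>(-1)\<^esub> u\<^bsub>(1)\<^esub> \<otimes> m\<^bsub>(0)\<^esub> u\<^bsub>(2)+\<^esub>\<close>.\<close>

lemma coact_act:
  assumes m: "m \<in> carrier M" and u: "u \<in> carrier U"
  shows "coact M (act m u) = dsum W (\<lambda>u1 u2. csum M W (phi u1 (transl_l B u2)) m) u"
proof -
  have cl: "u1 \<boxtimes>\<^bsub>U_balanced B\<^esub> transl_l B u2 \<in> carrier (U_balanced B)"
    if "u1 \<in> carrier U" "u2 \<in> carrier U" for u1 u2
    using that by (intro pure_closed[OF U_balanced_tensor] transl_l_balanced)
  have d: "comul_transl_l B u \<in> carrier (U_balanced B)"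
    unfolding comul_transl_l_eq[OF proj_right u] using u cl by (intro dsum_closed) auto
  have "coact M (act m u) = sweedler (U_balanced B) W (\<lambda>w c. sweedler (UopU B) W (\<lambda>v y.
      csum M W (\<lambda>x m'. (y \<cdot> x \<cdot> w) \<boxtimes>\<^bsub>W\<^esub> act m' v) m) c) (comul_transl_l B u)"
    by (rule anti_Yetter_Drinfeld.coact_act[OF aYD m u])
  also have "\<dots> = sweedler (U_balanced B) W (\<lambda>w c. csum M W (phi w c) m) (comul_transl_l B u)"
    unfolding phi_def
  proof (rule sweedler_congT[OF U_balanced_tensor d])
    fix w c assume wc: "w \<in> carrier U" "c \<in> carrier (UopU_balanced B)"
    show "sweedler (UopU B) W (\<lambda>v y. csum M W (\<lambda>x m'. (y \<cdot> x \<cdot> w) \<boxtimes>\<^bsub>W\<^esub> act m' v) m) c =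
        csum M W (\<lambda>x m'. sweedler (UopU B) W (\<lambda>v y. (y \<cdot> x \<cdot> w) \<boxtimes>\<^bsub>W\<^esub> act m' v) c) m"
      using wc m by (intro sweedler_swap[OF UopU_tensor UX_tensor]) (auto simp: UopU_balanced_closed)
  qed
  also have "\<dots> = dsum W (\<lambda>u1 u2. csum M W (phi u1 (transl_l B u2)) m) u"
    unfolding comul_transl_l_eq[OF proj_right u] using u
    by (intro sweedler_push[OF UU_tensor U_balanced_tensor W_ab phi_balanced[OF m]])
      (auto simp: transl_l_balanced)
  finally show ?thesis .
qed

section \<open>The inverse of the trace\<close>

context
  fixes N P :: "('a, 'u, 'v) ucomodule" and g
  assumes N [simp]: "left_comodule B N" and P [simp]: "left_comodule B P"
    and g: "g \<in> comod_hom B (P \<star> N) M"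
begin

lemmas g_simps [simp] = comod_hom_simps(1-3)[OF g]

lemma g_ra: "a \<in> carrier A \<Longrightarrow> n \<in> carrier N \<Longrightarrow> p \<in> carrier P \<Longrightarrow>
    g (comod_pure B P N p (right_act B N n a)) = right_act B M (g (comod_pure B P N p n)) a"
  using comod_hom_ra[OF left_comodule_CT[OF P N] M g, of a "comod_pure B P N p n"] by simp

lemma g_smult [simp]: "a \<in> carrier A \<Longrightarrow> n \<in> carrier N \<Longrightarrow> p \<in> carrier P \<Longrightarrow>
    g (comod_pure B P N (a \<odot>\<^bsub>P\<^esub> p) n) = a \<odot>\<^bsub>M\<^esub> g (comod_pure B P N p n)"
  using comod_hom_simps(3)[OF g, of a "comod_pure B P N p n"] by simp

text \<open>The well-definedness on \<open>N \<otimes>\<^sub>A P\<close> below rests on \<open>act_s_mult\<close>; left linearity in \<open>n\<close> on the Takeuchi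
  property of the coaction on \<open>P\<close>.\<close>

definition untr where "untr n p = csum P M (\<lambda>u p'. act (g (comod_pure B P N p' n)) u) p"

lemma untr_bal: "n \<in> carrier N \<Longrightarrow> bal P M (\<lambda>u p'. act (g (comod_pure B P N p' n)) u)"
  by (rule balI) (simp_all add: act_add cp_add_left act_t_mult)

lemma untr_closed [simp]: "n \<in> carrier N \<Longrightarrow> p \<in> carrier P \<Longrightarrow> untr n p \<in> carrier M"
  unfolding untr_def by (rule csum_q_closed[OF P comodule_ab[OF M] untr_bal])

lemma untr_balN: "balN N P M untr"
proof (rule balancedI)
  show "untr (n \<oplus>\<^bsub>N\<^esub> n') p = untr n p \<oplus>\<^bsub>M\<^esub> untr n' p"
    if "n \<in> carrier N" "n' \<in> carrier N" "p \<in> carrier P" for n n' p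
    unfolding untr_def using that
    by (subst csum_fun_add[OF P comodule_ab[OF M], symmetric])
      (auto simp: cp_add_right act_add intro!: csum_cong[OF P])
  show "untr n (p \<oplus>\<^bsub>P\<^esub> p') = untr n p \<oplus>\<^bsub>M\<^esub> untr n p'"
    if "n \<in> carrier N" "p \<in> carrier P" "p' \<in> carrier P" for n p p'
    unfolding untr_def using that by (intro csum_add[OF P comodule_ab[OF M] untr_bal])
  show "untr (right_act B N n a) p = untr n (a \<odot>\<^bsub>P\<^esub> p)"
    if "a \<in> carrier A" "n \<in> carrier N" "p \<in> carrier P" for a n p
    unfolding untr_def using that
    by (auto simp: csum_smult[OF P comodule_ab[OF M] untr_bal] g_ra act_s_mult intro!: csum_cong[OF P])
qed simp

lemma untr_smult:
  assumes "a \<in> carrier A" "n \<in> carrier N" "p \<in> carrier P"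
  shows "untr (a \<odot>\<^bsub>N\<^esub> n) p = a \<odot>\<^bsub>M\<^esub> untr n p"
proof -
  have "untr (a \<odot>\<^bsub>N\<^esub> n) p = csum P M (\<lambda>u p'. act (g (comod_pure B P N (right_act B P p' a) n)) u) p"
    unfolding untr_def using assms by (intro csum_cong[OF P]) (auto simp: cp_move)
  also have "\<dots> = csum P M (\<lambda>u p'. act (g (comod_pure B P N p' n)) (u \<cdot> t a)) p"
    using assms by (intro csum_takeuchi[OF P comodule_ab[OF M] untr_bal, symmetric])
  also have "\<dots> = csum P M (\<lambda>u p'. a \<odot>\<^bsub>M\<^esub> act (g (comod_pure B P N p' n)) u) p"
    using assms by (intro csum_cong[OF P]) (auto simp: act_mult_t)
  also have "\<dots> = a \<odot>\<^bsub>M\<^esub> untr n p"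
    unfolding untr_def using assms by (intro csum_hom[OF P _ _ smult_additive[OF M], symmetric]) auto
  finally show ?thesis .
qed

text \<open>Writing the coaction of \<open>g(p\<^bsub>(0)\<^esub> \<otimes> n) p\<^bsub>(-1)\<^esub>\<close> by the anti Yetter-Drinfel'd condition and moving
  \<open>\<Delta>(p\<^bsub>(-1)\<^esub>)\<close> to two successive coactions on \<open>p\<close> gives \<open>x\<^sub>- z n\<^bsub>(-1)\<^esub> u \<otimes> g(p\<^bsub>(0)\<^esub> \<otimes> n\<^bsub>(0)\<^esub>) x\<^sub>+\<close> with
  \<open>u = p\<^bsub>(-3)\<^esub>\<close>, \<open>x = p\<^bsub>(-2)\<^esub>\<close>, \<open>z = p\<^bsub>(-1)\<^esub>\<close>. Coassociativity in the other direction makes \<open>x\<close> and \<open>z\<close>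
  the two legs of one comultiplication, and \<open>x\<^bsub>(1)+\<^esub> \<otimes> x\<^bsub>(1)-\<^esub> x\<^bsub>(2)\<^esub> = x \<otimes> 1\<close> applies.\<close>

lemma untr_coact:
  assumes n: "n \<in> carrier N" and p: "p \<in> carrier P"
  shows "coact M (untr n p) = csum P W (\<lambda>v p'. csum N W (\<lambda>u n'. (u \<cdot> v) \<boxtimes>\<^bsub>W\<^esub> untr n' p') n) p"
proof -
  let ?c = "comod_pure B P N"
  let ?PN = "(P \<star> N)"
  \<comment> \<open>The coaction of \<open>g(p' \<otimes> n) u\<close> has summand \<open>Q\<close> at the legs \<open>u1\<close>, \<open>u2\<close> of \<open>u\<close>. Expanding the coaction of
    \<open>g(p' \<otimes> n)\<close> by colinearity turns \<open>Q\<close> into sums of \<open>L\<close>, and \<open>S\<close> collects the sum over the coaction of \<open>n\<close>.\<close>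
  define Q where "Q u1 u2 p' = csum M W (phi u1 (transl_l B u2)) (g (?c p' n))" for u1 u2 p'
  define L where "L u x z p3 w n' = lsum W (\<lambda>v y. (y \<cdot> (z \<cdot> (w \<cdot> u))) \<boxtimes>\<^bsub>W\<^esub> act (g (?c p3 n')) v) x"
    for u x z p3 w n'
  define S where "S u x z p3 = csum N W (L u x z p3) n" for u x z p3
  have L_closed [simp]: "L u x z p3 w n' \<in> carrier W"
    if "u \<in> carrier U" "x \<in> carrier U" "z \<in> carrier U" "p3 \<in> carrier P" "w \<in> carrier U" "n' \<in> carrier N"
    for u x z p3 w n'
    unfolding L_def using that by (intro lsum_closed) auto
  note tb = transl_l_balanced
  \<comment> \<open>First use of coassociativity, for the coaction on \<open>P\<close>; \<open>S3\<close> below serves for the second one.\<close>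
  have Q3: "balanced3 P W Q"
  proof (rule balanced3I)
    show "Q u1 u2 p' \<in> carrier W" if "u1 \<in> carrier U" "u2 \<in> carrier U" "p' \<in> carrier P" for u1 u2 p'
      unfolding Q_def using that n tb by (intro balancedD(1)[OF phi_balanced]) auto
    show "Q (u1 \<oplus>\<^bsub>U\<^esub> u1') u2 p' = Q u1 u2 p' \<oplus>\<^bsub>W\<^esub> Q u1' u2 p'"
      if "u1 \<in> carrier U" "u1' \<in> carrier U" "u2 \<in> carrier U" "p' \<in> carrier P" for u1 u1' u2 p'
      unfolding Q_def using that n tb by (intro balancedD(2)[OF phi_balanced]) auto
    show "Q u1 (u2 \<oplus>\<^bsub>U\<^esub> u2') p' = Q u1 u2 p' \<oplus>\<^bsub>W\<^esub> Q u1 u2' p'"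
      if "u1 \<in> carrier U" "u2 \<in> carrier U" "u2' \<in> carrier U" "p' \<in> carrier P" for u1 u2 u2' p'
      unfolding Q_def using that n tb balancedD(3)[OF phi_balanced, of "g (?c p' n)" u1 "transl_l B u2" "transl_l B u2'"]
      by (simp add: transl_l_add)
    show "Q u1 u2 (p' \<oplus>\<^bsub>P\<^esub> p'') = Q u1 u2 p' \<oplus>\<^bsub>W\<^esub> Q u1 u2 p''"
      if "u1 \<in> carrier U" "u2 \<in> carrier U" "p' \<in> carrier P" "p'' \<in> carrier P" for u1 u2 p' p''
      unfolding Q_def using that n tb by (simp add: cp_add_left csum_add[OF M W_ab phi_bal])
    show "Q (t a \<cdot> u1) u2 p' = Q u1 (s a \<cdot> u2) p'"
      if "a \<in> carrier A" "u1 \<in> carrier U" "u2 \<in> carrier U" "p' \<in> carrier P" for a u1 u2 p'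
      unfolding Q_def using that n tb balancedD(4)[OF phi_balanced, of "g (?c p' n)" a u1 "transl_l B u2"]
      by (simp add: transl_l_s)
    show "Q u1 (t a \<cdot> u2) p' = Q u1 u2 (a \<odot>\<^bsub>P\<^esub> p')"
      if a: "a \<in> carrier A" "u1 \<in> carrier U" "u2 \<in> carrier U" "p' \<in> carrier P" for a u1 u2 p'
    proof -
      have "Q u1 (t a \<cdot> u2) p' = csum M W (\<lambda>x m. phi u1 (transl_l B u2) (s a \<cdot> x) m) (g (?c p' n))"
        unfolding Q_def phi_def using a n
        by (intro csum_cong[OF M]) (auto simp: lsum_t[OF W_ab phi_balL] U.m_assoc intro!: lsum_cong)
      also have "\<dots> = Q u1 u2 (a \<odot>\<^bsub>P\<^esub> p')"
        unfolding Q_def using a n tb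
        by (subst csum_smult[OF M W_ab phi_bal, symmetric]) simp_all
      finally show ?thesis .
    qed
  qed
  have SL: "balL W (\<lambda>v y. (y \<cdot> (z \<cdot> (w \<cdot> u))) \<boxtimes>\<^bsub>W\<^esub> act m v)"
    if "z \<in> carrier U" "w \<in> carrier U" "u \<in> carrier U" "m \<in> carrier M" for z w u m
    using phi_balL[of z "w \<cdot> u" m] that
    by (intro balLI)
      (simp_all add: distribs act_add act_mult_t UX_pure_add_left UX_pure_add_right U.m_assoc UX_move)
  have S3: "balanced3 P W (S u)" if u: "u \<in> carrier U" for u
  proof (rule balanced3I)
    note [simp] = u n
    show "S u x z p3 \<in> carrier W" if "x \<in> carrier U" "z \<in> carrier U" "p3 \<in> carrier P" for x z p3
      unfolding S_def using that by (intro csum_closed[OF N]) auto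
    show "S u (x \<oplus>\<^bsub>U\<^esub> x') z p3 = S u x z p3 \<oplus>\<^bsub>W\<^esub> S u x' z p3"
      if "x \<in> carrier U" "x' \<in> carrier U" "z \<in> carrier U" "p3 \<in> carrier P" for x x' z p3
    proof -
      have "S u (x \<oplus>\<^bsub>U\<^esub> x') z p3 = csum N W (\<lambda>w n'. L u x z p3 w n' \<oplus>\<^bsub>W\<^esub> L u x' z p3 w n') n"
        unfolding S_def using that
        by (intro csum_cong[OF N n]) (simp add: L_def lsum_add[OF W_ab SL])
      also have "\<dots> = S u x z p3 \<oplus>\<^bsub>W\<^esub> S u x' z p3"
        unfolding S_def using that by (intro csum_fun_add[OF N W_ab n]) auto
      finally show ?thesis .
    qed
    show "S u x (z \<oplus>\<^bsub>U\<^esub> z') p3 = S u x z p3 \<oplus>\<^bsub>W\<^esub> S u x z' p3"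
      if "x \<in> carrier U" "z \<in> carrier U" "z' \<in> carrier U" "p3 \<in> carrier P" for x z z' p3
    proof -
      have "S u x (z \<oplus>\<^bsub>U\<^esub> z') p3 = csum N W (\<lambda>w n'. L u x z p3 w n' \<oplus>\<^bsub>W\<^esub> L u x z' p3 w n') n"
        unfolding S_def using that
        by (intro csum_cong[OF N n]) (simp add: L_def lsum_fun_add[OF W_ab, symmetric] distribs
            UX_pure_add_left cong: lsum_cong)
      also have "\<dots> = S u x z p3 \<oplus>\<^bsub>W\<^esub> S u x z' p3"
        unfolding S_def using that by (intro csum_fun_add[OF N W_ab n]) auto
      finally show ?thesis .
    qed
    show "S u x z (p3 \<oplus>\<^bsub>P\<^esub> p3') = S u x z p3 \<oplus>\<^bsub>W\<^esub> S u x z p3'"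
      if "x \<in> carrier U" "z \<in> carrier U" "p3 \<in> carrier P" "p3' \<in> carrier P" for x z p3 p3'
    proof -
      have "S u x z (p3 \<oplus>\<^bsub>P\<^esub> p3') = csum N W (\<lambda>w n'. L u x z p3 w n' \<oplus>\<^bsub>W\<^esub> L u x z p3' w n') n"
        unfolding S_def using that
        by (intro csum_cong[OF N n]) (simp add: L_def lsum_fun_add[OF W_ab, symmetric] cp_add_left
            act_add UX_pure_add_right cong: lsum_cong)
      also have "\<dots> = S u x z p3 \<oplus>\<^bsub>W\<^esub> S u x z p3'"
        unfolding S_def using that by (intro csum_fun_add[OF N W_ab n]) auto
      finally show ?thesis .
    qed
    show "S u (t a \<cdot> x) z p3 = S u x (s a \<cdot> z) p3"
      if "a \<in> carrier A" "x \<in> carrier U" "z \<in> carrier U" "p3 \<in> carrier P" for a x z p3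
      unfolding S_def using that
      by (intro csum_cong[OF N]) (simp_all add: L_def lsum_t[OF W_ab SL] U.m_assoc cong: lsum_cong)
    show "S u x (t a \<cdot> z) p3 = S u x z (a \<odot>\<^bsub>P\<^esub> p3)"
      if a: "a \<in> carrier A" "x \<in> carrier U" "z \<in> carrier U" "p3 \<in> carrier P" for a x z p3
      unfolding S_def L_def
    proof (rule csum_cong[OF N n])
      fix w n' assume w: "w \<in> carrier U" "n' \<in> carrier N"
      have "lsum W (\<lambda>v y. (y \<cdot> (t a \<cdot> z \<cdot> (w \<cdot> u))) \<boxtimes>\<^bsub>W\<^esub> act (g (?c p3 n')) v) x =
          lsum W (\<lambda>v y. (y \<cdot> t a \<cdot> (z \<cdot> (w \<cdot> u))) \<boxtimes>\<^bsub>W\<^esub> act (g (?c p3 n')) v) x"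
        using a w by (intro lsum_cong) (auto simp: U.m_assoc)
      also have "\<dots> = lsum W (\<lambda>v y. (y \<cdot> (z \<cdot> (w \<cdot> u))) \<boxtimes>\<^bsub>W\<^esub> act (g (?c p3 n')) (t a \<cdot> v)) x"
        using a w by (intro lsum_tgt[OF W_ab SL, symmetric]) auto
      also have "\<dots> = lsum W (\<lambda>v y. (y \<cdot> (z \<cdot> (w \<cdot> u))) \<boxtimes>\<^bsub>W\<^esub> act (g (?c (a \<odot>\<^bsub>P\<^esub> p3) n')) v) x"
        using a w by (intro lsum_cong) (auto simp: act_t_mult)
      finally show "lsum W (\<lambda>v y. (y \<cdot> (t a \<cdot> z \<cdot> (w \<cdot> u))) \<boxtimes>\<^bsub>W\<^esub> act (g (?c p3 n')) v) x =
          lsum W (\<lambda>v y. (y \<cdot> (z \<cdot> (w \<cdot> u))) \<boxtimes>\<^bsub>W\<^esub> act (g (?c (a \<odot>\<^bsub>P\<^esub> p3) n')) v) x" .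
    qed
  qed
  have Q_expand: "Q u x p' = csum P W (\<lambda>z p3. S u x z p3) p'"
    if x: "u \<in> carrier U" "x \<in> carrier U" "p' \<in> carrier P" for u x p'
  proof -
    have b: "bal ?PN W (\<lambda>x' z'. phi u (transl_l B x) x' (g z'))"
      using balancedD(1-3)[OF phi_bal[OF x(1) tb[OF x(2)]]] bal_move[OF phi_bal[OF x(1) tb[OF x(2)]]]
      by (intro balI) simp_all
    have "Q u x p' = csum ?PN W (\<lambda>x' z'. phi u (transl_l B x) x' (g z')) (?c p' n)"
      unfolding Q_def using x n tb
      by (intro csum_colinear[OF left_comodule_CT[OF P N] M g W_ab phi_bal]) auto
    also have "\<dots> = csum P W (\<lambda>z p3. csum N W (\<lambda>w n'. phi u (transl_l B x) (z \<cdot> w) (g (?c p3 n'))) n) p'"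
      by (rule csum_CT_pure[OF P N W_ab b x(3) n])
    also have "\<dots> = csum P W (\<lambda>z p3. S u x z p3) p'"
      unfolding S_def L_def phi_def using x n
      by (intro csum_cong[OF P] csum_cong[OF N] lsum_cong) (auto simp: U.m_assoc)
    finally show ?thesis .
  qed
  \<comment> \<open>Two of the three coactions cancel.\<close>
  have S_dsum: "dsum W (\<lambda>x1 x2. S u x1 x2 p'') x = csum N W (\<lambda>w n'. (w \<cdot> u) \<boxtimes>\<^bsub>W\<^esub> act (g (?c p'' n')) x) n"
    if x: "u \<in> carrier U" "x \<in> carrier U" "p'' \<in> carrier P" for u x p''
  proof -
    have "dsum W (\<lambda>x1 x2. S u x1 x2 p'') x = csum N W (\<lambda>w n'. dsum W (\<lambda>x1 x2.
        lsum W (\<lambda>v y. (y \<cdot> (x2 \<cdot> (w \<cdot> u))) \<boxtimes>\<^bsub>W\<^esub> act (g (?c p'' n')) v) x1) x) n"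
      unfolding S_def L_def using x n
      by (intro csum_dsum_swap[OF N W_ab, symmetric] lsum_closed) auto
    also have "\<dots> = csum N W (\<lambda>w n'. dsum W (\<lambda>x1 x2.
        lsum W (\<lambda>v y. (y \<cdot> x2 \<cdot> (\<one>\<^bsub>U\<^esub> \<cdot> (w \<cdot> u))) \<boxtimes>\<^bsub>W\<^esub> act (g (?c p'' n')) v) x1) x) n"
      using x n by (intro csum_cong[OF N] dsum_cong lsum_cong) (auto simp: U.m_assoc)
    also have "\<dots> = csum N W (\<lambda>w n'. (\<one>\<^bsub>U\<^esub> \<cdot> (\<one>\<^bsub>U\<^esub> \<cdot> (w \<cdot> u))) \<boxtimes>\<^bsub>W\<^esub> act (g (?c p'' n')) x) n"
      using x n by (intro csum_cong[OF N] lsum_dsum[OF W_ab SL]) auto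
    also have "\<dots> = csum N W (\<lambda>w n'. (w \<cdot> u) \<boxtimes>\<^bsub>W\<^esub> act (g (?c p'' n')) x) n"
      using x n by (intro csum_cong[OF N]) auto
    finally show ?thesis .
  qed
  have "coact M (untr n p) = csum P W (\<lambda>u p'. coact M (act (g (?c p' n)) u)) p"
    unfolding untr_def using n p by (intro csum_hom[OF P _ _ coact_additive[OF M]]) auto
  also have "\<dots> = csum P W (\<lambda>u p'. dsum W (\<lambda>u1 u2. Q u1 u2 p') u) p"
    unfolding Q_def using n p by (intro csum_cong[OF P] coact_act) auto
  also have "\<dots> = csum P W (\<lambda>u p'. csum P W (Q u) p') p"
    by (rule csum_coassoc[OF P W_ab Q3 p])
  also have "\<dots> = csum P W (\<lambda>u p'. csum P W (\<lambda>x p''. csum P W (S u x) p'') p') p"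
    using p by (intro csum_cong[OF P] Q_expand) auto
  also have "\<dots> = csum P W (\<lambda>u p'. csum P W (\<lambda>x p''. dsum W (\<lambda>x1 x2. S u x1 x2 p'') x) p') p"
    using p by (intro csum_cong[OF P p] csum_coassoc[OF P W_ab S3, symmetric]) auto
  also have "\<dots> = csum P W (\<lambda>u p'. csum P W (\<lambda>x p''. csum N W (\<lambda>w n'. (w \<cdot> u) \<boxtimes>\<^bsub>W\<^esub> act (g (?c p'' n')) x) n) p') p"
    using p by (intro csum_cong[OF P] S_dsum) auto
  also have "\<dots> = csum P W (\<lambda>u p'. csum N W (\<lambda>w n'. csum P W (\<lambda>x p''. (w \<cdot> u) \<boxtimes>\<^bsub>W\<^esub> act (g (?c p'' n')) x) p') n) p"
    using p n by (intro csum_cong[OF P p] csum_swap[OF P N W_ab]) auto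
  also have "\<dots> = csum P W (\<lambda>v p'. csum N W (\<lambda>u n'. (u \<cdot> v) \<boxtimes>\<^bsub>W\<^esub> untr n' p') n) p"
    unfolding untr_def using p n
    by (intro csum_cong[OF P p] csum_cong[OF N n]
        csum_hom[OF P comodule_ab[OF M] W_ab balanced_additive_right[OF UX_pure_bal[OF comodule_module[OF M]]], symmetric]) auto
  finally show ?thesis .
qed

definition untrace where "untrace = (\<lambda>z\<in>carrier (N \<star> P). tsum N P M untr z)"

lemma untrace_hom: "untrace \<in> comod_hom B (N \<star> P) M"
  unfolding untrace_def by (rule CT_homI[OF N P M untr_balN untr_smult untr_coact])

lemma untrace_pure: "n \<in> carrier N \<Longrightarrow> p \<in> carrier P \<Longrightarrow>
    untrace (comod_pure B N P n p) = csum P M (\<lambda>u p'. act (g (comod_pure B P N p' n)) u) p"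
  using tsum_pure[OF N P comodule_ab[OF M] untr_balN] by (simp add: untrace_def untr_def)

end

end

section \<open>Right Hopf algebroids\<close>

context left_bialgebroid
begin

abbreviation balR where "balR G q \<equiv> balanced (carrier A) U (rblack B) (lwhite B) U G q"
abbreviation rsum where "rsum G q u \<equiv> sweedler (UrU B) G q (transl_r B u)"

lemma UrU_tensor: "is_tensor (UrU B) (carrier A) U (rblack B) (lwhite B) U"
  by (simp add: is_tensor_def tensor_data_def UrU_def)

lemmas UrU_ab [simp] = tensor_abelian_group[OF UrU_tensor]
lemmas UrU_pure_closed [simp] = pure_closed[OF UrU_tensor]
lemmas UrU_pure_add_left = pure_add_left[OF UrU_tensor]
lemmas UrU_pure_add_right = pure_add_right[OF UrU_tensor]
lemmas UrU_move = pure_move[OF UrU_tensor, simplified]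

lemma balRI:
  assumes "\<And>u v. u \<in> carrier U \<Longrightarrow> v \<in> carrier U \<Longrightarrow> q u v \<in> carrier G"
    and "\<And>u u' v. u \<in> carrier U \<Longrightarrow> u' \<in> carrier U \<Longrightarrow> v \<in> carrier U \<Longrightarrow>
      q (u \<oplus>\<^bsub>U\<^esub> u') v = q u v \<oplus>\<^bsub>G\<^esub> q u' v"
    and "\<And>u v v'. u \<in> carrier U \<Longrightarrow> v \<in> carrier U \<Longrightarrow> v' \<in> carrier U \<Longrightarrow>
      q u (v \<oplus>\<^bsub>U\<^esub> v') = q u v \<oplus>\<^bsub>G\<^esub> q u v'"
    and "\<And>a u v. a \<in> carrier A \<Longrightarrow> u \<in> carrier U \<Longrightarrow> v \<in> carrier U \<Longrightarrow> q (u \<cdot> s a) v = q u (s a \<cdot> v)"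
  shows "balR G q"
  using assms by (intro balancedI) simp_all

lemma alpha_r_inner: "v \<in> carrier U \<Longrightarrow> bal (U_left B) (UU B) (\<lambda>u1 u2. (u1 \<cdot> v) \<boxtimes>\<^bsub>UU B\<^esub> u2)"
  by (rule balI) (simp_all add: UU_pure_add_left UU_pure_add_right UU_move[symmetric] distribs U.m_assoc)

lemma alpha_r_bal: "balR (UU B) (\<lambda>u v. dsum (UU B) (\<lambda>u1 u2. (u1 \<cdot> v) \<boxtimes>\<^bsub>UU B\<^esub> u2) u)"
proof (rule balRI)
  show "dsum (UU B) (\<lambda>u1 u2. (u1 \<cdot> v) \<boxtimes>\<^bsub>UU B\<^esub> u2) (u \<cdot> s a) =
      dsum (UU B) (\<lambda>u1 u2. (u1 \<cdot> (s a \<cdot> v)) \<boxtimes>\<^bsub>UU B\<^esub> u2) u"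
    if "a \<in> carrier A" "u \<in> carrier U" "v \<in> carrier U" for a u v
    using that by (simp add: dsum_s_right[OF UU_ab alpha_r_inner] U.m_assoc cong: dsum_cong)
qed (simp_all add: dsum_add[OF UU_ab alpha_r_inner] dsum_closed distribs UU_pure_add_left
    dsum_fun_add[symmetric] cong: dsum_cong)

lemma alpha_r_pure: "u \<in> carrier U \<Longrightarrow> v \<in> carrier U \<Longrightarrow>
    alpha_r B (u \<boxtimes>\<^bsub>UrU B\<^esub> v) = dsum (UU B) (\<lambda>u1 u2. (u1 \<cdot> v) \<boxtimes>\<^bsub>UU B\<^esub> u2) u"
  unfolding alpha_r_def by (rule sweedler_pure[OF UrU_tensor UU_ab alpha_r_bal])

lemma alpha_r_additive: "alpha_r B \<in> additive_maps (UrU B) (UU B)"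
  unfolding alpha_r_def by (rule sweedler_additive[OF UrU_tensor UU_ab alpha_r_bal])

definition UrU_tmult where "UrU_tmult a = sweedler (UrU B) (UrU B) (\<lambda>x y. (t a \<cdot> x) \<boxtimes>\<^bsub>UrU B\<^esub> y)"
definition UrU_rmult where "UrU_rmult a = sweedler (UrU B) (UrU B) (\<lambda>x y. (x \<cdot> t a) \<boxtimes>\<^bsub>UrU B\<^esub> y)"
definition UU_tmult where "UU_tmult a = sweedler (UU B) (UU B) (\<lambda>x y. x \<boxtimes>\<^bsub>UU B\<^esub> (t a \<cdot> y))"

lemma UrU_tmult_bal: "a \<in> carrier A \<Longrightarrow> balR (UrU B) (\<lambda>x y. (t a \<cdot> x) \<boxtimes>\<^bsub>UrU B\<^esub> y)"
  by (rule balRI) (simp_all add: UrU_pure_add_left UrU_pure_add_right UrU_move[symmetric] distribs U.m_assoc)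

lemma UrU_rmult_bal: "a \<in> carrier A \<Longrightarrow> balR (UrU B) (\<lambda>x y. (x \<cdot> t a) \<boxtimes>\<^bsub>UrU B\<^esub> y)"
  by (rule balRI)
    (simp_all add: UrU_pure_add_left UrU_pure_add_right UrU_move[symmetric] distribs U.m_assoc ts)

lemmas UrU_tmult_additive = sweedler_additive[OF UrU_tensor UrU_ab UrU_tmult_bal, folded UrU_tmult_def]
lemmas UrU_rmult_additive = sweedler_additive[OF UrU_tensor UrU_ab UrU_rmult_bal, folded UrU_rmult_def]
lemmas UrU_tmult_pure = sweedler_pure[OF UrU_tensor UrU_ab UrU_tmult_bal, folded UrU_tmult_def]
lemmas UrU_rmult_pure = sweedler_pure[OF UrU_tensor UrU_ab UrU_rmult_bal, folded UrU_rmult_def]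
lemmas UU_tmult_additive = sweedler_additive[OF UU_tensor UU_ab UU_tgt_bal, folded UU_tmult_def]
lemmas UU_tmult_pure = sweedler_pure[OF UU_tensor UU_ab UU_tgt_bal, folded UU_tmult_def, simplified]

lemma alpha_r_tmult:
  assumes a: "a \<in> carrier A" and c: "c \<in> carrier (UrU B)"
  shows "alpha_r B (UrU_tmult a c) = UU_tmult a (alpha_r B c)"
proof (rule tensor_ext[OF UrU_tensor UU_ab additive_maps_comp[OF UrU_tmult_additive[OF a] alpha_r_additive]
      additive_maps_comp[OF alpha_r_additive UU_tmult_additive[OF a]] _ c])
  fix u v assume uv: "u \<in> carrier U" "v \<in> carrier U"
  have "UU_tmult a (alpha_r B (u \<boxtimes>\<^bsub>UrU B\<^esub> v)) =
      dsum (UU B) (\<lambda>u1 u2. UU_tmult a ((u1 \<cdot> v) \<boxtimes>\<^bsub>UU B\<^esub> u2)) u"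
    unfolding alpha_r_pure[OF uv] using uv by (intro dsum_hom[OF _ _ UU_tmult_additive[OF a]]) auto
  also have "\<dots> = dsum (UU B) (\<lambda>u1 u2. (u1 \<cdot> v) \<boxtimes>\<^bsub>UU B\<^esub> (t a \<cdot> u2)) u"
    using uv a by (intro dsum_cong) (simp_all add: UU_tmult_pure)
  finally show "alpha_r B (UrU_tmult a (u \<boxtimes>\<^bsub>UrU B\<^esub> v)) = UU_tmult a (alpha_r B (u \<boxtimes>\<^bsub>UrU B\<^esub> v))"
    using uv a by (simp add: UrU_tmult_pure alpha_r_pure dsum_t_left[OF UU_ab alpha_r_inner])
qed

lemma alpha_r_rmult:
  assumes a: "a \<in> carrier A" and c: "c \<in> carrier (UrU B)"
  shows "alpha_r B (UrU_rmult a c) = UU_rmult (t a) (alpha_r B c)"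
proof (rule tensor_ext[OF UrU_tensor UU_ab additive_maps_comp[OF UrU_rmult_additive[OF a] alpha_r_additive]
      additive_maps_comp[OF alpha_r_additive UU_rmult_additive[OF t_closed[OF a]]] _ c])
  fix u v assume uv: "u \<in> carrier U" "v \<in> carrier U"
  have "UU_rmult (t a) (alpha_r B (u \<boxtimes>\<^bsub>UrU B\<^esub> v)) =
      dsum (UU B) (\<lambda>u1 u2. UU_rmult (t a) ((u1 \<cdot> v) \<boxtimes>\<^bsub>UU B\<^esub> u2)) u"
    unfolding alpha_r_pure[OF uv] using uv a by (intro dsum_hom[OF _ _ UU_rmult_additive]) auto
  also have "\<dots> = dsum (UU B) (\<lambda>u1 u2. (u1 \<cdot> v) \<boxtimes>\<^bsub>UU B\<^esub> (u2 \<cdot> t a)) u"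
    using uv a by (intro dsum_cong) simp_all
  finally show "alpha_r B (UrU_rmult a (u \<boxtimes>\<^bsub>UrU B\<^esub> v)) = UU_rmult (t a) (alpha_r B (u \<boxtimes>\<^bsub>UrU B\<^esub> v))"
    using uv a by (simp add: UrU_rmult_pure alpha_r_pure dsum_t_right[OF UU_ab alpha_r_inner])
qed

lemma balanced3_dsum_right:
  assumes G: "abelian_group G" and q: "balanced3 (U_left B) G q"
  shows "bal (U_left B) G (\<lambda>u v. dsum G (q u) v)"
proof (rule balI)
  note qD = balanced3D[OF q, simplified]
  have q1: "bal (U_left B) G (q u)" if "u \<in> carrier U" for u using q that by (simp add: balanced3_def)
  show "dsum G (q (t a \<cdot> u)) v = dsum G (q u) (a \<odot>\<^bsub>U_left B\<^esub> v)"
    if "a \<in> carrier A" "u \<in> carrier U" "v \<in> carrier (U_left B)" for a u v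
    using that by (auto simp: dsum_s_left[OF G q1] qD intro!: dsum_cong)
  show "dsum G (q (u \<oplus>\<^bsub>U\<^esub> u')) v = dsum G (q u) v \<oplus>\<^bsub>G\<^esub> dsum G (q u') v"
    if "u \<in> carrier U" "u' \<in> carrier U" "v \<in> carrier (U_left B)" for u u' v
    using that by (simp add: dsum_fun_add[OF G, symmetric] qD cong: dsum_cong)
  show "dsum G (q u) (v \<oplus>\<^bsub>U_left B\<^esub> v') = dsum G (q u) v \<oplus>\<^bsub>G\<^esub> dsum G (q u) v'"
    if "u \<in> carrier U" "v \<in> carrier (U_left B)" "v' \<in> carrier (U_left B)" for u v v'
    using that dsum_add[OF G q1] by simp
  show "dsum G (q u) v \<in> carrier G" if "u \<in> carrier U" "v \<in> carrier (U_left B)" for u v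
    using that dsum_q_closed[OF G q1] by simp
qed

end

text \<open>A right Hopf algebroid with a dual basis \<open>j, f\<^sub>j\<close> (\<open>j \<in> U\<close>) of \<open>\<^sub>\<triangleright>U\<close>. The expansion is required along
  every larger finite index set, because index sets that come from different elements have to be merged.\<close>

locale right_hopf_dual_basis = left_bialgebroid k B
  for k :: "('k, 'r) ring_scheme" and B :: "('k, 'a, 'u) bialgebroid" +
  fixes f :: "'u \<Rightarrow> 'u \<Rightarrow> 'a"
  assumes right_hopf: "right_hopf B"
    and f_closed [simp]: "u \<in> carrier U \<Longrightarrow> f j u \<in> carrier A"
    and f_add: "u \<in> carrier U \<Longrightarrow> v \<in> carrier U \<Longrightarrow> f j (u \<oplus>\<^bsub>U\<^esub> v) = f j u \<oplus>\<^bsub>A\<^esub> f j v"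
    and f_s: "a \<in> carrier A \<Longrightarrow> u \<in> carrier U \<Longrightarrow> f j (s a \<cdot> u) = a \<otimes>\<^bsub>A\<^esub> f j u"
    and f_supp: "finite V \<Longrightarrow> V \<subseteq> carrier U \<Longrightarrow> \<exists>J. finite J \<and> J \<subseteq> carrier U \<and>
      (\<forall>K. finite K \<and> J \<subseteq> K \<and> K \<subseteq> carrier U \<longrightarrow> (\<forall>v\<in>V. v = (\<Oplus>\<^bsub>U\<^esub>j\<in>K. s (f j v) \<cdot> j)))"
begin

abbreviation taur where "taur \<equiv> inv_into (carrier (UrU B)) (alpha_r B)"

lemma taur_alpha: "c \<in> carrier (UrU B) \<Longrightarrow> taur (alpha_r B c) = c"
  using right_hopf unfolding right_hopf_def by (rule bij_betw_inv_into_left)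

lemma alpha_taur: "c \<in> carrier (UU B) \<Longrightarrow> alpha_r B (taur c) = c"
  using right_hopf unfolding right_hopf_def by (rule bij_betw_inv_into_right)

lemma taur_closed [simp]: "c \<in> carrier (UU B) \<Longrightarrow> taur c \<in> carrier (UrU B)"
  using right_hopf unfolding right_hopf_def by (metis bij_betw_def inv_into_into)

lemma alpha_r_inj: "c \<in> carrier (UrU B) \<Longrightarrow> d \<in> carrier (UrU B) \<Longrightarrow> alpha_r B c = alpha_r B d \<Longrightarrow> c = d"
  using taur_alpha by metis

lemma taur_additive: "taur \<in> additive_maps (UU B) (UrU B)"
proof (rule additive_mapsI)
  interpret V: abelian_group "UrU B" by simp
  interpret W: abelian_group "UU B" by simp
  show "taur (c \<oplus>\<^bsub>UU B\<^esub> d) = taur c \<oplus>\<^bsub>UrU B\<^esub> taur d"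
    if "c \<in> carrier (UU B)" "d \<in> carrier (UU B)" for c d
    using that by - (rule alpha_r_inj, simp_all add: alpha_taur additive_maps_add[OF alpha_r_additive])
qed simp

lemma transl_r_taur: "transl_r B u = taur (\<one>\<^bsub>U\<^esub> \<boxtimes>\<^bsub>UU B\<^esub> u)"
  by (simp add: transl_r_def)

lemma transl_r_closed [simp]: "u \<in> carrier U \<Longrightarrow> transl_r B u \<in> carrier (UrU B)"
  by (simp add: transl_r_taur)

lemma alpha_transl_r: "u \<in> carrier U \<Longrightarrow> alpha_r B (transl_r B u) = \<one>\<^bsub>U\<^esub> \<boxtimes>\<^bsub>UU B\<^esub> u"
  by (simp add: transl_r_taur alpha_taur)

lemma taur_t:
  "a \<in> carrier A \<Longrightarrow> u \<in> carrier U \<Longrightarrow> v \<in> carrier U \<Longrightarrow>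
    taur (u \<boxtimes>\<^bsub>UU B\<^esub> (t a \<cdot> v)) = UrU_tmult a (taur (u \<boxtimes>\<^bsub>UU B\<^esub> v))"
  by (rule alpha_r_inj)
    (simp_all add: alpha_taur alpha_r_tmult UU_tmult_pure additive_maps_closed[OF UrU_tmult_additive])

lemma transl_r_rt:
  "a \<in> carrier A \<Longrightarrow> u \<in> carrier U \<Longrightarrow> transl_r B (u \<cdot> t a) = UrU_rmult a (transl_r B u)"
  by (rule alpha_r_inj)
    (simp_all add: alpha_transl_r alpha_r_rmult additive_maps_closed[OF UrU_rmult_additive])

lemma rsum_cong:
  assumes "u \<in> carrier U" "\<And>x y. x \<in> carrier U \<Longrightarrow> y \<in> carrier U \<Longrightarrow> g x y = h x y"
  shows "rsum G g u = rsum G h u"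
  using assms by (intro sweedler_congT[OF UrU_tensor]) auto

lemma rsum_closed:
  assumes "abelian_group G" "u \<in> carrier U"
    "\<And>x y. x \<in> carrier U \<Longrightarrow> y \<in> carrier U \<Longrightarrow> g x y \<in> carrier G"
  shows "rsum G g u \<in> carrier G"
  using assms by (intro sweedler_closed[OF UrU_tensor]) auto

lemma rsum_hom:
  assumes "abelian_group G" "abelian_group H" "h \<in> additive_maps G H" "u \<in> carrier U"
    "\<And>x y. x \<in> carrier U \<Longrightarrow> y \<in> carrier U \<Longrightarrow> g x y \<in> carrier G"
  shows "h (rsum G g u) = rsum H (\<lambda>x y. h (g x y)) u"
  using assms by (intro sweedler_hom[OF UrU_tensor]) auto

text \<open>\<open>G\<^sub>j(u) = u\<^bsub>[+]\<^esub> s(f\<^sub>j(u\<^bsub>[-]\<^esub>))\<close>; the second legs of \<open>u\<^bsub>[+]\<^esub> \<otimes> u\<^bsub>[-]\<^esub>\<close> are only ever accessed through the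
  coordinates \<open>f\<^sub>j\<close>.\<close>

definition gam where "gam j = sweedler (UrU B) U (\<lambda>x y. x \<cdot> s (f j y))"
definition Gf where "Gf j u = gam j (transl_r B u)"

lemma gam_bal: "balR U (\<lambda>x y. x \<cdot> s (f j y))"
  by (rule balRI) (simp_all add: distribs f_add f_s s_mult U.m_assoc)

lemma gam_pure [simp]: "x \<in> carrier U \<Longrightarrow> y \<in> carrier U \<Longrightarrow> gam j (x \<boxtimes>\<^bsub>UrU B\<^esub> y) = x \<cdot> s (f j y)"
  unfolding gam_def by (rule sweedler_pure[OF UrU_tensor U_ab gam_bal])

lemma gam_additive: "gam j \<in> additive_maps (UrU B) U"
  unfolding gam_def by (rule sweedler_additive[OF UrU_tensor U_ab gam_bal])

lemmas gam_closed [simp] = additive_maps_closed[OF gam_additive]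

lemma gam_tmult:
  assumes a: "a \<in> carrier A" and c: "c \<in> carrier (UrU B)"
  shows "gam j (UrU_tmult a c) = t a \<cdot> gam j c"
  by (rule tensor_ext[OF UrU_tensor U_ab additive_maps_comp[OF UrU_tmult_additive[OF a] gam_additive]
        additive_maps_comp[OF gam_additive, of "\<lambda>x. t a \<cdot> x" U] _ c])
    (use a in \<open>auto intro!: additive_mapsI simp: distribs UrU_tmult_pure U.m_assoc\<close>)

lemma gam_rmult:
  assumes a: "a \<in> carrier A" and c: "c \<in> carrier (UrU B)"
  shows "gam j (UrU_rmult a c) = gam j c \<cdot> t a"
  by (rule tensor_ext[OF UrU_tensor U_ab additive_maps_comp[OF UrU_rmult_additive[OF a] gam_additive]
        additive_maps_comp[OF gam_additive, of "\<lambda>x. x \<cdot> t a" U] _ c])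
    (use a in \<open>auto intro!: additive_mapsI simp: distribs UrU_rmult_pure U.m_assoc ts\<close>)

lemma Gf_closed [simp]: "u \<in> carrier U \<Longrightarrow> Gf j u \<in> carrier U"
  by (simp add: Gf_def)

lemma Gf_add: "u \<in> carrier U \<Longrightarrow> v \<in> carrier U \<Longrightarrow> Gf j (u \<oplus>\<^bsub>U\<^esub> v) = Gf j u \<oplus>\<^bsub>U\<^esub> Gf j v"
  by (simp add: Gf_def transl_r_taur UU_pure_add_right additive_maps_add[OF taur_additive]
      additive_maps_add[OF gam_additive])

lemma Gf_t: "a \<in> carrier A \<Longrightarrow> u \<in> carrier U \<Longrightarrow> Gf j (t a \<cdot> u) = t a \<cdot> Gf j u"
  by (simp add: Gf_def transl_r_taur taur_t gam_tmult)

lemma Gf_rt: "a \<in> carrier A \<Longrightarrow> u \<in> carrier U \<Longrightarrow> Gf j (u \<cdot> t a) = Gf j u \<cdot> t a"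
  by (simp add: Gf_def transl_r_rt gam_rmult)

text \<open>\<open>\<Delta>(G\<^sub>j(u)) = G\<^sub>j(u\<^bsub>(1)\<^esub>) \<otimes> u\<^bsub>(2)\<^esub>\<close>, the coordinate form of
  \<open>u\<^bsub>[+](1)\<^esub> \<otimes> u\<^bsub>[+](2)\<^esub> \<otimes> u\<^bsub>[-]\<^esub> = u\<^bsub>(1)[+]\<^esub> \<otimes> u\<^bsub>(2)\<^esub> \<otimes> u\<^bsub>(1)[-]\<^esub>\<close>. Both sides are functions of
  \<open>\<alpha>\<^sub>r(u\<^bsub>[+]\<^esub> \<otimes> u\<^bsub>[-]\<^esub>) = 1 \<otimes> u\<close>, and they agree on all \<open>\<alpha>\<^sub>r(x \<otimes> y)\<close> by coassociativity.\<close>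

lemma dsum_Gf:
  assumes H: "abelian_group H" and q: "bal (U_left B) H q" and u: "u \<in> carrier U"
  shows "dsum H q (Gf j u) = dsum H (\<lambda>u1 u2. q (Gf j u1) u2) u"
proof -
  note qD = balancedD(1-3)[OF q, simplified] bal_move[OF q, simplified]
  have b3: "balanced3 (U_left B) H (\<lambda>p w1 w2. q (gam j (taur ((p \<cdot> y) \<boxtimes>\<^bsub>UU B\<^esub> w1))) w2)" if y: "y \<in> carrier U" for y
    using y by (intro balanced3I)
      (simp_all add: qD distribs UU_pure_add_left UU_pure_add_right additive_maps_add[OF taur_additive]
        additive_maps_add[OF gam_additive] U.m_assoc UU_move taur_t gam_tmult)
  note b = balanced3_dsum_right[OF H b3[OF U.one_closed]]
  \<comment> \<open>\<open>?X\<close> is \<open>p \<otimes> w \<mapsto> q (gam j (\<alpha>\<^sub>r\<^sup>-\<^sup>1(p \<otimes> w\<^bsub>(1)\<^esub>))) w\<^bsub>(2)\<^esub>\<close>.\<close>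
  let ?X = "sweedler (UU B) H (\<lambda>p w. dsum H (\<lambda>w1 w2. q (gam j (taur ((p \<cdot> \<one>\<^bsub>U\<^esub>) \<boxtimes>\<^bsub>UU B\<^esub> w1))) w2) w)"
  have "dsum H q (gam j (transl_r B u)) = ?X (alpha_r B (transl_r B u))"
  proof (rule tensor_ext[OF UrU_tensor H additive_maps_comp[OF gam_additive dsum_additive[OF H q]]
        additive_maps_comp[OF alpha_r_additive sweedler_additive[OF UU_tensor H b]] _ transl_r_closed[OF u]])
    fix x y assume xy: "x \<in> carrier U" "y \<in> carrier U"
    have "?X (alpha_r B (x \<boxtimes>\<^bsub>UrU B\<^esub> y)) = dsum H (\<lambda>x1 x2. dsum H
        (\<lambda>w1 w2. q (gam j (taur ((x1 \<cdot> y \<cdot> \<one>\<^bsub>U\<^esub>) \<boxtimes>\<^bsub>UU B\<^esub> w1))) w2) x2) x"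
      unfolding alpha_r_pure[OF xy] using xy
      by (subst sweedler_push[OF UU_tensor UU_tensor H b]) auto
    also have "\<dots> = dsum H (\<lambda>x1 x2. dsum H (\<lambda>w1 w2. q (gam j (taur ((x1 \<cdot> y) \<boxtimes>\<^bsub>UU B\<^esub> w1))) w2) x2) x"
      using xy by (intro dsum_cong) auto
    also have "\<dots> = dsum H (\<lambda>x1 x2. dsum H (\<lambda>p1 p2. q (gam j (taur ((p1 \<cdot> y) \<boxtimes>\<^bsub>UU B\<^esub> p2))) x2) x1) x"
      by (rule dsum_coassoc[OF H b3[OF xy(2)] xy(1), symmetric])
    also have "\<dots> = dsum H (\<lambda>x1 x2. q (x1 \<cdot> s (f j y)) x2) x"
    proof (rule dsum_cong[OF xy(1)])
      fix x1 x2 assume x: "x1 \<in> carrier U" "x2 \<in> carrier U"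
      have h: "(\<lambda>c. q (gam j (taur c)) x2) \<in> additive_maps (UU B) H"
        using x by (intro additive_maps_comp[OF additive_maps_comp[OF taur_additive gam_additive]
              balanced_additive_left[OF q]]) auto
      have "dsum H (\<lambda>p1 p2. q (gam j (taur ((p1 \<cdot> y) \<boxtimes>\<^bsub>UU B\<^esub> p2))) x2) x1 =
          q (gam j (taur (alpha_r B (x1 \<boxtimes>\<^bsub>UrU B\<^esub> y)))) x2"
        unfolding alpha_r_pure[OF x(1) xy(2)] using x xy
        by (intro dsum_hom[OF UU_ab H h, symmetric]) auto
      then show "dsum H (\<lambda>p1 p2. q (gam j (taur ((p1 \<cdot> y) \<boxtimes>\<^bsub>UU B\<^esub> p2))) x2) x1 = q (x1 \<cdot> s (f j y)) x2"
        using x xy by (simp add: taur_alpha)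
    qed
    also have "\<dots> = dsum H q (gam j (x \<boxtimes>\<^bsub>UrU B\<^esub> y))"
      using xy by (simp add: dsum_s_right[OF H q])
    finally show "dsum H q (gam j (x \<boxtimes>\<^bsub>UrU B\<^esub> y)) = ?X (alpha_r B (x \<boxtimes>\<^bsub>UrU B\<^esub> y))" by simp
  qed
  also have "\<dots> = dsum H (\<lambda>w1 w2. q (gam j (taur ((\<one>\<^bsub>U\<^esub> \<cdot> \<one>\<^bsub>U\<^esub>) \<boxtimes>\<^bsub>UU B\<^esub> w1))) w2) u"
    using u sweedler_pure[OF UU_tensor H b, of "\<one>\<^bsub>U\<^esub>" u] by (simp add: alpha_transl_r)
  also have "\<dots> = dsum H (\<lambda>u1 u2. q (Gf j u1) u2) u"
    using u by (intro dsum_cong) (auto simp: Gf_def transl_r_taur)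
  finally show ?thesis by (simp add: Gf_def)
qed

text \<open>\<open>u\<^bsub>[+]\<^esub> u\<^bsub>[-]\<^esub> = t(\<epsilon>(u))\<close>: by counitality \<open>x \<otimes> y \<mapsto> x y\<close> is \<open>\<alpha>\<^sub>r\<close> followed by
  \<open>u\<^sub>1 \<otimes> u\<^sub>2 \<mapsto> t(\<epsilon>(u\<^sub>2)) u\<^sub>1\<close>.\<close>

lemma rsum_mult:
  assumes u: "u \<in> carrier U"
  shows "rsum U (\<lambda>x y. x \<cdot> y) u = t (eps u)"
proof -
  note h = sweedler_additive[OF UU_tensor U_ab counit_r_bal]
  let ?h = "sweedler (UU B) U (\<lambda>u1 u2. t (eps u2) \<cdot> u1)"
  have "rsum U (\<lambda>x y. x \<cdot> y) u = ?h (alpha_r B (transl_r B u))"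
  proof (rule sweedler_eq_hom[OF UrU_tensor U_ab additive_maps_comp[OF alpha_r_additive h]])
    fix x y assume xy: "x \<in> carrier U" "y \<in> carrier U"
    have "?h (alpha_r B (x \<boxtimes>\<^bsub>UrU B\<^esub> y)) = dsum U (\<lambda>u1 u2. t (eps u2) \<cdot> (u1 \<cdot> y)) x"
      unfolding alpha_r_pure[OF xy] using xy
      by (subst sweedler_push[OF UU_tensor UU_tensor U_ab counit_r_bal]) auto
    also have "\<dots> = dsum U (\<lambda>u1 u2. (t (eps u2) \<cdot> u1) \<cdot> y) x"
      using xy by (intro dsum_cong) (auto simp: U.m_assoc)
    also have "\<dots> = dsum U (\<lambda>u1 u2. t (eps u2) \<cdot> u1) x \<cdot> y"
      using xy by (intro dsum_hom[symmetric, of U U "\<lambda>x. x \<cdot> y"]) (auto intro!: additive_mapsI simp: distribs)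
    finally show "?h (alpha_r B (x \<boxtimes>\<^bsub>UrU B\<^esub> y)) = x \<cdot> y" using xy by (simp add: counit_r)
  qed (use u in simp)
  then show ?thesis
    using u by (simp add: alpha_transl_r sweedler_pure[OF UU_tensor U_ab counit_r_bal])
qed

text \<open>Expand the second legs of \<open>u\<^bsub>[+]\<^esub> \<otimes> u\<^bsub>[-]\<^esub>\<close> along the dual basis in \<open>u\<^bsub>[+]\<^esub> u\<^bsub>[-]\<^esub> = t(\<epsilon>(u))\<close>.\<close>

lemma Gf_sum:
  assumes u: "u \<in> carrier U"
    and J: "finite J" "J \<subseteq> carrier U"
      "\<And>x y. (x, y) \<in> set (representative (UrU B) (transl_r B u)) \<Longrightarrow> y = (\<Oplus>\<^bsub>U\<^esub>j\<in>J. s (f j y) \<cdot> j)"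
  shows "(\<Oplus>\<^bsub>U\<^esub>j\<in>J. Gf j u \<cdot> j) = t (eps u)"
proof -
  have jU [simp]: "j \<in> carrier U" if "j \<in> J" for j using that J(2) by auto
  have "t (eps u) = rsum U (\<lambda>x y. x \<cdot> y) u" using u by (simp add: rsum_mult)
  also have "\<dots> = rsum U (\<lambda>x y. \<Oplus>\<^bsub>U\<^esub>j\<in>J. x \<cdot> s (f j y) \<cdot> j) u"
  proof (rule sweedler_cong)
    fix x y assume xy: "(x, y) \<in> set (representative (UrU B) (transl_r B u))"
    note [simp] = representativeD[OF UrU_tensor transl_r_closed[OF u] xy]
    have "x \<cdot> y = x \<cdot> (\<Oplus>\<^bsub>U\<^esub>j\<in>J. s (f j y) \<cdot> j)" using J(3)[OF xy] by simp
    also have "\<dots> = (\<Oplus>\<^bsub>U\<^esub>j\<in>J. x \<cdot> (s (f j y) \<cdot> j))"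
      by (rule additive_maps_finsum[OF U_ab U_ab _ J(1), of "\<lambda>y. x \<cdot> y"])
        (auto intro!: additive_mapsI simp: distribs)
    also have "\<dots> = (\<Oplus>\<^bsub>U\<^esub>j\<in>J. x \<cdot> s (f j y) \<cdot> j)"
      by (rule U.finsum_cong') (auto simp: U.m_assoc)
    finally show "x \<cdot> y = (\<Oplus>\<^bsub>U\<^esub>j\<in>J. x \<cdot> s (f j y) \<cdot> j)" .
  qed
  also have "\<dots> = (\<Oplus>\<^bsub>U\<^esub>j\<in>J. rsum U (\<lambda>x y. x \<cdot> s (f j y) \<cdot> j) u)"
    using u J(1) by (intro sweedler_finsum[OF UrU_tensor U_ab]) auto
  also have "\<dots> = (\<Oplus>\<^bsub>U\<^esub>j\<in>J. Gf j u \<cdot> j)"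
  proof (rule U.finsum_cong'[OF refl])
    fix j assume j: "j \<in> J"
    show "rsum U (\<lambda>x y. x \<cdot> s (f j y) \<cdot> j) u = Gf j u \<cdot> j"
      unfolding Gf_def gam_def using u j
      by (intro rsum_hom[symmetric, of U U "\<lambda>x. x \<cdot> j"]) (auto intro!: additive_mapsI simp: distribs)
  qed (use u in auto)
  finally show ?thesis by simp
qed

section \<open>The right coaction\<close>

context
  fixes P :: "('a, 'u, 'p) comodule"
  assumes P [simp]: "left_comodule B P"
begin

abbreviation UP where "UP \<equiv> UX B P"

lemma UP_ab [simp]: "abelian_group UP" by simp

lemmas UP_tensor = UX_tensor[OF comodule_module[OF P]]
lemmas UP_pure_simps = UX_pure_add_left[OF comodule_module[OF P]] UX_pure_add_right[OF comodule_module[OF P]]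
  UX_move[OF comodule_module[OF P]]

lemma UX_right_bal: "a \<in> carrier A \<Longrightarrow> bal P UP (\<lambda>u p. (u \<cdot> s a) \<boxtimes>\<^bsub>UP\<^esub> p)"
  by (rule balI) (simp_all add: UP_pure_simps distribs U.m_assoc)

lemma UX_right_pure [simp]: "a \<in> carrier A \<Longrightarrow> u \<in> carrier U \<Longrightarrow> p \<in> carrier P \<Longrightarrow>
    UX_right B P (u \<boxtimes>\<^bsub>UP\<^esub> p) a = (u \<cdot> s a) \<boxtimes>\<^bsub>UP\<^esub> p"
  unfolding UX_right_def using sweedler_pure[OF UP_tensor UP_ab UX_right_bal] by simp

lemma UX_right_additive: "a \<in> carrier A \<Longrightarrow> (\<lambda>c. UX_right B P c a) \<in> additive_maps UP UP"
  unfolding UX_right_def using sweedler_additive[OF UP_tensor UP_ab UX_right_bal] by simp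

lemmas UX_right_closed [simp] = additive_maps_closed[OF UX_right_additive]

lemma UXU_tensor: "is_tensor (UXU B P) (carrier A) UP (UX_right B P) (lwhite B) U"
  by (simp add: is_tensor_def tensor_data_def UXU_def)

lemmas UXU_ab [simp] = tensor_abelian_group[OF UXU_tensor]
lemmas UXU_pure_closed [simp] = pure_closed[OF UXU_tensor]

lemma tak_left_bal: "a \<in> carrier A \<Longrightarrow> bal P UP (\<lambda>u p. (u \<cdot> t a) \<boxtimes>\<^bsub>UP\<^esub> p)"
  by (rule balI) (simp_all add: UP_pure_simps distribs U.m_assoc)

lemma tak_right_bal: "a \<in> carrier A \<Longrightarrow> bal P UP (\<lambda>u p. u \<boxtimes>\<^bsub>UP\<^esub> right_act B P p a)"
  by (rule balI) (simp_all add: UP_pure_simps ra_add ra_smult distribs)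

lemmas tak_left_additive = sweedler_additive[OF UP_tensor UP_ab tak_left_bal]
lemmas tak_right_additive = sweedler_additive[OF UP_tensor UP_ab tak_right_bal]

lemma takeuchi_iff: "c \<in> carrier (takeuchi B P) \<longleftrightarrow> c \<in> carrier UP \<and> (\<forall>a\<in>carrier A.
    sweedler UP UP (\<lambda>u p. (u \<cdot> t a) \<boxtimes>\<^bsub>UP\<^esub> p) c = sweedler UP UP (\<lambda>u p. u \<boxtimes>\<^bsub>UP\<^esub> right_act B P p a) c)"
  by (simp add: takeuchi_def)

lemma takeuchi_closed: "c \<in> carrier (takeuchi B P) \<Longrightarrow> c \<in> carrier UP"
  by (simp add: takeuchi_iff)

lemma takeuchi_ab [simp]: "abelian_group (takeuchi B P)"
  unfolding takeuchi_def
  using abelian_group_equalizer[OF UP_ab UP_ab, of "carrier A", OF tak_left_additive tak_right_additive] by simp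

lemma takeuchi_simps [simp]: "add (takeuchi B P) = add UP" "zero (takeuchi B P) = zero UP"
  "sweedler T (takeuchi B P) = sweedler T UP"
  by (simp_all add: takeuchi_def)

lemma takeuchiD:
  assumes "abelian_group H" "bal P H q" "c \<in> carrier (takeuchi B P)" "a \<in> carrier A"
  shows "sweedler UP H (\<lambda>u p. q (u \<cdot> t a) p) c = sweedler UP H (\<lambda>u p. q u (right_act B P p a)) c"
proof -
  have c: "c \<in> carrier UP" and eq: "sweedler UP UP (\<lambda>u p. (u \<cdot> t a) \<boxtimes>\<^bsub>UP\<^esub> p) c =
      sweedler UP UP (\<lambda>u p. u \<boxtimes>\<^bsub>UP\<^esub> right_act B P p a) c"
    using assms by (auto simp: takeuchi_iff)
  have "sweedler UP H (\<lambda>u p. q (u \<cdot> t a) p) c = sweedler UP H q (sweedler UP UP (\<lambda>u p. (u \<cdot> t a) \<boxtimes>\<^bsub>UP\<^esub> p) c)"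
    using assms c by (intro sweedler_push[OF UP_tensor UP_tensor, symmetric]) auto
  also have "\<dots> = sweedler UP H (\<lambda>u p. q u (right_act B P p a)) c"
    unfolding eq using assms c by (intro sweedler_push[OF UP_tensor UP_tensor]) auto
  finally show ?thesis .
qed

lemma UX_right_takeuchi:
  assumes b: "b \<in> carrier A" and c: "c \<in> carrier (takeuchi B P)"
  shows "UX_right B P c b \<in> carrier (takeuchi B P)"
proof -
  note c' [simp] = takeuchi_closed[OF c]
  have "sweedler UP UP (\<lambda>u p. (u \<cdot> t a) \<boxtimes>\<^bsub>UP\<^esub> p) (UX_right B P c b) =
      sweedler UP UP (\<lambda>u p. u \<boxtimes>\<^bsub>UP\<^esub> right_act B P p a) (UX_right B P c b)" if a: "a \<in> carrier A" for a
  proof -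
    have "sweedler UP UP (\<lambda>u p. (u \<cdot> t a) \<boxtimes>\<^bsub>UP\<^esub> p) (UX_right B P c b) =
        sweedler UP UP (\<lambda>u p. (u \<cdot> s b \<cdot> t a) \<boxtimes>\<^bsub>UP\<^esub> p) c"
      unfolding UX_right_def using a b
      by (simp, subst sweedler_push[OF UP_tensor UP_tensor UP_ab tak_left_bal]) auto
    also have "\<dots> = sweedler UP UP (\<lambda>u p. (u \<cdot> t a \<cdot> s b) \<boxtimes>\<^bsub>UP\<^esub> p) c"
      using a b by (intro sweedler_congT[OF UP_tensor c']) (simp add: U.m_assoc ts)
    also have "\<dots> = sweedler UP UP (\<lambda>u p. (u \<cdot> s b) \<boxtimes>\<^bsub>UP\<^esub> right_act B P p a) c"
      by (rule takeuchiD[OF UP_ab UX_right_bal[OF b] c a])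
    also have "\<dots> = sweedler UP UP (\<lambda>u p. u \<boxtimes>\<^bsub>UP\<^esub> right_act B P p a) (UX_right B P c b)"
      unfolding UX_right_def using a b
      by (simp, subst sweedler_push[OF UP_tensor UP_tensor UP_ab tak_right_bal]) auto
    finally show ?thesis .
  qed
  then show ?thesis using b by (simp add: takeuchi_iff)
qed

lemma takeuchi_U_tensor: "is_tensor (takeuchi_U B P) (carrier A) (takeuchi B P) (UX_right B P) (lwhite B) U"
  by (simp add: is_tensor_def tensor_data_def takeuchi_U_def UX_right_takeuchi)

lemmas takeuchi_U_ab [simp] = tensor_abelian_group[OF takeuchi_U_tensor]

lemma takeuchi_incl_bal: "balanced (carrier A) (takeuchi B P) (UX_right B P) (lwhite B) U (UXU B P)
    (\<lambda>e v. e \<boxtimes>\<^bsub>UXU B P\<^esub> v)"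
  using pure_balanced[OF UXU_tensor] by (auto simp: balanced_def takeuchi_closed)

lemma XU_tensor: "is_tensor (XU B P) (carrier A) P (right_act B P) (lwhite B) U"
  by (simp add: is_tensor_def tensor_data_def XU_def)

lemmas XU_ab [simp] = tensor_abelian_group[OF XU_tensor]
lemmas XU_pure_closed [simp] = pure_closed[OF XU_tensor]

text \<open>The map \<open>u \<otimes> p \<mapsto> \<epsilon>(u) p\<close>. It is right \<open>A\<close>-linear on the Takeuchi product, since there
  \<open>\<epsilon>(u s(a)) p = \<epsilon>(u t(a)) p\<close> turns into \<open>\<epsilon>(u) (p a)\<close>.\<close>

definition evl where "evl = sweedler UP P (\<lambda>u p'. eps u \<odot>\<^bsub>P\<^esub> p')"

lemma evl_bal: "bal P P (\<lambda>u p'. eps u \<odot>\<^bsub>P\<^esub> p')"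
  by (rule balI) (simp_all add: distribs comodule_distribs comodule_assoc)

lemma evl_additive: "evl \<in> additive_maps UP P"
  unfolding evl_def by (rule sweedler_additive[OF UP_tensor comodule_ab[OF P] evl_bal])

lemmas evl_closed [simp] = additive_maps_closed[OF evl_additive]

lemma evl_right:
  assumes a: "a \<in> carrier A" and c: "c \<in> carrier (takeuchi B P)"
  shows "evl (UX_right B P c a) = right_act B P (evl c) a"
proof -
  note c' [simp] = takeuchi_closed[OF c]
  have ea: "eps (s a) = a" using eps_s[OF a U.one_closed] a by (simp add: counit_one)
  have "evl (UX_right B P c a) = sweedler UP P (\<lambda>u p. eps (u \<cdot> s a) \<odot>\<^bsub>P\<^esub> p) c"
    unfolding evl_def UX_right_def using a
    by (simp, subst sweedler_push[OF UP_tensor UP_tensor comodule_ab[OF P] evl_bal]) auto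
  also have "\<dots> = sweedler UP P (\<lambda>u p. eps (u \<cdot> t a) \<odot>\<^bsub>P\<^esub> p) c"
    using a counit_mult_tgt[of _ "s a"] by (intro sweedler_congT[OF UP_tensor c']) (simp add: ea)
  also have "\<dots> = sweedler UP P (\<lambda>u p. eps u \<odot>\<^bsub>P\<^esub> right_act B P p a) c"
    by (rule takeuchiD[OF comodule_ab[OF P] evl_bal c a])
  also have "\<dots> = sweedler UP P (\<lambda>u p. right_act B P (eps u \<odot>\<^bsub>P\<^esub> p) a) c"
    using a by (intro sweedler_congT[OF UP_tensor c']) (simp add: ra_smult)
  also have "\<dots> = right_act B P (evl c) a"
    unfolding evl_def using a
    by (intro sweedler_hom[OF UP_tensor _ _ ra_additive[OF P], symmetric]) auto
  finally show ?thesis .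
qed

text \<open>\<open>Y\<^sub>j = (id \<otimes> f\<^sub>j)((p\<^bsub>(-1)[+]\<^esub> \<otimes> p\<^bsub>(0)\<^esub>) \<otimes> p\<^bsub>(-1)[-]\<^esub>)\<close> and \<open>K\<^sub>j = \<epsilon>(G\<^sub>j(p\<^bsub>(-1)\<^esub>)) p\<^bsub>(0)\<^esub>\<close>.\<close>

definition Yj where "Yj j p = csum P UP (\<lambda>u p'. Gf j u \<boxtimes>\<^bsub>UP\<^esub> p') p"
definition Kj where "Kj j p = csum P P (\<lambda>u p'. eps (Gf j u) \<odot>\<^bsub>P\<^esub> p') p"

lemma Gf_comp_bal: "bal P H q \<Longrightarrow> bal P H (\<lambda>u p'. q (Gf j u) p')"
  using balancedD[of "carrier A" U "rwhite B" "smult P" P H q] bal_move[of P H q]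
  by (intro balI) (simp_all add: Gf_add Gf_t)

text \<open>\<open>G\<^sub>j\<close> commutes with right multiplication by \<open>t(a)\<close>, so the Takeuchi property of \<open>p\<^bsub>(-1)\<^esub> \<otimes> p\<^bsub>(0)\<^esub>\<close> passes to
  \<open>Y\<^sub>j\<close>.\<close>

lemma Yj_takeuchi:
  assumes p: "p \<in> carrier P"
  shows "Yj j p \<in> carrier (takeuchi B P)"
proof -
  note b = Gf_comp_bal[OF UX_pure_bal[OF comodule_module[OF P]]]
  have Y: "Yj j p \<in> carrier UP" unfolding Yj_def using p by (intro csum_closed[OF P]) auto
  have "sweedler UP UP (\<lambda>u p. (u \<cdot> t a) \<boxtimes>\<^bsub>UP\<^esub> p) (Yj j p) =
      sweedler UP UP (\<lambda>u p. u \<boxtimes>\<^bsub>UP\<^esub> right_act B P p a) (Yj j p)" if a: "a \<in> carrier A" for a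
  proof -
    have "sweedler UP UP (\<lambda>u p. (u \<cdot> t a) \<boxtimes>\<^bsub>UP\<^esub> p) (Yj j p) =
        csum P UP (\<lambda>u p'. (Gf j u \<cdot> t a) \<boxtimes>\<^bsub>UP\<^esub> p') p"
      unfolding Yj_def using a p
      by (intro sweedler_push[OF UP_tensor UP_tensor UP_ab tak_left_bal]) auto
    also have "\<dots> = csum P UP (\<lambda>u p'. Gf j (u \<cdot> t a) \<boxtimes>\<^bsub>UP\<^esub> p') p"
      using a p by (intro csum_cong[OF P]) (simp_all add: Gf_rt)
    also have "\<dots> = csum P UP (\<lambda>u p'. Gf j u \<boxtimes>\<^bsub>UP\<^esub> right_act B P p' a) p"
      by (rule csum_takeuchi[OF P UP_ab b a p])
    also have "\<dots> = sweedler UP UP (\<lambda>u p. u \<boxtimes>\<^bsub>UP\<^esub> right_act B P p a) (Yj j p)"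
      unfolding Yj_def using a p
      by (intro sweedler_push[OF UP_tensor UP_tensor UP_ab tak_right_bal, symmetric]) auto
    finally show ?thesis .
  qed
  then show ?thesis using Y by (simp add: takeuchi_iff)
qed

lemma evl_Yj: "p \<in> carrier P \<Longrightarrow> evl (Yj j p) = Kj j p"
  unfolding Yj_def Kj_def evl_def
  by (intro sweedler_push[OF UP_tensor UP_tensor comodule_ab[OF P] evl_bal]) auto

lemma Kj_closed [simp]: "p \<in> carrier P \<Longrightarrow> Kj j p \<in> carrier P"
  unfolding Kj_def by (intro csum_closed[OF P]) auto

text \<open>\<open>\<lambda>(K\<^sub>j) = G\<^sub>j(p\<^bsub>(-1)\<^esub>) \<otimes> p\<^bsub>(0)\<^esub>\<close>, from \<open>\<Delta>(G\<^sub>j(u)) = G\<^sub>j(u\<^bsub>(1)\<^esub>) \<otimes> u\<^bsub>(2)\<^esub>\<close> and counitality.\<close>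

lemma csum_Kj:
  assumes H: "abelian_group H" and q: "bal P H q" and p: "p \<in> carrier P"
  shows "csum P H q (Kj j p) = csum P H (\<lambda>u p'. q (Gf j u) p') p"
proof -
  note qD = balancedD(1-3)[OF q] bal_move[OF q]
  have q3: "balanced3 P H (\<lambda>u v p'. q (s (eps (Gf j u)) \<cdot> v) p')"
    by (rule balanced3I) (simp_all add: qD Gf_add Gf_t distribs s_mult U.m_assoc ts_left[symmetric])
  have "csum P H q (Kj j p) = csum P H (\<lambda>u p'. csum P H q (eps (Gf j u) \<odot>\<^bsub>P\<^esub> p')) p"
    unfolding Kj_def using p by (intro csum_hom[OF P _ H csum_additive[OF P H q]]) auto
  also have "\<dots> = csum P H (\<lambda>u p'. csum P H (\<lambda>v p''. q (s (eps (Gf j u)) \<cdot> v) p'') p') p"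
    using p by (intro csum_cong[OF P p] csum_smult[OF P H q]) auto
  also have "\<dots> = csum P H (\<lambda>u p'. dsum H (\<lambda>u1 u2. q (s (eps (Gf j u1)) \<cdot> u2) p') u) p"
    by (rule csum_coassoc[OF P H q3 p, symmetric])
  also have "\<dots> = csum P H (\<lambda>u p'. q (Gf j u) p') p"
  proof (rule csum_cong[OF P p])
    fix u p' assume u: "u \<in> carrier U" "p' \<in> carrier P"
    have b: "bal (U_left B) H (\<lambda>x y. q (s (eps x) \<cdot> y) p')"
      using u by (intro balI) (simp_all add: qD distribs s_mult U.m_assoc)
    have "dsum H (\<lambda>u1 u2. q (s (eps (Gf j u1)) \<cdot> u2) p') u = dsum H (\<lambda>x y. q (s (eps x) \<cdot> y) p') (Gf j u)"
      by (rule dsum_Gf[OF H b u(1), symmetric])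
    also have "\<dots> = q (dsum U (\<lambda>x y. s (eps x) \<cdot> y) (Gf j u)) p'"
      using u by (intro dsum_hom[OF U_ab H balanced_additive_left[OF q], symmetric]) auto
    finally show "dsum H (\<lambda>u1 u2. q (s (eps (Gf j u1)) \<cdot> u2) p') u = q (Gf j u) p'"
      using u by (simp add: counit_l)
  qed
  finally show ?thesis .
qed

lemma pre_f_bal: "balanced (carrier A) UP (UX_right B P) (lwhite B) U UP (\<lambda>c v. UX_right B P c (f j v))"
proof (rule balancedI)
  show "UX_right B P c (f j (v \<oplus>\<^bsub>U\<^esub> v')) = UX_right B P c (f j v) \<oplus>\<^bsub>UP\<^esub> UX_right B P c (f j v')"
    if "c \<in> carrier UP" "v \<in> carrier U" "v' \<in> carrier U" for c v v'
    unfolding UX_right_def using that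
    by (subst sweedler_fun_add[OF UP_tensor UP_ab, symmetric])
      (simp_all add: f_add distribs UP_pure_simps cong: sweedler_congT[OF UP_tensor])
  show "UX_right B P (UX_right B P c a) (f j v) = UX_right B P c (f j (lwhite B a v))"
    if "a \<in> carrier A" "c \<in> carrier UP" "v \<in> carrier U" for a c v
    using that
    by (intro tensor_ext[OF UP_tensor UP_ab additive_maps_comp[OF UX_right_additive[of a] UX_right_additive[of "f j v"]]
        UX_right_additive[of "f j (lwhite B a v)"] _ that(2)])
      (simp_all add: f_s s_mult U.m_assoc)
qed (simp_all add: additive_maps_add[OF UX_right_additive])

text \<open>The coordinate \<open>id \<otimes> f\<^sub>j\<close> of \<open>(p\<^bsub>(-1)[+]\<^esub> \<otimes> p\<^bsub>(0)\<^esub>) \<otimes> p\<^bsub>(-1)[-]\<^esub>\<close>; it is what determines the value of the right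
  coaction, whichever lift is chosen.\<close>

lemma pre_f:
  assumes p: "p \<in> carrier P"
  shows "sweedler (UXU B P) UP (\<lambda>c v. UX_right B P c (f j v)) (right_coact_pre B P p) = Yj j p"
proof -
  let ?F = "sweedler (UXU B P) UP (\<lambda>c v. UX_right B P c (f j v))"
  note h = sweedler_additive[OF UXU_tensor UP_ab pre_f_bal]
  have "?F (right_coact_pre B P p) = csum P UP (\<lambda>u p'. ?F (rsum (UXU B P) (\<lambda>x y. (x \<boxtimes>\<^bsub>UP\<^esub> p') \<boxtimes>\<^bsub>UXU B P\<^esub> y) u)) p"
    unfolding right_coact_pre_def using p by (intro csum_hom[OF P _ _ h]) (auto intro!: rsum_closed)
  also have "\<dots> = Yj j p"
    unfolding Yj_def
  proof (rule csum_cong[OF P p])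
    fix u p' assume u: "u \<in> carrier U" "p' \<in> carrier P"
    have "?F (rsum (UXU B P) (\<lambda>x y. (x \<boxtimes>\<^bsub>UP\<^esub> p') \<boxtimes>\<^bsub>UXU B P\<^esub> y) u) =
        rsum UP (\<lambda>x y. UX_right B P (x \<boxtimes>\<^bsub>UP\<^esub> p') (f j y)) u"
      using u by (intro sweedler_push[OF UrU_tensor UXU_tensor UP_ab pre_f_bal]) auto
    also have "\<dots> = rsum UP (\<lambda>x y. (x \<cdot> s (f j y)) \<boxtimes>\<^bsub>UP\<^esub> p') u"
      using u by (intro rsum_cong) auto
    also have "\<dots> = Gf j u \<boxtimes>\<^bsub>UP\<^esub> p'"
      unfolding Gf_def gam_def using u
      by (intro rsum_hom[OF U_ab UP_ab balanced_additive_left[OF UX_pure_bal[OF comodule_module[OF P]]], symmetric]) auto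
    finally show "?F (rsum (UXU B P) (\<lambda>x y. (x \<boxtimes>\<^bsub>UP\<^esub> p') \<boxtimes>\<^bsub>UXU B P\<^esub> y) u) = Gf j u \<boxtimes>\<^bsub>UP\<^esub> p'" .
  qed
  finally show ?thesis .
qed

text \<open>Hence \<open>\<Sum>\<^sub>j Y\<^sub>j \<otimes> j\<close>, taken in the Takeuchi product, is a lift.\<close>

lemma right_coact_pre_sum:
  assumes p: "p \<in> carrier P" and J: "finite J" "J \<subseteq> carrier U"
    and cov: "\<And>u p' x y. (u, p') \<in> set (representative UP (coact P p)) \<Longrightarrow>
      (x, y) \<in> set (representative (UrU B) (transl_r B u)) \<Longrightarrow> y = (\<Oplus>\<^bsub>U\<^esub>j\<in>J. s (f j y) \<cdot> j)"
  shows "right_coact_pre B P p = (\<Oplus>\<^bsub>UXU B P\<^esub>j\<in>J. Yj j p \<boxtimes>\<^bsub>UXU B P\<^esub> j)"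
proof -
  let ?T = "UXU B P"
  interpret T: abelian_group ?T by simp
  have jU [simp]: "j \<in> carrier U" if "j \<in> J" for j using that J(2) by auto
  have pc: "coact P p \<in> carrier UP" using p by simp
  have "right_coact_pre B P p = csum P ?T (\<lambda>u p'. \<Oplus>\<^bsub>?T\<^esub>j\<in>J. (Gf j u \<boxtimes>\<^bsub>UP\<^esub> p') \<boxtimes>\<^bsub>?T\<^esub> j) p"
    unfolding right_coact_pre_def
  proof (rule sweedler_cong)
    fix u p' assume up: "(u, p') \<in> set (representative UP (coact P p))"
    note u [simp] = representativeD[OF UP_tensor pc up]
    have "rsum ?T (\<lambda>x y. (x \<boxtimes>\<^bsub>UP\<^esub> p') \<boxtimes>\<^bsub>?T\<^esub> y) u =
        rsum ?T (\<lambda>x y. \<Oplus>\<^bsub>?T\<^esub>j\<in>J. ((x \<cdot> s (f j y)) \<boxtimes>\<^bsub>UP\<^esub> p') \<boxtimes>\<^bsub>?T\<^esub> j) u"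
    proof (rule sweedler_cong)
      fix x y assume xy: "(x, y) \<in> set (representative (UrU B) (transl_r B u))"
      note [simp] = representativeD[OF UrU_tensor transl_r_closed[OF u(1)] xy]
      have "(x \<boxtimes>\<^bsub>UP\<^esub> p') \<boxtimes>\<^bsub>?T\<^esub> y = (x \<boxtimes>\<^bsub>UP\<^esub> p') \<boxtimes>\<^bsub>?T\<^esub> (\<Oplus>\<^bsub>U\<^esub>j\<in>J. s (f j y) \<cdot> j)"
        using cov[OF up xy] by simp
      also have "\<dots> = (\<Oplus>\<^bsub>?T\<^esub>j\<in>J. (x \<boxtimes>\<^bsub>UP\<^esub> p') \<boxtimes>\<^bsub>?T\<^esub> (s (f j y) \<cdot> j))"
        by (rule additive_maps_finsum[OF U_ab UXU_ab balanced_additive_right[OF pure_balanced[OF UXU_tensor]] J(1)]) auto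
      also have "\<dots> = (\<Oplus>\<^bsub>?T\<^esub>j\<in>J. ((x \<cdot> s (f j y)) \<boxtimes>\<^bsub>UP\<^esub> p') \<boxtimes>\<^bsub>?T\<^esub> j)"
        using pure_move[OF UXU_tensor, of "f j y" "x \<boxtimes>\<^bsub>UP\<^esub> p'" j for j]
        by (intro T.finsum_cong') auto
      finally show "(x \<boxtimes>\<^bsub>UP\<^esub> p') \<boxtimes>\<^bsub>?T\<^esub> y = (\<Oplus>\<^bsub>?T\<^esub>j\<in>J. ((x \<cdot> s (f j y)) \<boxtimes>\<^bsub>UP\<^esub> p') \<boxtimes>\<^bsub>?T\<^esub> j)" .
    qed
    also have "\<dots> = (\<Oplus>\<^bsub>?T\<^esub>j\<in>J. rsum ?T (\<lambda>x y. ((x \<cdot> s (f j y)) \<boxtimes>\<^bsub>UP\<^esub> p') \<boxtimes>\<^bsub>?T\<^esub> j) u)"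
      using J(1) by (intro sweedler_finsum[OF UrU_tensor]) auto
    also have "\<dots> = (\<Oplus>\<^bsub>?T\<^esub>j\<in>J. (Gf j u \<boxtimes>\<^bsub>UP\<^esub> p') \<boxtimes>\<^bsub>?T\<^esub> j)"
    proof (rule T.finsum_cong'[OF refl])
      fix j assume j: "j \<in> J"
      have h: "(\<lambda>z. (z \<boxtimes>\<^bsub>UP\<^esub> p') \<boxtimes>\<^bsub>?T\<^esub> j) \<in> additive_maps U ?T"
        using j by (intro additive_mapsI) (simp_all add: UP_pure_simps pure_add_left[OF UXU_tensor])
      show "rsum ?T (\<lambda>x y. ((x \<cdot> s (f j y)) \<boxtimes>\<^bsub>UP\<^esub> p') \<boxtimes>\<^bsub>?T\<^esub> j) u = (Gf j u \<boxtimes>\<^bsub>UP\<^esub> p') \<boxtimes>\<^bsub>?T\<^esub> j"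
        unfolding Gf_def gam_def by (intro rsum_hom[OF U_ab _ h, symmetric]) auto
    qed auto
    finally show "rsum ?T (\<lambda>x y. (x \<boxtimes>\<^bsub>UP\<^esub> p') \<boxtimes>\<^bsub>?T\<^esub> y) u = (\<Oplus>\<^bsub>?T\<^esub>j\<in>J. (Gf j u \<boxtimes>\<^bsub>UP\<^esub> p') \<boxtimes>\<^bsub>?T\<^esub> j)" .
  qed
  also have "\<dots> = (\<Oplus>\<^bsub>?T\<^esub>j\<in>J. csum P ?T (\<lambda>u p'. (Gf j u \<boxtimes>\<^bsub>UP\<^esub> p') \<boxtimes>\<^bsub>?T\<^esub> j) p)"
    using J(1) pc by (intro sweedler_finsum[OF UP_tensor]) auto
  also have "\<dots> = (\<Oplus>\<^bsub>?T\<^esub>j\<in>J. Yj j p \<boxtimes>\<^bsub>?T\<^esub> j)"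
    unfolding Yj_def using p
    by (intro T.finsum_cong' refl csum_hom[OF P UP_ab UXU_ab balanced_additive_left[OF pure_balanced[OF UXU_tensor]], symmetric])
      (auto intro!: UXU_pure_closed csum_closed[OF P])
  finally show ?thesis .
qed

text \<open>The lift \<open>e\<close> chosen in the definition of the right coaction is expanded along the dual basis; its
  coordinates are those of \<open>\<Sum>\<^sub>j Y\<^sub>j \<otimes> j\<close>, and \<open>\<epsilon>\<close> sends \<open>Y\<^sub>j\<close> to \<open>K\<^sub>j\<close>. The second conclusion is recorded for the
  same index set \<open>J\<close>, which therefore must contain the supports of the second legs of all \<open>u\<^bsub>[+]\<^esub> \<otimes> u\<^bsub>[-]\<^esub>\<close> as
  well as those of \<open>e\<close>.\<close>

lemma right_coact_sum:
  assumes p: "p \<in> carrier P"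
  obtains J where "finite J" "J \<subseteq> carrier U"
    "right_coact B P p = (\<Oplus>\<^bsub>XU B P\<^esub>j\<in>J. Kj j p \<boxtimes>\<^bsub>XU B P\<^esub> j)"
    "\<And>u p'. (u, p') \<in> set (representative UP (coact P p)) \<Longrightarrow> (\<Oplus>\<^bsub>U\<^esub>j\<in>J. Gf j u \<cdot> j) = t (eps u)"
proof -
  let ?T = "takeuchi_U B P" and ?W = "UXU B P" and ?Z = "XU B P"
  interpret T: abelian_group ?T by simp
  interpret W: abelian_group ?W by simp
  interpret Z: abelian_group ?Z by simp
  have pc: "coact P p \<in> carrier UP" using p by simp
  \<comment> \<open>All second legs that occur in \<open>right_coact_pre\<close>; their expansion yields one lift \<open>d\<close>.\<close>
  define V where "V = (\<Union>z\<in>set (representative UP (coact P p)). snd ` set (representative (UrU B) (transl_r B (fst z))))"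
  have V: "finite V" "V \<subseteq> carrier U"
    unfolding V_def using representativeD[OF UP_tensor pc] representativeD(2)[OF UrU_tensor transl_r_closed] by fastforce+
  obtain J1 where J1: "finite J1" "J1 \<subseteq> carrier U" and J1_sum: "\<forall>K. finite K \<and> J1 \<subseteq> K \<and> K \<subseteq> carrier U \<longrightarrow>
      (\<forall>v\<in>V. v = (\<Oplus>\<^bsub>U\<^esub>j\<in>K. s (f j v) \<cdot> j))"
    using f_supp[OF V] by blast
  have cover1: "v = (\<Oplus>\<^bsub>U\<^esub>j\<in>K. s (f j v) \<cdot> j)"
    if "finite K" "J1 \<subseteq> K" "K \<subseteq> carrier U" "v \<in> V" for K v
    using J1_sum that by blast
  have V_mem: "y \<in> V" if "(u, p') \<in> set (representative UP (coact P p))"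
    "(x, y) \<in> set (representative (UrU B) (transl_r B u))" for u p' x y
    unfolding V_def using that by force
  define d where "d = (\<Oplus>\<^bsub>?T\<^esub>j\<in>J1. Yj j p \<boxtimes>\<^bsub>?T\<^esub> j)"
  note hincl = sweedler_additive[OF takeuchi_U_tensor UXU_ab takeuchi_incl_bal, folded takeuchi_incl_def]
  have dT: "Yj j p \<boxtimes>\<^bsub>?T\<^esub> j \<in> carrier ?T" if "j \<in> J1" for j
    using that J1(2) p by (intro pure_closed[OF takeuchi_U_tensor] Yj_takeuchi) auto
  have d: "d \<in> carrier ?T" unfolding d_def using dT by (intro T.finsum_closed) auto
  have "takeuchi_incl B P d = (\<Oplus>\<^bsub>?W\<^esub>j\<in>J1. takeuchi_incl B P (Yj j p \<boxtimes>\<^bsub>?T\<^esub> j))"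
    unfolding d_def by (rule additive_maps_finsum[OF takeuchi_U_ab UXU_ab hincl J1(1) dT])
  also have "\<dots> = (\<Oplus>\<^bsub>?W\<^esub>j\<in>J1. Yj j p \<boxtimes>\<^bsub>?W\<^esub> j)"
  proof (rule W.finsum_cong'[OF refl])
    show "(\<lambda>j. Yj j p \<boxtimes>\<^bsub>?W\<^esub> j) \<in> J1 \<rightarrow> carrier ?W"
      using J1(2) takeuchi_closed[OF Yj_takeuchi[OF p]] by auto
    show "takeuchi_incl B P (Yj j p \<boxtimes>\<^bsub>?T\<^esub> j) = Yj j p \<boxtimes>\<^bsub>?W\<^esub> j" if "j \<in> J1" for j
      unfolding takeuchi_incl_def using that J1(2)
      by (intro sweedler_pure[OF takeuchi_U_tensor UXU_ab takeuchi_incl_bal] Yj_takeuchi p) auto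
  qed
  also have "\<dots> = right_coact_pre B P p"
    by (rule right_coact_pre_sum[OF p J1(1,2) cover1[OF J1(1) subset_refl J1(2)], symmetric]) (rule V_mem)
  finally have im: "right_coact_pre B P p \<in> takeuchi_incl B P ` carrier ?T" using d by (metis imageI)
  define e where "e = inv_into (carrier ?T) (takeuchi_incl B P) (right_coact_pre B P p)"
  have e: "e \<in> carrier ?T" "takeuchi_incl B P e = right_coact_pre B P p"
    unfolding e_def by (rule inv_into_into[OF im], rule f_inv_into_f[OF im])
  \<comment> \<open>The chosen lift \<open>e\<close> may differ from \<open>d\<close>, so its own second legs have to be covered as well.\<close>
  define V2 where "V2 = snd ` set (representative ?T e)"
  have V2: "finite V2" "V2 \<subseteq> carrier U"
    unfolding V2_def using representativeD(2)[OF takeuchi_U_tensor e(1)] by auto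
  obtain J2 where J2: "finite J2" "J2 \<subseteq> carrier U" and J2_sum: "\<forall>K. finite K \<and> J2 \<subseteq> K \<and> K \<subseteq> carrier U \<longrightarrow>
      (\<forall>v\<in>V2. v = (\<Oplus>\<^bsub>U\<^esub>j\<in>K. s (f j v) \<cdot> j))"
    using f_supp[OF V2] by blast
  define J where "J = J1 \<union> J2"
  have J: "finite J" "J \<subseteq> carrier U" "J1 \<subseteq> J" "J2 \<subseteq> J" using J1(1,2) J2(1,2) by (auto simp: J_def)
  have jU [simp]: "j \<in> carrier U" if "j \<in> J" for j using that J(2) by auto
  have "right_coact B P p = sweedler ?T ?Z (\<lambda>x v. evl x \<boxtimes>\<^bsub>?Z\<^esub> v) e"
    by (simp add: right_coact_def e_def evl_def)
  also have "\<dots> = sweedler ?T ?Z (\<lambda>x v. \<Oplus>\<^bsub>?Z\<^esub>j\<in>J. evl (UX_right B P x (f j v)) \<boxtimes>\<^bsub>?Z\<^esub> j) e"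
  proof (rule sweedler_cong)
    fix x v assume xv: "(x, v) \<in> set (representative ?T e)"
    note x = representativeD[OF takeuchi_U_tensor e(1) xv]
    note [simp] = x(2) takeuchi_closed[OF x(1)]
    have "v \<in> V2" unfolding V2_def using xv by force
    then have "v = (\<Oplus>\<^bsub>U\<^esub>j\<in>J. s (f j v) \<cdot> j)" using J2_sum J(1,4,2) by blast
    then have "evl x \<boxtimes>\<^bsub>?Z\<^esub> v = evl x \<boxtimes>\<^bsub>?Z\<^esub> (\<Oplus>\<^bsub>U\<^esub>j\<in>J. s (f j v) \<cdot> j)"
      by simp
    also have "\<dots> = (\<Oplus>\<^bsub>?Z\<^esub>j\<in>J. evl x \<boxtimes>\<^bsub>?Z\<^esub> (s (f j v) \<cdot> j))"
      by (rule additive_maps_finsum[OF U_ab XU_ab balanced_additive_right[OF pure_balanced[OF XU_tensor]] J(1)]) auto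
    also have "\<dots> = (\<Oplus>\<^bsub>?Z\<^esub>j\<in>J. evl (UX_right B P x (f j v)) \<boxtimes>\<^bsub>?Z\<^esub> j)"
      using pure_move[OF XU_tensor, of "f j v" "evl x" j for j] x
      by (intro Z.finsum_cong') (auto simp: evl_right)
    finally show "evl x \<boxtimes>\<^bsub>?Z\<^esub> v = (\<Oplus>\<^bsub>?Z\<^esub>j\<in>J. evl (UX_right B P x (f j v)) \<boxtimes>\<^bsub>?Z\<^esub> j)" .
  qed
  also have "\<dots> = (\<Oplus>\<^bsub>?Z\<^esub>j\<in>J. sweedler ?T ?Z (\<lambda>x v. evl (UX_right B P x (f j v)) \<boxtimes>\<^bsub>?Z\<^esub> j) e)"
    using J(1) e(1) by (intro sweedler_finsum[OF takeuchi_U_tensor]) (auto simp: takeuchi_closed)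
  also have "\<dots> = (\<Oplus>\<^bsub>?Z\<^esub>j\<in>J. Kj j p \<boxtimes>\<^bsub>?Z\<^esub> j)"
  proof (rule Z.finsum_cong'[OF refl])
    fix j assume j: "j \<in> J"
    have h: "(\<lambda>c. evl c \<boxtimes>\<^bsub>?Z\<^esub> j) \<in> additive_maps UP ?Z"
      using j by (intro additive_maps_comp[OF evl_additive balanced_additive_left[OF pure_balanced[OF XU_tensor]]]) auto
    have "sweedler ?T ?Z (\<lambda>x v. evl (UX_right B P x (f j v)) \<boxtimes>\<^bsub>?Z\<^esub> j) e =
        evl (sweedler ?T UP (\<lambda>x v. UX_right B P x (f j v)) e) \<boxtimes>\<^bsub>?Z\<^esub> j"
      using e(1) by (intro sweedler_hom[OF takeuchi_U_tensor UP_ab XU_ab h, symmetric]) (auto simp: takeuchi_closed)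
    also have "sweedler ?T UP (\<lambda>x v. UX_right B P x (f j v)) e =
        sweedler ?W UP (\<lambda>x v. UX_right B P x (f j v)) (takeuchi_incl B P e)"
      unfolding takeuchi_incl_def using e(1)
      by (intro sweedler_push[OF takeuchi_U_tensor UXU_tensor UP_ab pre_f_bal, symmetric]) (auto simp: takeuchi_closed)
    also have "\<dots> = Yj j p" unfolding e(2) by (rule pre_f[OF p])
    finally show "sweedler ?T ?Z (\<lambda>x v. evl (UX_right B P x (f j v)) \<boxtimes>\<^bsub>?Z\<^esub> j) e = Kj j p \<boxtimes>\<^bsub>?Z\<^esub> j"
      by (simp add: evl_Yj p)
  qed (use p in auto)
  finally have rc: "right_coact B P p = (\<Oplus>\<^bsub>?Z\<^esub>j\<in>J. Kj j p \<boxtimes>\<^bsub>?Z\<^esub> j)" .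
  have "(\<Oplus>\<^bsub>U\<^esub>j\<in>J. Gf j u \<cdot> j) = t (eps u)"
    if up: "(u, p') \<in> set (representative UP (coact P p))" for u p'
    by (rule Gf_sum[OF representativeD(1)[OF UP_tensor pc up] J(1,2)])
      (rule cover1[OF J(1,3,2)], rule V_mem[OF up])
  with rc J(1,2) show ?thesis by (intro that)
qed

end

end

section \<open>The module of colinear maps\<close>

context left_bialgebroid
begin

lemma module_base: "module k A"
  using base_algebra by (simp add: k_algebra_def)

lemma kA_closed [simp]: "c \<in> carrier k \<Longrightarrow> c \<odot>\<^bsub>A\<^esub> \<one>\<^bsub>A\<^esub> \<in> carrier A"
  using module.smult_closed[OF module_base] by simp

text \<open>\<open>k\<close> acts on comodules through its central image in \<open>A\<close>, on which source and target agree; this is why the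
  action preserves colinearity.\<close>

lemma kA_central:
  assumes "c \<in> carrier k" "a \<in> carrier A"
  shows "a \<otimes>\<^bsub>A\<^esub> (c \<odot>\<^bsub>A\<^esub> \<one>\<^bsub>A\<^esub>) = (c \<odot>\<^bsub>A\<^esub> \<one>\<^bsub>A\<^esub>) \<otimes>\<^bsub>A\<^esub> a"
  using k_algebra.scale_left[OF base_algebra, of c "\<one>\<^bsub>A\<^esub>" a] k_algebra.scale_right[OF base_algebra, of c a "\<one>\<^bsub>A\<^esub>"]
    assms by simp

lemma kU_st:
  assumes "c \<in> carrier k"
  shows "s (c \<odot>\<^bsub>A\<^esub> \<one>\<^bsub>A\<^esub>) = t (c \<odot>\<^bsub>A\<^esub> \<one>\<^bsub>A\<^esub>)"
  using assms by (simp add: src_scale tgt_scale)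

lemma kU_central:
  assumes "c \<in> carrier k" "u \<in> carrier U"
  shows "u \<cdot> t (c \<odot>\<^bsub>A\<^esub> \<one>\<^bsub>A\<^esub>) = t (c \<odot>\<^bsub>A\<^esub> \<one>\<^bsub>A\<^esub>) \<cdot> u"
  using k_algebra.scale_left[OF total_algebra, of c "\<one>\<^bsub>U\<^esub>" u] k_algebra.scale_right[OF total_algebra, of c u "\<one>\<^bsub>U\<^esub>"]
    assms by (simp add: tgt_scale)

lemma hom_module_simps [simp]:
  "carrier (comod_hom_module B M N) = comod_hom B N M"
  "\<zero>\<^bsub>comod_hom_module B M N\<^esub> = (\<lambda>n\<in>carrier N. \<zero>\<^bsub>M\<^esub>)"
  "f \<oplus>\<^bsub>comod_hom_module B M N\<^esub> g = (\<lambda>n\<in>carrier N. f n \<oplus>\<^bsub>M\<^esub> g n)"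
  "c \<odot>\<^bsub>comod_hom_module B M N\<^esub> f = (\<lambda>n\<in>carrier N. (c \<odot>\<^bsub>A\<^esub> \<one>\<^bsub>A\<^esub>) \<odot>\<^bsub>M\<^esub> f n)"
  by (simp_all add: comod_hom_module_def)

context
  fixes M :: "('a, 'u, 'm) comodule" and N :: "('a, 'u, 'n) comodule"
  assumes M [simp]: "left_comodule B M" and N [simp]: "left_comodule B N"
begin

interpretation MG: abelian_group M by simp

lemma comod_hom_add:
  assumes f: "f \<in> comod_hom B N M" and g: "g \<in> comod_hom B N M"
  shows "(\<lambda>n\<in>carrier N. f n \<oplus>\<^bsub>M\<^esub> g n) \<in> comod_hom B N M"
proof (rule comod_homI)
  note [simp] = comod_hom_simps(1-3)[OF f] comod_hom_simps(1-3)[OF g]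
  show "coact M ((\<lambda>n\<in>carrier N. f n \<oplus>\<^bsub>M\<^esub> g n) n) =
      csum N (UX B M) (\<lambda>u n'. u \<boxtimes>\<^bsub>UX B M\<^esub> (\<lambda>n\<in>carrier N. f n \<oplus>\<^bsub>M\<^esub> g n) n') n" if "n \<in> carrier N" for n
    using that csum_fun_add[OF N, of "UX B M" n "\<lambda>u n'. u \<boxtimes>\<^bsub>UX B M\<^esub> f n'" "\<lambda>u n'. u \<boxtimes>\<^bsub>UX B M\<^esub> g n'"]
    by (simp add: additive_maps_add[OF coact_additive[OF M]] comod_hom_coact[OF f] comod_hom_coact[OF g]
        UX_pure_add_right cong: csum_cong[OF N])
qed (simp_all add: comod_hom_simps[OF f] comod_hom_simps[OF g] comodule_distribs MG.a_ac)

lemma comod_hom_scale: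
  assumes c: "c \<in> carrier k" and f: "f \<in> comod_hom B N M"
  shows "(\<lambda>n\<in>carrier N. (c \<odot>\<^bsub>A\<^esub> \<one>\<^bsub>A\<^esub>) \<odot>\<^bsub>M\<^esub> f n) \<in> comod_hom B N M"
proof (rule comod_homI)
  let ?c = "c \<odot>\<^bsub>A\<^esub> \<one>\<^bsub>A\<^esub>"
  note [simp] = comod_hom_simps(1-3)[OF f]
  show "coact M ((\<lambda>n\<in>carrier N. ?c \<odot>\<^bsub>M\<^esub> f n) n) =
      csum N (UX B M) (\<lambda>u n'. u \<boxtimes>\<^bsub>UX B M\<^esub> (\<lambda>n\<in>carrier N. ?c \<odot>\<^bsub>M\<^esub> f n) n') n" if n: "n \<in> carrier N" for n
  proof -
    have b: "bal M (UX B M) (\<lambda>u m. (s ?c \<cdot> u) \<boxtimes>\<^bsub>UX B M\<^esub> m)"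
      using c by (intro UX_left_bal) auto
    have "coact M (?c \<odot>\<^bsub>M\<^esub> f n) = csum M (UX B M) (\<lambda>u m. (s ?c \<cdot> u) \<boxtimes>\<^bsub>UX B M\<^esub> m) (f n)"
      using csum_smult[OF M _ UX_pure_bal[OF comodule_module[OF M]], of ?c "f n"] c n by (simp add: coact_csum)
    also have "\<dots> = csum N (UX B M) (\<lambda>u n'. (s ?c \<cdot> u) \<boxtimes>\<^bsub>UX B M\<^esub> f n') n"
      using n by (intro csum_colinear[OF N M f _ b]) auto
    also have "\<dots> = csum N (UX B M) (\<lambda>u n'. u \<boxtimes>\<^bsub>UX B M\<^esub> (?c \<odot>\<^bsub>M\<^esub> f n')) n"
      using n c by (intro csum_cong[OF N]) (simp_all add: kU_st UX_move)
    finally show ?thesis using n by (simp cong: csum_cong[OF N])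
  qed
  show "(\<lambda>n\<in>carrier N. ?c \<odot>\<^bsub>M\<^esub> f n) (a \<odot>\<^bsub>N\<^esub> n) = a \<odot>\<^bsub>M\<^esub> (\<lambda>n\<in>carrier N. ?c \<odot>\<^bsub>M\<^esub> f n) n"
    if "a \<in> carrier A" "n \<in> carrier N" for a n
    using that c by (simp add: comodule_assoc[OF M, symmetric] kA_central)
qed (use c in \<open>simp_all add: comod_hom_simps[OF f] comodule_distribs\<close>)

lemma comod_hom_zero: "(\<lambda>n\<in>carrier N. \<zero>\<^bsub>M\<^esub>) \<in> comod_hom B N M"
proof (rule comod_homI)
  have az: "a \<odot>\<^bsub>M\<^esub> \<zero>\<^bsub>M\<^esub> = \<zero>\<^bsub>M\<^esub>" if "a \<in> carrier A" for a
    by (rule additive_maps_zero[OF comodule_ab[OF M] comodule_ab[OF M] smult_additive[OF M that]])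
  show "(\<lambda>n\<in>carrier N. \<zero>\<^bsub>M\<^esub>) (a \<odot>\<^bsub>N\<^esub> n) = a \<odot>\<^bsub>M\<^esub> (\<lambda>n\<in>carrier N. \<zero>\<^bsub>M\<^esub>) n"
    if "a \<in> carrier A" "n \<in> carrier N" for a n using that by (simp add: az)
  have uz: "u \<boxtimes>\<^bsub>UX B M\<^esub> \<zero>\<^bsub>M\<^esub> = \<zero>\<^bsub>UX B M\<^esub>" if "u \<in> carrier U" for u
    by (rule additive_maps_zero[OF comodule_ab[OF M] _ balanced_additive_right[OF UX_pure_bal[OF comodule_module[OF M]] that]]) simp
  show "coact M ((\<lambda>n\<in>carrier N. \<zero>\<^bsub>M\<^esub>) n) = csum N (UX B M) (\<lambda>u n'. u \<boxtimes>\<^bsub>UX B M\<^esub> (\<lambda>n\<in>carrier N. \<zero>\<^bsub>M\<^esub>) n') n"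
    if n: "n \<in> carrier N" for n
  proof -
    have "csum N (UX B M) (\<lambda>u n'. u \<boxtimes>\<^bsub>UX B M\<^esub> (\<lambda>n\<in>carrier N. \<zero>\<^bsub>M\<^esub>) n') n = csum N (UX B M) (\<lambda>u n'. \<zero>\<^bsub>UX B M\<^esub>) n"
      using n by (intro csum_cong[OF N]) (simp_all add: uz)
    also have "\<dots> = \<zero>\<^bsub>UX B M\<^esub>" unfolding sweedler_def by (rule list_sum_zero) simp
    finally show ?thesis
      using n additive_maps_zero[OF comodule_ab[OF M] _ coact_additive[OF M]] by simp
  qed
qed simp_all

lemma module_comod_hom: "module k (comod_hom_module B M N)"
proof (rule moduleI)
  interpret K: module k A by (rule module_base)
  note cs = comod_hom_simps
  show "cring k" by (rule K.R.is_cring)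
  have ext: "(\<lambda>n\<in>carrier N. h n) = f" if "f \<in> comod_hom B N M" "\<And>n. n \<in> carrier N \<Longrightarrow> h n = f n" for h f
    using that by (intro extensionalityI[of _ "carrier N"]) (auto simp: cs)
  show "abelian_group (comod_hom_module B M N)"
  proof (rule abelian_groupI)
    fix f assume f: "f \<in> carrier (comod_hom_module B M N)"
    have "((\<ominus>\<^bsub>k\<^esub> \<one>\<^bsub>k\<^esub>) \<odot>\<^bsub>A\<^esub> \<one>\<^bsub>A\<^esub>) \<odot>\<^bsub>M\<^esub> f n \<oplus>\<^bsub>M\<^esub> f n = \<zero>\<^bsub>M\<^esub>" if n: "n \<in> carrier N" for n
    proof -
      have m: "f n \<in> carrier M" using f n by (simp add: cs)
      have "((\<ominus>\<^bsub>k\<^esub> \<one>\<^bsub>k\<^esub>) \<odot>\<^bsub>A\<^esub> \<one>\<^bsub>A\<^esub>) \<oplus>\<^bsub>A\<^esub> \<one>\<^bsub>A\<^esub> = \<zero>\<^bsub>A\<^esub>"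
        using K.smult_l_distr[of "\<ominus>\<^bsub>k\<^esub> \<one>\<^bsub>k\<^esub>" "\<one>\<^bsub>k\<^esub>" "\<one>\<^bsub>A\<^esub>"] by (simp add: K.R.l_neg K.smult_one)
      moreover have "((\<ominus>\<^bsub>k\<^esub> \<one>\<^bsub>k\<^esub>) \<odot>\<^bsub>A\<^esub> \<one>\<^bsub>A\<^esub>) \<odot>\<^bsub>M\<^esub> f n \<oplus>\<^bsub>M\<^esub> f n =
          (((\<ominus>\<^bsub>k\<^esub> \<one>\<^bsub>k\<^esub>) \<odot>\<^bsub>A\<^esub> \<one>\<^bsub>A\<^esub>) \<oplus>\<^bsub>A\<^esub> \<one>\<^bsub>A\<^esub>) \<odot>\<^bsub>M\<^esub> f n"
        using m by (simp add: comodule_distribs)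
      moreover have "\<zero>\<^bsub>A\<^esub> \<odot>\<^bsub>M\<^esub> f n = \<zero>\<^bsub>M\<^esub>"
        using comodule_distribs(1)[OF M A.zero_closed A.zero_closed m] m by simp
      ultimately show ?thesis by simp
    qed
    then show "\<exists>g\<in>carrier (comod_hom_module B M N). g \<oplus>\<^bsub>comod_hom_module B M N\<^esub> f = \<zero>\<^bsub>comod_hom_module B M N\<^esub>"
      using f comod_hom_scale[of "\<ominus>\<^bsub>k\<^esub> \<one>\<^bsub>k\<^esub>" f]
      by (intro bexI[of _ "\<lambda>n\<in>carrier N. ((\<ominus>\<^bsub>k\<^esub> \<one>\<^bsub>k\<^esub>) \<odot>\<^bsub>A\<^esub> \<one>\<^bsub>A\<^esub>) \<odot>\<^bsub>M\<^esub> f n"]) (auto simp: restrict_def)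
  next
    fix f g h assume fg: "f \<in> carrier (comod_hom_module B M N)" "g \<in> carrier (comod_hom_module B M N)"
    then show "f \<oplus>\<^bsub>comod_hom_module B M N\<^esub> g \<in> carrier (comod_hom_module B M N)"
      by (simp add: comod_hom_add)
    show "f \<oplus>\<^bsub>comod_hom_module B M N\<^esub> g = g \<oplus>\<^bsub>comod_hom_module B M N\<^esub> f"
      using fg by (auto simp: fun_eq_iff restrict_def cs MG.a_comm)
    show "\<zero>\<^bsub>comod_hom_module B M N\<^esub> \<oplus>\<^bsub>comod_hom_module B M N\<^esub> f = f"
      using fg by (auto simp: cs intro!: ext)
    assume h: "h \<in> carrier (comod_hom_module B M N)"
    show "f \<oplus>\<^bsub>comod_hom_module B M N\<^esub> g \<oplus>\<^bsub>comod_hom_module B M N\<^esub> h =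
        f \<oplus>\<^bsub>comod_hom_module B M N\<^esub> (g \<oplus>\<^bsub>comod_hom_module B M N\<^esub> h)"
      using fg h by (auto simp: fun_eq_iff restrict_def cs MG.a_assoc)
  qed (simp add: comod_hom_zero)
  show "a \<odot>\<^bsub>comod_hom_module B M N\<^esub> f \<in> carrier (comod_hom_module B M N)"
    if "a \<in> carrier k" "f \<in> carrier (comod_hom_module B M N)" for a f
    using that by (simp add: comod_hom_scale)
  show "(a \<otimes>\<^bsub>k\<^esub> b) \<odot>\<^bsub>comod_hom_module B M N\<^esub> f = a \<odot>\<^bsub>comod_hom_module B M N\<^esub> (b \<odot>\<^bsub>comod_hom_module B M N\<^esub> f)"
    if "a \<in> carrier k" "b \<in> carrier k" "f \<in> carrier (comod_hom_module B M N)" for a b f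
  proof -
    have "(a \<otimes>\<^bsub>k\<^esub> b) \<odot>\<^bsub>A\<^esub> \<one>\<^bsub>A\<^esub> = (a \<odot>\<^bsub>A\<^esub> \<one>\<^bsub>A\<^esub>) \<otimes>\<^bsub>A\<^esub> (b \<odot>\<^bsub>A\<^esub> \<one>\<^bsub>A\<^esub>)"
      using that k_algebra.scale_left[OF base_algebra, of a "\<one>\<^bsub>A\<^esub>" "b \<odot>\<^bsub>A\<^esub> \<one>\<^bsub>A\<^esub>"] by (simp add: K.smult_assoc1)
    then show ?thesis using that by (auto simp: restrict_def fun_eq_iff cs comodule_assoc)
  qed
  show "\<one>\<^bsub>k\<^esub> \<odot>\<^bsub>comod_hom_module B M N\<^esub> f = f" if "f \<in> carrier (comod_hom_module B M N)" for f
    using that by (auto simp: cs K.smult_one intro!: ext)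
qed (auto simp: restrict_def fun_eq_iff comod_hom_simps module.smult_l_distr[OF module_base]
    comodule_distribs)

end

lemma contravariant_functor_Hom:
  fixes M :: "('a, 'u, 'v) ucomodule"
  assumes M [simp]: "left_comodule B M"
  shows "contravariant_functor (comod_cat B) k
    (comod_hom_module B M :: ('a, 'u, 'v) ucomodule \<Rightarrow> ('k, ('a, 'v) univ \<Rightarrow> ('a, 'v) univ) module) precompose"
proof (rule contravariant_functor.intro[OF monoidal_category_comodules contravariant_functor_axioms.intro],
    unfold comod_cat_simps mem_Collect_eq)
  fix X Y Z :: "('a, 'u, 'v) ucomodule" and f g x
  show "left_comodule B X \<Longrightarrow> module k (comod_hom_module B M X)" by (rule module_comod_hom[OF M])
  show "left_comodule B X \<Longrightarrow> left_comodule B Y \<Longrightarrow> f \<in> comod_hom B X Y \<Longrightarrow>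
      precompose X Y f \<in> linear_maps k (comod_hom_module B M Y) (comod_hom_module B M X)"
    using comod_hom_restrict_comp[OF _ _ M, of X Y f]
    by (auto simp: linear_maps_def precompose_def compose_def restrict_def fun_eq_iff comod_hom_simps)
  show "left_comodule B X \<Longrightarrow> x \<in> carrier (comod_hom_module B M X) \<Longrightarrow> precompose X X (\<lambda>x\<in>carrier X. x) x = x"
    by (intro extensionalityI[of _ "carrier X"]) (auto simp: precompose_def comod_hom_simps)
  show "left_comodule B X \<Longrightarrow> left_comodule B Y \<Longrightarrow> left_comodule B Z \<Longrightarrow> f \<in> comod_hom B X Y \<Longrightarrow>
      g \<in> comod_hom B Y Z \<Longrightarrow> x \<in> carrier (comod_hom_module B M Z) \<Longrightarrow>
      precompose X Z (compose (carrier X) g f) x = precompose X Y f (precompose Y Z g x)"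
    by (intro extensionalityI[of _ "carrier X"]) (auto simp: precompose_def comod_hom_simps)
qed

end

section \<open>The trace\<close>

context left_bialgebroid
begin

lemma CT_ext_right:
  fixes X Y Z :: "('a, 'u, 'v) ucomodule"
  assumes X: "left_comodule B X" and Y: "left_comodule B Y" and Z: "left_comodule B Z"
    and W: "left_comodule B W"
    and f: "f \<in> comod_hom B (X \<star> (Y \<star> Z)) W"
    and g: "g \<in> comod_hom B (X \<star> (Y \<star> Z)) W"
    and eq: "\<And>x y z. x \<in> carrier X \<Longrightarrow> y \<in> carrier Y \<Longrightarrow> z \<in> carrier Z \<Longrightarrow>
      f (comod_pure B X (Y \<star> Z) x (comod_pure B Y Z y z)) =
      g (comod_pure B X (Y \<star> Z) x (comod_pure B Y Z y z))"
  shows "f = g"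
proof (rule comod_hom_CT_ext[OF X left_comodule_CT[OF Y Z] W f g])
  fix x c assume x: "x \<in> carrier X" and c: "c \<in> carrier (Y \<star> Z)"
  note b = balanced_additive_right[OF cp_bal[OF X left_comodule_CT[OF Y Z]] x]
  show "f (comod_pure B X (Y \<star> Z) x c) = g (comod_pure B X (Y \<star> Z) x c)"
    by (rule CT_ext[OF Y Z comodule_ab[OF W] additive_maps_comp[OF b comod_hom_additive[OF f]]
          additive_maps_comp[OF b comod_hom_additive[OF g]] eq[OF x] c])
qed

end

context aYD_module
begin

lemma act_right_bal: "bal M M (\<lambda>x m. act m x)"
  by (rule balI) (simp_all add: act_add act_t_mult)

text \<open>The map \<open>\<sigma>(m) = m\<^bsub>(0)\<^esub> m\<^bsub>(-1)\<^esub>\<close>, which is the identity if and only if \<open>M\<close> is stable.\<close>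

definition sig where "sig m = csum M M (\<lambda>x m'. act m' x) m"
definition sigma where "sigma = (\<lambda>m\<in>carrier M. sig m)"

lemma sig_closed [simp]: "m \<in> carrier M \<Longrightarrow> sig m \<in> carrier M"
  unfolding sig_def by (rule csum_q_closed[OF M comodule_ab[OF M] act_right_bal])

lemma stable_iff_sig: "stable_aYD B M act \<longleftrightarrow> (\<forall>m\<in>carrier M. sig m = m)"
  by (simp add: stable_aYD_def sig_def)

text \<open>\<open>\<sigma>\<close> is the composite of \<open>M \<simeq> A \<otimes> M\<close> with the inverse trace of \<open>M \<otimes> A \<simeq> M\<close>, hence colinear.\<close>

lemma sigma_hom: "sigma \<in> comod_hom B M M"
proof -
  let ?C = "comod_unit B :: ('a, 'u, 'v) ucomodule"
  let ?T = "(?C \<star> M)"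
  note C = left_comodule_CU
  have lp: "lu M (comod_pure B ?C M (Scalar \<one>\<^bsub>A\<^esub>) m) = m" if "m \<in> carrier M" for m
    using that by simp
  have cl: "comod_pure B ?C M (Scalar \<one>\<^bsub>A\<^esub>) m \<in> carrier ?T" if "m \<in> carrier M" for m
    using that by simp
  have bij: "bij_betw (lu M) (carrier ?T) (carrier M)"
    using comod_hom_simps(1)[OF lunit_hom[OF M]] lunit_inverse[OF M] lp cl
    by (intro bij_betw_byWitness[where f'="\<lambda>m. comod_pure B ?C M (Scalar \<one>\<^bsub>A\<^esub>) m"]) auto
  let ?i = "restrict (inv_into (carrier ?T) (lu M)) (carrier M)"
  have i: "?i \<in> comod_hom B M ?T"
    by (rule comod_hom_inverse[OF left_comodule_CT[OF C M] M lunit_hom[OF M] bij])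
  have i_eq: "?i m = comod_pure B ?C M (Scalar \<one>\<^bsub>A\<^esub>) m" if "m \<in> carrier M" for m
    using bij_betw_inv_into_left[OF bij cl[OF that]] lp[OF that] that by simp
  have "compose (carrier M) (untrace ?C M (ru M)) ?i \<in> comod_hom B M M"
    by (rule comod_hom_restrict_comp[OF M left_comodule_CT[OF C M] M i
          untrace_hom[OF C M runit_hom[OF M]]])
  also have "compose (carrier M) (untrace ?C M (ru M)) ?i = sigma"
  proof (rule extensionalityI[of _ "carrier M"])
    fix m assume m: "m \<in> carrier M"
    have one: "Scalar \<one>\<^bsub>A\<^esub> \<in> carrier ?C" by simp
    have "untrace ?C M (ru M) (?i m) = csum M M (\<lambda>u m'. act (ru M (comod_pure B M ?C m' (Scalar \<one>\<^bsub>A\<^esub>))) u) m"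
      unfolding i_eq[OF m] by (rule untrace_pure[OF C M runit_hom[OF M] one m])
    also have "\<dots> = sig m"
      unfolding sig_def by (rule csum_cong[OF M m]) simp
    finally show "compose (carrier M) (untrace ?C M (ru M)) ?i m = sigma m"
      using m by (simp add: sigma_def compose_eq)
  qed (simp_all add: sigma_def)
  finally show ?thesis .
qed

lemma sigma_apply [simp]: "m \<in> carrier M \<Longrightarrow> sigma m = sig m"
  by (simp add: sigma_def)

lemma sig_add: "m \<in> carrier M \<Longrightarrow> m' \<in> carrier M \<Longrightarrow> sig (m \<oplus>\<^bsub>M\<^esub> m') = sig m \<oplus>\<^bsub>M\<^esub> sig m'"
  and sig_smult: "a \<in> carrier A \<Longrightarrow> m \<in> carrier M \<Longrightarrow> sig (a \<odot>\<^bsub>M\<^esub> m) = a \<odot>\<^bsub>M\<^esub> sig m"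
  using comod_hom_simps(2,3)[OF sigma_hom] by simp_all

lemma sig_additive: "sig \<in> additive_maps M M"
  by (intro additive_mapsI) (simp_all add: sig_add)

text \<open>\<open>\<sigma>\<close> is \<open>U\<close>-linear: by the anti Yetter-Drinfel'd condition \<open>\<sigma>(m u) = m\<^bsub>(0)\<^esub> u\<^bsub>(2)+\<^esub> u\<^bsub>(2)-\<^esub> m\<^bsub>(-1)\<^esub> u\<^bsub>(1)\<^esub>\<close>, where
  \<open>u\<^sub>+ u\<^sub>- = s(\<epsilon>(u))\<close>; the Takeuchi property then moves \<open>\<epsilon>(u\<^bsub>(2)\<^esub>)\<close> next to \<open>u\<^bsub>(1)\<^esub>\<close>.\<close>

lemma sig_act:
  assumes m: "m \<in> carrier M" and u: "u \<in> carrier U"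
  shows "sig (act m u) = act (sig m) u"
proof -
  note Mg = comodule_ab[OF M]
  let ?h = "sweedler W M (\<lambda>x m. act m x)"
  note WT = UX_tensor[OF comodule_module[OF M]]
  note h = sweedler_additive[OF WT Mg act_right_bal]
  have act_hom: "(\<lambda>x. act m' x) \<in> additive_maps U M" if "m' \<in> carrier M" for m'
    using that by (intro additive_mapsI) (simp_all add: act_add)
  have act_hom': "(\<lambda>m'. act m' x) \<in> additive_maps M M" if "x \<in> carrier U" for x
    using that by (intro additive_mapsI) (simp_all add: act_add)
  have phi_h: "?h (phi u1 (transl_l B u2) x m') = act (right_act B M m' (eps u2)) (x \<cdot> u1)"
    if c: "u1 \<in> carrier U" "u2 \<in> carrier U" "x \<in> carrier U" "m' \<in> carrier M" for u1 u2 x m'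
  proof -
    have "?h (phi u1 (transl_l B u2) x m') = lsum M (\<lambda>v y. act (act m' v) (y \<cdot> x \<cdot> u1)) u2"
      unfolding phi_def using c
      by (intro sweedler_push[OF UopU_tensor WT Mg act_right_bal]) auto
    also have "\<dots> = lsum M (\<lambda>v y. act m' (v \<cdot> y \<cdot> (x \<cdot> u1))) u2"
      using c by (intro lsum_cong) (simp_all add: act_mult[symmetric] U.m_assoc)
    also have "\<dots> = act m' (lsum U (\<lambda>v y. v \<cdot> y) u2 \<cdot> (x \<cdot> u1))"
      using c by (intro lsum_hom[of U M "\<lambda>z. act m' (z \<cdot> (x \<cdot> u1))", symmetric])
        (auto intro!: additive_mapsI simp: act_add distribs)
    finally show ?thesis using c by (simp add: lsum_mult act_s_mult)
  qed
  have "sig (act m u) = ?h (dsum W (\<lambda>u1 u2. csum M W (phi u1 (transl_l B u2)) m) u)"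
    by (simp add: sig_def coact_act[OF m u])
  also have "\<dots> = dsum M (\<lambda>u1 u2. ?h (csum M W (phi u1 (transl_l B u2)) m)) u"
    using u m balancedD(1)[OF phi_balanced[OF m]] by (intro dsum_hom[OF _ Mg h]) (auto simp: transl_l_balanced)
  also have "\<dots> = dsum M (\<lambda>u1 u2. csum M M (\<lambda>x m'. act m' (x \<cdot> (t (eps u2) \<cdot> u1))) m) u"
  proof (rule dsum_cong[OF u])
    fix u1 u2 assume c: "u1 \<in> carrier U" "u2 \<in> carrier U"
    have b: "bal M M (\<lambda>x m'. act m' (x \<cdot> u1))"
      using c by (intro balI) (simp_all add: act_add distribs U.m_assoc act_t_mult)
    have "?h (csum M W (phi u1 (transl_l B u2)) m) = csum M M (\<lambda>x m'. ?h (phi u1 (transl_l B u2) x m')) m"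
      using c balancedD(1)[OF phi_bal] by (intro csum_hom[OF M _ Mg h m]) (auto simp: transl_l_balanced)
    also have "\<dots> = csum M M (\<lambda>x m'. act (right_act B M m' (eps u2)) (x \<cdot> u1)) m"
      using c by (intro csum_cong[OF M m] phi_h)
    also have "\<dots> = csum M M (\<lambda>x m'. act m' (x \<cdot> t (eps u2) \<cdot> u1)) m"
      using c by (intro csum_takeuchi[OF M Mg b _ m, symmetric]) auto
    also have "\<dots> = csum M M (\<lambda>x m'. act m' (x \<cdot> (t (eps u2) \<cdot> u1))) m"
      using c by (intro csum_cong[OF M m]) (simp add: U.m_assoc)
    finally show "?h (csum M W (phi u1 (transl_l B u2)) m) =
        csum M M (\<lambda>x m'. act m' (x \<cdot> (t (eps u2) \<cdot> u1))) m" .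
  qed
  also have "\<dots> = csum M M (\<lambda>x m'. dsum M (\<lambda>u1 u2. act m' (x \<cdot> (t (eps u2) \<cdot> u1))) u) m"
    using u m by (intro csum_dsum_swap[OF M Mg, symmetric]) auto
  also have "\<dots> = csum M M (\<lambda>x m'. act (act m' x) u) m"
  proof (rule csum_cong[OF M m])
    fix x m' assume c: "x \<in> carrier U" "m' \<in> carrier M"
    have "dsum M (\<lambda>u1 u2. act m' (x \<cdot> (t (eps u2) \<cdot> u1))) u = act m' (x \<cdot> dsum U (\<lambda>u1 u2. t (eps u2) \<cdot> u1) u)"
      using c u by (intro dsum_hom[of U M "\<lambda>z. act m' (x \<cdot> z)", symmetric])
        (auto intro!: additive_mapsI simp: act_add distribs)
    then show "dsum M (\<lambda>u1 u2. act m' (x \<cdot> (t (eps u2) \<cdot> u1))) u = act (act m' x) u"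
      using c u by (simp add: counit_r act_mult)
  qed
  also have "\<dots> = act (sig m) u"
    unfolding sig_def using u m by (intro csum_hom[OF M Mg Mg act_hom' m, symmetric]) auto
  finally show ?thesis .
qed

text \<open>The coactions of \<open>p\<close> and \<open>n\<close> that the two steps introduce form the codiagonal coaction of \<open>p \<otimes> n\<close>, and \<open>g\<close> is
  colinear; so \<open>\<sigma>\<close> gets applied to \<open>g(p \<otimes> n)\<close>.\<close>

lemma untrace_untrace:
  assumes N [simp]: "left_comodule B N" and P [simp]: "left_comodule B P"
    and g: "g \<in> comod_hom B (P \<star> N) M"
  shows "untrace P N (untrace N P g) = compose (carrier (P \<star> N)) sigma g"
proof (rule comod_hom_CT_ext[OF P N M])
  note Mg = comodule_ab[OF M]
  note g1 = untrace_hom[OF N P g]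
  show "untrace P N (untrace N P g) \<in> comod_hom B (P \<star> N) M"
    by (rule untrace_hom[OF P N g1])
  show "compose (carrier (P \<star> N)) sigma g \<in> comod_hom B (P \<star> N) M"
    by (rule comod_hom_restrict_comp[OF left_comodule_CT[OF P N] M M g sigma_hom])
  fix p n assume p: "p \<in> carrier P" and n: "n \<in> carrier N"
  let ?z = "comod_pure B P N p n"
  note [simp] = comod_hom_simps(1-3)[OF g]
  have b: "bal (P \<star> N) M (\<lambda>x z. act (g z) x)"
    using balancedD(1-3)[OF act_right_bal] bal_move[OF act_right_bal] by (intro balI) simp_all
  have "untrace P N (untrace N P g) ?z = csum N M (\<lambda>w n'. act (untrace N P g (comod_pure B N P n' p)) w) n"
    by (rule untrace_pure[OF P N g1 p n])
  also have "\<dots> = csum N M (\<lambda>w n'. csum P M (\<lambda>u p'. act (g (comod_pure B P N p' n')) (u \<cdot> w)) p) n"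
  proof (rule csum_cong[OF N n])
    fix w n' assume c: "w \<in> carrier U" "n' \<in> carrier N"
    have "act (untrace N P g (comod_pure B N P n' p)) w =
        csum P M (\<lambda>u p'. act (act (g (comod_pure B P N p' n')) u) w) p"
      unfolding untrace_pure[OF N P g c(2) p] using c p
      by (intro csum_hom[OF P Mg Mg, of "\<lambda>m. act m w"]) (auto intro!: additive_mapsI simp: act_add)
    also have "\<dots> = csum P M (\<lambda>u p'. act (g (comod_pure B P N p' n')) (u \<cdot> w)) p"
      using c by (intro csum_cong[OF P p]) (simp add: act_mult)
    finally show "act (untrace N P g (comod_pure B N P n' p)) w =
        csum P M (\<lambda>u p'. act (g (comod_pure B P N p' n')) (u \<cdot> w)) p" .
  qed
  also have "\<dots> = csum P M (\<lambda>u p'. csum N M (\<lambda>w n'. act (g (comod_pure B P N p' n')) (u \<cdot> w)) n) p"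
    using n p by (intro csum_swap[OF N P Mg]) auto
  also have "\<dots> = csum (P \<star> N) M (\<lambda>x z. act (g z) x) ?z"
    by (rule csum_CT_pure[OF P N Mg b p n, symmetric])
  also have "\<dots> = sig (g ?z)"
    unfolding sig_def using p n
    by (intro csum_colinear[OF left_comodule_CT[OF P N] M g Mg act_right_bal, symmetric]) auto
  finally show "untrace P N (untrace N P g) ?z = compose (carrier (P \<star> N)) sigma g ?z"
    using p n by simp
qed

text \<open>Colinearity of \<open>g\<close> moves it through the coaction of the second factor, over which \<open>untrace\<close> sums.\<close>

lemma untrace_natural:
  assumes X [simp]: "left_comodule B X" and X' [simp]: "left_comodule B X'"
    and Y [simp]: "left_comodule B Y" and Y' [simp]: "left_comodule B Y'"
    and f: "f \<in> comod_hom B X X'" and g: "g \<in> comod_hom B Y Y'"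
    and y: "y \<in> comod_hom B (Y' \<star> X') M"
  shows "untrace X Y (compose (carrier (Y \<star> X)) y (tm Y Y' X X' g f)) =
    compose (carrier (X \<star> Y)) (untrace X' Y' y) (tm X X' Y Y' f g)"
proof (rule comod_hom_CT_ext[OF X Y M])
  note Mg = comodule_ab[OF M]
  note [simp] = comod_hom_simps(1-3)[OF f] comod_hom_simps(1-3)[OF g] tmor_pure[OF X X' Y Y' f g]
    tmor_pure[OF Y Y' X X' g f]
  have y1: "compose (carrier (Y \<star> X)) y (tm Y Y' X X' g f) \<in> comod_hom B (Y \<star> X) M"
    by (rule comod_hom_restrict_comp[OF _ _ M tmor_hom[OF Y Y' X X' g f] y]) simp_all
  show "untrace X Y (compose (carrier (Y \<star> X)) y (tm Y Y' X X' g f)) \<in> comod_hom B (X \<star> Y) M"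
    by (rule untrace_hom[OF X Y y1])
  show "compose (carrier (X \<star> Y)) (untrace X' Y' y) (tm X X' Y Y' f g) \<in> comod_hom B (X \<star> Y) M"
    by (rule comod_hom_restrict_comp[OF _ _ M tmor_hom[OF X X' Y Y' f g] untrace_hom[OF X' Y' y]]) simp_all
  fix x z assume x: "x \<in> carrier X" and z: "z \<in> carrier Y"
  have "untrace X Y (compose (carrier (Y \<star> X)) y (tm Y Y' X X' g f)) (comod_pure B X Y x z) =
      csum Y M (\<lambda>u z'. act (compose (carrier (Y \<star> X)) y (tm Y Y' X X' g f) (comod_pure B Y X z' x)) u) z"
    by (rule untrace_pure[OF X Y y1 x z])
  also have "\<dots> = csum Y M (\<lambda>u z'. act (y (comod_pure B Y' X' (g z') (f x))) u) z"
    using x by (intro csum_cong[OF Y z]) simp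
  also have "\<dots> = csum Y' M (\<lambda>u z'. act (y (comod_pure B Y' X' z' (f x))) u) (g z)"
    using x z by (intro csum_colinear[OF Y Y' g Mg untr_bal[OF X' Y' y], symmetric]) auto
  also have "\<dots> = untrace X' Y' y (comod_pure B X' Y' (f x) (g z))"
    using x z by (intro untrace_pure[OF X' Y' y, symmetric]) auto
  finally show "untrace X Y (compose (carrier (Y \<star> X)) y (tm Y Y' X X' g f)) (comod_pure B X Y x z) =
      compose (carrier (X \<star> Y)) (untrace X' Y' y) (tm X X' Y Y' f g) (comod_pure B X Y x z)"
    using x z by simp
qed

text \<open>Read backwards, the condition on traces says that \<open>x\<close> is the inverse trace of the composite of \<open>x4\<close> with the
  associator. Both sides are \<open>x4(x\<^bsub>(0)\<^esub> \<otimes> (y\<^bsub>(0)\<^esub> \<otimes> z)) x\<^bsub>(-1)\<^esub> y\<^bsub>(-1)\<^esub>\<close>, by the codiagonal coaction of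
  \<open>X \<otimes> Y\<close> on one side and by two successive inverse traces on the other.\<close>

lemma untrace_hexagon:
  assumes X [simp]: "left_comodule B X" and Y [simp]: "left_comodule B Y" and Z [simp]: "left_comodule B Z"
    and x4: "x4 \<in> comod_hom B (X \<star> (Y \<star> Z)) M"
    and x2: "x2 \<in> comod_hom B (Y \<star> (Z \<star> X)) M"
    and x: "x \<in> comod_hom B (Z \<star> (X \<star> Y)) M"
    and eq42: "untrace (Y \<star> Z) X x4 =
      compose (carrier ((Y \<star> Z) \<star> X)) x2 (as Y Z X)"
    and eq2: "untrace (Z \<star> X) Y x2 =
      compose (carrier ((Z \<star> X) \<star> Y)) x (as Z X Y)"
  shows "untrace Z (X \<star> Y)
    (compose (carrier ((X \<star> Y) \<star> Z)) x4 (as X Y Z)) = x"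
proof -
  note Mg = comodule_ab[OF M]
  let ?XY = "(X \<star> Y)" and ?YZ = "(Y \<star> Z)" and ?ZX = "(Z \<star> X)"
  let ?x5 = "compose (carrier (?XY \<star> Z)) x4 (as X Y Z)"
  have x5: "?x5 \<in> comod_hom B (?XY \<star> Z) M"
    by (rule comod_hom_restrict_comp[OF _ _ M assoc_hom x4]) simp_all
  show ?thesis
  proof (rule CT_ext_right[OF Z X Y M untrace_hom[OF Z left_comodule_CT[OF X Y] x5] x])
    fix z xx y assume c [simp]: "z \<in> carrier Z" "xx \<in> carrier X" "y \<in> carrier Y"
    let ?q = "\<lambda>x' y'. x4 (comod_pure B X ?YZ x' (comod_pure B Y Z y' z))"
    have q [simp]: "?q x' y' \<in> carrier M" if "x' \<in> carrier X" "y' \<in> carrier Y" for x' y'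
      using that by (intro comod_hom_simps(1)[OF x4]) simp
    have "untrace Z ?XY ?x5 (comod_pure B Z ?XY z (comod_pure B X Y xx y)) =
        csum ?XY M (\<lambda>w v. act (?x5 (comod_pure B ?XY Z v z)) w) (comod_pure B X Y xx y)"
      by (rule untrace_pure[OF Z left_comodule_CT[OF X Y] x5]) simp_all
    also have "\<dots> = csum X M (\<lambda>u x'. csum Y M (\<lambda>w y'. act (?x5 (comod_pure B ?XY Z (comod_pure B X Y x' y') z)) (u \<cdot> w)) y) xx"
      by (rule csum_CT_pure[OF X Y Mg untr_bal[OF Z left_comodule_CT[OF X Y] x5]]) simp_all
    also have "\<dots> = csum X M (\<lambda>u x'. csum Y M (\<lambda>w y'. act (?q x' y') (u \<cdot> w)) y) xx"
      by (intro csum_cong[OF X] csum_cong[OF Y]) (simp_all add: assoc_pure)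
    also have "\<dots> = csum Y M (\<lambda>w y'. csum X M (\<lambda>u x'. act (?q x' y') (u \<cdot> w)) xx) y"
      by (intro csum_swap[OF X Y Mg]) auto
    also have "\<dots> = csum Y M (\<lambda>w y'. act (csum X M (\<lambda>u x'. act (?q x' y') u) xx) w) y"
    proof (rule csum_cong[OF Y c(3)])
      fix w y' assume w: "w \<in> carrier U" "y' \<in> carrier Y"
      have "act (csum X M (\<lambda>u x'. act (?q x' y') u) xx) w = csum X M (\<lambda>u x'. act (act (?q x' y') u) w) xx"
        using w by (intro csum_hom[OF X Mg Mg, of "\<lambda>m. act m w"]) (auto intro!: additive_mapsI simp: act_add)
      also have "\<dots> = csum X M (\<lambda>u x'. act (?q x' y') (u \<cdot> w)) xx"
        using w by (intro csum_cong[OF X c(2)]) (simp add: act_mult)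
      finally show "csum X M (\<lambda>u x'. act (?q x' y') (u \<cdot> w)) xx = act (csum X M (\<lambda>u x'. act (?q x' y') u) xx) w" by simp
    qed
    also have "\<dots> = csum Y M (\<lambda>w y'. act (x2 (comod_pure B Y ?ZX y' (comod_pure B Z X z xx))) w) y"
    proof (rule csum_cong[OF Y c(3)])
      fix w y' assume w: "w \<in> carrier U" "y' \<in> carrier Y"
      have "csum X M (\<lambda>u x'. act (?q x' y') u) xx = untrace ?YZ X x4 (comod_pure B ?YZ X (comod_pure B Y Z y' z) xx)"
        using w by (intro untrace_pure[OF left_comodule_CT[OF Y Z] X x4, symmetric]) simp_all
      also have "\<dots> = x2 (comod_pure B Y ?ZX y' (comod_pure B Z X z xx))"
        unfolding eq42 using w by (simp add: assoc_pure)
      finally show "act (csum X M (\<lambda>u x'. act (?q x' y') u) xx) w =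
          act (x2 (comod_pure B Y ?ZX y' (comod_pure B Z X z xx))) w" by simp
    qed
    also have "\<dots> = untrace ?ZX Y x2 (comod_pure B ?ZX Y (comod_pure B Z X z xx) y)"
      by (rule untrace_pure[OF left_comodule_CT[OF Z X] Y x2, symmetric]) simp_all
    also have "\<dots> = x (comod_pure B Z ?XY z (comod_pure B X Y xx y))"
      unfolding eq2 by (simp add: assoc_pure)
    finally show "untrace Z ?XY ?x5 (comod_pure B Z ?XY z (comod_pure B X Y xx y)) =
        x (comod_pure B Z ?XY z (comod_pure B X Y xx y))" .
  qed
qed

text \<open>Replacing \<open>p\<^bsub>(0)\<^esub>\<close> by \<open>p\<^bsub>(0)\<^esub> a\<close> amounts, by the Takeuchi property, to multiplying by \<open>t(a)\<close> after the coaction,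
  that is to the left action of \<open>a\<close> on \<open>\<sigma>(x(p))\<close>.\<close>

lemma untrace_unit:
  fixes X :: "('a, 'u, 'v) ucomodule"
  assumes X [simp]: "left_comodule B X" and x: "x \<in> comod_hom B X M"
  shows "untrace CU X (compose (carrier (X \<star> CU)) x (ru X)) =
    compose (carrier (CU \<star> X)) (compose (carrier X) sigma x) (lu X)"
proof (rule comod_hom_CT_ext[OF left_comodule_CU X M])
  note Mg = comodule_ab[OF M]
  note [simp] = comod_hom_simps(1-3)[OF x]
  have x1: "compose (carrier (X \<star> CU)) x (ru X) \<in> comod_hom B (X \<star> CU) M"
    by (rule comod_hom_restrict_comp[OF _ X M runit_hom x]) simp_all
  show h1: "untrace CU X (compose (carrier (X \<star> CU)) x (ru X)) \<in> comod_hom B (CU \<star> X) M"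
    by (rule untrace_hom[OF left_comodule_CU X x1])
  show h2: "compose (carrier (CU \<star> X)) (compose (carrier X) sigma x) (lu X) \<in> comod_hom B (CU \<star> X) M"
    by (rule comod_hom_restrict_comp[OF _ X M lunit_hom comod_hom_restrict_comp[OF X M M x sigma_hom]]) simp_all
  fix c p assume "c \<in> carrier (CU :: ('a, 'u, 'v) ucomodule)" and p: "p \<in> carrier X"
  then obtain a where a: "a \<in> carrier A" "c = Scalar a" by auto
  have "untrace CU X (compose (carrier (X \<star> CU)) x (ru X)) (comod_pure B CU X (Scalar a) p) =
      csum X M (\<lambda>u p'. act (compose (carrier (X \<star> CU)) x (ru X) (comod_pure B X CU p' (Scalar a))) u) p"
    using a by (intro untrace_pure[OF left_comodule_CU X x1 _ p]) simp
  also have "\<dots> = csum X M (\<lambda>u p'. act (x (right_act B X p' a)) u) p"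
    using a by (intro csum_cong[OF X p]) simp
  also have "\<dots> = csum X M (\<lambda>u p'. act (right_act B M (x p') a) u) p"
    using a by (intro csum_cong[OF X p]) (simp add: comod_hom_ra[OF X M x])
  also have "\<dots> = csum M M (\<lambda>u m. act (right_act B M m a) u) (x p)"
  proof (rule csum_colinear[OF X M x Mg _ p, symmetric])
    show "bal M M (\<lambda>u m. act (right_act B M m a) u)"
      using a by (intro balI) (simp_all add: act_add act_t_mult ra_add ra_smult)
  qed
  also have "\<dots> = csum M M (\<lambda>u m. act m (u \<cdot> t a)) (x p)"
    using a p by (intro csum_takeuchi[OF M Mg act_right_bal, symmetric]) auto
  also have "\<dots> = csum M M (\<lambda>u m. a \<odot>\<^bsub>M\<^esub> act m u) (x p)"
    using a p by (intro csum_cong[OF M]) (simp_all add: act_mult_t)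
  also have "\<dots> = a \<odot>\<^bsub>M\<^esub> sig (x p)"
    unfolding sig_def using a p by (intro csum_hom[OF M Mg Mg smult_additive[OF M], symmetric]) auto
  finally show "untrace CU X (compose (carrier (X \<star> CU)) x (ru X)) (comod_pure B CU X c p) =
      compose (carrier (CU \<star> X)) (compose (carrier X) sigma x) (lu X) (comod_pure B CU X c p)"
    using a p by (simp add: sig_smult)
qed

lemma untrace_linear:
  assumes N [simp]: "left_comodule B N" and P [simp]: "left_comodule B P"
  shows "untrace N P \<in> linear_maps k (comod_hom_module B M (P \<star> N)) (comod_hom_module B M (N \<star> P))"
proof -
  note Mg = comodule_ab[OF M]
  interpret MG: abelian_group M by simp
  let ?PN = "(P \<star> N)" and ?NP = "(N \<star> P)"
  have add: "untrace N P (\<lambda>z\<in>carrier ?PN. g z \<oplus>\<^bsub>M\<^esub> h z) = (\<lambda>z\<in>carrier ?NP. untrace N P g z \<oplus>\<^bsub>M\<^esub> untrace N P h z)"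
    if g: "g \<in> comod_hom B ?PN M" and h: "h \<in> comod_hom B ?PN M" for g h
  proof (rule comod_hom_CT_ext[OF N P M])
    note [simp] = comod_hom_simps(1)[OF g] comod_hom_simps(1)[OF h]
    have gh: "(\<lambda>z\<in>carrier ?PN. g z \<oplus>\<^bsub>M\<^esub> h z) \<in> comod_hom B ?PN M"
      by (rule comod_hom_add[OF M _ g h]) simp
    show "untrace N P (\<lambda>z\<in>carrier ?PN. g z \<oplus>\<^bsub>M\<^esub> h z) \<in> comod_hom B ?NP M"
      by (rule untrace_hom[OF N P gh])
    show "(\<lambda>z\<in>carrier ?NP. untrace N P g z \<oplus>\<^bsub>M\<^esub> untrace N P h z) \<in> comod_hom B ?NP M"
      by (rule comod_hom_add[OF M _ untrace_hom[OF N P g] untrace_hom[OF N P h]]) simp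
    fix n p assume np: "n \<in> carrier N" "p \<in> carrier P"
    have "untrace N P (\<lambda>z\<in>carrier ?PN. g z \<oplus>\<^bsub>M\<^esub> h z) (comod_pure B N P n p) =
        csum P M (\<lambda>u p'. act ((\<lambda>z\<in>carrier ?PN. g z \<oplus>\<^bsub>M\<^esub> h z) (comod_pure B P N p' n)) u) p"
      by (rule untrace_pure[OF N P gh np])
    also have "\<dots> = csum P M (\<lambda>u p'. act (g (comod_pure B P N p' n)) u \<oplus>\<^bsub>M\<^esub> act (h (comod_pure B P N p' n)) u) p"
      using np by (intro csum_cong[OF P]) (simp_all add: act_add)
    also have "\<dots> = untrace N P g (comod_pure B N P n p) \<oplus>\<^bsub>M\<^esub> untrace N P h (comod_pure B N P n p)"
      unfolding untrace_pure[OF N P g np] untrace_pure[OF N P h np]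
      using np by (intro csum_fun_add[OF P Mg]) auto
    finally show "untrace N P (\<lambda>z\<in>carrier ?PN. g z \<oplus>\<^bsub>M\<^esub> h z) (comod_pure B N P n p) =
        (\<lambda>z\<in>carrier ?NP. untrace N P g z \<oplus>\<^bsub>M\<^esub> untrace N P h z) (comod_pure B N P n p)"
      using np by simp
  qed
  have scale: "untrace N P (\<lambda>z\<in>carrier ?PN. (c \<odot>\<^bsub>A\<^esub> \<one>\<^bsub>A\<^esub>) \<odot>\<^bsub>M\<^esub> g z) = (\<lambda>z\<in>carrier ?NP. (c \<odot>\<^bsub>A\<^esub> \<one>\<^bsub>A\<^esub>) \<odot>\<^bsub>M\<^esub> untrace N P g z)"
    if c: "c \<in> carrier k" and g: "g \<in> comod_hom B ?PN M" for c g
  proof (rule comod_hom_CT_ext[OF N P M])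
    let ?c = "c \<odot>\<^bsub>A\<^esub> \<one>\<^bsub>A\<^esub>"
    note [simp] = comod_hom_simps(1)[OF g]
    have cg: "(\<lambda>z\<in>carrier ?PN. ?c \<odot>\<^bsub>M\<^esub> g z) \<in> comod_hom B ?PN M"
      by (rule comod_hom_scale[OF M _ c g]) simp
    show "untrace N P (\<lambda>z\<in>carrier ?PN. ?c \<odot>\<^bsub>M\<^esub> g z) \<in> comod_hom B ?NP M"
      by (rule untrace_hom[OF N P cg])
    show "(\<lambda>z\<in>carrier ?NP. ?c \<odot>\<^bsub>M\<^esub> untrace N P g z) \<in> comod_hom B ?NP M"
      by (rule comod_hom_scale[OF M _ c untrace_hom[OF N P g]]) simp
    fix n p assume np: "n \<in> carrier N" "p \<in> carrier P"
    have "untrace N P (\<lambda>z\<in>carrier ?PN. ?c \<odot>\<^bsub>M\<^esub> g z) (comod_pure B N P n p) =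
        csum P M (\<lambda>u p'. act ((\<lambda>z\<in>carrier ?PN. ?c \<odot>\<^bsub>M\<^esub> g z) (comod_pure B P N p' n)) u) p"
      by (rule untrace_pure[OF N P cg np])
    also have "\<dots> = csum P M (\<lambda>u p'. ?c \<odot>\<^bsub>M\<^esub> act (g (comod_pure B P N p' n)) u) p"
      using np c by (intro csum_cong[OF P]) (simp_all add: act_t_mult[symmetric] act_mult_t[symmetric] kU_central)
    also have "\<dots> = ?c \<odot>\<^bsub>M\<^esub> untrace N P g (comod_pure B N P n p)"
      unfolding untrace_pure[OF N P g np]
      using np c by (intro csum_hom[OF P Mg Mg smult_additive[OF M], symmetric]) auto
    finally show "untrace N P (\<lambda>z\<in>carrier ?PN. ?c \<odot>\<^bsub>M\<^esub> g z) (comod_pure B N P n p) =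
        (\<lambda>z\<in>carrier ?NP. ?c \<odot>\<^bsub>M\<^esub> untrace N P g z) (comod_pure B N P n p)"
      using np by simp
  qed
  show ?thesis
    using untrace_hom[OF N P] by (auto simp: linear_maps_def add scale)
qed

end

section \<open>Bijectivity of the inverse trace\<close>

lemma linear_maps_inv_into:
  assumes X: "module k X" and h: "h \<in> linear_maps k X Y" and bij: "bij_betw h (carrier X) (carrier Y)"
  shows "inv_into (carrier X) h \<in> linear_maps k Y X"
proof -
  interpret X: module k X by fact
  note inv [simp] = bij_betw_inv_into_right[OF bij] bij_betwE[OF bij_betw_inv_into[OF bij], rule_format]
  have eqI: "inv_into (carrier X) h y = x" if "x \<in> carrier X" "h x = y" for x y
    using bij_betw_inv_into_left[OF bij that(1)] that(2) by simp
  show ?thesis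
    using h unfolding linear_maps_def by (auto intro!: eqI)
qed

locale aYD_module_right_hopf = aYD_module k B M act + right_hopf_dual_basis k B f
  for k :: "('k, 'r) ring_scheme" and B :: "('k, 'a, 'u) bialgebroid"
    and M :: "('a, 'u, 'v) ucomodule" and act and f
begin

text \<open>\<open>q(p\<^bsub>[0](0)\<^esub>) p\<^bsub>[0](-1)\<^esub> p\<^bsub>[1]\<^esub> = q(p)\<close>. In terms of the dual basis the left hand side is
  \<open>q(p\<^bsub>(0)\<^esub>) \<Sum>\<^sub>j G\<^sub>j(p\<^bsub>(-1)\<^esub>) j = q(p\<^bsub>(0)\<^esub>) t(\<epsilon>(p\<^bsub>(-1)\<^esub>))\<close>.\<close>

lemma act_coact_right_coact_sum:
  fixes P :: "('a, 'u, 'p) comodule"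
  assumes P [simp]: "left_comodule B P" and p: "p \<in> carrier P"
    and q: "q \<in> additive_maps P M" and qs: "\<And>a p. a \<in> carrier A \<Longrightarrow> p \<in> carrier P \<Longrightarrow> q (a \<odot>\<^bsub>P\<^esub> p) = a \<odot>\<^bsub>M\<^esub> q p"
    and J: "finite J" "J \<subseteq> carrier U"
    and G: "\<And>u p'. (u, p') \<in> set (representative (UX B P) (coact P p)) \<Longrightarrow> (\<Oplus>\<^bsub>U\<^esub>j\<in>J. Gf j u \<cdot> j) = t (eps u)"
  shows "(\<Oplus>\<^bsub>M\<^esub>j\<in>J. act (csum P M (\<lambda>u p'. act (q p') u) (Kj P j p)) j) = q p"
proof -
  note Mg = comodule_ab[OF M]
  interpret MG: abelian_group M by simp
  note T = UX_tensor[OF comodule_module[OF P]]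
  have jU [simp]: "j \<in> carrier U" if "j \<in> J" for j using that J(2) by auto
  note [simp] = additive_maps_closed[OF q] additive_maps_add[OF q] qs
  have pc: "coact P p \<in> carrier (UX B P)" using p by simp
  have b: "bal P M (\<lambda>u p'. act (q p') u)"
    by (rule balI) (simp_all add: act_add act_t_mult)
  have "(\<Oplus>\<^bsub>M\<^esub>j\<in>J. act (csum P M (\<lambda>u p'. act (q p') u) (Kj P j p)) j) =
      (\<Oplus>\<^bsub>M\<^esub>j\<in>J. csum P M (\<lambda>u p'. act (q p') (Gf j u \<cdot> j)) p)"
  proof (rule MG.finsum_cong'[OF refl])
    show "(\<lambda>j. csum P M (\<lambda>u p'. act (q p') (Gf j u \<cdot> j)) p) \<in> J \<rightarrow> carrier M"
      using p by (auto intro!: csum_closed[OF P])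
    fix j assume j: "j \<in> J"
    have "act (csum P M (\<lambda>u p'. act (q p') u) (Kj P j p)) j = act (csum P M (\<lambda>u p'. act (q p') (Gf j u)) p) j"
      by (simp only: csum_Kj[OF P Mg b p])
    also have "\<dots> = csum P M (\<lambda>u p'. act (act (q p') (Gf j u)) j) p"
      using j p by (intro csum_hom[OF P Mg Mg, of "\<lambda>m. act m j"]) (auto intro!: additive_mapsI simp: act_add)
    also have "\<dots> = csum P M (\<lambda>u p'. act (q p') (Gf j u \<cdot> j)) p"
      using j by (intro csum_cong[OF P p]) (simp add: act_mult)
    finally show "act (csum P M (\<lambda>u p'. act (q p') u) (Kj P j p)) j = csum P M (\<lambda>u p'. act (q p') (Gf j u \<cdot> j)) p" .
  qed
  also have "\<dots> = csum P M (\<lambda>u p'. \<Oplus>\<^bsub>M\<^esub>j\<in>J. act (q p') (Gf j u \<cdot> j)) p"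
    using J(1) pc by (intro sweedler_finsum[OF T Mg, symmetric]) auto
  also have "\<dots> = csum P M (\<lambda>u p'. q (eps u \<odot>\<^bsub>P\<^esub> p')) p"
  proof (rule sweedler_cong)
    fix u p' assume up: "(u, p') \<in> set (representative (UX B P) (coact P p))"
    note [simp] = representativeD[OF T pc up]
    have "(\<Oplus>\<^bsub>M\<^esub>j\<in>J. act (q p') (Gf j u \<cdot> j)) = act (q p') (\<Oplus>\<^bsub>U\<^esub>j\<in>J. Gf j u \<cdot> j)"
      using J(1) by (intro additive_maps_finsum[OF U_ab Mg, of "act (q p')", symmetric])
        (auto intro!: additive_mapsI simp: act_add)
    also have "\<dots> = q (eps u \<odot>\<^bsub>P\<^esub> p')" by (simp add: G[OF up] act_t)
    finally show "(\<Oplus>\<^bsub>M\<^esub>j\<in>J. act (q p') (Gf j u \<cdot> j)) = q (eps u \<odot>\<^bsub>P\<^esub> p')" .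
  qed
  also have "\<dots> = q (csum P P (\<lambda>u p'. eps u \<odot>\<^bsub>P\<^esub> p') p)"
    using p by (intro csum_hom[OF P _ Mg q, symmetric]) auto
  finally show ?thesis using p by (simp add: csum_counit)
qed

text \<open>Since \<open>\<sigma>\<close> is colinear it commutes with \<open>K\<^sub>j\<close>. So \<open>m = \<Sum>\<^sub>j \<sigma>(K\<^sub>j(m)) j = \<Sum>\<^sub>j K\<^sub>j(\<sigma>(m)) j\<close>, which shows that \<open>\<sigma>\<close> is
  injective; and by \<open>U\<close>-linearity \<open>m = \<sigma>(\<Sum>\<^sub>j K\<^sub>j(m) j)\<close>, which shows that it is surjective.\<close>

lemma sig_Kj:
  assumes m: "m \<in> carrier M"
  shows "sig (Kj M j m) = Kj M j (sig m)"
proof -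
  note Mg = comodule_ab[OF M]
  have b: "bal M M (\<lambda>u m'. eps (Gf j u) \<odot>\<^bsub>M\<^esub> m')"
    by (rule Gf_comp_bal[OF M evl_bal[OF M]])
  have "Kj M j (sigma m) = csum M M (\<lambda>u m'. eps (Gf j u) \<odot>\<^bsub>M\<^esub> sigma m') m"
    unfolding Kj_def[OF M] by (rule csum_colinear[OF M M sigma_hom Mg b m])
  also have "\<dots> = csum M M (\<lambda>u m'. sig (eps (Gf j u) \<odot>\<^bsub>M\<^esub> m')) m"
    by (rule csum_cong[OF M m]) (simp add: sig_smult)
  also have "\<dots> = sig (Kj M j m)"
    unfolding Kj_def[OF M] using m by (intro csum_hom[OF M Mg Mg sig_additive, symmetric]) auto
  finally show ?thesis using m by simp
qed

lemma sig_expansion: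
  assumes m: "m \<in> carrier M"
  obtains J where "finite J" "J \<subseteq> carrier U" "(\<Oplus>\<^bsub>M\<^esub>j\<in>J. act (sig (Kj M j m)) j) = m"
proof -
  obtain J where J: "finite J" "J \<subseteq> carrier U"
    and "right_coact B M m = (\<Oplus>\<^bsub>XU B M\<^esub>j\<in>J. Kj M j m \<boxtimes>\<^bsub>XU B M\<^esub> j)"
    and G: "\<And>u m'. (u, m') \<in> set (representative W (coact M m)) \<Longrightarrow> (\<Oplus>\<^bsub>U\<^esub>j\<in>J. Gf j u \<cdot> j) = t (eps u)"
    by (rule right_coact_sum[OF M m], rule that)
  have "(\<lambda>m. m) \<in> additive_maps M M" by (auto intro!: additive_mapsI)
  from act_coact_right_coact_sum[OF M m this refl J G]
  show ?thesis using J by (intro that) (simp_all add: sig_def)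
qed

lemma sig_bij: "bij_betw sigma (carrier M) (carrier M)"
proof (rule bij_betwI')
  note Mg = comodule_ab[OF M]
  interpret MG: abelian_group M by simp
  note hom = additive_maps_finsum[OF Mg Mg sig_additive]
  show "(sigma m = sigma m') = (m = m')" if m: "m \<in> carrier M" "m' \<in> carrier M" for m m'
  proof
    assume "sigma m = sigma m'"
    then have eq: "sig (m \<ominus>\<^bsub>M\<^esub> m') = \<zero>\<^bsub>M\<^esub>"
      using m sig_add[of "m \<ominus>\<^bsub>M\<^esub> m'" m'] by (simp add: MG.minus_eq MG.a_assoc MG.l_neg)
    have c: "m \<ominus>\<^bsub>M\<^esub> m' \<in> carrier M" using m by simp
    obtain J where J: "finite J" "J \<subseteq> carrier U" "(\<Oplus>\<^bsub>M\<^esub>j\<in>J. act (sig (Kj M j (m \<ominus>\<^bsub>M\<^esub> m'))) j) = m \<ominus>\<^bsub>M\<^esub> m'"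
      by (rule sig_expansion[OF c], rule that)
    have "Kj M j \<zero>\<^bsub>M\<^esub> = \<zero>\<^bsub>M\<^esub>" for j
      unfolding Kj_def[OF M] by (rule additive_maps_zero[OF Mg Mg csum_additive[OF M Mg Gf_comp_bal[OF M evl_bal[OF M]]]])
    moreover have "act \<zero>\<^bsub>M\<^esub> j = \<zero>\<^bsub>M\<^esub>" if "j \<in> J" for j
      using that J(2) by (intro additive_maps_zero[OF Mg Mg, of "\<lambda>m. act m j"]) (auto intro!: additive_mapsI simp: act_add)
    moreover have "(\<Oplus>\<^bsub>M\<^esub>j\<in>J. g j) = \<zero>\<^bsub>M\<^esub>" if "\<And>j. j \<in> J \<Longrightarrow> g j = \<zero>\<^bsub>M\<^esub>" for g
      using that by (induct J rule: infinite_finite_induct) simp_all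
    ultimately have "m \<ominus>\<^bsub>M\<^esub> m' = \<zero>\<^bsub>M\<^esub>"
      using J(3) by (simp add: sig_Kj[OF c] eq )
    moreover have "m = (m \<ominus>\<^bsub>M\<^esub> m') \<oplus>\<^bsub>M\<^esub> m'" using m by (simp add: MG.minus_eq MG.a_assoc MG.l_neg)
    ultimately show "m = m'" using m by simp
  qed simp
  show "sigma m \<in> carrier M" if "m \<in> carrier M" for m using that by simp
  show "\<exists>m'\<in>carrier M. m = sigma m'" if m: "m \<in> carrier M" for m
  proof -
    obtain J where J: "finite J" "J \<subseteq> carrier U" "(\<Oplus>\<^bsub>M\<^esub>j\<in>J. act (sig (Kj M j m)) j) = m"
      by (rule sig_expansion[OF m], rule that)
    have c: "act (Kj M j m) j \<in> carrier M" if "j \<in> J" for j using that J(2) m by auto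
    have "sig (\<Oplus>\<^bsub>M\<^esub>j\<in>J. act (Kj M j m) j) = (\<Oplus>\<^bsub>M\<^esub>j\<in>J. sig (act (Kj M j m) j))"
      using c by (intro hom J(1))
    also have "\<dots> = (\<Oplus>\<^bsub>M\<^esub>j\<in>J. act (sig (Kj M j m)) j)"
      using J(2) m by (intro MG.finsum_cong' refl) (auto simp: sig_act)
    finally show ?thesis using J(3) c by (intro bexI[of _ "\<Oplus>\<^bsub>M\<^esub>j\<in>J. act (Kj M j m) j"]) (auto intro!: MG.finsum_closed)
  qed
qed

definition sigma_inv where "sigma_inv = restrict (inv_into (carrier M) sigma) (carrier M)"

lemma sigma_inv_hom: "sigma_inv \<in> comod_hom B M M"
  unfolding sigma_inv_def by (rule comod_hom_inverse[OF M M sigma_hom sig_bij])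

lemma sig_sigma_inv: "m \<in> carrier M \<Longrightarrow> sig (sigma_inv m) = m"
  using bij_betw_inv_into_right[OF sig_bij] comod_hom_simps(1)[OF sigma_inv_hom]
  by (simp add: sigma_inv_def)

text \<open>The formula \<open>f(n \<otimes> p\<^bsub>[0]\<^esub>) p\<^bsub>[1]\<^esub>\<close>, evaluated on \<open>f = untrace N P g\<close>, is \<open>g(p\<^bsub>[0](0)\<^esub> \<otimes> n) p\<^bsub>[0](-1)\<^esub> p\<^bsub>[1]\<^esub>\<close>.
  The formula is balanced over \<open>A\<close> by colinearity of \<open>f\<close>, which is right \<open>A\<close>-linear, and \<open>act_s_mult\<close>.\<close>

lemma untrace_right_coact:
  assumes N [simp]: "left_comodule B N" and P [simp]: "left_comodule B P"
    and g: "g \<in> comod_hom B (P \<star> N) M" and n [simp]: "n \<in> carrier N" and p: "p \<in> carrier P"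
  shows "sweedler (XU B P) M (\<lambda>p0 p1. act (untrace N P g (comod_pure B N P n p0)) p1) (right_coact B P p) =
    g (comod_pure B P N p n)"
proof -
  note Mg = comodule_ab[OF M]
  interpret MG: abelian_group M by simp
  let ?F = "untrace N P g"
  let ?q = "\<lambda>p'. g (comod_pure B P N p' n)"
  note F = untrace_hom[OF N P g]
  note [simp] = comod_hom_simps(1-3)[OF F] comod_hom_simps(1-3)[OF g]
  obtain J where J: "finite J" "J \<subseteq> carrier U"
    and rc: "right_coact B P p = (\<Oplus>\<^bsub>XU B P\<^esub>j\<in>J. Kj P j p \<boxtimes>\<^bsub>XU B P\<^esub> j)"
    and G: "\<And>u p'. (u, p') \<in> set (representative (UX B P) (coact P p)) \<Longrightarrow> (\<Oplus>\<^bsub>U\<^esub>j\<in>J. Gf j u \<cdot> j) = t (eps u)"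
    by (rule right_coact_sum[OF P p], rule that)
  have jU [simp]: "j \<in> carrier U" if "j \<in> J" for j using that J(2) by auto
  have b: "balanced (carrier A) P (right_act B P) (lwhite B) U M (\<lambda>p0 p1. act (?F (comod_pure B N P n p0)) p1)"
  proof (rule balancedI)
    show "act (?F (comod_pure B N P n (right_act B P p0 a))) p1 = act (?F (comod_pure B N P n p0)) (lwhite B a p1)"
      if "a \<in> carrier A" "p0 \<in> carrier P" "p1 \<in> carrier U" for a p0 p1
      using that comod_hom_ra[OF left_comodule_CT[OF N P] M F, of a "comod_pure B N P n p0"] by (simp add: act_s_mult)
  qed (simp_all add: act_add cp_add_right)
  note h = sweedler_additive[OF XU_tensor[OF P] Mg b]
  have "sweedler (XU B P) M (\<lambda>p0 p1. act (?F (comod_pure B N P n p0)) p1) (right_coact B P p) =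
      (\<Oplus>\<^bsub>M\<^esub>j\<in>J. sweedler (XU B P) M (\<lambda>p0 p1. act (?F (comod_pure B N P n p0)) p1) (Kj P j p \<boxtimes>\<^bsub>XU B P\<^esub> j))"
    unfolding rc using p by (intro additive_maps_finsum[OF XU_ab[OF P] Mg h J(1)]) auto
  also have "\<dots> = (\<Oplus>\<^bsub>M\<^esub>j\<in>J. act (csum P M (\<lambda>u p'. act (?q p') u) (Kj P j p)) j)"
  proof (rule MG.finsum_cong'[OF refl])
    fix j assume j: "j \<in> J"
    have K: "Kj P j p \<in> carrier P" using p by simp
    show "sweedler (XU B P) M (\<lambda>p0 p1. act (?F (comod_pure B N P n p0)) p1) (Kj P j p \<boxtimes>\<^bsub>XU B P\<^esub> j) =
        act (csum P M (\<lambda>u p'. act (?q p') u) (Kj P j p)) j"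
      unfolding sweedler_pure[OF XU_tensor[OF P] Mg b K jU[OF j]] untrace_pure[OF N P g n K] ..
  qed (use p in \<open>auto intro!: csum_closed[OF P] act_closed\<close>)
  also have "\<dots> = ?q p"
  proof (rule act_coact_right_coact_sum[OF P p _ _ J G])
    show "?q \<in> additive_maps P M" by (intro additive_mapsI) (simp_all add: cp_add_left)
    show "?q (a \<odot>\<^bsub>P\<^esub> p') = a \<odot>\<^bsub>M\<^esub> ?q p'" if "a \<in> carrier A" "p' \<in> carrier P" for a p'
      using that comod_hom_simps(3)[OF g, of a "comod_pure B P N p' n"] by simp
  qed
  finally show ?thesis .
qed

lemma untrace_bij:
  assumes N: "left_comodule B N" and P: "left_comodule B P"
  shows "bij_betw (untrace N P) (comod_hom B (P \<star> N) M) (comod_hom B (N \<star> P) M)"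
proof (rule bij_betwI')
  let ?PN = "(P \<star> N)" and ?NP = "(N \<star> P)"
  show "(untrace N P g = untrace N P h) = (g = h)"
    if g: "g \<in> comod_hom B ?PN M" and h: "h \<in> comod_hom B ?PN M" for g h
  proof
    assume eq: "untrace N P g = untrace N P h"
    show "g = h"
    proof (rule comod_hom_CT_ext[OF P N M g h])
      show "g (comod_pure B P N p n) = h (comod_pure B P N p n)" if "p \<in> carrier P" "n \<in> carrier N" for p n
        using untrace_right_coact[OF N P g that(2,1)] untrace_right_coact[OF N P h that(2,1)] eq by simp
    qed
  qed simp
  show "untrace N P g \<in> comod_hom B ?NP M" if "g \<in> comod_hom B ?PN M" for g
    by (rule untrace_hom[OF N P that])
  show "\<exists>g\<in>comod_hom B ?PN M. h = untrace N P g" if h: "h \<in> comod_hom B ?NP M" for h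
  proof -
    let ?h = "compose (carrier ?NP) sigma_inv h"
    have h': "?h \<in> comod_hom B ?NP M"
      by (rule comod_hom_restrict_comp[OF left_comodule_CT[OF N P] M M h sigma_inv_hom])
    have "untrace N P (untrace P N ?h) = compose (carrier ?NP) sigma ?h"
      by (rule untrace_untrace[OF P N h'])
    also have "\<dots> = h"
      by (rule extensionalityI[of _ "carrier ?NP"])
        (use comod_hom_simps(4)[OF h] comod_hom_simps(1)[OF h] comod_hom_simps(1)[OF sigma_inv_hom] in
          \<open>simp_all add: compose_eq sig_sigma_inv\<close>)
    finally show ?thesis using untrace_hom[OF P N h'] by metis
  qed
qed

definition tracemap where
  "tracemap N P = inv_into (comod_hom B (P \<star> N) M) (untrace N P)"

context
  fixes N :: "('a, 'u, 'v) ucomodule" and P :: "('a, 'u, 'v) ucomodule"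
  assumes N: "left_comodule B N" and P: "left_comodule B P"
begin

lemma tracemap_bij:
  "bij_betw (tracemap N P) (comod_hom B (N \<star> P) M) (comod_hom B (P \<star> N) M)"
  unfolding tracemap_def by (rule bij_betw_inv_into[OF untrace_bij[OF N P]])

lemma tracemap_hom: "h \<in> comod_hom B (N \<star> P) M \<Longrightarrow> tracemap N P h \<in> comod_hom B (P \<star> N) M"
  using tracemap_bij by (rule bij_betwE[rule_format])

lemma untrace_tracemap: "h \<in> comod_hom B (N \<star> P) M \<Longrightarrow> untrace N P (tracemap N P h) = h"
  unfolding tracemap_def by (rule bij_betw_inv_into_right[OF untrace_bij[OF N P]])

lemma tracemap_eqI: "g \<in> comod_hom B (P \<star> N) M \<Longrightarrow> untrace N P g = h \<Longrightarrow> tracemap N P h = g"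
  unfolding tracemap_def using bij_betw_inv_into_left[OF untrace_bij[OF N P]] by auto

end

text \<open>Each axiom is the corresponding property of \<open>untrace\<close>, transported to its inverse.\<close>

theorem weak_trace_functor_tracemap:
  "weak_trace_functor (comod_cat B) k (comod_hom_module B M :: ('a, 'u, 'v) ucomodule \<Rightarrow> _) precompose tracemap"
proof (rule weak_trace_functor.intro[OF contravariant_functor_Hom[OF M] weak_trace_functor_axioms.intro],
    unfold comod_cat_simps)
  fix X Y Z X' Y' :: "('a, 'u, 'v) ucomodule" and f g x
  show "tracemap X Y \<in> linear_maps k (comod_hom_module B M (X \<star> Y)) (comod_hom_module B M (Y \<star> X))"
    if c: "left_comodule B X" "left_comodule B Y"
    using linear_maps_inv_into[OF module_comod_hom[OF M left_comodule_CT[OF c(2,1)]] untrace_linear[OF c]] untrace_bij[OF c]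
    by (simp add: tracemap_def)
  show "left_comodule B X \<Longrightarrow> left_comodule B Y \<Longrightarrow> bij_betw (tracemap X Y)
      (carrier (comod_hom_module B M (X \<star> Y))) (carrier (comod_hom_module B M (Y \<star> X)))"
    using tracemap_bij by simp
  show "tracemap X Y (precompose (X \<star> Y) (X' \<star> Y') (tm X X' Y Y' f g) x) =
      precompose (Y \<star> X) (Y' \<star> X') (tm Y Y' X X' g f) (tracemap X' Y' x)"
    if c: "left_comodule B X" "left_comodule B X'" "left_comodule B Y" "left_comodule B Y'"
      "f \<in> comod_hom B X X'" "g \<in> comod_hom B Y Y'" "x \<in> carrier (comod_hom_module B M (X' \<star> Y'))"
  proof -
    have x: "x \<in> comod_hom B (X' \<star> Y') M" using c(7) by simp
    note y = tracemap_hom[OF c(2,4) x]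
    show ?thesis
      unfolding precompose_def
      by (rule tracemap_eqI[OF c(1,3) comod_hom_restrict_comp[OF _ _ M tmor_hom[OF c(3,4,1,2,6,5)] y]])
        (simp_all add: c untrace_natural[OF c(1-6) y] untrace_tracemap[OF c(2,4) x])
  qed
  show "tracemap Z (X \<star> Y) x =
      precompose ((X \<star> Y) \<star> Z) (X \<star> (Y \<star> Z)) (as X Y Z)
        (tracemap (Y \<star> Z) X
          (precompose ((Y \<star> Z) \<star> X) (Y \<star> (Z \<star> X)) (as Y Z X)
            (tracemap (Z \<star> X) Y
              (precompose ((Z \<star> X) \<star> Y) (Z \<star> (X \<star> Y)) (as Z X Y) x))))"
    if c: "left_comodule B X" "left_comodule B Y" "left_comodule B Z"
      "x \<in> carrier (comod_hom_module B M (Z \<star> (X \<star> Y)))"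
  proof -
    note XY = left_comodule_CT[OF c(1,2)] and YZ = left_comodule_CT[OF c(2,3)] and ZX = left_comodule_CT[OF c(3,1)]
    have x: "x \<in> comod_hom B (Z \<star> (X \<star> Y)) M" using c(4) by simp
    let ?x1 = "compose (carrier ((Z \<star> X) \<star> Y)) x (as Z X Y)"
    have x1: "?x1 \<in> comod_hom B ((Z \<star> X) \<star> Y) M"
      by (rule comod_hom_restrict_comp[OF left_comodule_CT[OF ZX c(2)] left_comodule_CT[OF c(3) XY] M assoc_hom[OF c(3,1,2)] x])
    let ?x2 = "tracemap (Z \<star> X) Y ?x1"
    note x2 = tracemap_hom[OF ZX c(2) x1]
    let ?x3 = "compose (carrier ((Y \<star> Z) \<star> X)) ?x2 (as Y Z X)"
    have x3: "?x3 \<in> comod_hom B ((Y \<star> Z) \<star> X) M"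
      by (rule comod_hom_restrict_comp[OF left_comodule_CT[OF YZ c(1)] left_comodule_CT[OF c(2) ZX] M assoc_hom[OF c(2,3,1)] x2])
    note x4 = tracemap_hom[OF YZ c(1) x3]
    show ?thesis
      unfolding precompose_def
    proof (rule tracemap_eqI[OF c(3) XY])
      show "compose (carrier ((X \<star> Y) \<star> Z)) (tracemap (Y \<star> Z) X ?x3) (as X Y Z)
          \<in> comod_hom B ((X \<star> Y) \<star> Z) M"
        by (rule comod_hom_restrict_comp[OF left_comodule_CT[OF XY c(3)] left_comodule_CT[OF c(1) YZ] M assoc_hom[OF c(1,2,3)] x4])
    qed (rule untrace_hexagon[OF c(1,2,3) x4 x2 x untrace_tracemap[OF YZ c(1) x3] untrace_tracemap[OF ZX c(2) x1]])
  qed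
qed

text \<open>For the converse take the identity of \<open>M\<close> and evaluate at \<open>1 \<otimes> m\<close>.\<close>

theorem unital_tracemap_iff_stable:
  "unital_trace (comod_cat B) (comod_hom_module B M :: ('a, 'u, 'v) ucomodule \<Rightarrow> ('k, _) module) precompose tracemap \<longleftrightarrow>
    stable_aYD B M act"
proof -
  have lu: "compose (carrier (CU \<star> X)) x (lu X) \<in> comod_hom B (CU \<star> X) M"
    and ru: "compose (carrier (X \<star> CU)) x (ru X) \<in> comod_hom B (X \<star> CU) M"
    if "left_comodule B X" "x \<in> comod_hom B X M" for X :: "('a, 'u, 'v) ucomodule" and x
    using that by (intro comod_hom_restrict_comp[of _ X] M lunit_hom runit_hom left_comodule_CT left_comodule_CU; simp)+
  show ?thesis
  proof
    assume "stable_aYD B M act"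
    then have st: "sig m = m" if "m \<in> carrier M" for m using that by (simp add: stable_iff_sig)
    show "unital_trace (comod_cat B) (comod_hom_module B M :: ('a, 'u, 'v) ucomodule \<Rightarrow> ('k, _) module) precompose tracemap"
      unfolding unital_trace_def comod_cat_simps
    proof (intro ballI)
      fix X :: "('a, 'u, 'v) ucomodule" and x assume "X \<in> Obj (comod_cat B)" "x \<in> carrier (comod_hom_module B M X)"
      then have X: "left_comodule B X" and x: "x \<in> comod_hom B X M" by simp_all
      have "compose (carrier X) sigma x = x"
        by (rule extensionalityI[of _ "carrier X"]) (use comod_hom_simps(1,4)[OF x] in \<open>simp_all add: compose_eq st\<close>)
      then show "tracemap CU X (precompose (CU \<star> X) X (lu X) x) = precompose (X \<star> CU) X (ru X) x"
        unfolding precompose_def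
        by (intro tracemap_eqI[OF left_comodule_CU X ru[OF X x]]) (simp add: untrace_unit[OF X x])
    qed
  next
    assume un: "unital_trace (comod_cat B) (comod_hom_module B M :: ('a, 'u, 'v) ucomodule \<Rightarrow> ('k, _) module) precompose tracemap"
    let ?i = "\<lambda>m\<in>carrier M. m"
    note i = comod_hom_ident[OF M]
    have "tracemap CU M (precompose (CU \<star> M) M (lu M) ?i) = precompose (M \<star> CU) M (ru M) ?i"
      using un i unfolding unital_trace_def by simp
    then have eq: "compose (carrier (CU \<star> M)) (compose (carrier M) sigma ?i) (lu M) =
        compose (carrier (CU \<star> M)) ?i (lu M)"
      using untrace_tracemap[OF left_comodule_CU M lu[OF M i]] untrace_unit[OF M i] by (simp add: precompose_def)
    have "sig m = m" if m [simp]: "m \<in> carrier M" for m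
    proof -
      let ?z = "comod_pure B CU M (Scalar \<one>\<^bsub>A\<^esub>) m"
      have "lu M ?z = m" "?z \<in> carrier (CU \<star> M)" by simp_all
      then show ?thesis using fun_cong[OF eq, of ?z] by (simp add: compose_eq)
    qed
    then show "stable_aYD B M act" by (simp add: stable_iff_sig)
  qed
qed

end

section \<open>The weak trace functor\<close>

lemma (in left_bialgebroid) dual_basis_U_left:
  assumes "projective_module A (U_left B)"
  obtains f where "\<And>j u. u \<in> carrier U \<Longrightarrow> f j u \<in> carrier A"
    "\<And>j u v. u \<in> carrier U \<Longrightarrow> v \<in> carrier U \<Longrightarrow> f j (u \<oplus>\<^bsub>U\<^esub> v) = f j u \<oplus>\<^bsub>A\<^esub> f j v"
    "\<And>j a u. a \<in> carrier A \<Longrightarrow> u \<in> carrier U \<Longrightarrow> f j (s a \<cdot> u) = a \<otimes>\<^bsub>A\<^esub> f j u"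
    "\<And>V. finite V \<Longrightarrow> V \<subseteq> carrier U \<Longrightarrow> \<exists>J. finite J \<and> J \<subseteq> carrier U \<and>
      (\<forall>K. finite K \<and> J \<subseteq> K \<and> K \<subseteq> carrier U \<longrightarrow> (\<forall>v\<in>V. v = (\<Oplus>\<^bsub>U\<^esub>j\<in>K. s (f j v) \<cdot> j)))"
proof -
  obtain f :: "'u \<Rightarrow> 'u \<Rightarrow> 'a" where f: "\<And>j. f j \<in> linear_maps A (U_left B) \<lparr>carrier = carrier A,
      mult = undefined, one = undefined, zero = \<zero>\<^bsub>A\<^esub>, add = add A, smult = mult A\<rparr>"
    and fin: "\<And>x. x \<in> carrier (U_left B) \<Longrightarrow> finite {j. f j x \<noteq> \<zero>\<^bsub>A\<^esub>}"
    and sub: "\<And>x. x \<in> carrier (U_left B) \<Longrightarrow> {j. f j x \<noteq> \<zero>\<^bsub>A\<^esub>} \<subseteq> carrier (U_left B)"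
    and exp: "\<And>x J. x \<in> carrier (U_left B) \<Longrightarrow> finite J \<Longrightarrow> J \<subseteq> carrier (U_left B) \<Longrightarrow> {j. f j x \<noteq> \<zero>\<^bsub>A\<^esub>} \<subseteq> J \<Longrightarrow>
      x = (\<Oplus>\<^bsub>U_left B\<^esub>j\<in>J. f j x \<odot>\<^bsub>U_left B\<^esub> j)"
    by (rule dual_basis[OF assms], rule that)
  have fc: "f j u \<in> carrier A" "v \<in> carrier U \<Longrightarrow> f j (u \<oplus>\<^bsub>U\<^esub> v) = f j u \<oplus>\<^bsub>A\<^esub> f j v"
    "a \<in> carrier A \<Longrightarrow> f j (s a \<cdot> u) = a \<otimes>\<^bsub>A\<^esub> f j u" if "u \<in> carrier U" for j u v a
    using f[of j] that by (auto simp: linear_maps_def Pi_iff)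
  have ex: "v = (\<Oplus>\<^bsub>U\<^esub>j\<in>K. s (f j v) \<cdot> j)"
    if K: "finite K" "K \<subseteq> carrier U" "{j. f j v \<noteq> \<zero>\<^bsub>A\<^esub>} \<subseteq> K" and v: "v \<in> carrier U" for K v
  proof -
    have "v = (\<Oplus>\<^bsub>U_left B\<^esub>j\<in>K. f j v \<odot>\<^bsub>U_left B\<^esub> j)" using exp[of v K] K v by simp
    also have "\<dots> = (\<Oplus>\<^bsub>U\<^esub>j\<in>K. f j v \<odot>\<^bsub>U_left B\<^esub> j)"
      using K(1,2) fc(1)[OF v] by (intro additive_maps_finsum[OF left_module.axioms(2)[OF left_module_U_left] U_ab, of "\<lambda>x. x"]) (auto intro!: additive_mapsI)
    finally show ?thesis by simp
  qed
  show thesis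
  proof (rule that[of f])
    show "\<exists>J. finite J \<and> J \<subseteq> carrier U \<and>
      (\<forall>K. finite K \<and> J \<subseteq> K \<and> K \<subseteq> carrier U \<longrightarrow> (\<forall>v\<in>V. v = (\<Oplus>\<^bsub>U\<^esub>j\<in>K. s (f j v) \<cdot> j)))"
      if V: "finite V" "V \<subseteq> carrier U" for V
      using V fin sub by (intro exI[of _ "\<Union>v\<in>V. {j. f j v \<noteq> \<zero>\<^bsub>A\<^esub>}"]) (auto intro!: ex)
  qed (use fc in auto)
qed

theorem theorem4p16:
  fixes k :: "('k, 'r) ring_scheme"
    and B :: "('k, 'a, 'u) bialgebroid"
    and M :: "('a, 'u, 'v) ucomodule"
    and act :: "('a, 'v) univ \<Rightarrow> 'u \<Rightarrow> ('a, 'v) univ"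
  assumes "left_bialgebroid k B"
    and "left_hopf B"
    and "right_hopf B"
    and "projective_module (opposite (base_alg B)) (U_right B)"
    and "projective_module (base_alg B) (U_left B)"
    and "anti_Yetter_Drinfeld B M act"
  shows "\<exists>trc :: ('a, 'u, 'v) ucomodule \<Rightarrow> ('a, 'u, 'v) ucomodule \<Rightarrow>
      (('a, 'v) univ \<Rightarrow> ('a, 'v) univ) \<Rightarrow> (('a, 'v) univ \<Rightarrow> ('a, 'v) univ).
    weak_trace_functor (comod_cat B) k (comod_hom_module B M) precompose trc \<and>
    (unital_trace (comod_cat B) (comod_hom_module B M) precompose trc \<longleftrightarrow> stable_aYD B M act) \<and>
    (\<forall>N P f n p. left_comodule B N \<and> left_comodule B P \<and>
       f \<in> comod_hom B (comod_tensor B N P) M \<and> n \<in> carrier N \<and> p \<in> carrier P \<longrightarrow>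
       trc N P f (comod_pure B P N p n) =
       sweedler (XU B P) M (\<lambda>p0 p1. act (f (comod_pure B N P n p0)) p1) (right_coact B P p))"
proof -
  interpret left_bialgebroid k B by fact
  obtain f where f: "right_hopf_dual_basis_axioms B f"
    by (rule dual_basis_U_left[OF assms(5)], rule that, rule right_hopf_dual_basis_axioms.intro[OF assms(3)])
  interpret aYD_module_right_hopf k B M act f
    using assms f by (intro aYD_module_right_hopf.intro aYD_module.intro left_hopf_algebroid.intro
        left_hopf_algebroid_axioms.intro aYD_module_axioms.intro right_hopf_dual_basis.intro)
  have "tracemap N P h (comod_pure B P N p n) =
      sweedler (XU B P) M (\<lambda>p0 p1. act (h (comod_pure B N P n p0)) p1) (right_coact B P p)"
    if "left_comodule B N" "left_comodule B P" "h \<in> comod_hom B (comod_tensor B N P) M" "n \<in> carrier N" "p \<in> carrier P"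
    for N P h n p
    using untrace_right_coact[OF that(1,2) tracemap_hom[OF that(1-3)] that(4,5)] untrace_tracemap[OF that(1-3)] by simp
  then show ?thesis
    using weak_trace_functor_tracemap unital_tracemap_iff_stable by (intro exI[of _ tracemap]) simp
qed

end
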